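(* Let $\mathcal{V}=(V_1,V_2,\ldots)$ and $\mathcal{W}=(W_1,W_2,\ldots)$ be independent, zero mean, strictly stationary, $\rho$-mixing sequences of real random variables with $E(V_1^4)<\infty$, $E(W_1^4)<\infty$, $\sigma_V^2=\mathrm{Var}(V_1)>0$, $\sigma_W^2=\mathrm{Var}(W_1)>0$, whose $\rho$-mixing coefficients $\rho_1(\cdot),\rho_2(\cdot)$ satisfy $\sum_{k=1}^\infty\rho_1(2^k)<\infty$ and $\sum_{k=1}^\infty\rho_2(2^k)<\infty$. Let $P$ and $Q$ be independent, positive, non-degenerate random variables with $E(P)$, $E(Q)$, $E(P^{-2})$, $E(Q^{-2})$ all finite. For each $d\ge1$ let $\mathbf{V}=(V_1,\ldots,V_d)$, $\mathbf{W}=(W_1,\ldots,W_d)$, $\mathbf{X}=\mu_1+\mathbf{V}/P$ and $\mathbf{Y}=\mu_2+\mathbf{W}/Q$, where $\mu_1,\mu_2\in\mathbb{R}^d$, and put $\mu=\mu_2-\mu_1$. Let $\mathbf{X}_1,\ldots,\mathbf{X}_m$ and $\mathbf{Y}_1,\ldots,\mathbf{Y}_n$ be i.i.d. copies of the independent random vectors $\mathbf{X}$ and $\mathbf{Y}$, respectively. Assume that $\mathbf{Y}$ has the same distribution as $\mathbf{X}+\mu$. Assume also that $\|\mu\|^2/d^{1/2+\epsilon}\to0$ for some $\epsilon>0$; that, with $\Sigma_V=\mathrm{Disp}(\mathbf{V})$ and $\Sigma_W=\mathrm{Disp}(\mathbf{W})$, $\mu'(\Sigma_V+\Sigma_W)\mu=o(\mathrm{tr}(\Sigma_V^2+\Sigma_W^2))$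 as $d\to\infty$; and that $\|\mu\|^2/d^{1/2}$ tends to a finite non-negative limit as $d\to\infty$. Let $\Sigma_1=\mathrm{Disp}(\mathbf{X})$, $\Sigma_2=\mathrm{Disp}(\mathbf{Y})$, $$\Gamma_1=\frac{2\,\mathrm{tr}(\Sigma_1^2)}{(m)_2}+\frac{2\,\mathrm{tr}(\Sigma_2^2)}{(n)_2}+\frac{4\,\mathrm{tr}(\Sigma_1\Sigma_2)}{mn},$$ and assume that $\lim_{m,n\to\infty}\lim_{d\to\infty}\|\mu\|^2/\Gamma_1^{1/2}=c$ for some $c\in(0,\infty)$. Let $\beta_{T_{WMW}}(\mu)$ and $\beta_{T_{CQ}^{(2)}}(\mu)$ denote the powers, under the alternative $H_A:\mu\ne\mathbf 0$, of the tests of $H_0:\mu=\mathbf 0$ based on $T_{WMW}$ and $T_{CQ}^{(2)}$ at a given level of significance $\alpha$. Then $$\lim_{m,n\to\infty}\lim_{d\to\infty}\beta_{T_{WMW}}(\mu)>\lim_{m,n\to\infty}\lim_{d\to\infty}\beta_{T_{CQ}^{(2)}}(\mu).$$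
   Context: Notation: $(p)_q=p(p-1)\cdots(p-q+1)$; $\|\cdot\|$ is the Euclidean norm on $\mathbb{R}^d$; $'$ denotes transpose; $\mathrm{Disp}$ denotes the dispersion (covariance) matrix; $S(\mathbf{x})=\mathbf{x}/\|\mathbf{x}\|$ is the spatial sign of $\mathbf{x}$. The vectors $\mu_1,\mu_2,\mu$ depend on $d$ and may depend on $m,n$. The two sample statistics are $$T_{CQ}^{(2)}=\frac{1}{(m)_2(n)_2}\sum_{\substack{i_1,i_2=1\\ i_1\ne i_2}}^m\ \sum_{\substack{j_1,j_2=1\\ j_1\ne j_2}}^n(\mathbf{X}_{i_1}-\mathbf{Y}_{j_1})'(\mathbf{X}_{i_2}-\mathbf{Y}_{j_2}),$$ $$T_{WMW}=\frac{1}{(m)_2(n)_2}\sum_{\substack{i_1,i_2=1\\ i_1\ne i_2}}^m\ \sum_{\substack{j_1,j_2=1\\ j_1\ne j_2}}^n S(\mathbf{Y}_{j_1}-\mathbf{X}_{i_1})'S(\mathbf{Y}_{j_2}-\mathbf{X}_{i_2}).$$ Tests and powers: let $\zeta_\alpha$ be the $(1-\alpha)$-quantile of the standard Gaussian distribution. The tests use the limiting Gaussian null distributions (first $d\to\infty$, then $m,n\to\infty$): the test based on $T_{WMW}$ rejects $H_0$ when $dT_{WMW}/\psi_2^{1/2}>\zeta_\alpha$, and the test based on $T_{CQ}^{(2)}$ rejects $H_0$ when $T_{CQ}^{(2)}/\Gamma_1^{1/2}>\zeta_\alpha$. Here, with $P_1,P_2$ i.i.d. copies of $P$ and, independently, $Q_1,Q_2$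 i.i.d. copies of $Q$, $$\psi_2=\frac{2\,\mathrm{tr}(\Sigma_V^2)\psi_{21}}{(m)_2}+\frac{2\,\mathrm{tr}(\Sigma_W^2)\psi_{22}}{(n)_2}+\frac{4\,\mathrm{tr}(\Sigma_V\Sigma_W)\psi_{23}}{mn},$$ $$\psi_{21}=\Big(E\Big\{\frac{Q_1Q_2}{[(\sigma_V^2Q_1^2+\sigma_W^2P_1^2)(\sigma_V^2Q_2^2+\sigma_W^2P_1^2)]^{1/2}}\Big\}\Big)^2,\quad \psi_{22}=\Big(E\Big\{\frac{P_1P_2}{[(\sigma_V^2Q_1^2+\sigma_W^2P_1^2)(\sigma_V^2Q_1^2+\sigma_W^2P_2^2)]^{1/2}}\Big\}\Big)^2,$$ and $\psi_{23}=(\psi_{21}\psi_{22})^{1/2}$. The powers are the probabilities of these rejection events when the mean difference is $\mu$. $\rho$-mixing: for an infinite sequence $(X_1,X_2,\ldots)$ of random variables, the $\rho$-mixing coefficient is $\rho(r)=\sup_{k\ge 1}\sup_{f,g}|\mathrm{Corr}(f,g)|$, where $f$ ranges over square integrable random variables measurable with respect to $\sigma(X_1,\ldots,X_k)$ and $g$ over square integrable random variables measurable with respect to $\sigma(X_{k+r},X_{k+r+1},\ldots)$. The sequence is $\rho$-mixing if $\rho(r)\to0$ as $r\to\infty$.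
   Formalization: The formal theorem additionally assumes that the sequence V is independent of P and that W is independent of Q; without this the dispersion of X may be undefined and the claimed inequality can fail. *)

theory Defs
  imports "HOL-Probability.Probability" "HOL-Library.Landau_Symbols"
begin

text \<open>
  Since the dimension tends to infinity, it cannot be a type. A vector of dimension \<open>d\<close> is a function
  \<open>nat \<Rightarrow> real\<close> of which only the values on \<open>{1..d}\<close> matter, a matrix of size \<open>d\<close> is a function
  \<open>nat \<Rightarrow> nat \<Rightarrow> real\<close> used on \<open>{1..d}\<close> in both arguments, and sequences are indexed from 1.
  Random vectors are functions of the outcome with values in \<open>RV d\<close>, so they are extensional, that
  is, equal to \<open>undefined\<close> outside \<open>{1..d}\<close>.
\<close>

subsection \<open>Vectors and matrices\<close>

definition inner_d :: "nat \<Rightarrow> (nat \<Rightarrow> real) \<Rightarrow> (nat \<Rightarrow> real) \<Rightarrow> real" where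
  "inner_d d x y = (\<Sum>k = 1..d. x k * y k)"

abbreviation norm_d :: "nat \<Rightarrow> (nat \<Rightarrow> real) \<Rightarrow> real" where
  "norm_d d x \<equiv> L2_set x {1..d}"

text \<open>At the zero vector, where the spatial sign is not defined by the formula, this gives zero.\<close>

definition spatial_sign :: "nat \<Rightarrow> (nat \<Rightarrow> real) \<Rightarrow> (nat \<Rightarrow> real)" where
  "spatial_sign d x = (\<lambda>k. x k / norm_d d x)"

definition vec_diff :: "(nat \<Rightarrow> real) \<Rightarrow> (nat \<Rightarrow> real) \<Rightarrow> (nat \<Rightarrow> real)" where
  "vec_diff x y = (\<lambda>k. x k - y k)"

definition mat_add :: "(nat \<Rightarrow> nat \<Rightarrow> real) \<Rightarrow> (nat \<Rightarrow> nat \<Rightarrow> real) \<Rightarrow> (nat \<Rightarrow> nat \<Rightarrow> real)" where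
  "mat_add A B = (\<lambda>k l. A k l + B k l)"

definition mat_mult :: "nat \<Rightarrow> (nat \<Rightarrow> nat \<Rightarrow> real) \<Rightarrow> (nat \<Rightarrow> nat \<Rightarrow> real) \<Rightarrow> (nat \<Rightarrow> nat \<Rightarrow> real)" where
  "mat_mult d A B = (\<lambda>k l. \<Sum>j = 1..d. A k j * B j l)"

definition mat_vec :: "nat \<Rightarrow> (nat \<Rightarrow> nat \<Rightarrow> real) \<Rightarrow> (nat \<Rightarrow> real) \<Rightarrow> (nat \<Rightarrow> real)" where
  "mat_vec d A x = (\<lambda>k. \<Sum>l = 1..d. A k l * x l)"

definition tr_d :: "nat \<Rightarrow> (nat \<Rightarrow> nat \<Rightarrow> real) \<Rightarrow> real" where
  "tr_d d A = (\<Sum>k = 1..d. A k k)"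

definition falling :: "nat \<Rightarrow> nat \<Rightarrow> real" where
  "falling p q = (\<Prod>i<q. real p - real i)"

subsection \<open>Random variables, vectors and sequences\<close>

definition covar :: "'a measure \<Rightarrow> ('a \<Rightarrow> real) \<Rightarrow> ('a \<Rightarrow> real) \<Rightarrow> real" where
  "covar M f g = (LINT \<omega>|M. (f \<omega> - (LINT \<xi>|M. f \<xi>)) * (g \<omega> - (LINT \<xi>|M. g \<xi>)))"

text \<open>For almost surely constant \<open>f\<close> or \<open>g\<close> the quotient below is \<open>0 / 0 = 0\<close>, so that constants do
  not contribute to the supremum in the mixing coefficient.\<close>

definition corr :: "'a measure \<Rightarrow> ('a \<Rightarrow> real) \<Rightarrow> ('a \<Rightarrow> real) \<Rightarrow> real" where
  "corr M f g = covar M f g / sqrt (covar M f f * covar M g g)"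

abbreviation RV :: "nat \<Rightarrow> (nat \<Rightarrow> real) measure" where
  "RV d \<equiv> PiM {1..d} (\<lambda>_. borel)"

abbreviation RSeq :: "(nat \<Rightarrow> real) measure" where
  "RSeq \<equiv> PiM {1..} (\<lambda>_. borel)"

definition seq_map :: "(nat \<Rightarrow> 'a \<Rightarrow> real) \<Rightarrow> 'a \<Rightarrow> (nat \<Rightarrow> real)" where
  "seq_map V \<omega> = (\<lambda>k\<in>{1..}. V k \<omega>)"

definition rvec :: "nat \<Rightarrow> (nat \<Rightarrow> 'a \<Rightarrow> real) \<Rightarrow> 'a \<Rightarrow> (nat \<Rightarrow> real)" where
  "rvec d V \<omega> = (\<lambda>k\<in>{1..d}. V k \<omega>)"

definition Disp :: "'a measure \<Rightarrow> ('a \<Rightarrow> (nat \<Rightarrow> real)) \<Rightarrow> (nat \<Rightarrow> nat \<Rightarrow> real)" where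
  "Disp M X = (\<lambda>k l. covar M (\<lambda>\<omega>. X \<omega> k) (\<lambda>\<omega>. X \<omega> l))"

definition scale_mix ::
  "nat \<Rightarrow> (nat \<Rightarrow> real) \<Rightarrow> (nat \<Rightarrow> 'a \<Rightarrow> real) \<Rightarrow> ('a \<Rightarrow> real) \<Rightarrow> 'a \<Rightarrow> (nat \<Rightarrow> real)" where
  "scale_mix d \<mu> V P \<omega> = (\<lambda>k\<in>{1..d}. \<mu> k + V k \<omega> / P \<omega>)"

definition strictly_stationary :: "'a measure \<Rightarrow> (nat \<Rightarrow> 'a \<Rightarrow> real) \<Rightarrow> bool" where
  "strictly_stationary M V \<longleftrightarrow>
     (\<forall>k\<ge>1. V k \<in> borel_measurable M) \<and>
     (\<forall>h. distr M RSeq (seq_map (\<lambda>k. V (k + h))) = distr M RSeq (seq_map V))"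

definition non_degenerate :: "'a measure \<Rightarrow> ('a \<Rightarrow> real) \<Rightarrow> bool" where
  "non_degenerate M P \<longleftrightarrow> \<not> (\<exists>c. AE \<omega> in M. P \<omega> = c)"

definition gen_sigma :: "'a measure \<Rightarrow> (nat \<Rightarrow> 'a \<Rightarrow> real) \<Rightarrow> nat set \<Rightarrow> 'a measure" where
  "gen_sigma M V I = sigma (space M) {V i -` A \<inter> space M | i A. i \<in> I \<and> A \<in> sets borel}"

text \<open>The library's \<open>indep_var\<close> needs two random variables of the same type; this is independence of
  the generated sigma-algebras.\<close>

definition indep_seq_rv :: "'a measure \<Rightarrow> (nat \<Rightarrow> 'a \<Rightarrow> real) \<Rightarrow> ('a \<Rightarrow> real) \<Rightarrow> bool" where
  "indep_seq_rv M V P \<longleftrightarrow>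
     prob_space.indep_set M
       (sets (gen_sigma M V {1..})) (sets (vimage_algebra (space M) P borel))"

definition sq_int_on :: "'a measure \<Rightarrow> (nat \<Rightarrow> 'a \<Rightarrow> real) \<Rightarrow> nat set \<Rightarrow> ('a \<Rightarrow> real) set" where
  "sq_int_on M V I =
     {f. f \<in> borel_measurable (gen_sigma M V I) \<and> integrable M (\<lambda>\<omega>. (f \<omega>)\<^sup>2)}"

text \<open>The suprema are over nonempty sets of reals bounded by 1, by the Cauchy-Schwarz inequality.\<close>

definition rho :: "'a measure \<Rightarrow> (nat \<Rightarrow> 'a \<Rightarrow> real) \<Rightarrow> nat \<Rightarrow> real" where
  "rho M V r =
     (SUP k\<in>{1..}. SUP (f, g)\<in>sq_int_on M V {1..k} \<times> sq_int_on M V {k + r..}. \<bar>corr M f g\<bar>)"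

definition rho_mixing :: "'a measure \<Rightarrow> (nat \<Rightarrow> 'a \<Rightarrow> real) \<Rightarrow> bool" where
  "rho_mixing M V \<longleftrightarrow> rho M V \<longlonglongrightarrow> 0"

definition iid_samples ::
  "'a measure \<Rightarrow> nat \<Rightarrow> nat \<Rightarrow> nat \<Rightarrow> ('a \<Rightarrow> (nat \<Rightarrow> real)) \<Rightarrow> ('a \<Rightarrow> (nat \<Rightarrow> real)) \<Rightarrow>
   (nat \<Rightarrow> 'a \<Rightarrow> (nat \<Rightarrow> real)) \<Rightarrow> (nat \<Rightarrow> 'a \<Rightarrow> (nat \<Rightarrow> real)) \<Rightarrow> bool" where
  "iid_samples M d m n X Y XS YS \<longleftrightarrow>
     prob_space.indep_vars M (\<lambda>_. RV d) (case_sum XS YS) ({1..m} <+> {1..n}) \<and>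
     (\<forall>i\<in>{1..m}. distr M (RV d) (XS i) = distr M (RV d) X) \<and>
     (\<forall>j\<in>{1..n}. distr M (RV d) (YS j) = distr M (RV d) Y)"

subsection \<open>Statistics, tests and powers\<close>

definition T_CQ2 ::
  "nat \<Rightarrow> nat \<Rightarrow> nat \<Rightarrow> (nat \<Rightarrow> nat \<Rightarrow> real) \<Rightarrow> (nat \<Rightarrow> nat \<Rightarrow> real) \<Rightarrow> real" where
  "T_CQ2 d m n x y =
     1 / (falling m 2 * falling n 2) *
     (\<Sum>i1 = 1..m. \<Sum>i2 \<in> {1..m} - {i1}. \<Sum>j1 = 1..n. \<Sum>j2 \<in> {1..n} - {j1}.
        inner_d d (vec_diff (x i1) (y j1)) (vec_diff (x i2) (y j2)))"

definition T_WMW ::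
  "nat \<Rightarrow> nat \<Rightarrow> nat \<Rightarrow> (nat \<Rightarrow> nat \<Rightarrow> real) \<Rightarrow> (nat \<Rightarrow> nat \<Rightarrow> real) \<Rightarrow> real" where
  "T_WMW d m n x y =
     1 / (falling m 2 * falling n 2) *
     (\<Sum>i1 = 1..m. \<Sum>i2 \<in> {1..m} - {i1}. \<Sum>j1 = 1..n. \<Sum>j2 \<in> {1..n} - {j1}.
        inner_d d (spatial_sign d (vec_diff (y j1) (x i1)))
                  (spatial_sign d (vec_diff (y j2) (x i2))))"

definition Gamma1 ::
  "nat \<Rightarrow> nat \<Rightarrow> nat \<Rightarrow> (nat \<Rightarrow> nat \<Rightarrow> real) \<Rightarrow> (nat \<Rightarrow> nat \<Rightarrow> real) \<Rightarrow> real" where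
  "Gamma1 d m n S1 S2 =
     2 * tr_d d (mat_mult d S1 S1) / falling m 2 +
     2 * tr_d d (mat_mult d S2 S2) / falling n 2 +
     4 * tr_d d (mat_mult d S1 S2) / (real m * real n)"

text \<open>In the following, \<open>sV\<close> and \<open>sW\<close> are the variances (not the standard deviations), and \<open>LP\<close>
  and \<open>LQ\<close> are the laws of \<open>P\<close> and \<open>Q\<close>; independent copies are the coordinates of a product measure.\<close>

definition psi21 :: "real \<Rightarrow> real \<Rightarrow> real measure \<Rightarrow> real measure \<Rightarrow> real" where
  "psi21 sV sW LP LQ =
     (LINT (p1, q1, q2)|(LP \<Otimes>\<^sub>M (LQ \<Otimes>\<^sub>M LQ)).
        q1 * q2 / sqrt ((sV * q1\<^sup>2 + sW * p1\<^sup>2) * (sV * q2\<^sup>2 + sW * p1\<^sup>2)))\<^sup>2"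

definition psi22 :: "real \<Rightarrow> real \<Rightarrow> real measure \<Rightarrow> real measure \<Rightarrow> real" where
  "psi22 sV sW LP LQ =
     (LINT (q1, p1, p2)|(LQ \<Otimes>\<^sub>M (LP \<Otimes>\<^sub>M LP)).
        p1 * p2 / sqrt ((sV * q1\<^sup>2 + sW * p1\<^sup>2) * (sV * q1\<^sup>2 + sW * p2\<^sup>2)))\<^sup>2"

definition psi23 :: "real \<Rightarrow> real \<Rightarrow> real measure \<Rightarrow> real measure \<Rightarrow> real" where
  "psi23 sV sW LP LQ = sqrt (psi21 sV sW LP LQ * psi22 sV sW LP LQ)"

definition psi2 ::
  "nat \<Rightarrow> nat \<Rightarrow> nat \<Rightarrow> (nat \<Rightarrow> nat \<Rightarrow> real) \<Rightarrow> (nat \<Rightarrow> nat \<Rightarrow> real) \<Rightarrow>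
   real \<Rightarrow> real \<Rightarrow> real measure \<Rightarrow> real measure \<Rightarrow> real" where
  "psi2 d m n SV SW sV sW LP LQ =
     2 * tr_d d (mat_mult d SV SV) * psi21 sV sW LP LQ / falling m 2 +
     2 * tr_d d (mat_mult d SW SW) * psi22 sV sW LP LQ / falling n 2 +
     4 * tr_d d (mat_mult d SV SW) * psi23 sV sW LP LQ / (real m * real n)"

definition quantile :: "real measure \<Rightarrow> real \<Rightarrow> real" where
  "quantile D p = Inf {x. p \<le> cdf D x}"

definition zeta :: "real \<Rightarrow> real" where
  "zeta \<alpha> = quantile std_normal_distribution (1 - \<alpha>)"

definition power_WMW ::
  "'a measure \<Rightarrow> real \<Rightarrow> real \<Rightarrow> nat \<Rightarrow> nat \<Rightarrow> nat \<Rightarrow>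
   (nat \<Rightarrow> 'a \<Rightarrow> (nat \<Rightarrow> real)) \<Rightarrow> (nat \<Rightarrow> 'a \<Rightarrow> (nat \<Rightarrow> real)) \<Rightarrow> real" where
  "power_WMW M \<alpha> \<psi> d m n XS YS =
     measure M {\<omega> \<in> space M.
       real d * T_WMW d m n (\<lambda>i. XS i \<omega>) (\<lambda>j. YS j \<omega>) / sqrt \<psi> > zeta \<alpha>}"

definition power_CQ2 ::
  "'a measure \<Rightarrow> real \<Rightarrow> real \<Rightarrow> nat \<Rightarrow> nat \<Rightarrow> nat \<Rightarrow>
   (nat \<Rightarrow> 'a \<Rightarrow> (nat \<Rightarrow> real)) \<Rightarrow> (nat \<Rightarrow> 'a \<Rightarrow> (nat \<Rightarrow> real)) \<Rightarrow> real" where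
  "power_CQ2 M \<alpha> \<Gamma> d m n XS YS =
     measure M {\<omega> \<in> space M.
       T_CQ2 d m n (\<lambda>i. XS i \<omega>) (\<lambda>j. YS j \<omega>) / sqrt \<Gamma> > zeta \<alpha>}"

text \<open>The iterated limit of \<open>f m n d\<close>: first \<open>d\<close> tends to infinity for fixed \<open>m\<close> and \<open>n\<close>, then \<open>m\<close> and
  \<open>n\<close> tend to infinity jointly, without any restriction on their ratio. Sample sizes are at least 2,
  as needed for the denominators of the statistics. The existence of all limits is part of the
  assertion.\<close>

definition has_iterated_limit :: "(nat \<Rightarrow> nat \<Rightarrow> nat \<Rightarrow> real) \<Rightarrow> real \<Rightarrow> bool" where
  "has_iterated_limit f L \<longleftrightarrow>
     (\<exists>g. (\<forall>m\<ge>2. \<forall>n\<ge>2. (\<lambda>d. f m n d) \<longlonglongrightarrow> g m n) \<and>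
          ((\<lambda>(m, n). g m n) \<longlongrightarrow> L) (sequentially \<times>\<^sub>F sequentially))"

end

theory Submission
  imports Defs
begin

text \<open>
  Since \<open>Y\<close> has the law of \<open>X + \<mu>\<close>, both samples may be generated from \<open>V\<close> and the scales \<open>r = 1 / P\<close>.
  The law of large numbers for \<open>V\<^sub>k\<^sup>2\<close> and \<open>W\<^sub>k\<^sup>2\<close> shows in addition that \<open>\<sigma>\<^sub>V / P\<close> and \<open>\<sigma>\<^sub>W / Q\<close> have the
  same law, which expresses \<open>\<Gamma>\<^sub>1\<close> and \<open>\<psi>\<^sub>2\<close> through the scales.

  Both statistics are averages of the forms \<open>\<Sum>k. (\<mu>\<^sub>k + r\<^sub>j V\<^sub>j\<^sub>k - r\<^sub>i V\<^sub>i\<^sub>k) (\<mu>\<^sub>k + r\<^sub>j' V\<^sub>j'\<^sub>k - r\<^sub>i' V\<^sub>i'\<^sub>k)\<close>, weighted by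
  reciprocal norms in the case of \<open>T\<^sub>W\<^sub>M\<^sub>W\<close>. Given the scales, the normalized norms tend to constants, and
  what remains is a quadratic form without diagonal in independent copies of a \<open>\<rho>\<close>-mixing sequence.
  Its summands are again \<open>\<rho>\<close>-mixing with the same coefficients, so a central limit theorem under
  \<open>\<Sum>k. \<rho> (2\<^sup>k) < \<infinity>\<close> applies as \<open>d\<close> tends to infinity.

  As \<open>m\<close> and \<open>n\<close> tend to infinity, the averages over the scales converge. With independent scales
  \<open>r\<close>, \<open>s\<close>, and \<open>h r = E\<^sub>s (\<sigma>\<^sub>V\<^sup>2 (r\<^sup>2 + s\<^sup>2))\<^sup>-\<^sup>1\<^sup>/\<^sup>2\<close>, the powers tend to \<open>1 - \<Phi> (\<zeta> - c)\<close> and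
  \<open>1 - \<Phi> (\<zeta> - c E (r\<^sup>2) (E (h r))\<^sup>2 / E ((r h r)\<^sup>2))\<close>, and the factor of \<open>c\<close> exceeds 1 because \<open>h\<close> decreases
  while \<open>r\<close> and \<open>r h r\<close> increase.
\<close>

section \<open>Square integrable functions and maximal correlation\<close>

text \<open>Two facts shape the proof. The covariances of the summands of a quadratic form without
  diagonal are a constant multiple of the squared covariances of \<open>V\<close>, hence
  nonnegative: variances of block sums have monotone increments, which takes the place of a lower
  bound on variance growth in the central limit theorem and also yields the summability of the
  squared covariances. And the scales have a second moment and an integrable reciprocal, so products
  such as \<open>r\<^sup>2 s\<^sup>2\<close> have a mean but possibly no variance. Since the
  statistics average over distinct indices, truncation still gives laws of large numbers in the
  mean, while those terms of the sign statistic that are squared are bounded, because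
  \<open>r\<close> times its weight is.

  The equality of the laws of \<open>Y\<close> and \<open>X + \<mu>\<close> does not identify
  \<open>V\<close> with \<open>W\<close>: it fixes the covariances of \<open>W\<close> up to a
  factor \<open>q\<close>, which cancels in \<psi>2.\<close>

lemma integrable_mult_of_squares:
  fixes f g :: "'a \<Rightarrow> real"
  assumes [measurable]: "f \<in> borel_measurable M" "g \<in> borel_measurable M"
    and "integrable M (\<lambda>x. (f x)\<^sup>2)" "integrable M (\<lambda>x. (g x)\<^sup>2)"
  shows "integrable M (\<lambda>x. f x * g x)"
proof (rule Bochner_Integration.integrable_bound)
  show "integrable M (\<lambda>x. (f x)\<^sup>2 + (g x)\<^sup>2)" using assms by simp
  show "AE x in M. norm (f x * g x) \<le> norm ((f x)\<^sup>2 + (g x)\<^sup>2)"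
  proof (rule AE_I2)
    fix x
    have "2 * (\<bar>f x\<bar> * \<bar>g x\<bar>) \<le> (f x)\<^sup>2 + (g x)\<^sup>2"
      using sum_squares_bound[of "\<bar>f x\<bar>" "\<bar>g x\<bar>"] by simp
    moreover have "0 \<le> \<bar>f x\<bar> * \<bar>g x\<bar>" by simp
    ultimately show "norm (f x * g x) \<le> norm ((f x)\<^sup>2 + (g x)\<^sup>2)"
      unfolding real_norm_def abs_mult by linarith
  qed
qed simp

lemma integral_Cauchy_Schwarz:
  fixes f g :: "'a \<Rightarrow> real"
  assumes [measurable]: "f \<in> borel_measurable M" "g \<in> borel_measurable M"
    and f: "integrable M (\<lambda>x. (f x)\<^sup>2)" and g: "integrable M (\<lambda>x. (g x)\<^sup>2)"
  shows "\<bar>\<integral>x. f x * g x \<partial>M\<bar> \<le> sqrt (\<integral>x. (f x)\<^sup>2 \<partial>M) * sqrt (\<integral>x. (g x)\<^sup>2 \<partial>M)"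
proof -
  define A where "A = (\<integral>x. (f x)\<^sup>2 \<partial>M)"
  define B where "B = (\<integral>x. (g x)\<^sup>2 \<partial>M)"
  define C where "C = (\<integral>x. f x * g x \<partial>M)"
  have fg: "integrable M (\<lambda>x. f x * g x)" by (rule integrable_mult_of_squares[OF assms])
  have A: "A \<ge> 0" and B: "B \<ge> 0" unfolding A_def B_def by auto
  have q: "0 \<le> s\<^sup>2 * A + 2 * s * t * C + t\<^sup>2 * B" for s t :: real
  proof -
    have "0 \<le> (\<integral>x. (s * f x + t * g x)\<^sup>2 \<partial>M)" by simp
    also have "\<dots> = (\<integral>x. s\<^sup>2 * (f x)\<^sup>2 + 2 * s * t * (f x * g x) + t\<^sup>2 * (g x)\<^sup>2 \<partial>M)"
      by (intro Bochner_Integration.integral_cong) (auto simp: power2_eq_square algebra_simps)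
    also have "\<dots> = s\<^sup>2 * A + 2 * s * t * C + t\<^sup>2 * B"
      unfolding A_def B_def C_def using f g fg by simp
    finally show ?thesis .
  qed
  have "C\<^sup>2 \<le> A * B"
  proof (cases "B = 0")
    case True
    have "0 \<le> A - 2 * k * C\<^sup>2" for k
      using q[of 1 "- k * C"] True by (simp add: power2_eq_square algebra_simps)
    \<comment> \<open>If B = 0 the form is affine in \<open>k\<close>; this value of
      \<open>k\<close> would make it equal to -1 unless C = 0.\<close>
    from this[of "(A + 1) / (2 * C\<^sup>2)"] have "C = 0" by (cases "C = 0") (auto simp: field_simps)
    then show ?thesis using True by simp
  next
    case False
    then have "B > 0" using B by simp
    have "0 \<le> B\<^sup>2 * A - 2 * B * C * C + C\<^sup>2 * B" using q[of B "- C"] by simp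
    then have "0 \<le> B * (A * B - C\<^sup>2)" by (simp add: power2_eq_square algebra_simps)
    then show ?thesis using \<open>B > 0\<close> by (simp add: zero_le_mult_iff)
  qed
  then have "\<bar>C\<bar> \<le> sqrt (A * B)" by (metis real_sqrt_abs real_sqrt_le_iff)
  then show ?thesis unfolding A_def B_def C_def by (simp add: real_sqrt_mult)
qed

text \<open>Cauchy-Schwarz in the plane. It recombines the two parts of a conditional covariance
  estimate without loss in the constant.\<close>

lemma sqrt_mult_add_le:
  fixes a b c d :: real
  assumes "a \<ge> 0" "b \<ge> 0" "c \<ge> 0" "d \<ge> 0"
  shows "sqrt a * sqrt b + sqrt c * sqrt d \<le> sqrt (a + c) * sqrt (b + d)"
proof -
  have "2 * (sqrt (a * d) * sqrt (b * c)) \<le> a * d + b * c"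
    using sum_squares_bound[of "sqrt (a * d)" "sqrt (b * c)"] assms by (simp add: mult.assoc)
  then have "(sqrt a * sqrt b + sqrt c * sqrt d)\<^sup>2 \<le> (a + c) * (b + d)"
    using assms by (simp add: power2_sum power_mult_distrib real_sqrt_mult algebra_simps)
  then have "sqrt a * sqrt b + sqrt c * sqrt d \<le> sqrt ((a + c) * (b + d))"
    by (rule real_le_rsqrt)
  then show ?thesis by (simp add: real_sqrt_mult)
qed

context prob_space
begin

lemma integrable_of_square:
  fixes f :: "'a \<Rightarrow> real"
  assumes "f \<in> borel_measurable M" "integrable M (\<lambda>x. (f x)\<^sup>2)"
  shows "integrable M f"
  using integrable_mult_of_squares[of f M "\<lambda>_. 1"] assms by simp

lemma covar_eq:
  assumes "f \<in> borel_measurable M" "g \<in> borel_measurable M"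
    and "integrable M (\<lambda>x. (f x)\<^sup>2)" "integrable M (\<lambda>x. (g x)\<^sup>2)"
  shows "covar M f g = expectation (\<lambda>x. f x * g x) - expectation f * expectation g"
proof -
  note [simp] = integrable_of_square[of f] integrable_of_square[of g] integrable_mult_of_squares[of f M g] assms
  have "covar M f g = expectation (\<lambda>x. f x * g x - f x * expectation g - expectation f * g x + expectation f * expectation g)"
    unfolding covar_def by (intro Bochner_Integration.integral_cong) (auto simp: algebra_simps)
  also have "\<dots> = expectation (\<lambda>x. f x * g x) - expectation f * expectation g"
    by (simp add: prob_space)
  finally show ?thesis .
qed

lemma covar_self_nonneg: "covar M f f \<ge> 0"
  unfolding covar_def by auto

lemma covar_self_le:
  assumes "f \<in> borel_measurable M" "integrable M (\<lambda>x. (f x)\<^sup>2)"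
  shows "covar M f f \<le> expectation (\<lambda>x. (f x)\<^sup>2)"
  using covar_eq[of f f] assms by (simp add: power2_eq_square)

lemma covar_Cauchy_Schwarz:
  assumes f: "f \<in> borel_measurable M" "integrable M (\<lambda>x. (f x)\<^sup>2)"
    and g: "g \<in> borel_measurable M" "integrable M (\<lambda>x. (g x)\<^sup>2)"
  shows "\<bar>covar M f g\<bar> \<le> sqrt (covar M f f) * sqrt (covar M g g)"
proof -
  have i: "integrable M (\<lambda>x. (h x - a)\<^sup>2)" if "h \<in> borel_measurable M" "integrable M (\<lambda>x. (h x)\<^sup>2)"
    for h :: "'a \<Rightarrow> real" and a
    using that integrable_of_square[OF that] by (simp add: power2_diff)
  show ?thesis unfolding covar_def
    using integral_Cauchy_Schwarz[of "\<lambda>x. f x - expectation f" M "\<lambda>x. g x - expectation g"] f g i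
    by (simp add: power2_eq_square)
qed

end

section \<open>Maximal correlation of sigma-algebras and its tensorization\<close>

text \<open>Bounded test functions suffice as a definition: their sections and conditional means are
  again bounded, so that Fubini applies freely. The product on the right replaces the quotient in
  \<open>corr\<close>, which would need a case distinction for constants.\<close>

definition max_corr_le :: "'a measure \<Rightarrow> 'a measure \<Rightarrow> 'a measure \<Rightarrow> real \<Rightarrow> bool" where
  "max_corr_le M A B \<rho> \<longleftrightarrow>
    (\<forall>f g. f \<in> borel_measurable A \<longrightarrow> g \<in> borel_measurable B \<longrightarrow>
      (\<exists>K. \<forall>x\<in>space M. \<bar>f x\<bar> \<le> K) \<longrightarrow> (\<exists>K. \<forall>x\<in>space M. \<bar>g x\<bar> \<le> K) \<longrightarrow>
      \<bar>covar M f g\<bar> \<le> \<rho> * (sqrt (covar M f f) * sqrt (covar M g g)))"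

lemma max_corr_leD:
  assumes "max_corr_le M A B \<rho>" "f \<in> borel_measurable A" "g \<in> borel_measurable B"
    and "\<And>x. x \<in> space M \<Longrightarrow> \<bar>f x\<bar> \<le> K" "\<And>x. x \<in> space M \<Longrightarrow> \<bar>g x\<bar> \<le> L"
  shows "\<bar>covar M f g\<bar> \<le> \<rho> * (sqrt (covar M f f) * sqrt (covar M g g))"
  using assms unfolding max_corr_le_def by blast

lemma (in prob_space) integrable_bounded:
  fixes f :: "'a \<Rightarrow> real"
  assumes "f \<in> borel_measurable M" "\<And>x. x \<in> space M \<Longrightarrow> \<bar>f x\<bar> \<le> K"
  shows "integrable M f"
  using assms by (intro integrable_const_bound[where B=K]) (auto intro!: AE_I2)

lemma (in prob_space) abs_expectation_le:
  fixes f :: "'a \<Rightarrow> real"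
  assumes "f \<in> borel_measurable M" "\<And>x. x \<in> space M \<Longrightarrow> \<bar>f x\<bar> \<le> K"
  shows "\<bar>expectation f\<bar> \<le> K"
proof -
  have "\<bar>expectation f\<bar> \<le> expectation (\<lambda>x. \<bar>f x\<bar>)"
    using integral_abs_bound[of M f] by simp
  also have "\<dots> \<le> expectation (\<lambda>_. K)"
    using assms integrable_bounded[OF assms] by (intro integral_mono) auto
  finally show ?thesis by (simp add: prob_space)
qed

lemma (in prob_space) integrable_square_bounded:
  fixes f :: "'a \<Rightarrow> real"
  assumes "f \<in> borel_measurable M" "\<And>x. x \<in> space M \<Longrightarrow> \<bar>f x\<bar> \<le> K"
  shows "integrable M (\<lambda>x. (f x)\<^sup>2)"
  using assms power_mono[OF assms(2), of _ 2] by (intro integrable_bounded[where K="K\<^sup>2"]) auto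

text \<open>Truncation at level n keeps the measurability with respect to \<open>A\<close> and
  \<open>B\<close>, and all three covariances converge by dominated convergence.\<close>

lemma (in prob_space) max_corr_le_square_integrable:
  assumes mc: "max_corr_le M A B \<rho>" and A: "subalgebra M A" and B: "subalgebra M B" and "\<rho> \<ge> 0"
    and f: "f \<in> borel_measurable A" "integrable M (\<lambda>x. (f x)\<^sup>2)"
    and g: "g \<in> borel_measurable B" "integrable M (\<lambda>x. (g x)\<^sup>2)"
  shows "\<bar>covar M f g\<bar> \<le> \<rho> * (sqrt (covar M f f) * sqrt (covar M g g))"
proof -
  have fM[measurable]: "f \<in> borel_measurable M" using f A measurable_from_subalg by blast
  have gM[measurable]: "g \<in> borel_measurable M" using g B measurable_from_subalg by blast
  define tr where "tr n x = max (- real n) (min (real n) x)" for n and x :: real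
  have tr_b: "\<bar>tr n x\<bar> \<le> real n" "\<bar>tr n x\<bar> \<le> \<bar>x\<bar>" for n x unfolding tr_def by auto
  have tr_m[measurable]: "tr n \<in> borel_measurable borel" for n unfolding tr_def by measurable
  have tr_lim: "(\<lambda>n. tr n x) \<longlonglongrightarrow> x" for x
  proof (rule tendsto_eventually)
    obtain N where "\<bar>x\<bar> \<le> real N" using real_arch_simple by blast
    then have "\<And>n. n \<ge> N \<Longrightarrow> tr n x = x" unfolding tr_def by (auto simp: max_def min_def)
    then show "\<forall>\<^sub>F n in sequentially. tr n x = x" using eventually_sequentially by blast
  qed
  have conv: "(\<lambda>n. covar M (\<lambda>x. tr n (f x)) (\<lambda>x. tr n (g x))) \<longlonglongrightarrow> covar M f g"
    if [measurable]: "f \<in> borel_measurable M" "g \<in> borel_measurable M"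
      and i: "integrable M (\<lambda>x. (f x)\<^sup>2)" "integrable M (\<lambda>x. (g x)\<^sup>2)" for f g
  proof -
    have sq: "integrable M (\<lambda>x. (tr n (h x))\<^sup>2)" if [measurable]: "h \<in> borel_measurable M" for h n
      by (rule integrable_square_bounded[where K="real n"]) (auto intro: tr_b)
    have e: "(\<lambda>n. expectation (\<lambda>x. tr n (h x))) \<longlonglongrightarrow> expectation h"
      if [measurable]: "h \<in> borel_measurable M" and "integrable M (\<lambda>x. (h x)\<^sup>2)" for h
      by (rule integral_dominated_convergence[where w="\<lambda>x. \<bar>h x\<bar>"])
         (use integrable_of_square[OF that] in \<open>auto intro: tr_lim tr_b\<close>)
    have p: "(\<lambda>n. expectation (\<lambda>x. tr n (f x) * tr n (g x))) \<longlonglongrightarrow> expectation (\<lambda>x. f x * g x)"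
    proof (rule integral_dominated_convergence[where w="\<lambda>x. \<bar>f x * g x\<bar>"])
      show "integrable M (\<lambda>x. \<bar>f x * g x\<bar>)" using integrable_mult_of_squares[of f M g] i by simp
      show "AE x in M. (\<lambda>n. tr n (f x) * tr n (g x)) \<longlonglongrightarrow> f x * g x"
        by (intro AE_I2 tendsto_mult tr_lim)
      show "AE x in M. norm (tr n (f x) * tr n (g x)) \<le> \<bar>f x * g x\<bar>" for n
        by (auto simp: abs_mult intro!: AE_I2 mult_mono tr_b)
    qed auto
    show ?thesis
      by (subst covar_eq, measurable, rule sq, measurable, rule sq, measurable, subst covar_eq)
         (auto intro!: tendsto_diff tendsto_mult p e i)
  qed
  have "\<bar>covar M (\<lambda>x. tr n (f x)) (\<lambda>x. tr n (g x))\<bar> \<le>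
      \<rho> * (sqrt (covar M (\<lambda>x. tr n (f x)) (\<lambda>x. tr n (f x))) * sqrt (covar M (\<lambda>x. tr n (g x)) (\<lambda>x. tr n (g x))))" for n
    using f(1) g(1) by (intro max_corr_leD[OF mc, where K="real n" and L="real n"]) (auto intro: tr_b)
  then show ?thesis
    by (intro LIMSEQ_le[OF tendsto_rabs[OF conv] tendsto_mult[OF tendsto_const tendsto_mult[OF
          tendsto_real_sqrt[OF conv] tendsto_real_sqrt[OF conv]]]]) (auto simp: f g)
qed

lemma subalgebra_pair_measure:
  assumes "subalgebra M1 A1" "subalgebra M2 A2"
  shows "subalgebra (M1 \<Otimes>\<^sub>M M2) (A1 \<Otimes>\<^sub>M A2)"
proof -
  have "(\<lambda>x. x) \<in> measurable (M1 \<Otimes>\<^sub>M M2) (A1 \<Otimes>\<^sub>M A2)"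
  proof (rule measurable_pair)
    have "(\<lambda>x. x) \<in> measurable M1 A1" "(\<lambda>x. x) \<in> measurable M2 A2"
      using assms by (auto simp: subalgebra_def intro!: measurableI)
    from measurable_compose[OF measurable_fst this(1)] measurable_compose[OF measurable_snd this(2)]
    show "fst \<circ> (\<lambda>x. x) \<in> measurable (M1 \<Otimes>\<^sub>M M2) A1" "snd \<circ> (\<lambda>x. x) \<in> measurable (M1 \<Otimes>\<^sub>M M2) A2"
      by (auto simp: comp_def)
  qed
  then have "(\<lambda>x. x) -` X \<inter> space (M1 \<Otimes>\<^sub>M M2) \<in> sets (M1 \<Otimes>\<^sub>M M2)" if "X \<in> sets (A1 \<Otimes>\<^sub>M A2)" for X
    using that measurable_sets by blast
  moreover have sp: "space (A1 \<Otimes>\<^sub>M A2) = space (M1 \<Otimes>\<^sub>M M2)"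
    using assms by (simp add: subalgebra_def space_pair_measure)
  moreover have "(\<lambda>x. x) -` X \<inter> space (M1 \<Otimes>\<^sub>M M2) = X" if "X \<in> sets (A1 \<Otimes>\<^sub>M A2)" for X
    using sets.sets_into_space[OF that] sp by auto
  ultimately show ?thesis unfolding subalgebra_def by auto
qed

lemma subalgebra_PiM:
  assumes "\<And>i. i \<in> I \<Longrightarrow> subalgebra (M i) (A i)"
  shows "subalgebra (PiM I M) (PiM I A)"
proof -
  have sp: "space (PiM I A) = space (PiM I M)"
    using assms by (auto simp: subalgebra_def space_PiM PiE_def Pi_def)
  have "(\<lambda>x. x) \<in> measurable (PiM I M) (PiM I A)"
  proof (rule measurable_PiM_single')
    fix i assume "i \<in> I"
    then have "(\<lambda>x. x) \<in> measurable (M i) (A i)"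
      using assms[of i] by (auto simp: subalgebra_def intro!: measurableI)
    from measurable_compose[OF measurable_component_singleton[OF \<open>i \<in> I\<close>, of M] this]
    show "(\<lambda>x. x i) \<in> measurable (PiM I M) (A i)" by simp
  qed (use sp in \<open>auto simp: space_PiM\<close>)
  then have "(\<lambda>x. x) -` X \<inter> space (PiM I M) \<in> sets (PiM I M)" if "X \<in> sets (PiM I A)" for X
    using that measurable_sets by blast
  moreover have "(\<lambda>x. x) -` X \<inter> space (PiM I M) = X" if "X \<in> sets (PiM I A)" for X
    using sets.sets_into_space[OF that] sp by auto
  ultimately show ?thesis unfolding subalgebra_def using sp by auto
qed

text \<open>The law of total covariance, conditioning on the second coordinate.\<close>

lemma total_covariance:
  fixes f g :: "'a \<times> 'b \<Rightarrow> real"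
  assumes "prob_space M1" "prob_space M2"
    and [measurable]: "f \<in> borel_measurable (M1 \<Otimes>\<^sub>M M2)" "g \<in> borel_measurable (M1 \<Otimes>\<^sub>M M2)"
    and K: "\<And>x. x \<in> space (M1 \<Otimes>\<^sub>M M2) \<Longrightarrow> \<bar>f x\<bar> \<le> K"
    and L: "\<And>x. x \<in> space (M1 \<Otimes>\<^sub>M M2) \<Longrightarrow> \<bar>g x\<bar> \<le> L"
  shows "covar (M1 \<Otimes>\<^sub>M M2) f g =
    covar M2 (\<lambda>y. \<integral>x. f (x, y) \<partial>M1) (\<lambda>y. \<integral>x. g (x, y) \<partial>M1) +
    (\<integral>y. covar M1 (\<lambda>x. f (x, y)) (\<lambda>x. g (x, y)) \<partial>M2)"
proof -
  interpret M1: prob_space M1 by fact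
  interpret M2: prob_space M2 by fact
  interpret P: pair_prob_space M1 M2 ..
  have sw[measurable]: "(\<lambda>(y, x). f (x, y)) \<in> borel_measurable (M2 \<Otimes>\<^sub>M M1)" "(\<lambda>(y, x). g (x, y)) \<in> borel_measurable (M2 \<Otimes>\<^sub>M M1)"
    by measurable
  have K': "\<bar>f (x, y)\<bar> \<le> K" "\<bar>g (x, y)\<bar> \<le> L" if "x \<in> space M1" "y \<in> space M2" for x y
    using K L that by (auto simp: space_pair_measure)
  have KL: "\<bar>f (x, y) * g (x, y)\<bar> \<le> K * L" if "x \<in> space M1" "y \<in> space M2" for x y
    using K'[OF that] by (auto simp: abs_mult intro!: mult_mono)
  have Fm[measurable]: "(\<lambda>y. \<integral>x. f (x, y) \<partial>M1) \<in> borel_measurable M2" "(\<lambda>y. \<integral>x. g (x, y) \<partial>M1) \<in> borel_measurable M2"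
    by measurable
  have b1: "\<bar>\<integral>x. f (x, y) \<partial>M1\<bar> \<le> K" "\<bar>\<integral>x. g (x, y) \<partial>M1\<bar> \<le> L" if "y \<in> space M2" for y
    using that K' by (auto intro!: M1.abs_expectation_le)
  have b2: "\<bar>\<integral>x. f (x, y) * g (x, y) \<partial>M1\<bar> \<le> K * L" if "y \<in> space M2" for y
    using that KL by (auto intro!: M1.abs_expectation_le)
  have b3: "\<bar>(\<integral>x. f (x, y) \<partial>M1) * (\<integral>x. g (x, y) \<partial>M1)\<bar> \<le> K * L" if "y \<in> space M2" for y
    using b1[OF that] by (auto simp: abs_mult intro!: mult_mono)
  have i: "integrable (M1 \<Otimes>\<^sub>M M2) f" "integrable (M1 \<Otimes>\<^sub>M M2) g" "integrable (M1 \<Otimes>\<^sub>M M2) (\<lambda>x. f x * g x)"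
    using K' KL by (auto intro!: P.integrable_bounded simp: space_pair_measure)
  have F: "(\<integral>x. h x \<partial>(M1 \<Otimes>\<^sub>M M2)) = (\<integral>y. \<integral>x. h (x, y) \<partial>M1 \<partial>M2)" if "integrable (M1 \<Otimes>\<^sub>M M2) h" for h :: "_ \<Rightarrow> real"
    using P.integral_snd[of "\<lambda>x y. h (x, y)"] that by simp
  have c1: "covar M1 (\<lambda>x. f (x, y)) (\<lambda>x. g (x, y)) =
      (\<integral>x. f (x, y) * g (x, y) \<partial>M1) - (\<integral>x. f (x, y) \<partial>M1) * (\<integral>x. g (x, y) \<partial>M1)" if "y \<in> space M2" for y
    using that K' by (intro M1.covar_eq M1.integrable_square_bounded) auto
  have "(\<integral>y. covar M1 (\<lambda>x. f (x, y)) (\<lambda>x. g (x, y)) \<partial>M2) =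
     (\<integral>y. (\<integral>x. f (x, y) * g (x, y) \<partial>M1) - (\<integral>x. f (x, y) \<partial>M1) * (\<integral>x. g (x, y) \<partial>M1) \<partial>M2)"
    by (intro Bochner_Integration.integral_cong c1) auto
  also have "\<dots> = (\<integral>y. (\<integral>x. f (x, y) * g (x, y) \<partial>M1) \<partial>M2) - (\<integral>y. (\<integral>x. f (x, y) \<partial>M1) * (\<integral>x. g (x, y) \<partial>M1) \<partial>M2)"
    by (intro Bochner_Integration.integral_diff M2.integrable_bounded[OF _ b2] M2.integrable_bounded[OF _ b3]) auto
  finally have 1: "(\<integral>y. covar M1 (\<lambda>x. f (x, y)) (\<lambda>x. g (x, y)) \<partial>M2) = \<dots>" .
  have 2: "covar M2 (\<lambda>y. \<integral>x. f (x, y) \<partial>M1) (\<lambda>y. \<integral>x. g (x, y) \<partial>M1) =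
     (\<integral>y. (\<integral>x. f (x, y) \<partial>M1) * (\<integral>x. g (x, y) \<partial>M1) \<partial>M2) - (\<integral>y. \<integral>x. f (x, y) \<partial>M1 \<partial>M2) * (\<integral>y. \<integral>x. g (x, y) \<partial>M1 \<partial>M2)"
    using b1 by (intro M2.covar_eq M2.integrable_square_bounded) auto
  have 3: "covar (M1 \<Otimes>\<^sub>M M2) f g = (\<integral>x. f x * g x \<partial>(M1 \<Otimes>\<^sub>M M2)) - (\<integral>x. f x \<partial>(M1 \<Otimes>\<^sub>M M2)) * (\<integral>x. g x \<partial>(M1 \<Otimes>\<^sub>M M2))"
    using K L by (intro P.covar_eq P.integrable_square_bounded) auto
  show ?thesis unfolding 1 2 3 using F[OF i(1)] F[OF i(2)] F[OF i(3)] by simp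
qed

text \<open>Conditioning on the second coordinate splits the covariance in two. The covariance of
  the conditional means is controlled by \<open>c2\<close>. The conditional covariance is controlled
  by \<open>c1\<close> for each fixed \<open>y\<close> and then integrated with Cauchy-Schwarz. The
  planar inequality \<open>sqrt_mult_add_le\<close> joins both parts with the same \<rho>.\<close>

lemma max_corr_le_pair:
  assumes M1: "prob_space M1" and M2: "prob_space M2" and "\<rho> \<ge> 0"
    and A1: "subalgebra M1 A1" and B1: "subalgebra M1 B1" and A2: "subalgebra M2 A2" and B2: "subalgebra M2 B2"
    and c1: "max_corr_le M1 A1 B1 \<rho>" and c2: "max_corr_le M2 A2 B2 \<rho>"
  shows "max_corr_le (M1 \<Otimes>\<^sub>M M2) (A1 \<Otimes>\<^sub>M A2) (B1 \<Otimes>\<^sub>M B2) \<rho>"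
  unfolding max_corr_le_def
proof (intro allI impI, elim exE)
  interpret M1: prob_space M1 by fact
  interpret M2: prob_space M2 by fact
  interpret P: pair_prob_space M1 M2 ..
  fix f g :: "'a \<times> 'b \<Rightarrow> real" and K L
  assume f: "f \<in> borel_measurable (A1 \<Otimes>\<^sub>M A2)" and g: "g \<in> borel_measurable (B1 \<Otimes>\<^sub>M B2)"
    and K: "\<forall>x\<in>space (M1 \<Otimes>\<^sub>M M2). \<bar>f x\<bar> \<le> K" and L: "\<forall>x\<in>space (M1 \<Otimes>\<^sub>M M2). \<bar>g x\<bar> \<le> L"
  have K': "\<bar>f (x, y)\<bar> \<le> K" "\<bar>g (x, y)\<bar> \<le> L" if "x \<in> space M1" "y \<in> space M2" for x y
    using K L that by (auto simp: space_pair_measure)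
  have fM[measurable]: "f \<in> borel_measurable (M1 \<Otimes>\<^sub>M M2)" and gM[measurable]: "g \<in> borel_measurable (M1 \<Otimes>\<^sub>M M2)"
    using measurable_from_subalg[OF subalgebra_pair_measure] A1 A2 B1 B2 f g by blast+
  define F where "F y = (\<integral>x. f (x, y) \<partial>M1)" for y
  define G where "G y = (\<integral>x. g (x, y) \<partial>M1)" for y
  \<comment> \<open>Only the first factor is enlarged to the full sigma-algebra: the conditional
    mean has to stay measurable with respect to the small sigma-algebra of the second
    factor.\<close>
  have meas: "(\<lambda>y. \<integral>x. h (x, y) \<partial>M1) \<in> borel_measurable C2"
    if h: "h \<in> borel_measurable (C1 \<Otimes>\<^sub>M C2)" and C1: "subalgebra M1 C1" for h :: "_ \<Rightarrow> real" and C1 and C2 :: "'b measure"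
  proof -
    have "subalgebra (M1 \<Otimes>\<^sub>M C2) (C1 \<Otimes>\<^sub>M C2)"
      by (rule subalgebra_pair_measure[OF C1]) (simp add: subalgebra_def)
    then have [measurable]: "h \<in> borel_measurable (M1 \<Otimes>\<^sub>M C2)" using h measurable_from_subalg by blast
    show ?thesis by measurable
  qed
  have sec: "(\<lambda>x. h (x, y)) \<in> borel_measurable C1"
    if h: "h \<in> borel_measurable (C1 \<Otimes>\<^sub>M C2)" and "y \<in> space C2" for h :: "_ \<Rightarrow> real" and C1 :: "'a measure" and C2 :: "'b measure" and y
    using that by (rule measurable_Pair1)
  have b1: "\<bar>F y\<bar> \<le> K" "\<bar>G y\<bar> \<le> L" if "y \<in> space M2" for y
    unfolding F_def G_def using that K' by (auto intro!: M1.abs_expectation_le)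
  have Fm: "F \<in> borel_measurable A2" "G \<in> borel_measurable B2"
    unfolding F_def G_def using meas[OF f A1] meas[OF g B1] by auto
  define Cf where "Cf y = covar M1 (\<lambda>x. f (x, y)) (\<lambda>x. f (x, y))" for y
  define Cg where "Cg y = covar M1 (\<lambda>x. g (x, y)) (\<lambda>x. g (x, y))" for y
  define Cfg where "Cfg y = covar M1 (\<lambda>x. f (x, y)) (\<lambda>x. g (x, y))" for y
  have Cm[measurable]: "Cf \<in> borel_measurable M2" "Cg \<in> borel_measurable M2" "Cfg \<in> borel_measurable M2"
    unfolding Cf_def Cg_def Cfg_def covar_def by measurable
  have Cnn: "Cf y \<ge> 0" "Cg y \<ge> 0" for y unfolding Cf_def Cg_def by (rule M1.covar_self_nonneg)+
  have sq1: "M1.expectation (\<lambda>x. (f (x, y))\<^sup>2) \<le> K\<^sup>2" if "y \<in> space M2" for y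
  proof -
    have "\<bar>M1.expectation (\<lambda>x. (f (x, y))\<^sup>2)\<bar> \<le> K\<^sup>2"
      by (rule M1.abs_expectation_le) (use that power_mono[OF K'(1), of _ _ 2] in auto)
    then show ?thesis by simp
  qed
  have sq2: "M1.expectation (\<lambda>x. (g (x, y))\<^sup>2) \<le> L\<^sup>2" if "y \<in> space M2" for y
  proof -
    have "\<bar>M1.expectation (\<lambda>x. (g (x, y))\<^sup>2)\<bar> \<le> L\<^sup>2"
      by (rule M1.abs_expectation_le) (use that power_mono[OF K'(2), of _ _ 2] in auto)
    then show ?thesis by simp
  qed
  have Cb: "Cf y \<le> K\<^sup>2" "Cg y \<le> L\<^sup>2" if "y \<in> space M2" for y
  proof -
    have "Cf y \<le> M1.expectation (\<lambda>x. (f (x, y))\<^sup>2)" unfolding Cf_def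
      using K' that by (intro M1.covar_self_le M1.integrable_square_bounded) auto
    then show "Cf y \<le> K\<^sup>2" using sq1[OF that] by simp
    have "Cg y \<le> M1.expectation (\<lambda>x. (g (x, y))\<^sup>2)" unfolding Cg_def
      using K' that by (intro M1.covar_self_le M1.integrable_square_bounded) auto
    then show "Cg y \<le> L\<^sup>2" using sq2[OF that] by simp
  qed
  have pt: "\<bar>Cfg y\<bar> \<le> \<rho> * (sqrt (Cf y) * sqrt (Cg y))" if y: "y \<in> space M2" for y
    unfolding Cfg_def Cf_def Cg_def
    by (rule max_corr_leD[OF c1, where K=K and L=L])
       (use y A2 B2 K' in \<open>auto intro!: sec[OF f] sec[OF g] simp: subalgebra_def\<close>)
  have i: "integrable M2 Cf" "integrable M2 Cg"
    by (rule M2.integrable_bounded[where K="K\<^sup>2"], use Cb Cnn in auto)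
       (rule M2.integrable_bounded[where K="L\<^sup>2"], use Cb Cnn in auto)
  have isq: "integrable M2 (\<lambda>y. sqrt (Cf y) * sqrt (Cg y))"
    by (rule integrable_mult_of_squares) (use Cnn i in auto)
  have iC: "integrable M2 Cfg"
    by (rule Bochner_Integration.integrable_bound[OF integrable_mult_right[OF isq, of \<rho>]])
       (use pt Cnn \<open>\<rho> \<ge> 0\<close> in \<open>auto intro!: AE_I2\<close>)
  have "\<bar>\<integral>y. Cfg y \<partial>M2\<bar> \<le> (\<integral>y. \<bar>Cfg y\<bar> \<partial>M2)" using integral_abs_bound[of M2 Cfg] by simp
  also have "\<dots> \<le> (\<integral>y. \<rho> * (sqrt (Cf y) * sqrt (Cg y)) \<partial>M2)"
    using pt iC isq by (intro integral_mono) auto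
  also have "\<dots> = \<rho> * (\<integral>y. sqrt (Cf y) * sqrt (Cg y) \<partial>M2)" by simp
  also have "\<dots> \<le> \<rho> * (sqrt (\<integral>y. Cf y \<partial>M2) * sqrt (\<integral>y. Cg y \<partial>M2))"
    using integral_Cauchy_Schwarz[of "\<lambda>y. sqrt (Cf y)" M2 "\<lambda>y. sqrt (Cg y)"] i Cnn \<open>\<rho> \<ge> 0\<close>
    by (intro mult_left_mono) auto
  finally have 1: "\<bar>\<integral>y. Cfg y \<partial>M2\<bar> \<le> \<dots>" .
  have 2: "\<bar>covar M2 F G\<bar> \<le> \<rho> * (sqrt (covar M2 F F) * sqrt (covar M2 G G))"
    by (rule max_corr_leD[OF c2 Fm b1])
  have t1: "covar (M1 \<Otimes>\<^sub>M M2) f g = covar M2 F G + (\<integral>y. Cfg y \<partial>M2)"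
    unfolding F_def G_def Cfg_def by (rule total_covariance) (use M1 M2 K L in auto)
  have t2: "covar (M1 \<Otimes>\<^sub>M M2) f f = covar M2 F F + (\<integral>y. Cf y \<partial>M2)"
    unfolding F_def Cf_def by (rule total_covariance) (use M1 M2 K L in auto)
  have t3: "covar (M1 \<Otimes>\<^sub>M M2) g g = covar M2 G G + (\<integral>y. Cg y \<partial>M2)"
    unfolding G_def Cg_def by (rule total_covariance) (use M1 M2 K L in auto)
  have "\<bar>covar (M1 \<Otimes>\<^sub>M M2) f g\<bar> \<le> \<rho> * (sqrt (covar M2 F F) * sqrt (covar M2 G G) + sqrt (\<integral>y. Cf y \<partial>M2) * sqrt (\<integral>y. Cg y \<partial>M2))"
    unfolding t1 using 1 2 by (simp add: distrib_left)
  also have "\<dots> \<le> \<rho> * (sqrt (covar (M1 \<Otimes>\<^sub>M M2) f f) * sqrt (covar (M1 \<Otimes>\<^sub>M M2) g g))"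
    unfolding t2 t3 using Cnn M2.covar_self_nonneg \<open>\<rho> \<ge> 0\<close> by (intro mult_left_mono sqrt_mult_add_le) auto
  finally show "\<bar>covar (M1 \<Otimes>\<^sub>M M2) f g\<bar> \<le> \<rho> * (sqrt (covar (M1 \<Otimes>\<^sub>M M2) f f) * sqrt (covar (M1 \<Otimes>\<^sub>M M2) g g))" .
qed

text \<open>The theorem of Csaki and Fischer: tensorization does not increase the maximal correlation.\<close>

lemma max_corr_le_PiM:
  assumes "finite I" and "\<rho> \<ge> 0"
    and M: "\<And>i. i \<in> I \<Longrightarrow> prob_space (M i)"
    and A: "\<And>i. i \<in> I \<Longrightarrow> subalgebra (M i) (A i)" and B: "\<And>i. i \<in> I \<Longrightarrow> subalgebra (M i) (B i)"
    and c: "\<And>i. i \<in> I \<Longrightarrow> max_corr_le (M i) (A i) (B i) \<rho>"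
  shows "max_corr_le (PiM I M) (PiM I A) (PiM I B) \<rho>"
  using assms(1) M A B c
proof (induction I)
  case empty
  have "covar (PiM {} M) f g = 0" for f g
    unfolding covar_def by (simp add: PiM_empty lebesgue_integral_count_space_finite)
  then show ?case unfolding max_corr_le_def by simp
next
  case (insert i I)
  let ?N = "PiM I M" and ?U = "\<lambda>(x, X). X(i := x)"
  interpret N: prob_space ?N using insert by (intro prob_space_PiM) auto
  interpret Mi: prob_space "M i" using insert by auto
  have um: "?U \<in> measurable (C i \<Otimes>\<^sub>M PiM I C) (PiM (insert i I) C)" for C :: "_ \<Rightarrow> 'b measure"
    by measurable
  have pr: "max_corr_le (M i \<Otimes>\<^sub>M ?N) (A i \<Otimes>\<^sub>M PiM I A) (B i \<Otimes>\<^sub>M PiM I B) \<rho>"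
    using insert by (intro max_corr_le_pair \<open>\<rho> \<ge> 0\<close> subalgebra_PiM prob_space_PiM insert.IH) auto
  have D: "PiM (insert i I) M = distr (M i \<Otimes>\<^sub>M ?N) (PiM (insert i I) M) ?U"
    using insert by (intro distr_pair_PiM_eq_PiM[symmetric]) auto
  have cov: "covar (PiM (insert i I) M) f g = covar (M i \<Otimes>\<^sub>M ?N) (\<lambda>z. f (?U z)) (\<lambda>z. g (?U z))"
    if "f \<in> borel_measurable (PiM (insert i I) M)" "g \<in> borel_measurable (PiM (insert i I) M)" for f g
  proof -
    have *: "integral\<^sup>L (PiM (insert i I) M) h = (\<integral>z. h (?U z) \<partial>(M i \<Otimes>\<^sub>M ?N))"
      if "h \<in> borel_measurable (PiM (insert i I) M)" for h :: "_ \<Rightarrow> real"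
      by (subst D) (rule integral_distr[OF um that])
    show ?thesis unfolding covar_def using that by (simp add: *)
  qed
  show ?case unfolding max_corr_le_def
  proof (intro allI impI, elim exE)
    fix f g :: "_ \<Rightarrow> real" and K L
    assume f: "f \<in> borel_measurable (PiM (insert i I) A)" and g: "g \<in> borel_measurable (PiM (insert i I) B)"
      and K: "\<forall>x\<in>space (PiM (insert i I) M). \<bar>f x\<bar> \<le> K" and L: "\<forall>x\<in>space (PiM (insert i I) M). \<bar>g x\<bar> \<le> L"
    have fM: "f \<in> borel_measurable (PiM (insert i I) M)"
      using measurable_from_subalg[OF subalgebra_PiM f] insert by auto
    have gM: "g \<in> borel_measurable (PiM (insert i I) M)"
      using measurable_from_subalg[OF subalgebra_PiM g] insert by auto
    show "\<bar>covar (PiM (insert i I) M) f g\<bar> \<le>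
       \<rho> * (sqrt (covar (PiM (insert i I) M) f f) * sqrt (covar (PiM (insert i I) M) g g))"
      unfolding cov[OF fM gM] cov[OF fM fM] cov[OF gM gM]
    proof (rule max_corr_leD[OF pr, where K=K and L=L])
      fix z assume "z \<in> space (M i \<Otimes>\<^sub>M ?N)"
      then have "?U z \<in> space (PiM (insert i I) M)" by (rule measurable_space[OF um])
      then show "\<bar>f (?U z)\<bar> \<le> K" "\<bar>g (?U z)\<bar> \<le> L" using K L by auto
    qed (use measurable_compose[OF um f] measurable_compose[OF um g] in auto)
  qed
qed

section \<open>A central limit theorem under logarithmic mixing rates\<close>

lemma cesaro_mean_tendsto:
  fixes a :: "nat \<Rightarrow> real"
  assumes "a \<longlonglongrightarrow> L"
  shows "(\<lambda>n. (\<Sum>k<n. a k) / real n) \<longlonglongrightarrow> L"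
proof (rule LIMSEQ_I)
  fix e :: real assume e: "e > 0"
  obtain N where N: "\<And>k. k \<ge> N \<Longrightarrow> \<bar>a k - L\<bar> < e / 2"
    using LIMSEQ_D[OF assms, of "e/2"] e by (auto simp: real_norm_def)
  define B where "B = (\<Sum>k<N. \<bar>a k - L\<bar>)"
  obtain n0 where n0: "real n0 > 2 * B / e" using reals_Archimedean2 by blast
  show "\<exists>n0. \<forall>n\<ge>n0. norm ((\<Sum>k<n. a k) / real n - L) < e"
  proof (intro exI allI impI)
    fix n assume n: "n \<ge> max (max N n0) 1"
    have "\<bar>(\<Sum>k<n. a k) - real n * L\<bar> = \<bar>\<Sum>k<n. (a k - L)\<bar>" by (simp add: sum_subtractf)
    also have "\<dots> \<le> (\<Sum>k<n. \<bar>a k - L\<bar>)" by (rule sum_abs)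
    also have "\<dots> = B + (\<Sum>k\<in>{N..<n}. \<bar>a k - L\<bar>)"
      unfolding B_def using n by (subst sum.union_disjoint[symmetric]) (auto intro!: sum.cong)
    also have "(\<Sum>k\<in>{N..<n}. \<bar>a k - L\<bar>) \<le> (\<Sum>k\<in>{N..<n}. e / 2)"
      using N by (intro sum_mono less_imp_le) auto
    also have "\<dots> \<le> real n * (e / 2)" using e by (simp add: field_simps)
    finally have "\<bar>(\<Sum>k<n. a k) - real n * L\<bar> \<le> B + real n * (e / 2)" by simp
    moreover have "B < real n * (e / 2)"
    proof -
      have "real n > 2 * B / e" using n n0 by linarith
      then show ?thesis using e by (simp add: field_simps)
    qed
    ultimately have "\<bar>(\<Sum>k<n. a k) - real n * L\<bar> < real n * e" by linarith
    moreover have "(\<Sum>k<n. a k) / real n - L = ((\<Sum>k<n. a k) - real n * L) / real n" using n by (simp add: field_simps)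
    ultimately show "norm ((\<Sum>k<n. a k) / real n - L) < e"
      using n by (simp add: field_simps)
  qed
qed

section \<open>Fourth moments and elementary estimates for characteristic functions\<close>

definition mom4_le :: "'a measure \<Rightarrow> ('a \<Rightarrow> real) \<Rightarrow> real \<Rightarrow> bool" where
  "mom4_le M X K \<longleftrightarrow> X \<in> borel_measurable M \<and> integrable M (\<lambda>x. X x ^ 4) \<and> (\<integral>x. X x ^ 4 \<partial>M) \<le> K"

lemma power4_add_le: "(x + y) ^ 4 \<le> 8 * (x ^ 4 + y ^ 4 :: real)"
proof -
  have a: "(s + t)\<^sup>2 \<le> 2 * (s\<^sup>2 + t\<^sup>2)" for s t :: real
    using sum_squares_bound[of s t] by (simp add: power2_sum)
  have "((x + y)\<^sup>2)\<^sup>2 \<le> (2 * (x\<^sup>2 + y\<^sup>2))\<^sup>2" using a[of x y] by (intro power_mono) auto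
  also have "\<dots> = 4 * (x\<^sup>2 + y\<^sup>2)\<^sup>2" by (simp only: power_mult_distrib) simp
  also have "\<dots> \<le> 8 * ((x\<^sup>2)\<^sup>2 + (y\<^sup>2)\<^sup>2)" using a[of "x\<^sup>2" "y\<^sup>2"] by simp
  finally show ?thesis by (simp flip: power_mult)
qed

lemma mom4_le_add:
  assumes X: "mom4_le M X K" and Y: "mom4_le M Y L"
  shows "mom4_le M (\<lambda>x. X x + Y x) (8 * (K + L))"
proof -
  have [measurable]: "X \<in> borel_measurable M" "Y \<in> borel_measurable M"
    using X Y by (auto simp: mom4_le_def)
  have i: "integrable M (\<lambda>x. 8 * (X x ^ 4 + Y x ^ 4))" using X Y by (auto simp: mom4_le_def)
  have j: "integrable M (\<lambda>x. (X x + Y x) ^ 4)"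
    by (rule Bochner_Integration.integrable_bound[OF i]) (use power4_add_le in auto)
  have "(\<integral>x. (X x + Y x) ^ 4 \<partial>M) \<le> (\<integral>x. 8 * (X x ^ 4 + Y x ^ 4) \<partial>M)"
    by (rule integral_mono[OF j i]) (rule power4_add_le)
  also have "\<dots> \<le> 8 * (K + L)" using X Y by (auto simp: mom4_le_def)
  finally show ?thesis using j by (simp add: mom4_le_def)
qed

lemma mom4_le_cmult:
  assumes X: "mom4_le M X K"
  shows "mom4_le M (\<lambda>x. a * X x) (a ^ 4 * K)"
  using assms by (auto simp: mom4_le_def power_mult_distrib intro: mult_left_mono)

lemma mom4_le_sum:
  assumes "finite I" "\<And>i k. i \<in> I \<Longrightarrow> mom4_le M (X i k) (K i)"
  shows "\<exists>L. \<forall>k. mom4_le M (\<lambda>x. \<Sum>i\<in>I. X i k x) L"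
  using assms
proof (induction I)
  case empty
  then show ?case by (auto simp: mom4_le_def)
next
  case (insert i I)
  then obtain L where "\<forall>k. mom4_le M (\<lambda>x. \<Sum>i\<in>I. X i k x) L" by auto
  with insert have "mom4_le M (\<lambda>x. X i k x + (\<Sum>i\<in>I. X i k x)) (8 * (K i + L))" for k
    by (intro mom4_le_add) auto
  then show ?case using insert by auto
qed

lemma (in prob_space) mom4_le_imp:
  assumes "mom4_le M X K"
  shows "integrable M (\<lambda>x. (X x)\<^sup>2)" "integrable M X"
    "expectation (\<lambda>x. \<bar>X x\<bar> ^ 3) \<le> 1 + K" "integrable M (\<lambda>x. \<bar>X x\<bar> ^ 3)"
proof -
  have [measurable]: "X \<in> borel_measurable M" and i: "integrable M (\<lambda>x. 1 + X x ^ 4)"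
    and K: "expectation (\<lambda>x. X x ^ 4) \<le> K"
    using assms by (auto simp: mom4_le_def)
  have b: "x\<^sup>2 \<le> 1 + x ^ 4" "\<bar>x\<bar> ^ 3 \<le> 1 + x ^ 4" for x :: real
  proof -
    have 1: "\<bar>x\<bar> ^ k \<le> 1 + \<bar>x\<bar> ^ 4" if "k \<le> 4" for k
    proof (cases "\<bar>x\<bar> \<le> 1")
      case True
      then show ?thesis using power_le_one[of "\<bar>x\<bar>" k] by (simp add: add_increasing2)
    next
      case False
      then show ?thesis using power_increasing[of k 4 "\<bar>x\<bar>"] that by simp
    qed
    show "x\<^sup>2 \<le> 1 + x ^ 4" "\<bar>x\<bar> ^ 3 \<le> 1 + x ^ 4" using 1[of 2] 1[of 3] by auto
  qed
  show sq: "integrable M (\<lambda>x. (X x)\<^sup>2)"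
    by (rule Bochner_Integration.integrable_bound[OF i]) (use b in \<open>auto simp: add_nonneg_nonneg\<close>)
  show c: "integrable M (\<lambda>x. \<bar>X x\<bar> ^ 3)"
    by (rule Bochner_Integration.integrable_bound[OF i]) (use b in \<open>auto simp: add_nonneg_nonneg\<close>)
  show "integrable M X" by (rule integrable_of_square[OF _ sq]) simp
  have "expectation (\<lambda>x. \<bar>X x\<bar> ^ 3) \<le> expectation (\<lambda>x. 1 + X x ^ 4)"
    by (rule integral_mono[OF c i]) (rule b)
  also have "\<dots> \<le> 1 + K" using i K by (simp add: prob_space assms[unfolded mom4_le_def])
  finally show "expectation (\<lambda>x. \<bar>X x\<bar> ^ 3) \<le> 1 + K" .
qed

text \<open>Passes from the Taylor polynomial \<open>1 - y\<close> of a characteristic function to a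
  Gaussian one with a slightly different variance: the remainder of the exponential is at most
  \<open>y\<^sup>2 / 2\<close>, and \<open>exp (- y)\<close> has Lipschitz constant 1 on the
  nonnegative axis.\<close>

lemma exp_minus_approx:
  fixes y z :: real
  assumes "y \<ge> 0" "z \<ge> 0"
  shows "\<bar>1 - y - exp (- z)\<bar> \<le> y\<^sup>2 / 2 + \<bar>y - z\<bar>"
proof -
  have l: "1 - y \<le> exp (- y)" using exp_ge_add_one_self[of "- y"] by simp
  have "exp (- y) = 1 / exp y" by (simp add: exp_minus divide_inverse)
  also have "\<dots> \<le> 1 / (1 + y + y\<^sup>2 / 2)"
    using exp_lower_Taylor_quadratic[of y] assms by (intro divide_left_mono) (auto simp: add_pos_nonneg)
  also have "\<dots> \<le> 1 - y + y\<^sup>2 / 2"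
  proof -
    have "(1 - y + y\<^sup>2 / 2) * (1 + y + y\<^sup>2 / 2) = 1 + (y\<^sup>2)\<^sup>2 / 4"
      by (simp add: field_simps power2_eq_square)
    then have "1 \<le> (1 - y + y\<^sup>2 / 2) * (1 + y + y\<^sup>2 / 2)" by simp
    then show ?thesis using assms by (simp add: divide_le_eq add_pos_nonneg)
  qed
  finally have u: "exp (- y) \<le> 1 - y + y\<^sup>2 / 2" .
  have lip: "\<bar>exp (- a) - exp (- b)\<bar> \<le> \<bar>a - b\<bar>" if "a \<ge> 0" "b \<ge> 0" for a b :: real
  proof -
    have *: "exp (- a) - exp (- b) \<le> b - a" if "a \<le> b" "a \<ge> 0" for a b :: real
    proof -
      have "exp (- a) - exp (- b) = exp (- a) * (1 - exp (- (b - a)))"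
        by (simp add: algebra_simps flip: exp_add)
      also have "\<dots> \<le> 1 * (b - a)"
      proof (rule mult_mono)
        show "1 - exp (- (b - a)) \<le> b - a" using exp_ge_add_one_self[of "- (b - a)"] by linarith
      qed (use that in auto)
      finally show ?thesis by simp
    qed
    show ?thesis using *[of a b] *[of b a] that by (cases "a \<le> b") auto
  qed
  show ?thesis using l u lip[OF assms] by linarith
qed

lemma norm_mult_diff_le:
  fixes a b c d :: complex
  assumes "norm a \<le> 1" "norm d \<le> 1"
  shows "norm (a * b - c * d) \<le> norm (a - c) + norm (b - d)"
proof -
  have "norm (a * b - c * d) = norm (a * (b - d) + (a - c) * d)" by (simp add: algebra_simps)
  also have "\<dots> \<le> norm a * norm (b - d) + norm (a - c) * norm d"
    by (metis norm_mult norm_triangle_ineq)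
  also have "\<dots> \<le> 1 * norm (b - d) + norm (a - c) * 1"
    using assms by (intro add_mono mult_mono) auto
  finally show ?thesis by simp
qed

lemma (in prob_space) covar_self_le_shift:
  assumes [measurable]: "f \<in> borel_measurable M" and f: "integrable M (\<lambda>x. (f x)\<^sup>2)"
  shows "covar M f f \<le> expectation (\<lambda>x. (f x - c)\<^sup>2)"
proof -
  have i: "integrable M f" by (rule integrable_of_square[OF _ f]) simp
  have "covar M f f = covar M (\<lambda>x. f x - c) (\<lambda>x. f x - c)"
    unfolding covar_def using i by (simp add: prob_space)
  also have "\<dots> \<le> expectation (\<lambda>x. (f x - c)\<^sup>2)"
    using f i by (intro covar_self_le) (auto simp: power2_diff)
  finally show ?thesis .
qed

lemma (in prob_space) covar_add_right:
  assumes [measurable]: "f \<in> borel_measurable M" "g \<in> borel_measurable M" "h \<in> borel_measurable M"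
    and i: "integrable M (\<lambda>x. (f x)\<^sup>2)" "integrable M (\<lambda>x. (g x)\<^sup>2)" "integrable M (\<lambda>x. (h x)\<^sup>2)"
  shows "covar M f (\<lambda>x. g x + h x) = covar M f g + covar M f h"
proof -
  have j: "integrable M (\<lambda>x. g x * h x)" using i by (intro integrable_mult_of_squares) auto
  have k: "integrable M (\<lambda>x. (g x + h x)\<^sup>2)"
    unfolding power2_sum using i integrable_mult_right[OF j, of 2] by (intro Bochner_Integration.integrable_add) (auto simp: mult.assoc)
  have fg: "integrable M (\<lambda>x. f x * g x)" and fh: "integrable M (\<lambda>x. f x * h x)"
    using i by (auto intro!: integrable_mult_of_squares)
  have gh: "integrable M g" "integrable M h"
    using i by (auto intro!: integrable_of_square)
  have "covar M f (\<lambda>x. g x + h x) = expectation (\<lambda>x. f x * g x + f x * h x) - expectation f * expectation (\<lambda>x. g x + h x)"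
    using i k by (subst covar_eq) (auto simp: distrib_left)
  also have "\<dots> = covar M f g + covar M f h"
    using i fg fh gh by (simp add: covar_eq distrib_left)
  finally show ?thesis .
qed

section \<open>Variance growth of a stationary mixing sequence\<close>

text \<open>The mixing inequality is demanded only for functions of two block sums separated by a
  gap, which is all that variances and characteristic functions of sums require. The condition
  \<open>c_nonneg\<close> is the substitute for assumptions on the growth of the variance.\<close>

locale mixing_sequence = prob_space N for N :: "'b measure" +
  fixes Z :: "nat \<Rightarrow> 'b \<Rightarrow> real" and c :: "nat \<Rightarrow> real" and \<rho> :: "nat \<Rightarrow> real" and K :: real
  assumes Z4: "\<And>k. mom4_le N (Z k) K"
    and mean: "\<And>k. expectation (Z k) = 0"
    and cov: "\<And>k j. expectation (\<lambda>x. Z k x * Z (k + j) x) = c j"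
    and c_nonneg: "\<And>j. c j \<ge> 0"
    and \<rho>_nonneg: "\<And>r. \<rho> r \<ge> 0"
    and \<rho>_summable: "summable (\<lambda>k. \<rho> (2 ^ k))"
    and mix: "\<And>h n r m f g. n \<ge> 1 \<Longrightarrow> f \<in> borel_measurable borel \<Longrightarrow> g \<in> borel_measurable borel \<Longrightarrow>
      integrable N (\<lambda>x. (f (\<Sum>j\<in>{h..<h+n}. Z j x))\<^sup>2) \<Longrightarrow>
      integrable N (\<lambda>x. (g (\<Sum>j\<in>{h+n+r..<h+n+r+m}. Z j x))\<^sup>2) \<Longrightarrow>
      \<bar>covar N (\<lambda>x. f (\<Sum>j\<in>{h..<h+n}. Z j x)) (\<lambda>x. g (\<Sum>j\<in>{h+n+r..<h+n+r+m}. Z j x))\<bar> \<le>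
        \<rho> r * (sqrt (covar N (\<lambda>x. f (\<Sum>j\<in>{h..<h+n}. Z j x)) (\<lambda>x. f (\<Sum>j\<in>{h..<h+n}. Z j x))) *
               sqrt (covar N (\<lambda>x. g (\<Sum>j\<in>{h+n+r..<h+n+r+m}. Z j x)) (\<lambda>x. g (\<Sum>j\<in>{h+n+r..<h+n+r+m}. Z j x))))"
begin

lemma Z_meas[measurable]: "Z k \<in> borel_measurable N"
  using Z4 by (simp add: mom4_le_def)

definition S :: "nat \<Rightarrow> nat \<Rightarrow> 'b \<Rightarrow> real" where
  "S h n x = (\<Sum>j\<in>{h..<h+n}. Z j x)"

lemma S_meas[measurable]: "S h n \<in> borel_measurable N"
  unfolding S_def by measurable

lemma S_add: "S h (m + n) x = S h m x + S (h + m) n x"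
  unfolding S_def by (subst sum.union_disjoint[symmetric]) (auto intro!: sum.cong)

lemma S4: "\<exists>L. \<forall>h. mom4_le N (S h n) L"
proof -
  have "\<exists>L. \<forall>h. mom4_le N (\<lambda>x. \<Sum>i\<in>{..<n}. Z (h + i) x) L"
    by (rule mom4_le_sum) (use Z4 in auto)
  moreover have "(\<Sum>i\<in>{..<n}. Z (h + i) x) = S h n x" for h x
    unfolding S_def by (rule sum.reindex_bij_witness[of _ "\<lambda>i. i - h" "\<lambda>i. i + h"]) (auto simp: add.commute)
  ultimately show ?thesis by simp
qed

lemma S_sq: "integrable N (\<lambda>x. (S h n x)\<^sup>2)"
  using S4[of n] mom4_le_imp by blast

lemma S_int: "integrable N (S h n)"
  using S4[of n] mom4_le_imp by blast

lemma Z_sq: "integrable N (\<lambda>x. (Z k x)\<^sup>2)" "integrable N (Z k)"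
  using Z4[of k] mom4_le_imp by blast+

lemma S_mean: "expectation (S h n) = 0"
  unfolding S_def using mean Z_sq by (subst Bochner_Integration.integral_sum) auto

text \<open>The growth of the variance when a block of length \<open>n\<close> gains one more term.
  It is monotone because the covariances are nonnegative.\<close>

definition inc :: "nat \<Rightarrow> real" where
  "inc n = c 0 + 2 * (\<Sum>j<n. c (Suc j))"

definition v :: "nat \<Rightarrow> real" where
  "v n = (\<Sum>k<n. inc k)"

lemma inc_mono: "m \<le> n \<Longrightarrow> inc m \<le> inc n"
  unfolding inc_def using c_nonneg by (intro add_left_mono mult_left_mono sum_mono2) auto

lemma inc_nonneg: "inc n \<ge> 0"
  unfolding inc_def using c_nonneg by (intro add_nonneg_nonneg mult_nonneg_nonneg sum_nonneg) auto

lemma v_mono: "m \<le> n \<Longrightarrow> v m \<le> v n"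
  unfolding v_def using inc_nonneg by (intro sum_mono2) auto

lemma v_nonneg: "v n \<ge> 0"
  unfolding v_def using inc_nonneg by (intro sum_nonneg) auto

lemma S_var: "expectation (\<lambda>x. (S h n x)\<^sup>2) = v n"
proof (induction n)
  case 0
  then show ?case by (simp add: S_def v_def)
next
  case (Suc n)
  have s: "S h (Suc n) x = S h n x + Z (h + n) x" for x by (simp add: S_def)
  have zz: "integrable N (\<lambda>x. Z j x * Z (h + n) x)" for j
    by (intro integrable_mult_of_squares Z_sq) auto
  have iz: "integrable N (\<lambda>x. S h n x * Z (h + n) x)"
    by (intro integrable_mult_of_squares Z_sq S_sq) auto
  have "expectation (\<lambda>x. S h n x * Z (h + n) x) = (\<Sum>j\<in>{h..<h+n}. expectation (\<lambda>x. Z j x * Z (h + n) x))"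
    unfolding S_def sum_distrib_right using zz by (rule Bochner_Integration.integral_sum)
  also have "\<dots> = (\<Sum>j\<in>{h..<h+n}. c (h + n - j))"
    by (intro sum.cong refl) (metis add.commute atLeastLessThan_iff cov le_add_diff_inverse2 less_imp_le)
  also have "\<dots> = (\<Sum>j<n. c (Suc j))"
    by (rule sum.reindex_bij_witness[of _ "\<lambda>j. h + n - Suc j" "\<lambda>j. h + n - Suc j"]) (auto simp: Suc_diff_Suc)
  finally have e: "expectation (\<lambda>x. S h n x * Z (h + n) x) = \<dots>" .
  have "expectation (\<lambda>x. (S h (Suc n) x)\<^sup>2) =
      expectation (\<lambda>x. (S h n x)\<^sup>2 + 2 * (S h n x * Z (h + n) x) + (Z (h + n) x)\<^sup>2)"
    unfolding s by (intro Bochner_Integration.integral_cong) (auto simp: power2_sum)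
  also have "\<dots> = expectation (\<lambda>x. (S h n x)\<^sup>2) + 2 * expectation (\<lambda>x. S h n x * Z (h + n) x) + expectation (\<lambda>x. (Z (h + n) x)\<^sup>2)"
    using iz S_sq Z_sq by simp
  also have "\<dots> = v n + inc n"
    using cov[of "h + n" 0] Suc e by (simp add: inc_def power2_eq_square)
  finally show ?case by (simp add: v_def)
qed

text \<open>Averages of the monotone increments grow with the length, so \<open>v q / q\<close> is
  at most \<open>v n / n\<close>. A short gap therefore carries only its proportional share of the
  variance.\<close>

lemma v_superadditive: "q \<le> n \<Longrightarrow> v q * real n \<le> real q * v n"
proof (induction n)
  case 0
  then show ?case by (simp add: v_def)
next
  case (Suc n)
  show ?case
  proof (cases "q = Suc n")
    case False
    then have q: "q \<le> n" using Suc by simp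
    have "v q \<le> (\<Sum>k<q. inc n)" unfolding v_def using q by (intro sum_mono inc_mono) auto
    then have "v q \<le> real q * inc n" by simp
    with Suc q show ?thesis by (simp add: v_def algebra_simps)
  qed (simp add: mult.commute)
qed

lemma mix_S:
  assumes "n \<ge> 1" "f \<in> borel_measurable borel" "g \<in> borel_measurable borel"
    and "integrable N (\<lambda>x. (f (S h n x))\<^sup>2)" "integrable N (\<lambda>x. (g (S (h + n + r) m x))\<^sup>2)"
  shows "\<bar>covar N (\<lambda>x. f (S h n x)) (\<lambda>x. g (S (h + n + r) m x))\<bar> \<le>
     \<rho> r * (sqrt (covar N (\<lambda>x. f (S h n x)) (\<lambda>x. f (S h n x))) *
       sqrt (covar N (\<lambda>x. g (S (h + n + r) m x)) (\<lambda>x. g (S (h + n + r) m x))))"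
  using mix[of n f g h r m] assms unfolding S_def by simp

text \<open>Splitting off a gap of length \<open>q\<close> between two neighbouring blocks costs a Cauchy-Schwarz
  term; the rest is controlled by the mixing coefficient. Both errors are of the order of the
  variance, which makes them summable along the dyadic recursion.\<close>

lemma block_covar:
  fixes f g :: "real \<Rightarrow> real"
  assumes "n1 \<ge> 1" "q \<le> n2"
    and [measurable]: "f \<in> borel_measurable borel" "g \<in> borel_measurable borel"
    and f: "\<And>x y. \<bar>f x - f y\<bar> \<le> \<bar>u\<bar> * \<bar>x - y\<bar>"
    and g: "\<And>x y. \<bar>g x - g y\<bar> \<le> \<bar>u\<bar> * \<bar>x - y\<bar>"
  shows "\<bar>covar N (\<lambda>x. f (S h n1 x)) (\<lambda>x. g (S (h + n1) n2 x))\<bar> \<le>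
    u\<^sup>2 * (\<rho> q * (sqrt (v n1) * sqrt (v n2)) + sqrt (v n1) * sqrt (v q))"
proof -
  let ?A = "S h n1" and ?G = "S (h + n1) q" and ?B = "S (h + n1 + q) (n2 - q)"
  have s: "S (h + n1) n2 x = ?G x + ?B x" for x
    using S_add[of "h + n1" q "n2 - q" x] assms by simp
  \<comment> \<open>Subtracting the value at 0 bounds the variance of a Lipschitz function of
    \<open>X\<close> by \<open>u\<^sup>2\<close> times the second moment of
    \<open>X\<close>.\<close>
  have lip_i: "integrable N (\<lambda>x. (k (X x))\<^sup>2)"
    and lip_c: "covar N (\<lambda>x. k (X x)) (\<lambda>x. k (X x)) \<le> u\<^sup>2 * expectation (\<lambda>x. (X x)\<^sup>2)"
    if [measurable]: "k \<in> borel_measurable borel" "X \<in> borel_measurable N" and k: "\<And>x y. \<bar>k x - k y\<bar> \<le> \<bar>u\<bar> * \<bar>x - y\<bar>"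
      and X: "integrable N (\<lambda>x. (X x)\<^sup>2)" for k :: "real \<Rightarrow> real" and X
  proof -
    have sq: "(k y - k 0)\<^sup>2 \<le> u\<^sup>2 * y\<^sup>2" for y
      using power_mono[OF k[of y 0], of 2] by (simp add: power_mult_distrib)
    have d: "integrable N (\<lambda>x. (k (X x) - k 0)\<^sup>2)"
      by (rule Bochner_Integration.integrable_bound[OF integrable_mult_right[OF X, of "u\<^sup>2"]]) (use sq in auto)
    have e: "(k y)\<^sup>2 \<le> 2 * (k y - k 0)\<^sup>2 + 2 * (k 0)\<^sup>2" for y
      using sum_squares_bound[of "k y - k 0" "k 0"] by (simp add: power2_eq_square algebra_simps)
    show i: "integrable N (\<lambda>x. (k (X x))\<^sup>2)"
      by (rule Bochner_Integration.integrable_bound[of _ "\<lambda>x. 2 * (k (X x) - k 0)\<^sup>2 + 2 * (k 0)\<^sup>2"])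
         (use d e in \<open>auto simp: add_nonneg_nonneg\<close>)
    have "covar N (\<lambda>x. k (X x)) (\<lambda>x. k (X x)) \<le> expectation (\<lambda>x. (k (X x) - k 0)\<^sup>2)"
      by (rule covar_self_le_shift[OF _ i]) simp
    also have "\<dots> \<le> expectation (\<lambda>x. u\<^sup>2 * (X x)\<^sup>2)"
      using sq X by (intro integral_mono d) auto
    finally show "covar N (\<lambda>x. k (X x)) (\<lambda>x. k (X x)) \<le> u\<^sup>2 * expectation (\<lambda>x. (X x)\<^sup>2)" by simp
  qed
  have fi: "integrable N (\<lambda>x. (f (?A x))\<^sup>2)" and fc: "covar N (\<lambda>x. f (?A x)) (\<lambda>x. f (?A x)) \<le> u\<^sup>2 * v n1"
    using lip_i[of f ?A] lip_c[of f ?A] f S_sq S_var by auto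
  have gi: "integrable N (\<lambda>x. (g (?B x))\<^sup>2)" and "covar N (\<lambda>x. g (?B x)) (\<lambda>x. g (?B x)) \<le> u\<^sup>2 * v (n2 - q)"
    using lip_i[of g ?B] lip_c[of g ?B] g S_sq S_var by auto
  then have gc: "covar N (\<lambda>x. g (?B x)) (\<lambda>x. g (?B x)) \<le> u\<^sup>2 * v n2"
    using v_mono[of "n2 - q" n2] mult_left_mono[of "v (n2 - q)" "v n2" "u\<^sup>2"] by simp
  \<comment> \<open>The effect of deleting the gap; by the Lipschitz condition it is at most |u|
    times the sum over the gap.\<close>
  define R where "R x = g (S (h + n1) n2 x) - g (?B x)" for x
  have Rm[measurable]: "R \<in> borel_measurable N" unfolding R_def by simp
  have Rsq: "(R x)\<^sup>2 \<le> u\<^sup>2 * (?G x)\<^sup>2" for x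
    using power_mono[OF g[of "?G x + ?B x" "?B x"], of 2] unfolding R_def s by (simp add: power_mult_distrib)
  have Ri: "integrable N (\<lambda>x. (R x)\<^sup>2)"
    by (rule Bochner_Integration.integrable_bound[OF integrable_mult_right[OF S_sq[of "h + n1" q], of "u\<^sup>2"]]) (use Rsq in auto)
  have "covar N R R \<le> expectation (\<lambda>x. (R x)\<^sup>2)" by (rule covar_self_le[OF _ Ri]) simp
  also have "\<dots> \<le> expectation (\<lambda>x. u\<^sup>2 * (?G x)\<^sup>2)"
    using Rsq S_sq by (intro integral_mono Ri) auto
  finally have Rc: "covar N R R \<le> u\<^sup>2 * v q" by (simp add: S_var)
  have rt: "sqrt (u\<^sup>2 * a) * sqrt (u\<^sup>2 * b) = u\<^sup>2 * (sqrt a * sqrt b)" for a b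
    by (simp add: real_sqrt_mult power2_eq_square)
  have "covar N (\<lambda>x. f (?A x)) (\<lambda>x. g (S (h + n1) n2 x)) = covar N (\<lambda>x. f (?A x)) (\<lambda>x. g (?B x) + R x)"
    by (simp add: R_def)
  also have "\<dots> = covar N (\<lambda>x. f (?A x)) (\<lambda>x. g (?B x)) + covar N (\<lambda>x. f (?A x)) R"
    by (rule covar_add_right) (use fi gi Ri in auto)
  finally have 0: "covar N (\<lambda>x. f (?A x)) (\<lambda>x. g (S (h + n1) n2 x)) = \<dots>" .
  have 1: "\<bar>covar N (\<lambda>x. f (?A x)) (\<lambda>x. g (?B x))\<bar> \<le> \<rho> q * (sqrt (u\<^sup>2 * v n1) * sqrt (u\<^sup>2 * v n2))"
  proof (rule order_trans[OF mix_S])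
    show "\<rho> q * (sqrt (covar N (\<lambda>x. f (?A x)) (\<lambda>x. f (?A x))) * sqrt (covar N (\<lambda>x. g (?B x)) (\<lambda>x. g (?B x)))) \<le>
        \<rho> q * (sqrt (u\<^sup>2 * v n1) * sqrt (u\<^sup>2 * v n2))"
      using fc gc v_nonneg covar_self_nonneg by (intro mult_left_mono[OF _ \<rho>_nonneg] mult_mono) auto
  qed (use fi gi assms in auto)
  have 2: "\<bar>covar N (\<lambda>x. f (?A x)) R\<bar> \<le> sqrt (u\<^sup>2 * v n1) * sqrt (u\<^sup>2 * v q)"
  proof (rule order_trans[OF covar_Cauchy_Schwarz])
    show "sqrt (covar N (\<lambda>x. f (?A x)) (\<lambda>x. f (?A x))) * sqrt (covar N R R) \<le> sqrt (u\<^sup>2 * v n1) * sqrt (u\<^sup>2 * v q)"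
      using fc Rc v_nonneg covar_self_nonneg by (intro mult_mono) auto
  qed (use fi Ri in auto)
  have "\<rho> q * (sqrt (u\<^sup>2 * v n1) * sqrt (u\<^sup>2 * v n2)) + sqrt (u\<^sup>2 * v n1) * sqrt (u\<^sup>2 * v q) =
     u\<^sup>2 * (\<rho> q * (sqrt (v n1) * sqrt (v n2)) + sqrt (v n1) * sqrt (v q))"
    unfolding rt by (simp add: distrib_left mult.left_commute)
  with 0 1 2 show ?thesis by linarith
qed

text \<open>The relative error of joining two blocks of length about \<open>2 ^ i\<close> when a gap
  of about the square root of that length is cut out. The first term is the mixing across the gap,
  the second the share of the gap in the variance. Halving the exponent repeats each
  \<open>\<rho> (2 ^ k)\<close> twice and leaves a geometric series, so both terms are
  summable.\<close>

definition \<delta> :: "nat \<Rightarrow> real" where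
  "\<delta> i = \<rho> (2 ^ (i div 2)) + sqrt (2 ^ (i div 2) / 2 ^ i)"

lemma \<delta>_nonneg: "\<delta> i \<ge> 0" unfolding \<delta>_def using \<rho>_nonneg by simp

lemma summable_div2:
  fixes f :: "nat \<Rightarrow> real"
  assumes "summable f" "\<And>k. f k \<ge> 0"
  shows "summable (\<lambda>i. f (i div 2))"
proof (rule bounded_imp_summable[where B = "2 * suminf f"])
  fix n
  have "(\<Sum>i\<le>n. f (i div 2)) \<le> (\<Sum>i<2 * Suc n. f (i div 2))"
    using assms by (intro sum_mono2) auto
  also have "\<dots> = 2 * (\<Sum>k<Suc n. f k)" by (induction n) auto
  also have "\<dots> \<le> 2 * suminf f" using assms by (intro mult_left_mono sum_le_suminf) auto
  finally show "(\<Sum>i\<le>n. f (i div 2)) \<le> 2 * suminf f" .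
qed (use assms in auto)

lemma \<delta>_summable: "summable \<delta>"
proof -
  have 1: "summable (\<lambda>i. \<rho> (2 ^ (i div 2)))"
    by (rule summable_div2[OF \<rho>_summable]) (use \<rho>_nonneg in auto)
  have 2: "summable (\<lambda>i. sqrt (2 ^ (i div 2) / 2 ^ i))"
  proof (rule summable_comparison_test')
    show "summable (\<lambda>i. (sqrt (1/2)) ^ (i div 2))"
      by (rule summable_div2, rule summable_geometric) (auto simp: real_sqrt_lt_1_iff)
    fix i :: nat assume "i \<ge> 0"
    have "(2::real) ^ i \<ge> 2 ^ (i div 2 + i div 2)" by (intro power_increasing) auto
    then have "(2::real) ^ (i div 2) / 2 ^ i \<le> (1/2) ^ (i div 2)"
      by (simp add: power_add field_simps power_one_over)
    then have "sqrt (2 ^ (i div 2) / 2 ^ i) \<le> sqrt ((1/2) ^ (i div 2))" by (rule real_sqrt_le_mono)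
    then show "norm (sqrt (2 ^ (i div 2) / 2 ^ i)) \<le> (sqrt (1/2)) ^ (i div 2)"
      by (simp add: real_sqrt_power)
  qed
  show ?thesis unfolding \<delta>_def by (rule summable_add[OF 1 2])
qed

text \<open>The covariance of two adjacent blocks is estimated by \<open>block_covar\<close> with
  the identity and u = 1; superadditivity turns the variance of the gap into a fraction of
  \<open>v (2 ^ i)\<close>.\<close>

lemma v_dyadic: "v (2 ^ Suc i) \<le> 2 * v (2 ^ i) * (1 + \<delta> i)"
proof -
  let ?n = "2 ^ i :: nat" and ?q = "2 ^ (i div 2) :: nat"
  have qn: "?q \<le> ?n" by (intro power_increasing) auto
  have "\<bar>covar N (\<lambda>x. id (S 0 ?n x)) (\<lambda>x. id (S (0 + ?n) ?n x))\<bar> \<le>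
     1\<^sup>2 * (\<rho> ?q * (sqrt (v ?n) * sqrt (v ?n)) + sqrt (v ?n) * sqrt (v ?q))"
    by (rule block_covar) (use qn in auto)
  moreover have "sqrt (v ?n) * sqrt (v ?q) \<le> v ?n * sqrt (2 ^ (i div 2) / 2 ^ i)"
  proof -
    have "v ?q * real ?n \<le> real ?q * v ?n" by (rule v_superadditive[OF qn])
    then have "v ?q \<le> v ?n * (2 ^ (i div 2) / 2 ^ i)" by (simp add: field_simps)
    then have "sqrt (v ?q) \<le> sqrt (v ?n) * sqrt (2 ^ (i div 2) / 2 ^ i)"
      by (metis real_sqrt_le_mono real_sqrt_mult)
    then have "sqrt (v ?n) * sqrt (v ?q) \<le> sqrt (v ?n) * (sqrt (v ?n) * sqrt (2 ^ (i div 2) / 2 ^ i))"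
      using v_nonneg by (intro mult_left_mono) auto
    then show ?thesis using v_nonneg[of ?n] by (simp flip: mult.assoc)
  qed
  ultimately have c: "covar N (S 0 ?n) (S ?n ?n) \<le> v ?n * \<delta> i"
    using v_nonneg[of ?n] by (simp add: \<delta>_def algebra_simps)
  have ce: "covar N (S 0 ?n) (S ?n ?n) = expectation (\<lambda>x. S 0 ?n x * S ?n ?n x)"
    using S_sq S_mean by (subst covar_eq) auto
  have "v (2 ^ Suc i) = expectation (\<lambda>x. (S 0 ?n x)\<^sup>2 + 2 * (S 0 ?n x * S ?n ?n x) + (S ?n ?n x)\<^sup>2)"
  proof -
    have "S 0 (2 ^ Suc i) x = S 0 ?n x + S ?n ?n x" for x
      using S_add[of 0 ?n ?n x] by (simp add: mult_2)
    then show ?thesis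
      unfolding S_var[of 0, symmetric]
      by (intro Bochner_Integration.integral_cong refl) (simp add: power2_sum)
  qed
  also have "\<dots> = v ?n + 2 * covar N (S 0 ?n) (S ?n ?n) + v ?n"
    unfolding ce using S_sq S_var integrable_mult_of_squares[of "S 0 ?n" N "S ?n ?n"] by simp
  finally show ?thesis using c by (simp add: algebra_simps)
qed

text \<open>The product of the factors \<open>1 + \<delta> i\<close> is bounded, hence so is
  \<open>v (2 ^ i) / 2 ^ i\<close>. Monotone increments are bounded by such averages, and the
  partial sums of the nonnegative \<open>c\<close> are bounded by increments.\<close>

lemma c_summable: "summable c"
proof -
  have w: "v (2 ^ i) / 2 ^ i \<le> v 1 * exp (\<Sum>k<i. \<delta> k)" for i
  proof (induction i)
    case (Suc i)
    have "v (2 ^ Suc i) / 2 ^ Suc i \<le> (v (2 ^ i) / 2 ^ i) * (1 + \<delta> i)"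
      using v_dyadic[of i] by (simp add: field_simps)
    also have "\<dots> \<le> (v 1 * exp (\<Sum>k<i. \<delta> k)) * exp (\<delta> i)"
      using Suc v_nonneg \<delta>_nonneg by (intro mult_mono) (auto simp: exp_ge_add_one_self)
    finally show ?case by (simp add: exp_add)
  qed simp
  define B where "B = 2 * v 1 * exp (suminf \<delta>)"
  have inc_le: "inc (2 ^ i) \<le> B" for i
  proof -
    \<comment> \<open>The increment at \<open>2 ^ i\<close> is a lower bound for all increments in
      the following dyadic block.\<close>
    have "real (2 ^ i) * inc (2 ^ i) = (\<Sum>k\<in>{2 ^ i..<2 * 2 ^ i :: nat}. inc (2 ^ i))" by simp
    also have "\<dots> \<le> (\<Sum>k\<in>{2 ^ i..<2 * 2 ^ i :: nat}. inc k)" by (intro sum_mono inc_mono) auto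
    also have "\<dots> \<le> v (2 ^ Suc i)" unfolding v_def using inc_nonneg by (intro sum_mono2) auto
    finally have "inc (2 ^ i) \<le> 2 * (v (2 ^ Suc i) / 2 ^ Suc i)" by (simp add: field_simps)
    also have "\<dots> \<le> 2 * (v 1 * exp (\<Sum>k<Suc i. \<delta> k))" by (intro mult_left_mono w) auto
    also have "\<dots> \<le> B" unfolding B_def
      using sum_le_suminf[OF \<delta>_summable, of "{..<Suc i}"] \<delta>_nonneg v_nonneg by (auto intro!: mult_left_mono)
    finally show ?thesis .
  qed
  have "summable (\<lambda>j. c (Suc j))"
  proof (rule bounded_imp_summable[where B=B])
    fix n :: nat
    have "(\<Sum>j\<le>n. c (Suc j)) \<le> inc (Suc n)"
      unfolding inc_def lessThan_Suc_atMost using c_nonneg sum_nonneg[of "{..n}" "\<lambda>j. c (Suc j)"] by auto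
    also have "\<dots> \<le> inc (2 ^ Suc n)" by (intro inc_mono less_imp_le) (rule less_exp)
    also have "\<dots> \<le> B" by (rule inc_le)
    finally show "(\<Sum>j\<le>n. c (Suc j)) \<le> B" .
  qed (use c_nonneg in auto)
  then show ?thesis by (simp only: summable_Suc_iff)
qed

definition \<sigma>2 :: real where "\<sigma>2 = c 0 + 2 * (\<Sum>j. c (Suc j))"

lemma inc_tendsto: "inc \<longlonglongrightarrow> \<sigma>2"
  unfolding inc_def \<sigma>2_def
  using summable_LIMSEQ[of "\<lambda>j. c (Suc j)"] c_summable summable_Suc_iff[of c]
  by (intro tendsto_intros) auto

lemma v_tendsto: "(\<lambda>n. v n / real n) \<longlonglongrightarrow> \<sigma>2"
  unfolding v_def by (rule cesaro_mean_tendsto[OF inc_tendsto])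

lemma inc_le: "inc n \<le> \<sigma>2"
  by (rule LIMSEQ_le_const[OF inc_tendsto]) (use inc_mono in blast)

lemma v_le: "v n \<le> \<sigma>2 * real n"
proof -
  have "v n \<le> (\<Sum>k<n. \<sigma>2)" unfolding v_def using inc_le by (intro sum_mono) auto
  then show ?thesis by (simp add: mult.commute)
qed

lemma \<sigma>2_nonneg: "\<sigma>2 \<ge> 0" using inc_nonneg[of 0] inc_le[of 0] by linarith

section \<open>Characteristic functions of block sums\<close>

text \<open>Cosine and sine are kept apart because the covariance estimates are for real
  functions.\<close>

definition \<phi> :: "nat \<Rightarrow> nat \<Rightarrow> real \<Rightarrow> complex" where
  "\<phi> h n u = Complex (expectation (\<lambda>x. cos (u * S h n x))) (expectation (\<lambda>x. sin (u * S h n x)))"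

lemma \<phi>_eq_char: "\<phi> h n u = char (distr N borel (S h n)) u"
proof -
  have i: "integrable N (\<lambda>x. iexp (u * S h n x))"
    by (rule integrable_const_bound[where B=1]) auto
  have "char (distr N borel (S h n)) u = (CLINT x|N. iexp (u * S h n x))"
    unfolding char_def by (subst integral_distr) auto
  moreover have "Re (CLINT x|N. iexp (u * S h n x)) = expectation (\<lambda>x. cos (u * S h n x))"
    using integral_bounded_linear[OF bounded_linear_Re i] by (simp add: Re_exp)
  moreover have "Im (CLINT x|N. iexp (u * S h n x)) = expectation (\<lambda>x. sin (u * S h n x))"
    using integral_bounded_linear[OF bounded_linear_Im i] by (simp add: Im_exp)
  ultimately show ?thesis by (simp add: \<phi>_def complex_eq_iff)
qed

lemma \<phi>_le: "norm (\<phi> h n u) \<le> 1"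
proof -
  interpret R: real_distribution "distr N borel (S h n)" by (rule real_distribution_distr) simp
  show ?thesis unfolding \<phi>_eq_char by (rule R.cmod_char_le_1)
qed

text \<open>By the addition formulas, the failure of multiplicativity consists of four covariances
  of sines and cosines of neighbouring block sums, and these are Lipschitz functions with constant
  |u|.\<close>

lemma \<phi>_split:
  assumes "n1 \<ge> 1" "q \<le> n2"
  shows "norm (\<phi> h (n1 + n2) u - \<phi> h n1 u * \<phi> (h + n1) n2 u) \<le>
     4 * (u\<^sup>2 * (\<rho> q * (sqrt (v n1) * sqrt (v n2)) + sqrt (v n1) * sqrt (v q)))"
proof -
  define E where "E = u\<^sup>2 * (\<rho> q * (sqrt (v n1) * sqrt (v n2)) + sqrt (v n1) * sqrt (v q))"
  let ?A = "\<lambda>x. u * S h n1 x" and ?B = "\<lambda>x. u * S (h + n1) n2 x"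
  have sin_lip: "\<bar>sin x - sin y\<bar> \<le> \<bar>x - y\<bar>" and cos_lip: "\<bar>cos x - cos y\<bar> \<le> \<bar>x - y\<bar>" for x y :: real
  proof -
    have s: "\<bar>sin ((x - y) / 2)\<bar> \<le> \<bar>x - y\<bar> / 2" "\<bar>sin ((y - x) / 2)\<bar> \<le> \<bar>x - y\<bar> / 2" using abs_sin_x_le_abs_x[of "(x - y)/2"] abs_sin_x_le_abs_x[of "(y - x)/2"] by auto
    have "\<bar>2 * sin ((x - y) / 2) * cos ((x + y) / 2)\<bar> \<le> 2 * (\<bar>x - y\<bar> / 2) * 1"
      unfolding abs_mult using s by (intro mult_mono) auto
    then show "\<bar>sin x - sin y\<bar> \<le> \<bar>x - y\<bar>" by (simp add: sin_diff_sin)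
    have "\<bar>2 * sin ((x + y) / 2) * sin ((y - x) / 2)\<bar> \<le> 2 * 1 * (\<bar>x - y\<bar> / 2)"
      unfolding abs_mult using s by (intro mult_mono) auto
    then show "\<bar>cos x - cos y\<bar> \<le> \<bar>x - y\<bar>" by (simp add: cos_diff_cos)
  qed
  have l: "\<bar>f (u * x) - f (u * y)\<bar> \<le> \<bar>u\<bar> * \<bar>x - y\<bar>" if "f = sin \<or> f = cos" for f and x y :: real
    using that sin_lip[of "u*x" "u*y"] cos_lip[of "u*x" "u*y"] by (auto simp: abs_mult right_diff_distrib[symmetric])
  have b: "\<bar>covar N (\<lambda>x. f (?A x)) (\<lambda>x. g (?B x))\<bar> \<le> E"
    if "f = sin \<or> f = cos" "g = sin \<or> g = cos" for f g :: "real \<Rightarrow> real"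
    unfolding E_def using that block_covar[of n1 q n2 "\<lambda>y. f (u * y)" "\<lambda>y. g (u * y)" u h] assms l by auto
  have sq: "integrable N (\<lambda>x. (f (u * S h n x))\<^sup>2)" if "f = sin \<or> f = cos" for f h n
    using that by (intro integrable_square_bounded[where K=1]) auto
  have ig: "integrable N (\<lambda>x. f (?A x) * g (?B x))" if "f = sin \<or> f = cos" "g = sin \<or> g = cos" for f g :: "real \<Rightarrow> real"
    using that by (intro integrable_mult_of_squares sq) auto
  have ce: "covar N (\<lambda>x. f (?A x)) (\<lambda>x. g (?B x)) = expectation (\<lambda>x. f (?A x) * g (?B x)) - expectation (\<lambda>x. f (?A x)) * expectation (\<lambda>x. g (?B x))"
    if "f = sin \<or> f = cos" "g = sin \<or> g = cos" for f g :: "real \<Rightarrow> real"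
    using that by (intro covar_eq sq) auto
  have AB: "u * S h (n1 + n2) x = ?A x + ?B x" for x by (simp add: S_add algebra_simps)
  have eq: "\<phi> h (n1 + n2) u - \<phi> h n1 u * \<phi> (h + n1) n2 u =
     Complex (covar N (\<lambda>x. cos (?A x)) (\<lambda>x. cos (?B x)) - covar N (\<lambda>x. sin (?A x)) (\<lambda>x. sin (?B x)))
             (covar N (\<lambda>x. sin (?A x)) (\<lambda>x. cos (?B x)) + covar N (\<lambda>x. cos (?A x)) (\<lambda>x. sin (?B x)))"
    unfolding \<phi>_def AB cos_add sin_add using ig by (simp add: complex_eq_iff ce)
  have "norm (\<phi> h (n1 + n2) u - \<phi> h n1 u * \<phi> (h + n1) n2 u) \<le>
      \<bar>covar N (\<lambda>x. cos (?A x)) (\<lambda>x. cos (?B x)) - covar N (\<lambda>x. sin (?A x)) (\<lambda>x. sin (?B x))\<bar>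
      + \<bar>covar N (\<lambda>x. sin (?A x)) (\<lambda>x. cos (?B x)) + covar N (\<lambda>x. cos (?A x)) (\<lambda>x. sin (?B x))\<bar>"
    unfolding eq by (rule order_trans[OF cmod_le]) simp
  also have "\<dots> \<le> 4 * E"
    using b[of cos cos] b[of sin sin] b[of sin cos] b[of cos sin] by simp
  finally show ?thesis unfolding E_def .
qed

text \<open>The Gaussian reference is exactly multiplicative in the length \<open>n\<close>, so
  distances merely add up, apart from the splitting error, when blocks are joined.\<close>

definition D :: "nat \<Rightarrow> nat \<Rightarrow> real \<Rightarrow> real" where
  "D h n u = norm (\<phi> h n u - complex_of_real (exp (- (u\<^sup>2 * \<sigma>2 * real n / 2))))"

lemma D_split:
  assumes "n1 \<ge> 1" "q \<le> n2"
  shows "D h (n1 + n2) u \<le> D h n1 u + D (h + n1) n2 u + 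
     4 * (u\<^sup>2 * (\<rho> q * (sqrt (v n1) * sqrt (v n2)) + sqrt (v n1) * sqrt (v q)))"
proof -
  let ?g = "\<lambda>n. complex_of_real (exp (- (u\<^sup>2 * \<sigma>2 * real n / 2)))"
  have gg: "?g (n1 + n2) = ?g n1 * ?g n2" by (simp add: field_simps flip: exp_add of_real_mult)
  have "norm (?g n2) \<le> 1" using \<sigma>2_nonneg by simp
  then have "norm (\<phi> h n1 u * \<phi> (h + n1) n2 u - ?g n1 * ?g n2) \<le> D h n1 u + D (h + n1) n2 u"
    unfolding D_def by (intro norm_mult_diff_le \<phi>_le)
  moreover have "D h (n1 + n2) u \<le> norm (\<phi> h (n1 + n2) u - \<phi> h n1 u * \<phi> (h + n1) n2 u) + norm (\<phi> h n1 u * \<phi> (h + n1) n2 u - ?g n1 * ?g n2)"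
    unfolding D_def gg by (rule order_trans[OF _ norm_triangle_ineq]) simp
  ultimately show ?thesis using \<phi>_split[OF assms, of h u] by linarith
qed

text \<open>Third-order Taylor expansion. The constant may depend on \<open>n\<close>: the estimate
  is applied only to the bounded range of lengths at which the dyadic recursion stops, and there the
  last factor is made small through \<open>u\<close>.\<close>

lemma D_base: "\<exists>B\<ge>0. \<forall>h u. D h n u \<le> u\<^sup>2 * (\<bar>v n - \<sigma>2 * real n\<bar> / 2 + B * (\<bar>u\<bar> + u\<^sup>2))"
proof -
  obtain L where L: "\<And>h. mom4_le N (S h n) L" using S4 by blast
  have L0: "L \<ge> 0"
    using L[of 0] order_trans[of 0 "expectation (\<lambda>x. S 0 n x ^ 4)" L] by (auto simp: mom4_le_def)
  have b: "D h n u \<le> u\<^sup>2 * (\<bar>v n - \<sigma>2 * real n\<bar> / 2 + (1 + L + (v n)\<^sup>2) * (\<bar>u\<bar> + u\<^sup>2))" for h u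
  proof -
    have mm: "min (6 * y\<^sup>2) (\<bar>u\<bar> * \<bar>y\<bar> ^ 3) \<le> \<bar>u\<bar> * \<bar>y\<bar> ^ 3" for y by simp
    have i3: "integrable N (\<lambda>x. \<bar>S h n x\<bar> ^ 3)" by (rule mom4_le_imp[OF L])
    have "expectation (\<lambda>x. min (6 * (S h n x)\<^sup>2) (\<bar>u\<bar> * \<bar>S h n x\<bar> ^ 3)) \<le> expectation (\<lambda>x. \<bar>u\<bar> * \<bar>S h n x\<bar> ^ 3)"
      using i3 S_sq by (intro integral_mono mm integrable_min) auto
    also have "\<dots> \<le> \<bar>u\<bar> * (1 + L)"
      using mom4_le_imp(3)[OF L] by (simp add: mult_left_mono)
    finally have m: "expectation (\<lambda>x. min (6 * (S h n x)\<^sup>2) (\<bar>u\<bar> * \<bar>S h n x\<bar> ^ 3)) \<le> \<bar>u\<bar> * (1 + L)" .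
    have var: "variance (S h n) = v n" by (simp add: S_mean S_var)
    have "norm (char (distr N borel (S h n)) u - (1 - u\<^sup>2 * v n / 2)) \<le>
       (u\<^sup>2 / 6) * expectation (\<lambda>x. min (6 * (S h n x)\<^sup>2) (\<bar>u\<bar> * \<bar>S h n x\<bar> ^ 3))"
      by (rule char_approx3'[OF _ S_int S_sq S_mean var refl]) simp
    also have "\<dots> \<le> (u\<^sup>2 / 6) * (\<bar>u\<bar> * (1 + L))" by (intro mult_left_mono m) auto
    also have "\<dots> \<le> u\<^sup>2 * (\<bar>u\<bar> * (1 + L))" using L0 by (simp add: divide_le_eq mult_left_mono)
    finally have 1: "norm (\<phi> h n u - complex_of_real (1 - u\<^sup>2 * v n / 2)) \<le> u\<^sup>2 * (\<bar>u\<bar> * (1 + L))"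
      by (simp add: \<phi>_eq_char)
    have "norm (complex_of_real (1 - u\<^sup>2 * v n / 2) - complex_of_real (exp (- (u\<^sup>2 * \<sigma>2 * real n / 2)))) =
      \<bar>1 - u\<^sup>2 * v n / 2 - exp (- (u\<^sup>2 * \<sigma>2 * real n / 2))\<bar>"
      by (simp only: norm_of_real flip: of_real_diff)
    also have "\<dots> \<le> (u\<^sup>2 * v n / 2)\<^sup>2 / 2 + \<bar>u\<^sup>2 * v n / 2 - u\<^sup>2 * \<sigma>2 * real n / 2\<bar>"
      using v_nonneg \<sigma>2_nonneg by (intro exp_minus_approx) auto
    finally have 3: "norm (complex_of_real (1 - u\<^sup>2 * v n / 2) - complex_of_real (exp (- (u\<^sup>2 * \<sigma>2 * real n / 2)))) \<le> \<dots>" .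
    have 4: "\<bar>u\<^sup>2 * v n / 2 - u\<^sup>2 * \<sigma>2 * real n / 2\<bar> = u\<^sup>2 * (\<bar>v n - \<sigma>2 * real n\<bar> / 2)"
    proof -
      have "u\<^sup>2 * v n / 2 - u\<^sup>2 * \<sigma>2 * real n / 2 = (u\<^sup>2 / 2) * (v n - \<sigma>2 * real n)" by (simp add: field_simps)
      then show ?thesis by (simp only: abs_mult) simp
    qed
    have 5: "(u\<^sup>2 * v n / 2)\<^sup>2 / 2 \<le> u\<^sup>2 * (u\<^sup>2 * (v n)\<^sup>2)"
    proof -
      have "(u\<^sup>2 * v n / 2)\<^sup>2 / 2 = (u\<^sup>2 * (u\<^sup>2 * (v n)\<^sup>2)) / 8" by (simp add: power2_eq_square)
      also have "\<dots> \<le> u\<^sup>2 * (u\<^sup>2 * (v n)\<^sup>2)"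
        using mult_nonneg_nonneg[OF zero_le_power2[of u] mult_nonneg_nonneg[OF zero_le_power2[of u] zero_le_power2[of "v n"]]] by simp
      finally show ?thesis .
    qed
    have 2: "norm (complex_of_real (1 - u\<^sup>2 * v n / 2) - complex_of_real (exp (- (u\<^sup>2 * \<sigma>2 * real n / 2)))) \<le>
       u\<^sup>2 * (u\<^sup>2 * (v n)\<^sup>2) + u\<^sup>2 * (\<bar>v n - \<sigma>2 * real n\<bar> / 2)" using 3 4 5 by linarith
    have "D h n u \<le> u\<^sup>2 * (\<bar>u\<bar> * (1 + L)) + (u\<^sup>2 * (u\<^sup>2 * (v n)\<^sup>2) + u\<^sup>2 * (\<bar>v n - \<sigma>2 * real n\<bar> / 2))"
      unfolding D_def using norm_triangle_ineq[of "\<phi> h n u - complex_of_real (1 - u\<^sup>2 * v n / 2)"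
        "complex_of_real (1 - u\<^sup>2 * v n / 2) - complex_of_real (exp (- (u\<^sup>2 * \<sigma>2 * real n / 2)))"] 1 2 by simp
    also have "\<dots> = u\<^sup>2 * (\<bar>v n - \<sigma>2 * real n\<bar> / 2 + ((1 + L) * \<bar>u\<bar> + (v n)\<^sup>2 * u\<^sup>2))"
      by (simp add: algebra_simps)
    also have "\<dots> \<le> u\<^sup>2 * (\<bar>v n - \<sigma>2 * real n\<bar> / 2 + ((1 + L + (v n)\<^sup>2) * \<bar>u\<bar> + (1 + L + (v n)\<^sup>2) * u\<^sup>2))"
    proof -
      have "(1 + L) * \<bar>u\<bar> \<le> (1 + L + (v n)\<^sup>2) * \<bar>u\<bar>" by (rule mult_right_mono) auto
      moreover have "(v n)\<^sup>2 * u\<^sup>2 \<le> (1 + L + (v n)\<^sup>2) * u\<^sup>2" using L0 by (intro mult_right_mono) auto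
      ultimately show ?thesis by (intro mult_left_mono add_left_mono add_mono) auto
    qed
    finally show ?thesis by (simp add: distrib_left)
  qed
  show ?thesis by (rule exI[of _ "1 + L + (v n)\<^sup>2"]) (use b L0 in auto)
qed

text \<open>Halving, with rounding, maps lengths between two consecutive powers of two to lengths
  between the preceding ones. The splitting error is of order \<open>u\<^sup>2 d\<close> times
  \<open>\<delta> i\<close>, because all variances are at most \<open>\<sigma>2\<close> times the
  length.\<close>

lemma D_dyadic:
  assumes d: "2 ^ Suc i \<le> d" "d \<le> 2 ^ Suc (Suc i)"
  shows "\<exists>n1 n2. n1 + n2 = d \<and> 2 ^ i \<le> n1 \<and> n1 \<le> 2 ^ Suc i \<and> 2 ^ i \<le> n2 \<and> n2 \<le> 2 ^ Suc i \<and>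
    (\<forall>h u. D h d u \<le> D h n1 u + D (h + n1) n2 u + u\<^sup>2 * real d * (4 * \<sigma>2 * \<delta> i))"
proof (intro exI conjI allI)
  define n1 n2 q where "n1 = d div 2" and "n2 = d - d div 2" and "q = (2::nat) ^ (i div 2)"
  show s: "n1 + n2 = d" unfolding n1_def n2_def by simp
  show n: "2 ^ i \<le> n1" "n1 \<le> 2 ^ Suc i" "2 ^ i \<le> n2" "n2 \<le> 2 ^ Suc i"
    using d unfolding n1_def n2_def by auto
  have q: "q \<le> 2 ^ i" unfolding q_def by (intro power_increasing) auto
  fix h u
  have n1: "n1 \<ge> 1" using n(1) one_le_power[of "2::nat" i] by linarith
  have vn: "sqrt (v n) \<le> sqrt (\<sigma>2 * real n)" for n using v_le by simp
  have sq: "sqrt (\<sigma>2 * a) * sqrt (\<sigma>2 * b) = \<sigma>2 * sqrt (a * b)" for a b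
    using \<sigma>2_nonneg by (simp add: real_sqrt_mult)
  have "sqrt (v n1) * sqrt (v n2) \<le> sqrt (\<sigma>2 * real n1) * sqrt (\<sigma>2 * real n2)"
    using v_nonneg vn \<sigma>2_nonneg by (intro mult_mono) auto
  also have "\<dots> \<le> \<sigma>2 * real d"
  proof -
    have "sqrt (real n1 * real n2) \<le> sqrt (real d * real d)"
      using s by (intro real_sqrt_le_mono mult_mono) auto
    then show ?thesis unfolding sq using \<sigma>2_nonneg by (intro mult_left_mono) auto
  qed
  finally have 1: "\<rho> q * (sqrt (v n1) * sqrt (v n2)) \<le> \<rho> q * (\<sigma>2 * real d)"
    using \<rho>_nonneg by (rule mult_left_mono)
  have "sqrt (v n1) * sqrt (v q) \<le> sqrt (\<sigma>2 * real n1) * sqrt (\<sigma>2 * real q)"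
    using v_nonneg vn \<sigma>2_nonneg by (intro mult_mono) auto
  also have "\<dots> \<le> \<sigma>2 * (real d * sqrt (real q / 2 ^ i))"
  proof -
    have "real n1 * real q = (real n1 * 2 ^ i) * (real q / 2 ^ i)" by simp
    also have "\<dots> \<le> (real d * real d) * (real q / 2 ^ i)"
      using s n by (intro mult_right_mono mult_mono) (auto simp flip: of_nat_power_eq_of_nat_cancel_iff intro: order_trans)
    finally have "sqrt (real n1 * real q) \<le> sqrt ((real d * real d) * (real q / 2 ^ i))" by (rule real_sqrt_le_mono)
    also have "sqrt ((real d * real d) * (real q / 2 ^ i)) = real d * sqrt (real q / 2 ^ i)"
      by (simp only: real_sqrt_mult[of "real d * real d"]) simp
    finally have "sqrt (real n1 * real q) \<le> real d * sqrt (real q / 2 ^ i)" .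
    then show ?thesis unfolding sq using \<sigma>2_nonneg by (intro mult_left_mono) auto
  qed
  finally have 2: "sqrt (v n1) * sqrt (v q) \<le> \<sigma>2 * (real d * sqrt (real q / 2 ^ i))" .
  have "D h d u \<le> D h n1 u + D (h + n1) n2 u + 4 * (u\<^sup>2 * (\<rho> q * (sqrt (v n1) * sqrt (v n2)) + sqrt (v n1) * sqrt (v q)))"
    using D_split[of n1 q n2 h u] n1 q n s by simp
  also have "4 * (u\<^sup>2 * (\<rho> q * (sqrt (v n1) * sqrt (v n2)) + sqrt (v n1) * sqrt (v q))) \<le>
     4 * (u\<^sup>2 * (\<rho> q * (\<sigma>2 * real d) + \<sigma>2 * (real d * sqrt (real q / 2 ^ i))))"
    by (intro mult_left_mono add_mono 1 2) auto
  also have "\<dots> = u\<^sup>2 * real d * (4 * \<sigma>2 * \<delta> i)" by (simp add: \<delta>_def q_def algebra_simps)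
  finally show "D h d u \<le> D h n1 u + D (h + n1) n2 u + u\<^sup>2 * real d * (4 * \<sigma>2 * \<delta> i)" by simp
qed

text \<open>A block is halved until its pieces have length about \<open>2 ^ s\<close>. As the pieces
  of each generation add up to \<open>d\<close>, each generation costs \<open>u\<^sup>2 d\<close>
  times one term of a summable series, so the total is governed by a tail of \<delta>. First
  \<open>s\<close> is taken so large that this tail and the error of the variance are small, then
  \<open>u0\<close> is chosen depending on \<open>s\<close>. An error of order
  \<open>u\<^sup>2 d\<close> is what is wanted, since \<open>u\<^sup>2 d\<close> stays constant
  under the normalization by \<open>sqrt d\<close>.\<close>

lemma D_small:
  assumes "e > 0"
  shows "\<exists>n0 u0. u0 > 0 \<and> (\<forall>d\<ge>n0. \<forall>h u. \<bar>u\<bar> \<le> u0 \<longrightarrow> D h d u \<le> e * u\<^sup>2 * real d)"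
proof -
  have "(\<lambda>s. \<Sum>i. \<delta> (i + s)) \<longlonglongrightarrow> 0" by (rule suminf_exist_split2[OF \<delta>_summable])
  then have "(\<lambda>s. 4 * \<sigma>2 * (\<Sum>i. \<delta> (i + s))) \<longlonglongrightarrow> 4 * \<sigma>2 * 0" by (intro tendsto_intros)
  then have ev1: "\<forall>\<^sub>F s in sequentially. 4 * \<sigma>2 * (\<Sum>i. \<delta> (i + s)) < e / 3"
    using assms by (intro order_tendstoD(2)[where y="4 * \<sigma>2 * 0"]) auto
  have "(\<lambda>n. \<bar>v n / real n - \<sigma>2\<bar>) \<longlonglongrightarrow> \<bar>\<sigma>2 - \<sigma>2\<bar>" by (intro tendsto_intros v_tendsto)
  then have "\<forall>\<^sub>F n in sequentially. \<bar>v n / real n - \<sigma>2\<bar> < e / 3"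
    using assms by (intro order_tendstoD(2)[where y="\<bar>\<sigma>2 - \<sigma>2\<bar>"]) auto
  then obtain N1 where N1: "\<And>n. n \<ge> N1 \<Longrightarrow> \<bar>v n / real n - \<sigma>2\<bar> < e / 3"
    unfolding eventually_sequentially by blast
  obtain N2 where N2: "\<And>s. s \<ge> N2 \<Longrightarrow> 4 * \<sigma>2 * (\<Sum>i. \<delta> (i + s)) < e / 3"
    using ev1 unfolding eventually_sequentially by blast
  define s where "s = max N1 N2"
  have s2: "n \<ge> N1" if "n \<ge> 2 ^ s" for n
  proof -
    have "s < 2 ^ s" by (rule less_exp)
    then show ?thesis using that unfolding s_def by linarith
  qed
  obtain B where B: "\<And>n. B n \<ge> 0" "\<And>n h u. D h n u \<le> u\<^sup>2 * (\<bar>v n - \<sigma>2 * real n\<bar> / 2 + B n * (\<bar>u\<bar> + u\<^sup>2))"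
    using D_base by metis
  define BB where "BB = (\<Sum>n\<le>2 ^ Suc s. B n)"
  have BB: "B n \<le> BB" if "n \<le> 2 ^ Suc s" for n
    unfolding BB_def using that B(1) by (intro member_le_sum) auto
  have BB0: "BB \<ge> 0" unfolding BB_def using B(1) by (rule sum_nonneg)
  \<comment> \<open>With |u| at most 1 one has \<open>u\<^sup>2 \<le> \<bar>u\<bar>\<close>, so the
    Taylor remainder is at most \<open>2 * BB * u0\<close>, which the second argument of the minimum
    keeps below e / 3.\<close>
  define u0 where "u0 = min 1 (e / (6 * (BB + 1)))"
  have u0: "u0 > 0" unfolding u0_def using assms BB0 by auto
  have main: "D h d u \<le> u\<^sup>2 * real d * (2 * e / 3 + 4 * \<sigma>2 * (\<Sum>i<j. \<delta> (i + s)))"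
    if "2 ^ (s + j) \<le> d" "d \<le> 2 ^ Suc (s + j)" "\<bar>u\<bar> \<le> u0" for d j h u
    using that
  proof (induction j arbitrary: d h)
    case 0
    then have d: "2 ^ s \<le> d" "d \<le> 2 ^ Suc s" by auto
    have dp: "real d \<ge> 1" using d(1) one_le_power[of "2::nat" s] by linarith
    have "\<bar>v d - \<sigma>2 * real d\<bar> = real d * \<bar>v d / real d - \<sigma>2\<bar>"
    proof -
      have "v d - \<sigma>2 * real d = real d * (v d / real d - \<sigma>2)" using dp by (simp add: field_simps)
      then show ?thesis by (simp add: abs_mult)
    qed
    also have "\<dots> \<le> real d * (e / 3)" using N1[OF s2[OF d(1)]] by (intro mult_left_mono) auto
    finally have 1: "\<bar>v d - \<sigma>2 * real d\<bar> / 2 \<le> real d * (e / 3)"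
      by (rule order_trans[rotated]) simp
    have "\<bar>u\<bar> \<le> 1" using 0 u0_def by simp
    then have "u\<^sup>2 \<le> \<bar>u\<bar>" using mult_left_le[of "\<bar>u\<bar>" "\<bar>u\<bar>"] by (simp add: power2_eq_square flip: abs_mult)
    then have "B d * (\<bar>u\<bar> + u\<^sup>2) \<le> BB * (2 * u0)" using 0 BB[OF d(2)] B(1) BB0 by (intro mult_mono) auto
    also have "\<dots> \<le> BB * (2 * (e / (6 * (BB + 1))))" using BB0 by (intro mult_left_mono) (auto simp: u0_def)
    also have "\<dots> \<le> e / 3" using BB0 assms by (simp add: field_simps)
    also have "\<dots> \<le> real d * (e / 3)" using dp assms by simp
    finally have 2: "B d * (\<bar>u\<bar> + u\<^sup>2) \<le> real d * (e / 3)" .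
    have "D h d u \<le> u\<^sup>2 * (\<bar>v d - \<sigma>2 * real d\<bar> / 2 + B d * (\<bar>u\<bar> + u\<^sup>2))" by (rule B(2))
    also have "\<dots> \<le> u\<^sup>2 * (real d * (e / 3) + real d * (e / 3))" using 1 2 by (intro mult_left_mono add_mono) auto
    finally show ?case by (simp add: algebra_simps)
  next
    case (Suc j)
    obtain n1 n2 where n: "n1 + n2 = d" "2 ^ (s + j) \<le> n1" "n1 \<le> 2 ^ Suc (s + j)" "2 ^ (s + j) \<le> n2" "n2 \<le> 2 ^ Suc (s + j)"
      and le: "D h d u \<le> D h n1 u + D (h + n1) n2 u + u\<^sup>2 * real d * (4 * \<sigma>2 * \<delta> (s + j))"
      using D_dyadic[of "s + j" d] Suc.prems by auto
    \<comment> \<open>The bound is linear in the length, so the estimates for the two halves add up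
      to the one for \<open>d\<close>.\<close>
    define F where "F = 2 * e / 3 + 4 * \<sigma>2 * (\<Sum>i<j. \<delta> (i + s))"
    have "D h n1 u \<le> u\<^sup>2 * real n1 * F" "D (h + n1) n2 u \<le> u\<^sup>2 * real n2 * F"
      unfolding F_def using n Suc.prems by (auto intro!: Suc.IH)
    then have "D h d u \<le> u\<^sup>2 * real n1 * F + u\<^sup>2 * real n2 * F + u\<^sup>2 * real d * (4 * \<sigma>2 * \<delta> (s + j))"
      using le by linarith
    also have "\<dots> = u\<^sup>2 * real d * (2 * e / 3 + 4 * \<sigma>2 * (\<Sum>i<Suc j. \<delta> (i + s)))"
      unfolding F_def n(1)[symmetric] by (simp add: algebra_simps)
    finally show ?case .
  qed
  have "D h d u \<le> e * u\<^sup>2 * real d" if d: "d \<ge> 2 ^ s" and u: "\<bar>u\<bar> \<le> u0" for d h u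
  proof -
    have "\<exists>j. 2 ^ (s + j) \<le> d \<and> d \<le> 2 ^ Suc (s + j)"
    proof -
      define P where "P j \<longleftrightarrow> d < 2 ^ (s + j)" for j
      have "d < 2 ^ d" by (rule less_exp)
      also have "(2::nat) ^ d \<le> 2 ^ (s + d)" by (intro power_increasing) auto
      finally have ex: "P d" by (simp add: P_def)
      have "\<not> P 0" using d by (simp add: P_def)
      then obtain j where "\<not> P j" "P (Suc j)" using ex_least_nat_less[of P d] ex by blast
      then show ?thesis unfolding P_def by (intro exI[of _ j]) auto
    qed
    then obtain j where j: "2 ^ (s + j) \<le> d" "d \<le> 2 ^ Suc (s + j)" by blast
    have "(\<Sum>i<j. \<delta> (i + s)) \<le> (\<Sum>i. \<delta> (i + s))"
      using \<delta>_summable \<delta>_nonneg by (intro sum_le_suminf summable_ignore_initial_segment) auto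
    then have "4 * \<sigma>2 * (\<Sum>i<j. \<delta> (i + s)) \<le> 4 * \<sigma>2 * (\<Sum>i. \<delta> (i + s))"
      using \<sigma>2_nonneg by (intro mult_left_mono) auto
    also have "\<dots> < e / 3" by (rule N2) (simp add: s_def)
    finally have "u\<^sup>2 * real d * (2 * e / 3 + 4 * \<sigma>2 * (\<Sum>i<j. \<delta> (i + s))) \<le> u\<^sup>2 * real d * e"
      by (intro mult_left_mono) auto
    with main[OF j u, of h] have "D h d u \<le> u\<^sup>2 * real d * e" by linarith
    then show ?thesis by (simp add: mult_ac)
  qed
  then show ?thesis using u0 by blast
qed

theorem central_limit_char:
  "(\<lambda>n. char (distr N borel (\<lambda>x. S 0 n x / sqrt (real n))) t) \<longlonglongrightarrow> complex_of_real (exp (- (t\<^sup>2 * \<sigma>2 / 2)))"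
proof (rule LIMSEQ_I)
  fix e :: real assume e: "e > 0"
  \<comment> \<open>The error at \<open>u = t / sqrt n\<close> will be
    \<open>e' * t\<^sup>2\<close>; the summand 1 covers t = 0.\<close>
  define e' where "e' = e / (2 * (t\<^sup>2 + 1))"
  have t1: "t\<^sup>2 + 1 > 0" by (simp add: add_nonneg_pos)
  have "e' > 0" unfolding e'_def using e t1 by simp
  from D_small[OF this] obtain n0 u0 where u0: "u0 > 0"
    and D: "\<And>d h u. d \<ge> n0 \<Longrightarrow> \<bar>u\<bar> \<le> u0 \<Longrightarrow> D h d u \<le> e' * u\<^sup>2 * real d" by blast
  obtain n1 where n1: "real n1 > (t / u0)\<^sup>2" using reals_Archimedean2 by blast
  show "\<exists>no. \<forall>n\<ge>no. norm (char (distr N borel (\<lambda>x. S 0 n x / sqrt (real n))) t - complex_of_real (exp (- (t\<^sup>2 * \<sigma>2 / 2)))) < e"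
  proof (intro exI allI impI)
    fix n assume n: "n \<ge> max (max n0 n1) 1"
    define u where "u = t / sqrt (real n)"
    have n0: "real n > 0" using n by simp
    have u2: "u\<^sup>2 * real n = t\<^sup>2" unfolding u_def using n0 by (simp add: power_divide)
    have "(t / u0)\<^sup>2 \<le> real n" using n1 n by linarith
    then have "\<bar>t / u0\<bar>\<^sup>2 \<le> real n" by (simp only: power2_abs)
    then have "\<bar>t / u0\<bar> \<le> sqrt (real n)" by (rule real_le_rsqrt)
    then have "\<bar>u\<bar> \<le> u0" unfolding u_def using u0 n0 by (simp add: field_simps abs_divide)
    then have "D 0 n u \<le> e' * t\<^sup>2" using D[of n u 0] n u2 by (simp add: mult.assoc)
    also have "\<dots> < e"
    proof -
      have "e * t\<^sup>2 \<ge> 0" using e by simp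
      then have "e * t\<^sup>2 < e * (2 * (t\<^sup>2 + 1))" unfolding distrib_left using e by linarith
      then show ?thesis unfolding e'_def using t1 by (simp add: divide_less_eq)
    qed
    finally have "D 0 n u < e" .
    moreover have "char (distr N borel (\<lambda>x. S 0 n x / sqrt (real n))) t = \<phi> 0 n u"
      unfolding \<phi>_eq_char char_def u_def by (simp add: integral_distr)
    moreover have "u\<^sup>2 * \<sigma>2 * real n = t\<^sup>2 * \<sigma>2" using u2 by (simp add: algebra_simps)
    ultimately show "norm (char (distr N borel (\<lambda>x. S 0 n x / sqrt (real n))) t - complex_of_real (exp (- (t\<^sup>2 * \<sigma>2 / 2)))) < e"
      unfolding D_def by simp
  qed
qed

end

section \<open>Quadratic forms in independent copies of a mixing sequence\<close>

lemma integral_sum2: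
  fixes f :: "'i \<Rightarrow> 'j \<Rightarrow> 'a \<Rightarrow> real"
  assumes "\<And>i j. i \<in> I \<Longrightarrow> j \<in> J \<Longrightarrow> integrable M (f i j)"
  shows "(\<integral>x. (\<Sum>i\<in>I. \<Sum>j\<in>J. f i j x) \<partial>M) = (\<Sum>i\<in>I. \<Sum>j\<in>J. \<integral>x. f i j x \<partial>M)"
  using assms by (simp add: Bochner_Integration.integral_sum Bochner_Integration.integrable_sum)

text \<open>\<open>A n\<close> and \<open>B n\<close> stand for the past before and the future from
  index \<open>n\<close>, with indices starting at 0. They are abstract, so that tensorization can
  be applied to arbitrary subalgebras.\<close>

locale rho_sequence = prob_space M for M :: "'a measure" +
  fixes U :: "nat \<Rightarrow> 'a \<Rightarrow> real" and A B :: "nat \<Rightarrow> 'a measure" and \<gamma> :: "nat \<Rightarrow> real"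
    and \<rho> :: "nat \<Rightarrow> real" and K :: real
  assumes U4: "\<And>k. mom4_le M (U k) K"
    and U_mean: "\<And>k. expectation (U k) = 0"
    and U_cov: "\<And>k j. expectation (\<lambda>x. U k x * U (k + j) x) = \<gamma> j"
    and \<gamma>0: "\<gamma> 0 > 0"
    and sub_A: "\<And>n. subalgebra M (A n)" and sub_B: "\<And>n. subalgebra M (B n)"
    and U_A: "\<And>k n. k < n \<Longrightarrow> U k \<in> borel_measurable (A n)"
    and U_B: "\<And>k n. n \<le> k \<Longrightarrow> U k \<in> borel_measurable (B n)"
    and mcorr: "\<And>n r. n \<ge> 1 \<Longrightarrow> max_corr_le M (A n) (B (n + r)) (\<rho> r)"
    and \<rho>_nonneg: "\<And>r. \<rho> r \<ge> 0"
    and \<rho>_summable: "summable (\<lambda>k. \<rho> (2 ^ k))"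
    and \<rho>_null: "\<rho> \<longlonglongrightarrow> 0"
begin

lemma U_meas[measurable]: "U k \<in> borel_measurable M"
  using U4 by (simp add: mom4_le_def)

lemma U_sq: "integrable M (\<lambda>x. (U k x)\<^sup>2)" and U_int: "integrable M (U k)"
  using U4[of k] mom4_le_imp by blast+

lemma UU_int: "integrable M (\<lambda>x. U k x * U l x)"
  by (intro integrable_mult_of_squares U_sq) auto

lemma U_cov': "expectation (\<lambda>x. U k x * U l x) = \<gamma> (if k \<le> l then l - k else k - l)"
proof (cases "k \<le> l")
  case True
  then show ?thesis using U_cov[of k "l - k"] by simp
next
  case False
  then show ?thesis using U_cov[of l "k - l"] by (simp add: mult.commute)
qed

abbreviation Pr :: "'i set \<Rightarrow> ('i \<Rightarrow> 'a) measure" where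
  "Pr I \<equiv> PiM I (\<lambda>_. M)"

lemma prob_space_Pr: "prob_space (Pr I)"
  by (intro prob_space_PiM prob_space_axioms)

lemma coord_prod:
  fixes f :: "'i \<Rightarrow> 'a \<Rightarrow> real"
  assumes "finite I" "J \<subseteq> I" and f: "\<And>a. a \<in> J \<Longrightarrow> integrable M (f a)"
  shows "integrable (Pr I) (\<lambda>\<omega>. \<Prod>a\<in>J. f a (\<omega> a))"
    and "(\<integral>\<omega>. (\<Prod>a\<in>J. f a (\<omega> a)) \<partial>Pr I) = (\<Prod>a\<in>J. expectation (f a))"
proof -
  interpret P: product_sigma_finite "\<lambda>_::'i. M" ..
  define g where "g a = (if a \<in> J then f a else (\<lambda>_. 1))" for a
  have g: "integrable M (g a)" for a unfolding g_def using f by auto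
  have e: "(\<Prod>a\<in>I. g a (\<omega> a)) = (\<Prod>a\<in>J. f a (\<omega> a))" for \<omega>
    by (rule prod.mono_neutral_cong_right) (use assms in \<open>auto simp: g_def\<close>)
  have e2: "(\<Prod>a\<in>I. expectation (g a)) = (\<Prod>a\<in>J. expectation (f a))"
    by (rule prod.mono_neutral_cong_right) (use assms in \<open>auto simp: g_def prob_space\<close>)
  show "integrable (Pr I) (\<lambda>\<omega>. \<Prod>a\<in>J. f a (\<omega> a))"
    using P.product_integrable_prod[of I g] g assms by (simp add: e)
  show "(\<integral>\<omega>. (\<Prod>a\<in>J. f a (\<omega> a)) \<partial>Pr I) = (\<Prod>a\<in>J. expectation (f a))"
    using P.product_integral_prod[of I g] g assms by (simp add: e e2)
qed

text \<open>The expectation factorizes over the coordinates. A coordinate that occurs in only one of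
  the two pairs contributes the mean 0, one that occurs in both contributes a covariance.\<close>

lemma UU_pair_moment:
  assumes "finite I" "a \<in> I" "b \<in> I" "a' \<in> I" "b' \<in> I" "a \<noteq> b" "a' \<noteq> b'"
  shows "integrable (Pr I) (\<lambda>\<omega>. (U k (\<omega> a) * U k (\<omega> b)) * (U l (\<omega> a') * U l (\<omega> b')))"
    and "(\<integral>\<omega>. (U k (\<omega> a) * U k (\<omega> b)) * (U l (\<omega> a') * U l (\<omega> b')) \<partial>Pr I) =
      (if {a, b} = {a', b'} then (expectation (\<lambda>x. U k x * U l x))\<^sup>2 else 0)"
proof -
  define F where "F x y = (if x \<in> {a, b} then U k y else 1) * (if x \<in> {a', b'} then U l y else 1)" for x y
  define J where "J = {a, b} \<union> {a', b'}"
  have J: "finite J" "J \<subseteq> I" using assms by (auto simp: J_def)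
  have p1: "(\<Prod>x\<in>J. if x \<in> {a, b} then U k (\<omega> x) else 1) = U k (\<omega> a) * U k (\<omega> b)" for \<omega> :: "_ \<Rightarrow> 'a"
  proof -
    have "(\<Prod>x\<in>J. if x \<in> {a, b} then U k (\<omega> x) else 1) = (\<Prod>x\<in>{a, b}. U k (\<omega> x))"
      by (rule prod.mono_neutral_cong_right) (use J in \<open>auto simp: J_def\<close>)
    then show ?thesis using assms by simp
  qed
  have p2: "(\<Prod>x\<in>J. if x \<in> {a', b'} then U l (\<omega> x) else 1) = U l (\<omega> a') * U l (\<omega> b')" for \<omega> :: "_ \<Rightarrow> 'a"
  proof -
    have "(\<Prod>x\<in>J. if x \<in> {a', b'} then U l (\<omega> x) else 1) = (\<Prod>x\<in>{a', b'}. U l (\<omega> x))"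
      by (rule prod.mono_neutral_cong_right) (use J in \<open>auto simp: J_def\<close>)
    then show ?thesis using assms by simp
  qed
  have p: "(\<Prod>x\<in>J. F x (\<omega> x)) = (U k (\<omega> a) * U k (\<omega> b)) * (U l (\<omega> a') * U l (\<omega> b'))" for \<omega>
    unfolding F_def prod.distrib p1 p2 ..
  have FI: "integrable M (F x)" for x
  proof -
    consider "F x = (\<lambda>y. U k y * U l y)" | "F x = U k" | "F x = U l" | "F x = (\<lambda>_. 1)"
      unfolding F_def fun_eq_iff by (cases "x \<in> {a, b}"; cases "x \<in> {a', b'}") auto
    then show ?thesis by cases (use U_int UU_int in auto)
  qed
  show "integrable (Pr I) (\<lambda>\<omega>. (U k (\<omega> a) * U k (\<omega> b)) * (U l (\<omega> a') * U l (\<omega> b')))"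
    using coord_prod(1)[OF assms(1) J(2), of F] FI by (simp add: p)
  have e: "(\<integral>\<omega>. (U k (\<omega> a) * U k (\<omega> b)) * (U l (\<omega> a') * U l (\<omega> b')) \<partial>Pr I) = (\<Prod>x\<in>J. expectation (F x))"
    using coord_prod(2)[OF assms(1) J(2), of F] FI by (simp add: p)
  show "(\<integral>\<omega>. (U k (\<omega> a) * U k (\<omega> b)) * (U l (\<omega> a') * U l (\<omega> b')) \<partial>Pr I) =
      (if {a, b} = {a', b'} then (expectation (\<lambda>x. U k x * U l x))\<^sup>2 else 0)"
  proof (cases "{a, b} = {a', b'}")
    case True
    then have "(\<Prod>x\<in>J. expectation (F x)) = (\<Prod>x\<in>{a, b}. expectation (\<lambda>x. U k x * U l x))"
      unfolding J_def F_def by (intro prod.cong) auto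
    then show ?thesis using True assms e by (simp add: power2_eq_square)
  next
    case False
    then obtain x where x: "x \<in> J" "\<not> (x \<in> {a, b} \<and> x \<in> {a', b'})" unfolding J_def by blast
    have "expectation (F x) = 0"
    proof (cases "x \<in> {a, b}")
      case True
      then have "F x = U k" using x by (auto simp: F_def)
      then show ?thesis using U_mean by simp
    next
      case False
      then have "F x = U l" using x by (auto simp: F_def J_def)
      then show ?thesis using U_mean by simp
    qed
    then show ?thesis using e x J False by auto
  qed
qed

definition quad :: "'i set \<Rightarrow> ('i \<Rightarrow> 'i \<Rightarrow> real) \<Rightarrow> nat \<Rightarrow> ('i \<Rightarrow> 'a) \<Rightarrow> real" where
  "quad I T k \<omega> = (\<Sum>a\<in>I. \<Sum>b\<in>I. T a b * (U k (\<omega> a) * U k (\<omega> b)))"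

text \<open>Without a diagonal all products involve two distinct copies. This makes the form
  centred, and its fourth moment needs no more than the fourth moment of \<open>U\<close>.\<close>

definition sym0 :: "'i set \<Rightarrow> ('i \<Rightarrow> 'i \<Rightarrow> real) \<Rightarrow> bool" where
  "sym0 I T \<longleftrightarrow> (\<forall>a\<in>I. \<forall>b\<in>I. T a b = T b a) \<and> (\<forall>a\<in>I. T a a = 0)"

text \<open>Products over different unordered pairs are orthogonal. For each ordered pair the same
  and the reversed one survive, hence the factor 2. That the covariance enters squared is the source
  of nonnegativity.\<close>

lemma quad_cov:
  assumes fin: "finite I" and T: "sym0 I T"
  shows "(\<integral>\<omega>. quad I T k \<omega> * quad I T l \<omega> \<partial>Pr I) =
    2 * (\<Sum>a\<in>I. \<Sum>b\<in>I. (T a b)\<^sup>2) * (expectation (\<lambda>x. U k x * U l x))\<^sup>2"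
proof -
  define g where "g = (expectation (\<lambda>x. U k x * U l x))\<^sup>2"
  define W where "W k p \<omega> = U k (\<omega> (fst p)) * U k (\<omega> (snd p))" for k and p :: "'b \<times> 'b" and \<omega> :: "'b \<Rightarrow> 'a"
  define t where "t p = T (fst p) (snd p)" for p
  let ?I = "{p \<in> I \<times> I. fst p \<noteq> snd p}"
  have finI: "finite ?I" using fin by auto
  have q: "quad I T k \<omega> = (\<Sum>p\<in>?I. t p * W k p \<omega>)" for k \<omega>
  proof -
    have "quad I T k \<omega> = (\<Sum>p\<in>I \<times> I. t p * W k p \<omega>)"
      unfolding quad_def t_def W_def by (subst sum.cartesian_product) (simp add: case_prod_beta)
    also have "\<dots> = (\<Sum>p\<in>?I. t p * W k p \<omega>)"
      by (rule sum.mono_neutral_right) (use fin T in \<open>auto simp: t_def sym0_def\<close>)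
    finally show ?thesis .
  qed
  have W: "integrable (Pr I) (\<lambda>\<omega>. W k p \<omega> * W l p' \<omega>)"
    "(\<integral>\<omega>. W k p \<omega> * W l p' \<omega> \<partial>Pr I) = (if {fst p, snd p} = {fst p', snd p'} then g else 0)"
    if "p \<in> ?I" "p' \<in> ?I" for p p'
    unfolding W_def g_def
    by (rule UU_pair_moment; use that fin in force)+
  have "(\<integral>\<omega>. quad I T k \<omega> * quad I T l \<omega> \<partial>Pr I) = (\<integral>\<omega>. (\<Sum>p\<in>?I. \<Sum>p'\<in>?I. t p * t p' * (W k p \<omega> * W l p' \<omega>)) \<partial>Pr I)"
    unfolding q sum_product by (intro Bochner_Integration.integral_cong sum.cong refl) (simp add: mult_ac)
  also have "\<dots> = (\<Sum>p\<in>?I. \<Sum>p'\<in>?I. t p * t p' * (\<integral>\<omega>. W k p \<omega> * W l p' \<omega> \<partial>Pr I))"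
    by (subst integral_sum2) (use W(1) in auto)
  also have "\<dots> = (\<Sum>p\<in>?I. \<Sum>p'\<in>?I. t p * t p' * (if {fst p, snd p} = {fst p', snd p'} then g else 0))"
    by (intro sum.cong refl) (simp only: W(2))
  also have "\<dots> = (\<Sum>p\<in>?I. 2 * (t p)\<^sup>2 * g)"
  proof (rule sum.cong[OF refl])
    fix p assume p: "p \<in> ?I"
    obtain a b where ab: "p = (a, b)" "a \<in> I" "b \<in> I" "a \<noteq> b" using p by auto
    have "(\<Sum>p'\<in>?I. t p * t p' * (if {fst p, snd p} = {fst p', snd p'} then g else 0)) =
       (\<Sum>p'\<in>{(a, b), (b, a)}. t p * t p' * g)"
      by (rule sum.mono_neutral_cong_right) (use finI ab in \<open>auto simp: doubleton_eq_iff\<close>)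
    also have "\<dots> = 2 * (t p)\<^sup>2 * g"
      using ab T by (simp add: t_def sym0_def power2_eq_square)
    finally show "(\<Sum>p'\<in>?I. t p * t p' * (if {fst p, snd p} = {fst p', snd p'} then g else 0)) = 2 * (t p)\<^sup>2 * g" .
  qed
  also have "\<dots> = (\<Sum>p\<in>I\<times>I. 2 * (t p)\<^sup>2 * g)"
    by (rule sum.mono_neutral_left) (use fin T in \<open>auto simp: t_def sym0_def\<close>)
  also have "\<dots> = 2 * (\<Sum>a\<in>I. \<Sum>b\<in>I. (T a b)\<^sup>2) * g"
    unfolding sum.cartesian_product sum_distrib_left sum_distrib_right t_def by (simp add: case_prod_beta)
  finally show ?thesis unfolding g_def .
qed

lemma component_meas[measurable]:
  "a \<in> I \<Longrightarrow> (\<lambda>\<omega>. U k (\<omega> a)) \<in> borel_measurable (Pr I)"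
  by measurable

lemma quad_meas[measurable]: "quad I T k \<in> borel_measurable (Pr I)"
  unfolding quad_def by measurable

lemma quad_mom4:
  assumes fin: "finite I" and T: "sym0 I T"
  shows "\<exists>L. \<forall>k. mom4_le (Pr I) (quad I T k) L"
proof -
  have K0: "K \<ge> 0"
    using U4[of 0] order_trans[of 0 "expectation (\<lambda>x. U 0 x ^ 4)" K] by (auto simp: mom4_le_def)
  have W: "mom4_le (Pr I) (\<lambda>\<omega>. U k (\<omega> a) * U k (\<omega> b)) (K * K)" if "a \<in> I" "b \<in> I" "a \<noteq> b" for a b k
  proof -
    have i: "integrable M (\<lambda>x. U k x ^ 4)" "expectation (\<lambda>x. U k x ^ 4) \<le> K"
      using U4[of k] by (auto simp: mom4_le_def)
    have p: "(U k (\<omega> a) * U k (\<omega> b)) ^ 4 = (\<Prod>x\<in>{a, b}. U k (\<omega> x) ^ 4)" for \<omega> :: "_ \<Rightarrow> 'a"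
      using that by (simp add: power_mult_distrib)
    have "(\<integral>\<omega>. (U k (\<omega> a) * U k (\<omega> b)) ^ 4 \<partial>Pr I) = (\<Prod>x\<in>{a, b}. expectation (\<lambda>x. U k x ^ 4))"
      unfolding p using coord_prod(2)[OF fin, of "{a, b}" "\<lambda>_ x. U k x ^ 4"] that i by auto
    also have "\<dots> = expectation (\<lambda>x. U k x ^ 4) * expectation (\<lambda>x. U k x ^ 4)" using that by simp
    also have "\<dots> \<le> K * K" using i K0 by (intro mult_mono) auto
    finally have "(\<integral>\<omega>. (U k (\<omega> a) * U k (\<omega> b)) ^ 4 \<partial>Pr I) \<le> K * K" .
    moreover have "integrable (Pr I) (\<lambda>\<omega>. (U k (\<omega> a) * U k (\<omega> b)) ^ 4)"
      unfolding p using coord_prod(1)[OF fin, of "{a, b}" "\<lambda>_ x. U k x ^ 4"] that i by auto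
    ultimately show ?thesis using that by (simp add: mom4_le_def)
  qed
  have W2: "mom4_le (Pr I) (\<lambda>\<omega>. T (fst p) (snd p) * (U k (\<omega> (fst p)) * U k (\<omega> (snd p)))) ((T (fst p) (snd p)) ^ 4 * (K * K))"
    if "p \<in> I \<times> I" for p k
  proof (cases "fst p = snd p")
    case True
    then show ?thesis using T that by (auto simp: mom4_le_def sym0_def)
  next
    case False
    then show ?thesis using that by (intro mom4_le_cmult W) auto
  qed
  have "\<exists>L. \<forall>k. mom4_le (Pr I) (\<lambda>\<omega>. \<Sum>p\<in>I\<times>I. T (fst p) (snd p) * (U k (\<omega> (fst p)) * U k (\<omega> (snd p)))) L"
    by (rule mom4_le_sum[where K="\<lambda>p. (T (fst p) (snd p)) ^ 4 * (K * K)"]) (use fin W2 in auto)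
  moreover have "quad I T k = (\<lambda>\<omega>. \<Sum>p\<in>I\<times>I. T (fst p) (snd p) * (U k (\<omega> (fst p)) * U k (\<omega> (snd p))))" for k
    unfolding quad_def by (subst sum.cartesian_product) (simp add: case_prod_beta)
  ultimately show ?thesis by simp
qed

lemma quad_mean:
  assumes fin: "finite I" and T: "sym0 I T"
  shows "(\<integral>\<omega>. quad I T k \<omega> \<partial>Pr I) = 0"
proof -
  have *: "integrable (Pr I) (\<lambda>\<omega>. T a b * (U k (\<omega> a) * U k (\<omega> b))) \<and> (\<integral>\<omega>. T a b * (U k (\<omega> a) * U k (\<omega> b)) \<partial>Pr I) = 0"
    if "a \<in> I" "b \<in> I" for a b
  proof (cases "a = b")
    case False
    then show ?thesis using coord_prod[OF fin, of "{a, b}" "\<lambda>_. U k"] that U_int U_mean by simp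
  qed (use T that in \<open>auto simp: sym0_def\<close>)
  have "(\<integral>\<omega>. quad I T k \<omega> \<partial>Pr I) = (\<Sum>a\<in>I. \<Sum>b\<in>I. \<integral>\<omega>. T a b * (U k (\<omega> a) * U k (\<omega> b)) \<partial>Pr I)"
    unfolding quad_def by (rule integral_sum2) (use * in blast)
  also have "\<dots> = 0" by (intro sum.neutral ballI) (use * in blast)
  finally show ?thesis .
qed

text \<open>Block sums of the form are measurable with respect to products of past or of future
  algebras, and by tensorization these products have the same maximal correlation as the factors. No
  constant is lost, however many copies there are.\<close>

lemma quad_mixing_sequence:
  assumes fin: "finite I" and T: "sym0 I T"
  obtains L where "mixing_sequence (Pr I) (quad I T) (\<lambda>j. 2 * (\<Sum>a\<in>I. \<Sum>b\<in>I. (T a b)\<^sup>2) * (\<gamma> j)\<^sup>2) \<rho> L"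
proof -
  obtain L where L: "\<And>k. mom4_le (Pr I) (quad I T k) L" using quad_mom4[OF assms] by blast
  interpret P: prob_space "Pr I" by (rule prob_space_Pr)
  have subP: "subalgebra (Pr I) (PiM I (\<lambda>_. A n))" "subalgebra (Pr I) (PiM I (\<lambda>_. B n))" for n
    by (intro subalgebra_PiM sub_A sub_B)+
  have qA: "quad I T k \<in> borel_measurable (PiM I (\<lambda>_. A n))" if "k < n" for k n
    unfolding quad_def using U_A[OF that] by measurable
  have qB: "quad I T k \<in> borel_measurable (PiM I (\<lambda>_. B n))" if "n \<le> k" for k n
    unfolding quad_def using U_B[OF that] by measurable
  show ?thesis
  proof (rule that, unfold_locales)
    fix h n r m :: nat and f g :: "real \<Rightarrow> real"
    assume n: "n \<ge> 1" and f: "f \<in> borel_measurable borel" and g: "g \<in> borel_measurable borel"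
      and i: "integrable (Pr I) (\<lambda>x. (f (\<Sum>j\<in>{h..<h+n}. quad I T j x))\<^sup>2)"
        "integrable (Pr I) (\<lambda>x. (g (\<Sum>j\<in>{h+n+r..<h+n+r+m}. quad I T j x))\<^sup>2)"
    have "(\<lambda>x. \<Sum>j\<in>{h..<h+n}. quad I T j x) \<in> borel_measurable (PiM I (\<lambda>_. A (h + n)))"
      by (intro borel_measurable_sum qA) auto
    then have fm: "(\<lambda>x. f (\<Sum>j\<in>{h..<h+n}. quad I T j x)) \<in> borel_measurable (PiM I (\<lambda>_. A (h + n)))"
      by (rule measurable_compose[OF _ f])
    have "(\<lambda>x. \<Sum>j\<in>{h+n+r..<h+n+r+m}. quad I T j x) \<in> borel_measurable (PiM I (\<lambda>_. B (h + n + r)))"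
      by (intro borel_measurable_sum qB) auto
    then have gm: "(\<lambda>x. g (\<Sum>j\<in>{h+n+r..<h+n+r+m}. quad I T j x)) \<in> borel_measurable (PiM I (\<lambda>_. B (h + n + r)))"
      by (rule measurable_compose[OF _ g])
    have mc: "max_corr_le (Pr I) (PiM I (\<lambda>_. A (h + n))) (PiM I (\<lambda>_. B (h + n + r))) (\<rho> r)"
      using n by (intro max_corr_le_PiM fin \<rho>_nonneg sub_A sub_B mcorr prob_space_axioms) auto
    show "\<bar>covar (Pr I) (\<lambda>x. f (\<Sum>j\<in>{h..<h+n}. quad I T j x)) (\<lambda>x. g (\<Sum>j\<in>{h+n+r..<h+n+r+m}. quad I T j x))\<bar> \<le>
        \<rho> r * (sqrt (covar (Pr I) (\<lambda>x. f (\<Sum>j\<in>{h..<h+n}. quad I T j x)) (\<lambda>x. f (\<Sum>j\<in>{h..<h+n}. quad I T j x))) *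
               sqrt (covar (Pr I) (\<lambda>x. g (\<Sum>j\<in>{h+n+r..<h+n+r+m}. quad I T j x)) (\<lambda>x. g (\<Sum>j\<in>{h+n+r..<h+n+r+m}. quad I T j x))))"
      by (rule P.max_corr_le_square_integrable[OF mc subP \<rho>_nonneg fm i(1) gm i(2)])
  next
    fix k j
    show "(\<integral>x. quad I T k x * quad I T (k + j) x \<partial>Pr I) = 2 * (\<Sum>a\<in>I. \<Sum>b\<in>I. (T a b)\<^sup>2) * (\<gamma> j)\<^sup>2"
      unfolding quad_cov[OF assms] U_cov ..
    show "0 \<le> 2 * (\<Sum>a\<in>I. \<Sum>b\<in>I. (T a b)\<^sup>2) * (\<gamma> j)\<^sup>2"
      by (intro mult_nonneg_nonneg sum_nonneg) auto
  qed (use L quad_mean[OF assms] \<rho>_nonneg \<rho>_summable in auto)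
qed

section \<open>The trace of the squared covariance matrix and the limit theorem for forms\<close>

text \<open>The trace of the square of the covariance matrix of the first \<open>d\<close>
  variables; \<tau>, defined next, is its limit per dimension.\<close>

definition tr2 :: "nat \<Rightarrow> real" where
  "tr2 d = (\<Sum>k<d. \<Sum>l<d. (expectation (\<lambda>x. U k x * U l x))\<^sup>2)"

definition \<tau> :: real where "\<tau> = (\<gamma> 0)\<^sup>2 + 2 * (\<Sum>j. (\<gamma> (Suc j))\<^sup>2)"

lemma tr2_Suc: "tr2 (Suc n) = tr2 n + ((\<gamma> 0)\<^sup>2 + 2 * (\<Sum>j<n. (\<gamma> (Suc j))\<^sup>2))"
proof -
  have a: "(\<Sum>k<n. (expectation (\<lambda>x. U k x * U n x))\<^sup>2) = (\<Sum>j<n. (\<gamma> (Suc j))\<^sup>2)"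
    by (rule sum.reindex_bij_witness[of _ "\<lambda>j. n - Suc j" "\<lambda>j. n - Suc j"]) (auto simp: U_cov' Suc_diff_Suc)
  have b: "(\<Sum>k<n. (expectation (\<lambda>x. U n x * U k x))\<^sup>2) = (\<Sum>j<n. (\<gamma> (Suc j))\<^sup>2)"
    using a by (simp add: mult.commute)
  have "tr2 (Suc n) = tr2 n + (\<Sum>k<n. (expectation (\<lambda>x. U k x * U n x))\<^sup>2) + (\<Sum>k<n. (expectation (\<lambda>x. U n x * U k x))\<^sup>2)
     + (expectation (\<lambda>x. U n x * U n x))\<^sup>2"
    unfolding tr2_def by (simp add: sum.distrib)
  then show ?thesis unfolding a b by (simp add: U_cov')
qed

text \<open>Two copies indexed by the booleans are enough: with off-diagonal entries 1/2 the form is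
  the product of the two copies of \<open>U k\<close>, whose covariances are the squares of
  \<gamma>. Its block variance \<open>v d\<close> is then \<open>tr2 d\<close>, and the claims are
  those already proved for mixing sequences.\<close>

lemma tr2_tendsto: "(\<lambda>d. tr2 d / real d) \<longlonglongrightarrow> \<tau>"
  and tr2_le: "tr2 d \<le> \<tau> * real d"
  and \<gamma>_sq_summable: "summable (\<lambda>j. (\<gamma> j)\<^sup>2)"
  and \<tau>_pos: "\<tau> > 0"
proof -
  define T :: "bool \<Rightarrow> bool \<Rightarrow> real" where "T a b = (if a = b then 0 else 1 / 2)" for a b
  have T: "sym0 UNIV T" unfolding sym0_def T_def by auto
  have ss: "2 * (\<Sum>a\<in>UNIV. \<Sum>b\<in>UNIV. (T a b)\<^sup>2) = 1" unfolding T_def UNIV_bool by (simp add: power2_eq_square)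
  obtain L where "mixing_sequence (Pr UNIV) (quad UNIV T) (\<lambda>j. 2 * (\<Sum>a\<in>UNIV. \<Sum>b\<in>UNIV. (T a b)\<^sup>2) * (\<gamma> j)\<^sup>2) \<rho> L"
    by (rule quad_mixing_sequence[OF _ T]) auto
  then interpret Q: mixing_sequence "Pr UNIV" "quad UNIV T" "\<lambda>j. (\<gamma> j)\<^sup>2" \<rho> L unfolding ss by simp
  have v: "Q.v d = tr2 d" for d
    by (induction d) (simp_all add: Q.v_def Q.inc_def tr2_Suc, simp add: tr2_def)
  have s: "Q.\<sigma>2 = \<tau>" unfolding Q.\<sigma>2_def \<tau>_def ..
  show "(\<lambda>d. tr2 d / real d) \<longlonglongrightarrow> \<tau>" using Q.v_tendsto unfolding v s .
  show "tr2 d \<le> \<tau> * real d" using Q.v_le unfolding v s .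
  show sm: "summable (\<lambda>j. (\<gamma> j)\<^sup>2)" by (rule Q.c_summable)
  have "(\<Sum>j. (\<gamma> (Suc j))\<^sup>2) \<ge> 0" by (intro suminf_nonneg summable_Suc_iff[THEN iffD2, OF sm]) simp
  then show "\<tau> > 0" unfolding \<tau>_def using \<gamma>0 by (simp add: add_pos_nonneg)
qed

theorem quad_clt:
  assumes fin: "finite I" and T: "sym0 I T"
  shows "(\<lambda>d. char (distr (Pr I) borel (\<lambda>\<omega>. (\<Sum>k<d. quad I T k \<omega>) / sqrt (real d))) t)
    \<longlonglongrightarrow> complex_of_real (exp (- (t\<^sup>2 * (2 * (\<Sum>a\<in>I. \<Sum>b\<in>I. (T a b)\<^sup>2) * \<tau>) / 2)))"
    and "(\<integral>\<omega>. (\<Sum>k<d. quad I T k \<omega>)\<^sup>2 \<partial>Pr I) \<le> 2 * (\<Sum>a\<in>I. \<Sum>b\<in>I. (T a b)\<^sup>2) * \<tau> * real d"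
    and "integrable (Pr I) (\<lambda>\<omega>. (\<Sum>k<d. quad I T k \<omega>)\<^sup>2)"
proof -
  obtain L where "mixing_sequence (Pr I) (quad I T) (\<lambda>j. 2 * (\<Sum>a\<in>I. \<Sum>b\<in>I. (T a b)\<^sup>2) * (\<gamma> j)\<^sup>2) \<rho> L"
    by (rule quad_mixing_sequence[OF assms])
  then interpret Q: mixing_sequence "Pr I" "quad I T" "\<lambda>j. 2 * (\<Sum>a\<in>I. \<Sum>b\<in>I. (T a b)\<^sup>2) * (\<gamma> j)\<^sup>2" \<rho> L .
  have S: "Q.S 0 d = (\<lambda>\<omega>. \<Sum>k<d. quad I T k \<omega>)" for d unfolding Q.S_def by (simp add: atLeast0LessThan)
  have "(\<Sum>j. 2 * (\<Sum>a\<in>I. \<Sum>b\<in>I. (T a b)\<^sup>2) * (\<gamma> (Suc j))\<^sup>2) = 2 * (\<Sum>a\<in>I. \<Sum>b\<in>I. (T a b)\<^sup>2) * (\<Sum>j. (\<gamma> (Suc j))\<^sup>2)"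
    by (rule suminf_mult[OF summable_Suc_iff[THEN iffD2, OF \<gamma>_sq_summable]])
  then have s: "Q.\<sigma>2 = 2 * (\<Sum>a\<in>I. \<Sum>b\<in>I. (T a b)\<^sup>2) * \<tau>"
    unfolding Q.\<sigma>2_def \<tau>_def by (simp add: distrib_left)
  show "(\<lambda>d. char (distr (Pr I) borel (\<lambda>\<omega>. (\<Sum>k<d. quad I T k \<omega>) / sqrt (real d))) t)
    \<longlonglongrightarrow> complex_of_real (exp (- (t\<^sup>2 * (2 * (\<Sum>a\<in>I. \<Sum>b\<in>I. (T a b)\<^sup>2) * \<tau>) / 2)))"
    using Q.central_limit_char unfolding S s .
  show "(\<integral>\<omega>. (\<Sum>k<d. quad I T k \<omega>)\<^sup>2 \<partial>Pr I) \<le> 2 * (\<Sum>a\<in>I. \<Sum>b\<in>I. (T a b)\<^sup>2) * \<tau> * real d"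
    using Q.S_var[of 0 d] Q.v_le[of d] unfolding S s by simp
  show "integrable (Pr I) (\<lambda>\<omega>. (\<Sum>k<d. quad I T k \<omega>)\<^sup>2)" using Q.S_sq[of 0 d] unfolding S .
qed

text \<open>Mixing makes the squares asymptotically uncorrelated, so the variance of their mean is
  bounded by a Cesaro mean of a null sequence.\<close>

lemma U_sq_lln:
  "(\<lambda>d. expectation (\<lambda>x. ((\<Sum>k<d. (U k x)\<^sup>2) / real d - \<gamma> 0)\<^sup>2)) \<longlonglongrightarrow> 0"
  and U_sq_lln_int: "integrable M (\<lambda>x. ((\<Sum>k<d. (U k x)\<^sup>2) / real d - \<gamma> 0)\<^sup>2)"
proof -
  define Y where "Y k x = (U k x)\<^sup>2 - \<gamma> 0" for k x
  have U4i: "integrable M (\<lambda>x. ((U k x)\<^sup>2)\<^sup>2)" "expectation (\<lambda>x. ((U k x)\<^sup>2)\<^sup>2) \<le> K" for k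
    using U4[of k] by (auto simp: mom4_le_def simp flip: power_mult)
  have Ym[measurable]: "Y k \<in> borel_measurable M" for k unfolding Y_def by simp
  have Ysq: "integrable M (\<lambda>x. (Y k x)\<^sup>2)" for k
    unfolding Y_def power2_diff using U4i U_sq by auto
  have YY: "integrable M (\<lambda>x. Y k x * Y l x)" for k l
    by (intro integrable_mult_of_squares Ysq) auto
  have m: "expectation (\<lambda>x. (U k x)\<^sup>2) = \<gamma> 0" for k using U_cov[of k 0] by (simp add: power2_eq_square)
  have K0: "K \<ge> 0" using order_trans[OF _ U4i(2)[of 0], of 0] by simp
  have cv: "covar M (\<lambda>x. (U k x)\<^sup>2) (\<lambda>x. (U l x)\<^sup>2) = expectation (\<lambda>x. Y k x * Y l x)" for k l
    unfolding covar_def m Y_def ..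
  have c: "\<bar>expectation (\<lambda>x. Y k x * Y (k + r) x)\<bar> \<le> (if r = 0 then K else \<rho> (r - 1) * K)" for k r
  proof -
    have sd: "covar M (\<lambda>x. (U k x)\<^sup>2) (\<lambda>x. (U k x)\<^sup>2) \<le> K" for k
      using covar_self_le[of "\<lambda>x. (U k x)\<^sup>2"] U4i[of k] by simp
    have sd2: "sqrt (covar M (\<lambda>x. (U k x)\<^sup>2) (\<lambda>x. (U k x)\<^sup>2)) * sqrt (covar M (\<lambda>x. (U l x)\<^sup>2) (\<lambda>x. (U l x)\<^sup>2)) \<le> K" for k l
    proof -
      have "sqrt (covar M (\<lambda>x. (U k x)\<^sup>2) (\<lambda>x. (U k x)\<^sup>2)) * sqrt (covar M (\<lambda>x. (U l x)\<^sup>2) (\<lambda>x. (U l x)\<^sup>2)) \<le> sqrt K * sqrt K"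
        using sd covar_self_nonneg K0 by (intro mult_mono) auto
      then show ?thesis using K0 by simp
    qed
    show ?thesis
    proof (cases r)
      case 0
      then show ?thesis using covar_Cauchy_Schwarz[of "\<lambda>x. (U k x)\<^sup>2" "\<lambda>x. (U k x)\<^sup>2"] sd2[of k k] U4i cv[of k k] by simp
    next
      case (Suc s)
      have "\<bar>covar M (\<lambda>x. (U k x)\<^sup>2) (\<lambda>x. (U (k + r) x)\<^sup>2)\<bar> \<le>
         \<rho> s * (sqrt (covar M (\<lambda>x. (U k x)\<^sup>2) (\<lambda>x. (U k x)\<^sup>2)) * sqrt (covar M (\<lambda>x. (U (k + r) x)\<^sup>2) (\<lambda>x. (U (k + r) x)\<^sup>2)))"
      proof (rule max_corr_le_square_integrable[OF mcorr[of "Suc k" s] sub_A sub_B \<rho>_nonneg])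
        show "(\<lambda>x. (U k x)\<^sup>2) \<in> borel_measurable (A (Suc k))"
          by (intro borel_measurable_power U_A) simp
        show "(\<lambda>x. (U (k + r) x)\<^sup>2) \<in> borel_measurable (B (Suc k + s))"
          by (intro borel_measurable_power U_B) (simp add: Suc)
      qed (use U4i in auto)
      also have "\<dots> \<le> \<rho> s * K" by (intro mult_left_mono sd2 \<rho>_nonneg)
      finally show ?thesis using Suc cv by simp
    qed
  qed
  \<comment> \<open>The past that contains \<open>U k\<close> is \<open>A (Suc k)\<close>, so
    indices at distance j leave a separation of j - 1. At distance 0 the fourth moment takes
    over.\<close>
  define r' where "r' j = (if j = 0 then K else \<rho> (j - 1) * K)" for j :: nat
  have r'0: "r' j \<ge> 0" for j unfolding r'_def using K0 \<rho>_nonneg by simp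
  have r'lim: "r' \<longlonglongrightarrow> 0"
  proof -
    have "(\<lambda>j. r' (Suc j)) \<longlonglongrightarrow> 0 * K" unfolding r'_def by (simp only: nat.simps if_False diff_Suc_1) (intro tendsto_intros \<rho>_null)
    then show ?thesis by (simp only: mult_zero_left filterlim_sequentially_Suc)
  qed
  have bd: "expectation (\<lambda>x. (\<Sum>k<d. Y k x)\<^sup>2) \<le> 2 * real d * (\<Sum>j<d. r' j)" for d
  proof -
    have "expectation (\<lambda>x. (\<Sum>k<d. Y k x)\<^sup>2) = expectation (\<lambda>x. \<Sum>k<d. \<Sum>l<d. Y k x * Y l x)"
      by (simp add: power2_eq_square sum_product)
    also have "\<dots> = (\<Sum>k<d. \<Sum>l<d. expectation (\<lambda>x. Y k x * Y l x))"
      by (rule integral_sum2) (rule YY)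
    \<comment> \<open>Two triangular sums cover the square; counting the diagonal twice does no harm
      for an upper bound.\<close>
    also have "\<dots> \<le> (\<Sum>k<d. \<Sum>l<d. (if k \<le> l then r' (l - k) else 0) + (if l \<le> k then r' (k - l) else 0))"
    proof (intro sum_mono)
      fix k l :: nat
      show "expectation (\<lambda>x. Y k x * Y l x) \<le> (if k \<le> l then r' (l - k) else 0) + (if l \<le> k then r' (k - l) else 0)"
      proof (cases "k \<le> l")
        case True
        then show ?thesis using c[of k "l - k"] r'0[of "k - l"] unfolding r'_def[symmetric] by auto
      next
        case False
        then show ?thesis using c[of l "k - l"] unfolding r'_def[symmetric] by (auto simp: mult.commute)
      qed
    qed
    also have "\<dots> = 2 * (\<Sum>k<d. \<Sum>l<d. if k \<le> l then r' (l - k) else 0)"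
      unfolding sum.distrib by (subst (2) sum.swap) simp
    also have "\<dots> \<le> 2 * (\<Sum>k<d. \<Sum>j<d. r' j)"
    proof (rule mult_left_mono[OF sum_mono])
      fix k assume "k \<in> {..<d}"
      have "(\<Sum>l<d. if k \<le> l then r' (l - k) else 0) = (\<Sum>l\<in>{k..<d}. r' (l - k))"
        by (rule sum.mono_neutral_cong_right) auto
      also have "\<dots> = (\<Sum>j<d-k. r' j)"
        by (rule sum.reindex_bij_witness[of _ "\<lambda>j. j + k" "\<lambda>l. l - k"]) auto
      also have "\<dots> \<le> (\<Sum>j<d. r' j)" using r'0 by (intro sum_mono2) auto
      finally show "(\<Sum>l<d. if k \<le> l then r' (l - k) else 0) \<le> (\<Sum>j<d. r' j)" .
    qed auto
    finally show ?thesis by (simp add: algebra_simps)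
  qed
  have eqY: "((\<Sum>k<d. (U k x)\<^sup>2) / real d - \<gamma> 0)\<^sup>2 = (\<Sum>k<d. Y k x)\<^sup>2 / (real d)\<^sup>2" if "d \<ge> 1" for d x
    using that unfolding Y_def sum_subtractf by (simp add: power2_eq_square field_simps)
  have Ysi: "integrable M (\<lambda>x. (\<Sum>k<d. Y k x)\<^sup>2)" for d
    unfolding power2_eq_square sum_product using YY by auto
  show "integrable M (\<lambda>x. ((\<Sum>k<d. (U k x)\<^sup>2) / real d - \<gamma> 0)\<^sup>2)"
    using Ysi[of d] eqY[of d] by (cases "d = 0") (auto simp: Suc_le_eq)
  have lim: "(\<lambda>d. 2 * ((\<Sum>j<d. r' j) / real d)) \<longlonglongrightarrow> 2 * 0"
    by (intro tendsto_intros cesaro_mean_tendsto r'lim)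
  show "(\<lambda>d. expectation (\<lambda>x. ((\<Sum>k<d. (U k x)\<^sup>2) / real d - \<gamma> 0)\<^sup>2)) \<longlonglongrightarrow> 0"
  proof (rule tendsto_sandwich[OF _ _ tendsto_const lim[unfolded mult_zero_right]])
    show "\<forall>\<^sub>F d in sequentially. expectation (\<lambda>x. ((\<Sum>k<d. (U k x)\<^sup>2) / real d - \<gamma> 0)\<^sup>2) \<le> 2 * ((\<Sum>j<d. r' j) / real d)"
    proof (rule eventually_sequentiallyI[of 1])
      fix d :: nat assume d: "1 \<le> d"
      have "expectation (\<lambda>x. ((\<Sum>k<d. (U k x)\<^sup>2) / real d - \<gamma> 0)\<^sup>2) = expectation (\<lambda>x. (\<Sum>k<d. Y k x)\<^sup>2) / (real d)\<^sup>2"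
        unfolding eqY[OF d] by simp
      also have "\<dots> \<le> 2 * real d * (\<Sum>j<d. r' j) / (real d)\<^sup>2" by (intro divide_right_mono bd) auto
      also have "\<dots> = 2 * ((\<Sum>j<d. r' j) / real d)" using d by (simp add: power2_eq_square)
      finally show "expectation (\<lambda>x. ((\<Sum>k<d. (U k x)\<^sup>2) / real d - \<gamma> 0)\<^sup>2) \<le> 2 * ((\<Sum>j<d. r' j) / real d)" .
    qed
  qed auto
qed

end

section \<open>Convergence in probability\<close>

text \<open>The probability space may vary with the index, as it does when the sample sizes grow.
  Only constant limits occur, so no common space is required.\<close>

definition tends_prob :: "('i \<Rightarrow> 'b measure) \<Rightarrow> ('i \<Rightarrow> 'b \<Rightarrow> real) \<Rightarrow> real \<Rightarrow> 'i filter \<Rightarrow> bool" where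
  "tends_prob N X x F \<longleftrightarrow> (\<forall>i. X i \<in> borel_measurable (N i)) \<and>
     (\<forall>e>0. ((\<lambda>i. measure (N i) {\<omega>\<in>space (N i). e \<le> \<bar>X i \<omega> - x\<bar>}) \<longlongrightarrow> 0) F)"

lemma tends_probD:
  assumes "tends_prob N X x F"
  shows "X i \<in> borel_measurable (N i)"
    and "e > 0 \<Longrightarrow> ((\<lambda>i. measure (N i) {\<omega>\<in>space (N i). e \<le> \<bar>X i \<omega> - x\<bar>}) \<longlongrightarrow> 0) F"
  using assms by (auto simp: tends_prob_def)

lemma tends_prob_bound:
  assumes "\<And>i. X i \<in> borel_measurable (N i)"
    and "\<And>e. e > 0 \<Longrightarrow> \<exists>g. (g \<longlongrightarrow> 0) F \<and>
      (\<forall>\<^sub>F i in F. measure (N i) {\<omega>\<in>space (N i). e \<le> \<bar>X i \<omega> - x\<bar>} \<le> g i)"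
  shows "tends_prob N X x F"
  unfolding tends_prob_def
proof (intro conjI allI impI assms(1))
  fix e :: real assume "e > 0"
  from assms(2)[OF this] obtain g where g: "(g \<longlongrightarrow> 0) F"
    "\<forall>\<^sub>F i in F. measure (N i) {\<omega>\<in>space (N i). e \<le> \<bar>X i \<omega> - x\<bar>} \<le> g i" by blast
  show "((\<lambda>i. measure (N i) {\<omega>\<in>space (N i). e \<le> \<bar>X i \<omega> - x\<bar>}) \<longlongrightarrow> 0) F"
    by (rule tendsto_sandwich[OF _ g(2) tendsto_const g(1)]) simp
qed

text \<open>Continuity is asked for at the limit point alone; quotients and roots may take their
  default values elsewhere.\<close>

lemma tends_prob_cont2:
  fixes f :: "real \<Rightarrow> real \<Rightarrow> real"
  assumes N: "\<And>i. prob_space (N i)" and X: "tends_prob N X x F" and Y: "tends_prob N Y y F"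
    and [measurable]: "case_prod f \<in> borel_measurable (borel \<Otimes>\<^sub>M borel)"
    and c: "isCont (case_prod f) (x, y)"
  shows "tends_prob N (\<lambda>i \<omega>. f (X i \<omega>) (Y i \<omega>)) (f x y) F"
proof (rule tends_prob_bound)
  note [measurable] = tends_probD(1)[OF X] tends_probD(1)[OF Y]
  fix i
  show "(\<lambda>\<omega>. f (X i \<omega>) (Y i \<omega>)) \<in> borel_measurable (N i)" by measurable
next
  note [measurable] = tends_probD(1)[OF X] tends_probD(1)[OF Y]
  fix e :: real assume "e > 0"
  then obtain d where d: "d > 0" and D: "\<And>z. dist z (x, y) < d \<Longrightarrow> dist (case_prod f z) (f x y) < e"
    using c unfolding continuous_at_eps_delta by auto
  define d' where "d' = d / 2"
  have d': "d' > 0" using d by (simp add: d'_def)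
  let ?A = "\<lambda>i. {\<omega>\<in>space (N i). d' \<le> \<bar>X i \<omega> - x\<bar>}" and ?B = "\<lambda>i. {\<omega>\<in>space (N i). d' \<le> \<bar>Y i \<omega> - y\<bar>}"
  have "measure (N i) {\<omega>\<in>space (N i). e \<le> \<bar>f (X i \<omega>) (Y i \<omega>) - f x y\<bar>} \<le> measure (N i) (?A i) + measure (N i) (?B i)" for i
  proof -
    interpret prob_space "N i" by (rule N)
    have sub: "{\<omega>\<in>space (N i). e \<le> \<bar>f (X i \<omega>) (Y i \<omega>) - f x y\<bar>} \<subseteq> ?A i \<union> ?B i"
    proof (rule subsetI, rule ccontr)
      fix \<omega> assume w: "\<omega> \<in> {\<omega>\<in>space (N i). e \<le> \<bar>f (X i \<omega>) (Y i \<omega>) - f x y\<bar>}" "\<omega> \<notin> ?A i \<union> ?B i"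
      have "dist (X i \<omega>, Y i \<omega>) (x, y) \<le> \<bar>X i \<omega> - x\<bar> + \<bar>Y i \<omega> - y\<bar>"
        unfolding dist_Pair_Pair dist_real_def by (rule sqrt_sum_squares_le_sum_abs[THEN order_trans]) simp
      also have "\<dots> < d" using w by (auto simp: d'_def)
      finally show False using D[of "(X i \<omega>, Y i \<omega>)"] w by (auto simp: dist_real_def)
    qed
    have "measure (N i) {\<omega>\<in>space (N i). e \<le> \<bar>f (X i \<omega>) (Y i \<omega>) - f x y\<bar>} \<le> measure (N i) (?A i \<union> ?B i)"
      by (rule finite_measure_mono[OF sub]) measurable
    also have "\<dots> \<le> measure (N i) (?A i) + measure (N i) (?B i)"
      by (rule measure_Un_le) measurable
    finally show ?thesis .
  qed
  moreover have "((\<lambda>i. measure (N i) (?A i) + measure (N i) (?B i)) \<longlongrightarrow> 0 + 0) F"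
    by (intro tendsto_add tends_probD(2)[OF X d'] tends_probD(2)[OF Y d'])
  ultimately show "\<exists>g. (g \<longlongrightarrow> 0) F \<and> (\<forall>\<^sub>F i in F. measure (N i) {\<omega>\<in>space (N i). e \<le> \<bar>f (X i \<omega>) (Y i \<omega>) - f x y\<bar>} \<le> g i)"
    by (intro exI[of _ "\<lambda>i. measure (N i) (?A i) + measure (N i) (?B i)"]) auto
qed

lemma tends_prob_cont:
  fixes f :: "real \<Rightarrow> real"
  assumes N: "\<And>i. prob_space (N i)" and X: "tends_prob N X x F"
    and [measurable]: "f \<in> borel_measurable borel" and c: "isCont f x"
  shows "tends_prob N (\<lambda>i \<omega>. f (X i \<omega>)) (f x) F"
proof (rule tends_prob_cont2[OF N X X, where f="\<lambda>x y. f x"])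
  have "isCont (\<lambda>z. f (fst z)) (x, x)"
    by (rule isCont_o2[OF continuous_fst[OF continuous_ident]]) (simp add: c)
  then show "isCont (case_prod (\<lambda>x y. f x)) (x, x)" by (simp add: case_prod_beta')
qed measurable

lemma tends_prob_add:
  assumes N: "\<And>i. prob_space (N i)" and X: "tends_prob N X x F" and Y: "tends_prob N Y y F"
  shows "tends_prob N (\<lambda>i \<omega>. X i \<omega> + Y i \<omega>) (x + y) F"
  by (rule tends_prob_cont2[OF N X Y]) (auto simp: case_prod_beta' intro!: continuous_intros)

lemma tends_prob_mult:
  assumes N: "\<And>i. prob_space (N i)" and X: "tends_prob N X x F" and Y: "tends_prob N Y y F"
  shows "tends_prob N (\<lambda>i \<omega>. X i \<omega> * Y i \<omega>) (x * y) F"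
  by (rule tends_prob_cont2[OF N X Y]) (auto simp: case_prod_beta' intro!: continuous_intros)

lemma tends_prob_const:
  assumes N: "\<And>i. prob_space (N i)" and a: "(a \<longlongrightarrow> x) F"
  shows "tends_prob N (\<lambda>i \<omega>. a i) x F"
  unfolding tends_prob_def
proof (intro conjI allI impI)
  fix e :: real assume "e > 0"
  then have "\<forall>\<^sub>F i in F. dist (a i) x < e" using a by (simp add: tendsto_iff)
  then have "\<forall>\<^sub>F i in F. measure (N i) {\<omega>\<in>space (N i). e \<le> \<bar>a i - x\<bar>} = 0"
    by (rule eventually_mono) (auto simp: dist_real_def)
  then show "((\<lambda>i. measure (N i) {\<omega>\<in>space (N i). e \<le> \<bar>a i - x\<bar>}) \<longlongrightarrow> 0) F"
    by (rule tendsto_eventually)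
qed simp

lemma tends_prob_sum:
  assumes N: "\<And>i. prob_space (N i)" and "finite J" and X: "\<And>j. j \<in> J \<Longrightarrow> tends_prob N (X j) (x j) F"
  shows "tends_prob N (\<lambda>i \<omega>. \<Sum>j\<in>J. X j i \<omega>) (\<Sum>j\<in>J. x j) F"
  using assms(2) X
proof (induction J)
  case empty
  then show ?case using tends_prob_const[of N "\<lambda>_. 0" 0 F, OF N] by simp
next
  case (insert j J)
  then show ?case using tends_prob_add[of N "X j" "x j" F "\<lambda>i \<omega>. \<Sum>j\<in>J. X j i \<omega>", OF N] by simp
qed

lemma tends_prob_L2:
  assumes N: "\<And>i. prob_space (N i)" and [measurable]: "\<And>i. X i \<in> borel_measurable (N i)"
    and i: "\<And>i. integrable (N i) (\<lambda>\<omega>. (X i \<omega> - x)\<^sup>2)"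
    and l: "((\<lambda>i. \<integral>\<omega>. (X i \<omega> - x)\<^sup>2 \<partial>N i) \<longlongrightarrow> 0) F"
  shows "tends_prob N X x F"
proof (rule tends_prob_bound)
  fix e :: real assume e: "e > 0"
  have "measure (N i) {\<omega>\<in>space (N i). e \<le> \<bar>X i \<omega> - x\<bar>} \<le> (\<integral>\<omega>. (X i \<omega> - x)\<^sup>2 \<partial>N i) / e\<^sup>2" for i
  proof -
    interpret prob_space "N i" by (rule N)
    have "{\<omega>\<in>space (N i). e \<le> \<bar>X i \<omega> - x\<bar>} = {\<omega>\<in>space (N i). e\<^sup>2 \<le> (X i \<omega> - x)\<^sup>2}"
      using e by (auto simp flip: abs_le_square_iff)
    also have "measure (N i) \<dots> \<le> (\<integral>\<omega>. (X i \<omega> - x)\<^sup>2 \<partial>N i) / e\<^sup>2"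
      by (rule integral_Markov_inequality_measure[where A="{}"]) (use e in \<open>auto intro: i\<close>)
    finally show ?thesis .
  qed
  moreover have "((\<lambda>i. (\<integral>\<omega>. (X i \<omega> - x)\<^sup>2 \<partial>N i) / e\<^sup>2) \<longlongrightarrow> 0 / e\<^sup>2) F"
    using e by (intro tendsto_intros l) auto
  ultimately show "\<exists>g. (g \<longlongrightarrow> 0) F \<and> (\<forall>\<^sub>F i in F. measure (N i) {\<omega>\<in>space (N i). e \<le> \<bar>X i \<omega> - x\<bar>} \<le> g i)"
    by (intro exI[of _ "\<lambda>i. (\<integral>\<omega>. (X i \<omega> - x)\<^sup>2 \<partial>N i) / e\<^sup>2"]) auto
qed simp

lemma tends_prob_L1:
  assumes N: "\<And>i. prob_space (N i)" and [measurable]: "\<And>i. X i \<in> borel_measurable (N i)"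
    and i: "\<And>i. integrable (N i) (\<lambda>\<omega>. \<bar>X i \<omega> - x\<bar>)"
    and l: "((\<lambda>i. \<integral>\<omega>. \<bar>X i \<omega> - x\<bar> \<partial>N i) \<longlongrightarrow> 0) F"
  shows "tends_prob N X x F"
proof (rule tends_prob_bound)
  fix e :: real assume e: "e > 0"
  have "measure (N i) {\<omega>\<in>space (N i). e \<le> \<bar>X i \<omega> - x\<bar>} \<le> (\<integral>\<omega>. \<bar>X i \<omega> - x\<bar> \<partial>N i) / e" for i
  proof -
    interpret prob_space "N i" by (rule N)
    show ?thesis
      by (rule integral_Markov_inequality_measure[where A="{}"]) (use e in \<open>auto intro: i\<close>)
  qed
  moreover have "((\<lambda>i. (\<integral>\<omega>. \<bar>X i \<omega> - x\<bar> \<partial>N i) / e) \<longlongrightarrow> 0 / e) F"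
    using e by (intro tendsto_intros l) auto
  ultimately show "\<exists>g. (g \<longlongrightarrow> 0) F \<and> (\<forall>\<^sub>F i in F. measure (N i) {\<omega>\<in>space (N i). e \<le> \<bar>X i \<omega> - x\<bar>} \<le> g i)"
    by (intro exI[of _ "\<lambda>i. (\<integral>\<omega>. \<bar>X i \<omega> - x\<bar> \<partial>N i) / e"]) auto
qed simp

text \<open>A second moment bound makes \<open>Y\<close> bounded in probability. This is how random
  weights are replaced by their limits in front of a quadratic form that itself does not converge in
  probability.\<close>

lemma tends_prob_mult_bounded:
  assumes N: "\<And>i. prob_space (N i)" and X: "tends_prob N X 0 F"
    and [measurable]: "\<And>i. Y i \<in> borel_measurable (N i)"
    and i: "\<And>i. integrable (N i) (\<lambda>\<omega>. (Y i \<omega>)\<^sup>2)"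
    and C: "\<And>i. (\<integral>\<omega>. (Y i \<omega>)\<^sup>2 \<partial>N i) \<le> C"
  shows "tends_prob N (\<lambda>i \<omega>. X i \<omega> * Y i \<omega>) 0 F"
proof -
  note [measurable] = tends_probD(1)[OF X]
  have C0: "C \<ge> 0" using order_trans[OF _ C[of undefined], of 0] by simp
  show ?thesis unfolding tends_prob_def
  proof (intro conjI allI impI)
    fix e :: real assume e: "e > 0"
    show "((\<lambda>i. measure (N i) {\<omega>\<in>space (N i). e \<le> \<bar>X i \<omega> * Y i \<omega> - 0\<bar>}) \<longlongrightarrow> 0) F"
      unfolding tendsto_iff
    proof (intro allI impI)
      fix q :: real assume q: "q > 0"
      \<comment> \<open>By Markov's inequality, |Y| exceeds this level with probability at most q /
        2. The summand 1 keeps \<open>k\<close> positive when C = 0.\<close>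
      define k where "k = sqrt (2 * (C + 1) / q)"
      have k: "k > 0" "k\<^sup>2 = 2 * (C + 1) / q" unfolding k_def using q C0 by auto
      have ek: "e / k > 0" using e k by simp
      have b: "measure (N i) {\<omega>\<in>space (N i). e \<le> \<bar>X i \<omega> * Y i \<omega> - 0\<bar>} \<le>
          measure (N i) {\<omega>\<in>space (N i). e / k \<le> \<bar>X i \<omega> - 0\<bar>} + q / 2" for i
      proof -
        interpret prob_space "N i" by (rule N)
        let ?A = "{\<omega>\<in>space (N i). e / k \<le> \<bar>X i \<omega> - 0\<bar>}" and ?B = "{\<omega>\<in>space (N i). k\<^sup>2 \<le> (Y i \<omega>)\<^sup>2}"
        have sub: "{\<omega>\<in>space (N i). e \<le> \<bar>X i \<omega> * Y i \<omega> - 0\<bar>} \<subseteq> ?A \<union> ?B"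
        proof (rule subsetI, rule ccontr)
          fix \<omega> assume w: "\<omega> \<in> {\<omega>\<in>space (N i). e \<le> \<bar>X i \<omega> * Y i \<omega> - 0\<bar>}" "\<omega> \<notin> ?A \<union> ?B"
          then have "\<bar>X i \<omega>\<bar> < e / k" "\<not> k\<^sup>2 \<le> (Y i \<omega>)\<^sup>2" by auto
          moreover have "\<bar>Y i \<omega>\<bar> < k"
          proof (rule ccontr)
            assume "\<not> \<bar>Y i \<omega>\<bar> < k"
            then have "k\<^sup>2 \<le> \<bar>Y i \<omega>\<bar>\<^sup>2" using k(1) by (intro power_mono) auto
            then show False using \<open>\<not> k\<^sup>2 \<le> (Y i \<omega>)\<^sup>2\<close> by simp
          qed
          ultimately have "\<bar>X i \<omega>\<bar> < e / k" "\<bar>Y i \<omega>\<bar> < k" by auto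
          then have "\<bar>X i \<omega>\<bar> * \<bar>Y i \<omega>\<bar> < (e / k) * k" using k by (intro mult_strict_mono) auto
          then show False using w k by (simp add: abs_mult)
        qed
        have "measure (N i) ?B \<le> (\<integral>\<omega>. (Y i \<omega>)\<^sup>2 \<partial>N i) / k\<^sup>2"
          by (rule integral_Markov_inequality_measure[where A="{}"]) (use zero_less_power[OF k(1), of 2] in \<open>auto intro: i\<close>)
        also have "\<dots> \<le> (C + 1) / k\<^sup>2" using C[of i] by (intro divide_right_mono) auto
        also have "\<dots> = q / 2" using k q C0 by (simp add: field_simps)
        finally have B: "measure (N i) ?B \<le> q / 2" .
        have "measure (N i) {\<omega>\<in>space (N i). e \<le> \<bar>X i \<omega> * Y i \<omega> - 0\<bar>} \<le> measure (N i) (?A \<union> ?B)"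
          by (rule finite_measure_mono[OF sub]) measurable
        also have "\<dots> \<le> measure (N i) ?A + measure (N i) ?B"
          by (rule measure_Un_le) measurable
        finally show ?thesis using B by linarith
      qed
      have "\<forall>\<^sub>F i in F. dist (measure (N i) {\<omega>\<in>space (N i). e / k \<le> \<bar>X i \<omega> - 0\<bar>}) 0 < q / 2"
        using tends_probD(2)[OF X ek] half_gt_zero[OF q] unfolding tendsto_iff by blast
      then show "\<forall>\<^sub>F i in F. dist (measure (N i) {\<omega>\<in>space (N i). e \<le> \<bar>X i \<omega> * Y i \<omega> - 0\<bar>}) 0 < q"
      proof (rule eventually_mono)
        fix i assume "dist (measure (N i) {\<omega>\<in>space (N i). e / k \<le> \<bar>X i \<omega> - 0\<bar>}) 0 < q / 2"
        then show "dist (measure (N i) {\<omega>\<in>space (N i). e \<le> \<bar>X i \<omega> * Y i \<omega> - 0\<bar>}) 0 < q"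
          using b[of i] unfolding dist_real_def by (simp only: diff_0_right abs_of_nonneg measure_nonneg)
      qed
    qed
  qed measurable
qed

lemma tends_prob_expectation:
  assumes N: "\<And>i. prob_space (N i)" and Z: "tends_prob N Z z F" and K: "\<And>i \<omega>. \<bar>Z i \<omega>\<bar> \<le> K"
  shows "((\<lambda>i. \<integral>\<omega>. Z i \<omega> \<partial>N i) \<longlongrightarrow> z) F"
  unfolding tendsto_iff
proof (intro allI impI)
  note [measurable] = tends_probD(1)[OF Z]
  fix q :: real assume q: "q > 0"
  define L where "L = K + \<bar>z\<bar> + 1"
  have L: "L > 0" unfolding L_def using K[of undefined undefined] by linarith
  have "\<forall>\<^sub>F i in F. dist (measure (N i) {\<omega>\<in>space (N i). q / 2 \<le> \<bar>Z i \<omega> - z\<bar>}) 0 < q / (2 * L)"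
    using tends_probD(2)[OF Z, of "q / 2"] q L unfolding tendsto_iff by auto
  then show "\<forall>\<^sub>F i in F. dist (\<integral>\<omega>. Z i \<omega> \<partial>N i) z < q"
  proof (rule eventually_mono)
    fix i
    interpret prob_space "N i" by (rule N)
    let ?A = "{\<omega>\<in>space (N i). q / 2 \<le> \<bar>Z i \<omega> - z\<bar>}"
    assume "dist (measure (N i) ?A) 0 < q / (2 * L)"
    then have A: "L * measure (N i) ?A < q / 2" using L by (simp add: field_simps)
    have Am[measurable]: "?A \<in> sets (N i)" by measurable
    have iA: "integrable (N i) (\<lambda>\<omega>. q / 2 + L * indicator ?A \<omega>)"
      by (intro Bochner_Integration.integrable_add integrable_mult_right integrable_real_indicator) (use Am in \<open>simp_all add: less_top[symmetric]\<close>)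
    have iZ: "integrable (N i) (Z i)" using K by (intro integrable_bounded[where K=K]) auto
    have "\<bar>expectation (Z i) - z\<bar> = \<bar>expectation (\<lambda>\<omega>. Z i \<omega> - z)\<bar>" using iZ by (simp add: prob_space)
    also have "\<dots> \<le> expectation (\<lambda>\<omega>. \<bar>Z i \<omega> - z\<bar>)" using integral_abs_bound[of "N i" "\<lambda>\<omega>. Z i \<omega> - z"] by simp
    also have "\<dots> \<le> expectation (\<lambda>\<omega>. q / 2 + L * indicator ?A \<omega>)"
    proof (rule integral_mono)
      fix \<omega> assume "\<omega> \<in> space (N i)"
      then show "\<bar>Z i \<omega> - z\<bar> \<le> q / 2 + L * indicator ?A \<omega>"
        using K[of i \<omega>] q unfolding L_def by (auto simp: indicator_def)
    qed (use iZ iA in simp_all)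
    also have "\<dots> = q / 2 + L * measure (N i) ?A"
      by (subst Bochner_Integration.integral_add) (use Am in \<open>simp_all add: prob_space less_top[symmetric]\<close>)
    finally have "\<bar>expectation (Z i) - z\<bar> \<le> q / 2 + L * measure (N i) ?A" .
    then show "dist (expectation (Z i)) z < q" using A unfolding dist_real_def by linarith
  qed
qed

section \<open>The standard normal distribution and Slutsky's argument\<close>

definition Phi :: "real \<Rightarrow> real" where "Phi = cdf std_normal_distribution"

lemma std_normal_point: "measure std_normal_distribution {x} = 0"
proof -
  have "emeasure std_normal_distribution {x} = (\<integral>\<^sup>+y. ennreal (std_normal_density y) * indicator {x} y \<partial>lborel)"
    by (rule emeasure_density) auto
  also have "\<dots> = 0"
    by (subst nn_integral_0_iff_AE) (auto intro!: AE_I[where N="{x}"] simp: indicator_def)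
  finally show ?thesis by (simp add: measure_def)
qed

lemma isCont_Phi: "isCont Phi x"
  unfolding Phi_def using finite_borel_measure.isCont_cdf[of std_normal_distribution] std_normal_point
    real_distribution.finite_borel_measure_M[OF real_dist_normal_dist] by simp

lemma Phi_measurable[measurable]: "Phi \<in> borel_measurable borel"
  by (rule borel_measurable_continuous_onI) (simp add: continuous_on_eq_continuous_at isCont_Phi)

lemma Phi_bounds: "0 \<le> Phi x" "Phi x \<le> 1"
  unfolding Phi_def cdf_def
  using prob_space.prob_le_1[OF real_distribution.axioms(1)[OF real_dist_normal_dist]] by simp_all

lemma Phi_strict_mono:
  assumes "x < y"
  shows "Phi x < Phi y"
proof -
  interpret R: real_distribution std_normal_distribution by (rule real_dist_normal_dist)
  have "emeasure std_normal_distribution {x<..y} \<noteq> 0"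
  proof
    assume "emeasure std_normal_distribution {x<..y} = 0"
    then have "(\<integral>\<^sup>+z. ennreal (std_normal_density z) * indicator {x<..y} z \<partial>lborel) = 0"
      by (subst (asm) emeasure_density) auto
    then have "AE z in lborel. ennreal (std_normal_density z) * indicator {x<..y} z = 0"
      by (subst (asm) nn_integral_0_iff_AE) auto
    then have "AE z in lborel. z \<notin> {x<..y}"
      by (rule AE_mp) (auto intro!: AE_I2 simp: indicator_def normal_density_pos[THEN less_imp_neq, symmetric] split: if_splits)
    then have "{x<..y} \<in> null_sets lborel" by (subst (asm) AE_iff_null_sets[symmetric]) auto
    then show False using assms by (simp add: null_sets_def)
  qed
  then have "measure std_normal_distribution {x<..y} > 0"
    by (simp add: R.emeasure_eq_measure zero_less_measure_iff)
  then show ?thesis unfolding Phi_def using R.cdf_diff_eq[OF assms] by simp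
qed

lemma std_normal_limit:
  fixes N :: "nat \<Rightarrow> 'b measure"
  assumes N: "\<And>d. prob_space (N d)" and [measurable]: "\<And>d. X d \<in> borel_measurable (N d)"
    and c: "\<And>t. (\<lambda>d. char (distr (N d) borel (X d)) t) \<longlonglongrightarrow> complex_of_real (exp (- (t\<^sup>2 / 2)))"
  shows "(\<lambda>d. measure (N d) {\<omega>\<in>space (N d). X d \<omega> \<le> x}) \<longlonglongrightarrow> Phi x"
proof -
  have "weak_conv_m (\<lambda>d. distr (N d) borel (X d)) std_normal_distribution"
  proof (rule levy_continuity[OF _ real_dist_normal_dist])
    fix d
    interpret prob_space "N d" by (rule N)
    show "real_distribution (distr (N d) borel (X d))" by (rule real_distribution_distr) simp
  next
    fix t show "(\<lambda>d. char (distr (N d) borel (X d)) t) \<longlonglongrightarrow> char std_normal_distribution t"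
      using c[of t] by (simp add: char_std_normal_distribution)
  qed
  then have "(\<lambda>d. cdf (distr (N d) borel (X d)) x) \<longlonglongrightarrow> Phi x"
    using isCont_Phi unfolding weak_conv_m_def weak_conv_def Phi_def by blast
  moreover have "cdf (distr (N d) borel (X d)) x = measure (N d) {\<omega>\<in>space (N d). X d \<omega> \<le> x}" for d
    unfolding cdf_def by (subst measure_distr) (auto intro!: arg_cong[where f="measure (N d)"])
  ultimately show ?thesis by simp
qed

text \<open>Continuity of \<open>Phi\<close> allows the threshold to be moved by a small h in both
  directions, which absorbs the event that the approximation fails.\<close>

lemma slutsky_upper_tail:
  assumes N: "\<And>d. prob_space (N d)" and [measurable]: "\<And>d. X d \<in> borel_measurable (N d)"
    and [measurable]: "\<And>d. Y d \<in> borel_measurable (N d)"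
    and lim: "\<And>x. (\<lambda>d. measure (N d) {\<omega>\<in>space (N d). X d \<omega> \<le> x}) \<longlonglongrightarrow> Phi x"
    and diff: "tends_prob N (\<lambda>d \<omega>. Y d \<omega> - (b + s * X d \<omega>)) 0 sequentially" and s: "s > 0"
  shows "(\<lambda>d. measure (N d) {\<omega>\<in>space (N d). Y d \<omega> > z}) \<longlonglongrightarrow> 1 - Phi ((z - b) / s)"
proof -
  define x0 where "x0 = (z - b) / s"
  have "(\<lambda>d. measure (N d) {\<omega>\<in>space (N d). Y d \<omega> \<le> z}) \<longlonglongrightarrow> Phi x0"
    unfolding tendsto_iff
  proof (intro allI impI)
    fix q :: real assume q: "q > 0"
    from isCont_Phi[of x0] obtain \<delta> where \<delta>: "\<delta> > 0" "\<And>y. \<bar>y - x0\<bar> < \<delta> \<Longrightarrow> \<bar>Phi y - Phi x0\<bar> < q / 3"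
      unfolding continuous_at_eps_delta dist_real_def using q by (metis zero_less_divide_iff zero_less_numeral)
    define h where "h = \<delta> / 2"
    have h: "h > 0" "\<bar>Phi (x0 + h) - Phi x0\<bar> < q / 3" "\<bar>Phi (x0 - h) - Phi x0\<bar> < q / 3"
      using \<delta> by (auto simp: h_def)
    have sh: "s * h > 0" using s h by simp
    let ?E = "\<lambda>d. {\<omega>\<in>space (N d). s * h \<le> \<bar>Y d \<omega> - (b + s * X d \<omega>) - 0\<bar>}"
    have e1: "\<forall>\<^sub>F d in sequentially. dist (measure (N d) (?E d)) 0 < q / 3"
      using tends_probD(2)[OF diff sh] divide_pos_pos[OF q zero_less_numeral] unfolding tendsto_iff by blast
    have e2: "\<forall>\<^sub>F d in sequentially. dist (measure (N d) {\<omega>\<in>space (N d). X d \<omega> \<le> x0 + h}) (Phi (x0 + h)) < q / 3"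
      using lim[of "x0 + h"] divide_pos_pos[OF q zero_less_numeral] unfolding tendsto_iff by blast
    have e3: "\<forall>\<^sub>F d in sequentially. dist (measure (N d) {\<omega>\<in>space (N d). X d \<omega> \<le> x0 - h}) (Phi (x0 - h)) < q / 3"
      using lim[of "x0 - h"] divide_pos_pos[OF q zero_less_numeral] unfolding tendsto_iff by blast
    show "\<forall>\<^sub>F d in sequentially. dist (measure (N d) {\<omega>\<in>space (N d). Y d \<omega> \<le> z}) (Phi x0) < q"
      using e1 e2 e3
    proof eventually_elim
      case (elim d)
      interpret prob_space "N d" by (rule N)
      have ez: "z = b + s * x0" using s by (simp add: x0_def)
      have "measure (N d) {\<omega>\<in>space (N d). Y d \<omega> \<le> z} \<le> measure (N d) ({\<omega>\<in>space (N d). X d \<omega> \<le> x0 + h} \<union> ?E d)"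
      proof (rule finite_measure_mono)
        show "{\<omega>\<in>space (N d). Y d \<omega> \<le> z} \<subseteq> {\<omega>\<in>space (N d). X d \<omega> \<le> x0 + h} \<union> ?E d"
        proof (rule subsetI, rule ccontr)
          fix \<omega> assume w: "\<omega> \<in> {\<omega>\<in>space (N d). Y d \<omega> \<le> z}" "\<omega> \<notin> {\<omega>\<in>space (N d). X d \<omega> \<le> x0 + h} \<union> ?E d"
          then have "s * (x0 + h) < s * X d \<omega>" using s by auto
          with w show False unfolding ez by (auto simp: distrib_left abs_le_iff not_le)
        qed
      qed measurable
      also have "\<dots> \<le> measure (N d) {\<omega>\<in>space (N d). X d \<omega> \<le> x0 + h} + measure (N d) (?E d)"
        by (rule measure_Un_le) measurable
      finally have u: "measure (N d) {\<omega>\<in>space (N d). Y d \<omega> \<le> z} \<le> \<dots>" .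
      have "measure (N d) {\<omega>\<in>space (N d). X d \<omega> \<le> x0 - h} \<le> measure (N d) ({\<omega>\<in>space (N d). Y d \<omega> \<le> z} \<union> ?E d)"
      proof (rule finite_measure_mono)
        show "{\<omega>\<in>space (N d). X d \<omega> \<le> x0 - h} \<subseteq> {\<omega>\<in>space (N d). Y d \<omega> \<le> z} \<union> ?E d"
        proof (rule subsetI, rule ccontr)
          fix \<omega> assume w: "\<omega> \<in> {\<omega>\<in>space (N d). X d \<omega> \<le> x0 - h}" "\<omega> \<notin> {\<omega>\<in>space (N d). Y d \<omega> \<le> z} \<union> ?E d"
          then have "s * X d \<omega> \<le> s * (x0 - h)" using s by auto
          with w show False unfolding ez by (auto simp: right_diff_distrib abs_le_iff not_le)
        qed
      qed measurable
      also have "\<dots> \<le> measure (N d) {\<omega>\<in>space (N d). Y d \<omega> \<le> z} + measure (N d) (?E d)"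
        by (rule measure_Un_le) measurable
      finally have l: "measure (N d) {\<omega>\<in>space (N d). X d \<omega> \<le> x0 - h} \<le> \<dots>" .
      show ?case using u l elim h unfolding dist_real_def by linarith
    qed
  qed
  then have "(\<lambda>d. 1 - measure (N d) {\<omega>\<in>space (N d). Y d \<omega> \<le> z}) \<longlonglongrightarrow> 1 - Phi x0"
    by (intro tendsto_intros)
  moreover have "1 - measure (N d) {\<omega>\<in>space (N d). Y d \<omega> \<le> z} = measure (N d) {\<omega>\<in>space (N d). Y d \<omega> > z}" for d
  proof -
    interpret prob_space "N d" by (rule N)
    have "{\<omega>\<in>space (N d). Y d \<omega> > z} = space (N d) - {\<omega>\<in>space (N d). Y d \<omega> \<le> z}" by auto
    then show ?thesis using prob_compl[of "{\<omega>\<in>space (N d). Y d \<omega> \<le> z}"] by simp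
  qed
  ultimately show ?thesis unfolding x0_def by simp
qed

section \<open>The limit in the dimension for fixed scales\<close>

context rho_sequence
begin

lemma coord_integral:
  fixes f :: "'a \<Rightarrow> real"
  assumes "finite I" "a \<in> I" "integrable M f"
  shows "integrable (Pr I) (\<lambda>\<omega>. f (\<omega> a))" "(\<integral>\<omega>. f (\<omega> a) \<partial>Pr I) = expectation f"
  using coord_prod[of I "{a}" "\<lambda>_. f"] assms by auto

text \<open>The second moment of the linear form is the quadratic form of the shift in the
  covariance matrix, divided by \<open>d\<close>, so the hypothesis is convergence in mean
  square.\<close>

lemma lin_small:
  assumes fin: "finite I" and a: "a \<in> I"
    and lim: "(\<lambda>d. (\<Sum>k<d. \<Sum>l<d. \<delta> d k * \<delta> d l * expectation (\<lambda>x. U k x * U l x)) / real d) \<longlonglongrightarrow> 0"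
  shows "tends_prob (\<lambda>_. Pr I) (\<lambda>d \<omega>. (\<Sum>k<d. \<delta> d k * U k (\<omega> a)) / sqrt (real d)) 0 sequentially"
proof (rule tends_prob_L2)
  define f where "f d x = ((\<Sum>k<d. \<delta> d k * U k x) / sqrt (real d) - 0)\<^sup>2" for d x
  have f: "f d x = (\<Sum>k<d. \<Sum>l<d. \<delta> d k * \<delta> d l * (U k x * U l x)) / real d" for d x
    unfolding f_def power_divide power2_eq_square[of "\<Sum>k<d. \<delta> d k * U k x"] sum_product
    by (simp add: power_divide) (simp add: power2_eq_square sum_product mult_ac)
  have i: "integrable M (f d)" for d unfolding f using UU_int by auto
  have e: "expectation (f d) = (\<Sum>k<d. \<Sum>l<d. \<delta> d k * \<delta> d l * expectation (\<lambda>x. U k x * U l x)) / real d" for d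
    unfolding f by (simp add: UU_int integral_sum2)
  show "integrable (Pr I) (\<lambda>\<omega>. ((\<Sum>k<d. \<delta> d k * U k (\<omega> a)) / sqrt (real d) - 0)\<^sup>2)" for d
    using coord_integral(1)[OF fin a i] unfolding f_def .
  show "(\<lambda>d. \<integral>\<omega>. ((\<Sum>k<d. \<delta> d k * U k (\<omega> a)) / sqrt (real d) - 0)\<^sup>2 \<partial>Pr I) \<longlonglongrightarrow> 0"
    using coord_integral(2)[OF fin a i] lim unfolding f_def[symmetric] by (simp add: e)
qed (use a prob_space_Pr in auto)

lemma square_mean_tends_prob:
  assumes fin: "finite I" and a: "a \<in> I"
  shows "tends_prob (\<lambda>_. Pr I) (\<lambda>d \<omega>. (\<Sum>k<d. (U k (\<omega> a))\<^sup>2) / real d) (\<gamma> 0) sequentially"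
proof (rule tends_prob_L2)
  define f where "f d x = ((\<Sum>k<d. (U k x)\<^sup>2) / real d - \<gamma> 0)\<^sup>2" for d x
  have i: "integrable M (f d)" for d unfolding f_def by (rule U_sq_lln_int)
  show "integrable (Pr I) (\<lambda>\<omega>. ((\<Sum>k<d. (U k (\<omega> a))\<^sup>2) / real d - \<gamma> 0)\<^sup>2)" for d
    using coord_integral(1)[OF fin a i] unfolding f_def .
  show "(\<lambda>d. \<integral>\<omega>. ((\<Sum>k<d. (U k (\<omega> a))\<^sup>2) / real d - \<gamma> 0)\<^sup>2 \<partial>Pr I) \<longlonglongrightarrow> 0"
    using coord_integral(2)[OF fin a i] U_sq_lln unfolding f_def[symmetric] by simp
qed (use a prob_space_Pr in auto)

definition quad_mean :: "'i set \<Rightarrow> ('i \<Rightarrow> 'i \<Rightarrow> real) \<Rightarrow> nat \<Rightarrow> ('i \<Rightarrow> 'a) \<Rightarrow> real" where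
  "quad_mean I T d \<omega> = (\<Sum>k<d. quad I T k \<omega>) / sqrt (real d)"

lemma quad_mean_meas[measurable]: "quad_mean I T d \<in> borel_measurable (Pr I)"
  unfolding quad_mean_def by measurable

lemma quad_mean_sq:
  assumes "finite I" "sym0 I T"
  shows "integrable (Pr I) (\<lambda>\<omega>. (quad_mean I T d \<omega>)\<^sup>2)"
    "(\<integral>\<omega>. (quad_mean I T d \<omega>)\<^sup>2 \<partial>Pr I) \<le> 2 * (\<Sum>a\<in>I. \<Sum>b\<in>I. (T a b)\<^sup>2) * \<tau>"
proof -
  have e: "(quad_mean I T d \<omega>)\<^sup>2 = (\<Sum>k<d. quad I T k \<omega>)\<^sup>2 / real d" for \<omega>
    unfolding quad_mean_def by (simp add: power_divide)
  show "integrable (Pr I) (\<lambda>\<omega>. (quad_mean I T d \<omega>)\<^sup>2)" unfolding e using quad_clt(3)[OF assms] by simp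
  have nn: "0 \<le> 2 * (\<Sum>a\<in>I. \<Sum>b\<in>I. (T a b)\<^sup>2) * \<tau>" using \<tau>_pos by (intro mult_nonneg_nonneg sum_nonneg) auto
  show "(\<integral>\<omega>. (quad_mean I T d \<omega>)\<^sup>2 \<partial>Pr I) \<le> 2 * (\<Sum>a\<in>I. \<Sum>b\<in>I. (T a b)\<^sup>2) * \<tau>"
    unfolding e using quad_clt(2)[OF assms, of d] nn by (cases "d = 0") (auto simp: divide_le_eq)
qed

lemma quad_mean_small:
  assumes "finite I" "sym0 I T" and "a \<longlonglongrightarrow> (0::real)"
  shows "tends_prob (\<lambda>_. Pr I) (\<lambda>d \<omega>. a d * quad_mean I T d \<omega>) 0 sequentially"
  by (rule tends_prob_mult_bounded[OF prob_space_Pr tends_prob_const[OF prob_space_Pr assms(3)]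
        quad_mean_meas quad_mean_sq[OF assms(1,2)]])

text \<open>The inner product of two differences of sample points: the shift is common to both, and
  \<open>s\<close> and \<open>t\<close> tell which copies enter each difference with which scale and
  sign.\<close>

definition shifted_form :: "'i set \<Rightarrow> (nat \<Rightarrow> nat \<Rightarrow> real) \<Rightarrow> ('i \<Rightarrow> real) \<Rightarrow> ('i \<Rightarrow> real) \<Rightarrow> nat \<Rightarrow> ('i \<Rightarrow> 'a) \<Rightarrow> real" where
  "shifted_form I \<delta> s t d \<omega> =
     (\<Sum>k<d. (\<delta> d k + (\<Sum>a\<in>I. s a * U k (\<omega> a))) * (\<delta> d k + (\<Sum>a\<in>I. t a * U k (\<omega> a))))"

lemma shifted_form_meas[measurable]: "shifted_form I \<delta> s t d \<in> borel_measurable (Pr I)"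
  unfolding shifted_form_def by measurable

text \<open>The bilinear part is symmetrized so that it becomes a form with a symmetric matrix; its
  diagonal vanishes as soon as \<open>s\<close> and \<open>t\<close> have disjoint supports.\<close>

lemma shifted_form_eq:
  assumes "finite I"
  shows "shifted_form I \<delta> s t d \<omega> = (\<Sum>k<d. (\<delta> d k)\<^sup>2) + (\<Sum>a\<in>I. (s a + t a) * (\<Sum>k<d. \<delta> d k * U k (\<omega> a))) +
     (\<Sum>k<d. quad I (\<lambda>a b. (s a * t b + s b * t a) / 2) k \<omega>)"
proof -
  have q: "(\<Sum>a\<in>I. s a * U k (\<omega> a)) * (\<Sum>a\<in>I. t a * U k (\<omega> a)) = quad I (\<lambda>a b. (s a * t b + s b * t a) / 2) k \<omega>" for k
  proof -
    have 1: "(\<Sum>a\<in>I. s a * U k (\<omega> a)) * (\<Sum>a\<in>I. t a * U k (\<omega> a)) = (\<Sum>a\<in>I. \<Sum>b\<in>I. s a * t b * (U k (\<omega> a) * U k (\<omega> b)))"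
      by (simp add: sum_product mult_ac)
    have 2: "\<dots> = (\<Sum>a\<in>I. \<Sum>b\<in>I. s b * t a * (U k (\<omega> a) * U k (\<omega> b)))"
      by (subst sum.swap) (simp add: mult_ac)
    have "quad I (\<lambda>a b. (s a * t b + s b * t a) / 2) k \<omega> =
      ((\<Sum>a\<in>I. \<Sum>b\<in>I. s a * t b * (U k (\<omega> a) * U k (\<omega> b))) + (\<Sum>a\<in>I. \<Sum>b\<in>I. s b * t a * (U k (\<omega> a) * U k (\<omega> b)))) / 2"
      unfolding quad_def by (simp add: sum.distrib[symmetric] sum_divide_distrib algebra_simps)
    then show ?thesis using 1 2 by simp
  qed
  have l: "(\<Sum>a\<in>I. c a * (\<Sum>k<d. \<delta> d k * U k (\<omega> a))) = (\<Sum>k<d. \<delta> d k * (\<Sum>a\<in>I. c a * U k (\<omega> a)))" for c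
    unfolding sum_distrib_left by (subst sum.swap) (simp add: mult_ac)
  show ?thesis
    unfolding shifted_form_def distrib_right distrib_left q sum.distrib l
    by (simp add: power2_eq_square mult_ac)
qed

text \<open>The weights may be random, but they only enter through their limits in probability.\<close>

theorem weighted_forms_upper_tail:
  fixes s t :: "'h \<Rightarrow> 'i \<Rightarrow> real"
  assumes fin: "finite I" and H: "finite H"
    and diag: "\<And>h a. h \<in> H \<Longrightarrow> a \<in> I \<Longrightarrow> s h a * t h a = 0"
    and shift: "(\<lambda>d. (\<Sum>k<d. (\<delta> d k)\<^sup>2) / sqrt (real d)) \<longlonglongrightarrow> L"
    and cross: "(\<lambda>d. (\<Sum>k<d. \<Sum>l<d. \<delta> d k * \<delta> d l * expectation (\<lambda>x. U k x * U l x)) / real d) \<longlonglongrightarrow> 0"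
    and w: "\<And>h. h \<in> H \<Longrightarrow> tends_prob (\<lambda>_. Pr I) (w h) (w0 h) sequentially"
    and scale: "\<kappa> \<longlonglongrightarrow> \<kappa>0" "\<kappa>0 > 0"
    and T_def: "\<And>a b. T a b = (\<Sum>h\<in>H. w0 h * ((s h a * t h b + s h b * t h a) / 2))"
    and v_def: "v = 2 * (\<Sum>a\<in>I. \<Sum>b\<in>I. (T a b)\<^sup>2) * \<tau>" and v: "v > 0"
  shows "(\<lambda>d. measure (Pr I) {\<omega>\<in>space (Pr I).
      \<kappa> d * (\<Sum>h\<in>H. w h d \<omega> * (shifted_form I \<delta> (s h) (t h) d \<omega> / sqrt (real d))) > z})
    \<longlonglongrightarrow> 1 - Phi ((z - \<kappa>0 * (L * (\<Sum>h\<in>H. w0 h))) / (\<kappa>0 * sqrt v))"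
proof (rule slutsky_upper_tail[where X="\<lambda>d \<omega>. quad_mean I T d \<omega> / sqrt v"])
  define Th where "Th h a b = (s h a * t h b + s h b * t h a) / 2" for h a b
  have Th: "sym0 I (Th h)" if "h \<in> H" for h
    unfolding sym0_def Th_def using diag[OF that] by (auto simp: mult.commute)
  have T: "sym0 I T"
    unfolding sym0_def T_def using diag by (auto simp: mult.commute add.commute intro!: sum.neutral)
  define ell where "ell a d \<omega> = (\<Sum>k<d. \<delta> d k * U k (\<omega> a)) / sqrt (real d)" for a d and \<omega> :: "'i \<Rightarrow> 'a"
  define \<Delta> where "\<Delta> d = (\<Sum>k<d. (\<delta> d k)\<^sup>2) / sqrt (real d)" for d
  \<comment> \<open>Everything in the normalized form except its quadratic part. It tends to the
    constant \<open>L\<close> for every \<open>h\<close>, so all fluctuations come from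
    \<open>quad_mean\<close>.\<close>
  define R where "R h d \<omega> = \<Delta> d + (\<Sum>a\<in>I. (s h a + t h a) * ell a d \<omega>)" for h d \<omega>
  note P = prob_space_Pr
  note wm[measurable] = tends_probD(1)[OF w]
  show mY: "(\<lambda>\<omega>. \<kappa> d * (\<Sum>h\<in>H. w h d \<omega> * (shifted_form I \<delta> (s h) (t h) d \<omega> / sqrt (real d)))) \<in> borel_measurable (Pr I)" for d
    by (intro borel_measurable_times borel_measurable_sum borel_measurable_divide wm) auto
  have ell: "tends_prob (\<lambda>_. Pr I) (ell a) 0 sequentially" if "a \<in> I" for a
    unfolding ell_def by (rule lin_small[OF fin that cross])
  have R: "tends_prob (\<lambda>_. Pr I) (R h) L sequentially" for h
  proof -
    have "tends_prob (\<lambda>_. Pr I) (\<lambda>d \<omega>. \<Delta> d + (\<Sum>a\<in>I. (s h a + t h a) * ell a d \<omega>)) (L + (\<Sum>a\<in>I. (s h a + t h a) * 0)) sequentially"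
      by (intro tends_prob_add tends_prob_sum tends_prob_mult tends_prob_const tendsto_const ell P fin)
         (use shift in \<open>auto simp: \<Delta>_def\<close>)
    then show ?thesis unfolding R_def by simp
  qed
  have form: "shifted_form I \<delta> (s h) (t h) d \<omega> / sqrt (real d) = R h d \<omega> + quad_mean I (Th h) d \<omega>" for h d \<omega>
  proof -
    have e: "(\<Sum>a\<in>I. (s h a + t h a) * f a) / b = (\<Sum>a\<in>I. (s h a + t h a) * (f a / b))" for f and b :: real
      by (simp add: sum_divide_distrib)
    show ?thesis
      unfolding shifted_form_eq[OF fin] R_def ell_def \<Delta>_def quad_mean_def Th_def add_divide_distrib e ..
  qed
  have quadT: "quad_mean I T d \<omega> = (\<Sum>h\<in>H. w0 h * quad_mean I (Th h) d \<omega>)" for d \<omega>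
  proof -
    have "quad I T k \<omega> = (\<Sum>h\<in>H. w0 h * quad I (Th h) k \<omega>)" for k
    proof -
      have "quad I T k \<omega> = (\<Sum>a\<in>I. \<Sum>b\<in>I. \<Sum>h\<in>H. w0 h * (Th h a b * (U k (\<omega> a) * U k (\<omega> b))))"
        unfolding quad_def T_def Th_def[symmetric] sum_distrib_right by (simp add: mult_ac)
      also have "\<dots> = (\<Sum>a\<in>I. \<Sum>h\<in>H. \<Sum>b\<in>I. w0 h * (Th h a b * (U k (\<omega> a) * U k (\<omega> b))))"
        by (intro sum.cong refl sum.swap)
      also have "\<dots> = (\<Sum>h\<in>H. \<Sum>a\<in>I. \<Sum>b\<in>I. w0 h * (Th h a b * (U k (\<omega> a) * U k (\<omega> b))))"
        by (rule sum.swap)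
      finally show ?thesis unfolding quad_def sum_distrib_left .
    qed
    then have "quad_mean I T d \<omega> = (\<Sum>k<d. \<Sum>h\<in>H. w0 h * quad I (Th h) k \<omega>) / sqrt (real d)"
      unfolding quad_mean_def by simp
    also have "\<dots> = (\<Sum>h\<in>H. w0 h * quad_mean I (Th h) d \<omega>)"
      unfolding quad_mean_def by (subst sum.swap) (simp add: sum_divide_distrib sum_distrib_left)
    finally show ?thesis .
  qed
  have sw: "tends_prob (\<lambda>_. Pr I) (\<lambda>d \<omega>. \<Sum>h\<in>H. w h d \<omega> * R h d \<omega>) (\<Sum>h\<in>H. w0 h * L) sequentially"
    by (intro tends_prob_sum tends_prob_mult w R P H)
  \<comment> \<open>The quadratic part is bounded in mean square, hence the random weight may be
    exchanged for its limit.\<close>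
  have qm: "tends_prob (\<lambda>_. Pr I) (\<lambda>d \<omega>. (w h d \<omega> + - w0 h) * quad_mean I (Th h) d \<omega>) 0 sequentially" if h: "h \<in> H" for h
  proof (rule tends_prob_mult_bounded[OF P _ quad_mean_meas quad_mean_sq[OF fin Th[OF h]]])
    have "tends_prob (\<lambda>_. Pr I) (\<lambda>d \<omega>. w h d \<omega> + - w0 h) (w0 h + - w0 h) sequentially"
      by (intro tends_prob_add w h P tends_prob_const tendsto_const)
    then show "tends_prob (\<lambda>_. Pr I) (\<lambda>d \<omega>. w h d \<omega> + - w0 h) 0 sequentially" by simp
  qed
  have qms: "tends_prob (\<lambda>_. Pr I) (\<lambda>d \<omega>. \<Sum>h\<in>H. (w h d \<omega> + - w0 h) * quad_mean I (Th h) d \<omega>) (\<Sum>h\<in>H. 0) sequentially"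
    by (intro tends_prob_sum qm P H)
  have kq: "tends_prob (\<lambda>_. Pr I) (\<lambda>d \<omega>. (\<kappa> d - \<kappa>0) * quad_mean I T d \<omega>) 0 sequentially"
  proof (rule quad_mean_small[OF fin T])
    show "(\<lambda>d. \<kappa> d - \<kappa>0) \<longlonglongrightarrow> 0" using tendsto_diff[OF scale(1) tendsto_const, of \<kappa>0] by simp
  qed
  have all: "tends_prob (\<lambda>_. Pr I) (\<lambda>d \<omega>. \<kappa> d * ((\<Sum>h\<in>H. w h d \<omega> * R h d \<omega>) + (\<Sum>h\<in>H. (w h d \<omega> + - w0 h) * quad_mean I (Th h) d \<omega>))
      + (\<kappa> d - \<kappa>0) * quad_mean I T d \<omega> + - (\<kappa>0 * (L * (\<Sum>h\<in>H. w0 h))))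
      (\<kappa>0 * ((\<Sum>h\<in>H. w0 h * L) + (\<Sum>h\<in>H. 0)) + 0 + - (\<kappa>0 * (L * (\<Sum>h\<in>H. w0 h)))) sequentially"
    by (intro tends_prob_add tends_prob_mult sw qms kq P tends_prob_const tendsto_const scale)
  have z: "\<kappa>0 * ((\<Sum>h\<in>H. w0 h * L) + (\<Sum>h\<in>H. 0)) + 0 + - (\<kappa>0 * (L * (\<Sum>h\<in>H. w0 h))) = 0"
    by (simp add: sum_distrib_left sum_distrib_right mult_ac)
  have eq: "\<kappa> d * (\<Sum>h\<in>H. w h d \<omega> * (shifted_form I \<delta> (s h) (t h) d \<omega> / sqrt (real d))) -
      (\<kappa>0 * (L * (\<Sum>h\<in>H. w0 h)) + \<kappa>0 * sqrt v * (quad_mean I T d \<omega> / sqrt v)) =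
      \<kappa> d * ((\<Sum>h\<in>H. w h d \<omega> * R h d \<omega>) + (\<Sum>h\<in>H. (w h d \<omega> + - w0 h) * quad_mean I (Th h) d \<omega>))
      + (\<kappa> d - \<kappa>0) * quad_mean I T d \<omega> + - (\<kappa>0 * (L * (\<Sum>h\<in>H. w0 h)))" for d \<omega>
  proof -
    have "(\<Sum>h\<in>H. w h d \<omega> * (shifted_form I \<delta> (s h) (t h) d \<omega> / sqrt (real d))) =
       (\<Sum>h\<in>H. w h d \<omega> * R h d \<omega>) + (\<Sum>h\<in>H. (w h d \<omega> + - w0 h) * quad_mean I (Th h) d \<omega>) + quad_mean I T d \<omega>"
      unfolding form quadT by (simp add: distrib_left distrib_right left_diff_distrib sum.distrib sum_subtractf)
    then show ?thesis using v by (simp add: algebra_simps)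
  qed
  show "tends_prob (\<lambda>_. Pr I) (\<lambda>d \<omega>. \<kappa> d * (\<Sum>h\<in>H. w h d \<omega> * (shifted_form I \<delta> (s h) (t h) d \<omega> / sqrt (real d))) -
      (\<kappa>0 * (L * (\<Sum>h\<in>H. w0 h)) + \<kappa>0 * sqrt v * (quad_mean I T d \<omega> / sqrt v))) 0 sequentially"
    unfolding eq using all unfolding z .
  show "(\<lambda>d. measure (Pr I) {\<omega>\<in>space (Pr I). quad_mean I T d \<omega> / sqrt v \<le> x}) \<longlonglongrightarrow> Phi x" for x
  proof (rule std_normal_limit)
    fix u
    have c: "char (distr (Pr I) borel (\<lambda>\<omega>. quad_mean I T d \<omega> / sqrt v)) u =
        char (distr (Pr I) borel (\<lambda>\<omega>. (\<Sum>k<d. quad I T k \<omega>) / sqrt (real d))) (u / sqrt v)" for d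
      unfolding char_def quad_mean_def by (simp add: integral_distr)
    have "(u / sqrt v)\<^sup>2 * v / 2 = u\<^sup>2 / 2" using v by (simp add: power_divide)
    then show "(\<lambda>d. char (distr (Pr I) borel (\<lambda>\<omega>. quad_mean I T d \<omega> / sqrt v)) u) \<longlonglongrightarrow> complex_of_real (exp (- (u\<^sup>2 / 2)))"
      using quad_clt(1)[OF fin T, of "u / sqrt v"] unfolding c v_def[symmetric] by simp
  qed (use P in auto)
  show "\<kappa>0 * sqrt v > 0" using scale v by simp
qed (use prob_space_Pr in auto)

text \<open>In the expanded square divided by \<open>d\<close>, the shift is of order
  \<open>1 / sqrt d\<close>, the linear terms vanish by \<open>lin_small\<close>, the product of the
  two copies is a quadratic form divided once more by \<open>sqrt d\<close>, and the two sums of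
  squares obey the law of large numbers.\<close>

lemma norm_tends_prob:
  fixes I :: "'i set"
  assumes fin: "finite I" and i: "i \<in> I" "j \<in> I" "i \<noteq> j" and r: "r \<noteq> 0 \<or> q \<noteq> 0"
    and shift: "(\<lambda>d. (\<Sum>k<d. (\<delta> d k)\<^sup>2) / sqrt (real d)) \<longlonglongrightarrow> L"
    and cross: "(\<lambda>d. (\<Sum>k<d. \<Sum>l<d. \<delta> d k * \<delta> d l * expectation (\<lambda>x. U k x * U l x)) / real d) \<longlonglongrightarrow> 0"
  shows "tends_prob (\<lambda>_. Pr I) (\<lambda>d \<omega>. sqrt (real d) / sqrt (\<Sum>k<d. (\<delta> d k + q * U k (\<omega> j) - r * U k (\<omega> i))\<^sup>2))
    (1 / sqrt (\<gamma> 0 * (r\<^sup>2 + q\<^sup>2))) sequentially"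
proof -
  note P = prob_space_Pr
  define ell where "ell a d \<omega> = (\<Sum>k<d. \<delta> d k * U k (\<omega> a)) / sqrt (real d)" for a d and \<omega> :: "'i \<Rightarrow> 'a"
  \<comment> \<open>The mixed term of the square, written as a symmetric form without
    diagonal.\<close>
  define T where "T a b = (if a = i \<and> b = j \<or> a = j \<and> b = i then - (r * q) else 0)" for a b
  have T: "sym0 I T" unfolding sym0_def T_def using i by auto
  define sq where "sq a d \<omega> = (\<Sum>k<d. (U k (\<omega> a))\<^sup>2) / real d" for a d and \<omega> :: "'i \<Rightarrow> 'a"
  define Q where "Q d \<omega> = ((\<Sum>k<d. (\<delta> d k)\<^sup>2) / sqrt (real d)) * (1 / sqrt (real d))
      + (2 / sqrt (real d)) * (q * ell j d \<omega> + (- r) * ell i d \<omega>) + (q\<^sup>2 * sq j d \<omega> + r\<^sup>2 * sq i d \<omega>)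
      + (1 / sqrt (real d)) * quad_mean I T d \<omega>" for d \<omega>
  have inv: "(\<lambda>d. a / sqrt (real d)) \<longlonglongrightarrow> 0" for a :: real
    by (rule tendsto_divide_0[OF tendsto_const]) (intro filterlim_at_top_imp_at_infinity filterlim_compose[OF sqrt_at_top filterlim_real_sequentially])
  have "tends_prob (\<lambda>_. Pr I) Q (L * 0 + 0 * (q * 0 + (- r) * 0) + (q\<^sup>2 * \<gamma> 0 + r\<^sup>2 * \<gamma> 0) + 0) sequentially"
    unfolding Q_def
    by (intro tends_prob_add tends_prob_mult quad_mean_small[OF fin T] P tends_prob_const tendsto_const inv shift)
       (unfold ell_def sq_def, (intro lin_small[OF fin _ cross] square_mean_tends_prob fin i)+)
  then have Qt: "tends_prob (\<lambda>_. Pr I) Q (\<gamma> 0 * (r\<^sup>2 + q\<^sup>2)) sequentially" by (simp add: algebra_simps)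
  have pos: "\<gamma> 0 * (r\<^sup>2 + q\<^sup>2) > 0"
    using r \<gamma>0 by (auto simp: sum_power2_gt_zero_iff)
  have quadT: "quad I T k \<omega> = - (2 * r * q) * (U k (\<omega> i) * U k (\<omega> j))" for k \<omega>
  proof -
    have "quad I T k \<omega> = (\<Sum>p\<in>I\<times>I. T (fst p) (snd p) * (U k (\<omega> (fst p)) * U k (\<omega> (snd p))))"
      unfolding quad_def by (simp add: sum.cartesian_product case_prod_beta)
    also have "\<dots> = (\<Sum>p\<in>{(i, j), (j, i)}. T (fst p) (snd p) * (U k (\<omega> (fst p)) * U k (\<omega> (snd p))))"
      by (rule sum.mono_neutral_right) (use fin i in \<open>auto simp: T_def\<close>)
    also have "\<dots> = - (2 * r * q) * (U k (\<omega> i) * U k (\<omega> j))" using i by (simp add: T_def algebra_simps)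
    finally show ?thesis .
  qed
  have eq: "Q d \<omega> = (\<Sum>k<d. (\<delta> d k + q * U k (\<omega> j) - r * U k (\<omega> i))\<^sup>2) / real d" for d \<omega>
  proof (cases "d = 0")
    case False
    then have sd: "sqrt (real d) * sqrt (real d) = real d" "sqrt (real d) > 0" by auto
    have "(\<Sum>k<d. (\<delta> d k + q * U k (\<omega> j) - r * U k (\<omega> i))\<^sup>2) = (\<Sum>k<d. (\<delta> d k)\<^sup>2 + 2 * (q * (\<delta> d k * U k (\<omega> j)) + (- r) * (\<delta> d k * U k (\<omega> i)))
        + (q\<^sup>2 * (U k (\<omega> j))\<^sup>2 + r\<^sup>2 * (U k (\<omega> i))\<^sup>2) + quad I T k \<omega>)"
      unfolding quadT by (intro sum.cong refl) (simp add: power2_eq_square algebra_simps)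
    also have "\<dots> = (\<Sum>k<d. (\<delta> d k)\<^sup>2) + 2 * (q * (\<Sum>k<d. \<delta> d k * U k (\<omega> j)) + (- r) * (\<Sum>k<d. \<delta> d k * U k (\<omega> i)))
        + (q\<^sup>2 * (\<Sum>k<d. (U k (\<omega> j))\<^sup>2) + r\<^sup>2 * (\<Sum>k<d. (U k (\<omega> i))\<^sup>2)) + (\<Sum>k<d. quad I T k \<omega>)"
      by (simp only: sum.distrib sum_distrib_left[symmetric])
    finally have 1: "(\<Sum>k<d. (\<delta> d k + q * U k (\<omega> j) - r * U k (\<omega> i))\<^sup>2) = \<dots>" .
    have 2: "A / s * (1 / s) + 2 / s * (q * (Bj / s) + - r * (Bi / s)) + (q\<^sup>2 * (Cj / (s * s)) + r\<^sup>2 * (Ci / (s * s))) + 1 / s * (S / s) =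
        (A + 2 * (q * Bj + - r * Bi) + (q\<^sup>2 * Cj + r\<^sup>2 * Ci) + S) / (s * s)"
      if "s > 0" for A Bi Bj Ci Cj S s :: real
      using that by (simp add: field_simps)
    show ?thesis
      unfolding 1 Q_def ell_def sq_def quad_mean_def using 2[OF sd(2)] unfolding sd(1) .
  qed (simp add: Q_def ell_def sq_def quad_mean_def)
  have "tends_prob (\<lambda>_. Pr I) (\<lambda>d \<omega>. 1 / sqrt (Q d \<omega>)) (1 / sqrt (\<gamma> 0 * (r\<^sup>2 + q\<^sup>2))) sequentially"
    by (rule tends_prob_cont[OF P Qt]) (use pos in \<open>auto intro!: continuous_intros\<close>)
  then show ?thesis unfolding eq by (simp add: real_sqrt_divide)
qed

end

section \<open>From the sampling model to independent copies\<close>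

text \<open>Otherwise the index sets \<open>{1..}\<close> are rewritten to \<open>{Suc 0..}\<close>.\<close>

declare One_nat_def [simp del]

lemma subalgebra_gen_sigma:
  assumes "\<And>i. i \<in> I \<Longrightarrow> V i \<in> borel_measurable M"
  shows "subalgebra M (gen_sigma M V I)"
proof -
  have "{V i -` A \<inter> space M | i A. i \<in> I \<and> A \<in> sets borel} \<subseteq> sets M"
    using assms measurable_sets by blast
  then have "sets (gen_sigma M V I) \<subseteq> sets M"
    unfolding gen_sigma_def using sets.space_closed by (subst sets_measure_of) (auto intro: sets.sigma_sets_subset[THEN subsetD])
  then show ?thesis unfolding subalgebra_def gen_sigma_def
    by (simp add: space_measure_of_conv)
qed

lemma gen_sigma_measurable:
  assumes "i \<in> I"
  shows "V i \<in> borel_measurable (gen_sigma M V I)"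
proof (rule measurableI)
  fix A :: "real set" assume "A \<in> sets borel"
  then show "V i -` A \<inter> space (gen_sigma M V I) \<in> sets (gen_sigma M V I)"
    unfolding gen_sigma_def using assms
    by (subst space_measure_of_conv, subst sets_measure_of) (auto intro!: sigma_sets.Basic)
qed simp

text \<open>Real suprema are only meaningful for nonempty bounded sets, so |corr| \<le> 1 and
  membership of the zero functions come first; then a single correlation can be compared with the
  nested supremum.\<close>

lemma rho_bounds:
  assumes M: "prob_space M" and V: "\<And>k. k \<ge> 1 \<Longrightarrow> V k \<in> borel_measurable M" and n: "n \<ge> 1"
  shows "max_corr_le M (gen_sigma M V {1..n}) (gen_sigma M V {n + r..}) (rho M V r)"
    and "rho M V r \<ge> 0"
proof -
  interpret prob_space M by fact
  define A where "A k = sq_int_on M V {1..k} \<times> sq_int_on M V {k + r..}" for k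
  have sq: "f \<in> borel_measurable M \<and> integrable M (\<lambda>x. (f x)\<^sup>2)" if "f \<in> sq_int_on M V J" "J \<subseteq> {1..}" for f J
  proof
    show "f \<in> borel_measurable M"
      by (rule measurable_from_subalg[OF subalgebra_gen_sigma[of J V M]]) (use that V in \<open>auto simp: sq_int_on_def\<close>)
  qed (use that in \<open>auto simp: sq_int_on_def\<close>)
  have c1: "\<bar>corr M f g\<bar> \<le> 1" if "(f, g) \<in> A k" "k \<ge> 1" for f g k
  proof -
    have f: "f \<in> borel_measurable M" "integrable M (\<lambda>x. (f x)\<^sup>2)" and g: "g \<in> borel_measurable M" "integrable M (\<lambda>x. (g x)\<^sup>2)"
      using that sq[of f "{1..k}"] sq[of g "{k + r..}"] unfolding A_def by auto
    have "\<bar>covar M f g\<bar> \<le> sqrt (covar M f f * covar M g g)"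
      using covar_Cauchy_Schwarz[OF f g] by (simp add: real_sqrt_mult)
    moreover have "\<bar>x / s\<bar> \<le> 1" if "\<bar>x\<bar> \<le> s" for x s :: real
      using that by (cases "s = 0") (auto simp: abs_divide divide_le_eq)
    ultimately show ?thesis unfolding corr_def by blast
  qed
  have zero: "(\<lambda>_. 0, \<lambda>_. 0) \<in> A k" for k unfolding A_def sq_int_on_def by auto
  have bi: "bdd_above ((\<lambda>(f, g). \<bar>corr M f g\<bar>) ` A k)" if "k \<ge> 1" for k
    using c1[OF _ that] by (intro bdd_aboveI[where M=1]) auto
  have le1: "(SUP (f, g)\<in>A k. \<bar>corr M f g\<bar>) \<le> 1" if "k \<ge> 1" for k
    using zero c1[OF _ that] by (intro cSUP_least) auto
  have bo: "bdd_above ((\<lambda>k. SUP (f, g)\<in>A k. \<bar>corr M f g\<bar>) ` {1..})"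
    using le1 by (intro bdd_aboveI[where M=1]) auto
  have le: "\<bar>corr M f g\<bar> \<le> rho M V r" if "(f, g) \<in> A n" for f g
  proof -
    have "\<bar>corr M f g\<bar> \<le> (SUP (f, g)\<in>A n. \<bar>corr M f g\<bar>)"
      using cSUP_upper[OF that bi[OF n]] by simp
    also have "\<dots> \<le> rho M V r"
      unfolding rho_def A_def[symmetric] using n by (intro cSUP_upper bo) auto
    finally show ?thesis .
  qed
  show "rho M V r \<ge> 0" using le[OF zero] by simp
  show "max_corr_le M (gen_sigma M V {1..n}) (gen_sigma M V {n + r..}) (rho M V r)"
    unfolding max_corr_le_def
  proof (intro allI impI, elim exE)
    fix f g :: "'a \<Rightarrow> real" and K L
    assume fm: "f \<in> borel_measurable (gen_sigma M V {1..n})" and gm: "g \<in> borel_measurable (gen_sigma M V {n + r..})"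
      and K: "\<forall>x\<in>space M. \<bar>f x\<bar> \<le> K" and L: "\<forall>x\<in>space M. \<bar>g x\<bar> \<le> L"
    have fM: "f \<in> borel_measurable M" by (rule measurable_from_subalg[OF subalgebra_gen_sigma fm]) (use V in auto)
    have gM: "g \<in> borel_measurable M" by (rule measurable_from_subalg[OF subalgebra_gen_sigma gm]) (use V n in auto)
    have i: "integrable M (\<lambda>x. (f x)\<^sup>2)" "integrable M (\<lambda>x. (g x)\<^sup>2)"
      using integrable_square_bounded[OF fM] integrable_square_bounded[OF gM] K L by auto
    have "(f, g) \<in> A n" unfolding A_def sq_int_on_def using fm gm i by auto
    note le = le[OF this]
    define s where "s = sqrt (covar M f f * covar M g g)"
    have s: "s = sqrt (covar M f f) * sqrt (covar M g g)" by (simp add: s_def real_sqrt_mult)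
    show "\<bar>covar M f g\<bar> \<le> rho M V r * (sqrt (covar M f f) * sqrt (covar M g g))"
    \<comment> \<open>If a variance vanishes, the correlation is 0 by convention and says nothing;
      the covariance then vanishes by Cauchy-Schwarz.\<close>
    proof (cases "s = 0")
      case True
      then show ?thesis using covar_Cauchy_Schwarz[OF fM i(1) gM i(2)] unfolding s[symmetric] by simp
    next
      case False
      have "s \<ge> 0" unfolding s_def using covar_self_nonneg by simp
      with False have "s > 0" by simp
      then show ?thesis using le unfolding corr_def s_def[symmetric] s[symmetric] by (simp add: abs_divide divide_le_eq)
    qed
  qed
qed

lemma stationary_integral:
  fixes f :: "(nat \<Rightarrow> real) \<Rightarrow> real"
  assumes V: "strictly_stationary M V" and f: "f \<in> borel_measurable RSeq"
  shows "(\<integral>x. f (seq_map (\<lambda>k. V (k + h)) x) \<partial>M) = (\<integral>x. f (seq_map V x) \<partial>M)"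
    and "integrable M (\<lambda>x. f (seq_map (\<lambda>k. V (k + h)) x)) \<longleftrightarrow> integrable M (\<lambda>x. f (seq_map V x))"
proof -
  have m: "seq_map (\<lambda>k. V (k + h)) \<in> measurable M RSeq" for h
    using V unfolding seq_map_def strictly_stationary_def by (intro measurable_restrict) auto
  have e: "distr M RSeq (seq_map (\<lambda>k. V (k + h))) = distr M RSeq (seq_map V)"
    using V unfolding strictly_stationary_def by blast
  have m0: "seq_map V \<in> measurable M RSeq" using m[of 0] by simp
  show "(\<integral>x. f (seq_map (\<lambda>k. V (k + h)) x) \<partial>M) = (\<integral>x. f (seq_map V x) \<partial>M)"
    using arg_cong[OF e, of "\<lambda>N. integral\<^sup>L N f"] by (simp add: integral_distr[OF m f] integral_distr[OF m0 f])
  show "integrable M (\<lambda>x. f (seq_map (\<lambda>k. V (k + h)) x)) \<longleftrightarrow> integrable M (\<lambda>x. f (seq_map V x))"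
    using arg_cong[OF e, of "\<lambda>N. integrable N f"] by (simp add: integrable_distr_eq[OF m f] integrable_distr_eq[OF m0 f])
qed

text \<open>The sequence is reindexed from 0. The future from index \<open>n\<close> is generated
  from \<open>V n\<close> on, one variable earlier than \<open>V (Suc n)\<close>, because
  \<open>rho\<close> counts the distance from the last index of the past to the first of the future.
  The maximum excludes \<open>V 0\<close>, about which nothing is assumed.\<close>

lemma rho_sequence_of_stationary:
  assumes M: "prob_space M" and V: "strictly_stationary M V" and mix: "rho_mixing M V"
    and mean: "\<And>k. k \<ge> 1 \<Longrightarrow> (LINT \<omega>|M. V k \<omega>) = 0"
    and mom: "integrable M (\<lambda>\<omega>. V 1 \<omega> ^ 4)"
    and var: "covar M (V 1) (V 1) > 0"
    and sum: "summable (\<lambda>k. rho M V (2 ^ Suc k))"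
  shows "rho_sequence M (\<lambda>k. V (Suc k)) (\<lambda>n. gen_sigma M V {1..n}) (\<lambda>n. gen_sigma M V {max 1 n..})
    (\<lambda>j. LINT \<omega>|M. V 1 \<omega> * V (Suc j) \<omega>) (rho M V) (LINT \<omega>|M. V 1 \<omega> ^ 4)"
proof -
  interpret prob_space M by fact
  have Vm: "V k \<in> borel_measurable M" if "k \<ge> 1" for k using V that by (auto simp: strictly_stationary_def)
  have c: "(\<lambda>z. z (i::nat)) \<in> borel_measurable RSeq" if "i \<ge> 1" for i
    by (rule measurable_component_singleton) (use that in simp)
  show ?thesis
  proof (unfold_locales)
    fix k j n r :: nat
    have f4: "(\<lambda>z. z (1::nat) ^ 4) \<in> borel_measurable RSeq" by (intro borel_measurable_power c) simp
    show "mom4_le M (V (Suc k)) (LINT \<omega>|M. V 1 \<omega> ^ 4)"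
      using stationary_integral[OF V f4, of k] mom Vm by (auto simp: mom4_le_def seq_map_def One_nat_def)
    show "expectation (V (Suc k)) = 0" by (rule mean) simp
    have f2: "(\<lambda>z. z (1::nat) * z (Suc j)) \<in> borel_measurable RSeq" by (intro borel_measurable_times c) simp_all
    show "expectation (\<lambda>x. V (Suc k) x * V (Suc (k + j)) x) = expectation (\<lambda>x. V 1 x * V (Suc j) x)"
      using stationary_integral(1)[OF V f2, of k] by (simp add: seq_map_def add.commute One_nat_def)
    show "0 < expectation (\<lambda>x. V 1 x * V (Suc 0) x)"
      using var mean[of 1] by (simp add: covar_def One_nat_def)
    show "subalgebra M (gen_sigma M V {1..n})" "subalgebra M (gen_sigma M V {max 1 n..})"
      by (rule subalgebra_gen_sigma, simp add: Vm)+
    show "V (Suc k) \<in> borel_measurable (gen_sigma M V {1..n})" if "k < n"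
      by (rule gen_sigma_measurable) (use that in auto)
    show "V (Suc k) \<in> borel_measurable (gen_sigma M V {max 1 n..})" if "n \<le> k"
      by (rule gen_sigma_measurable) (use that in auto)
    show "max_corr_le M (gen_sigma M V {1..n}) (gen_sigma M V {max 1 (n + r)..}) (rho M V r)" if "1 \<le> n"
      using rho_bounds(1)[OF M Vm that, where r=r] that by (simp add: max_absorb2)
    show "0 \<le> rho M V r" using rho_bounds(2)[OF M Vm, where n=1 and r=r] by simp
    show "summable (\<lambda>k. rho M V (2 ^ k))" using sum by (subst (asm) summable_Suc_iff[where f="\<lambda>k. rho M V (2 ^ k)"])
    show "rho M V \<longlonglongrightarrow> 0" using mix by (simp add: rho_mixing_def)
  qed
qed

section \<open>The joint law of the samples in terms of scales and sequences\<close>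

text \<open>The first coordinate is the reciprocal of \<open>P\<close>, so the division by
  \<open>P\<close> has become a multiplication.\<close>

definition mix_map :: "nat \<Rightarrow> (nat \<Rightarrow> 'a \<Rightarrow> real) \<Rightarrow> (nat \<Rightarrow> real) \<Rightarrow> real \<times> 'a \<Rightarrow> (nat \<Rightarrow> real)" where
  "mix_map d V \<nu> z = (\<lambda>k\<in>{1..d}. \<nu> k + V k (snd z) * fst z)"

lemma mix_map_measurable:
  assumes "\<And>k. k \<ge> 1 \<Longrightarrow> V k \<in> borel_measurable M" and "sets L = sets borel"
  shows "mix_map d V \<nu> \<in> measurable (L \<Otimes>\<^sub>M M) (RV d)"
  unfolding mix_map_def
proof (rule measurable_restrict)
  fix k assume k: "k \<in> {1..d}"
  have "(\<lambda>z. V k (snd z)) \<in> borel_measurable (L \<Otimes>\<^sub>M M)"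
    by (rule measurable_compose[OF measurable_snd]) (use assms k in auto)
  moreover have "fst \<in> borel_measurable (L \<Otimes>\<^sub>M M)"
    using measurable_fst[of L M] unfolding measurable_cong_sets[OF refl assms(2)] .
  ultimately show "(\<lambda>z. \<nu> k + V k (snd z) * fst z) \<in> borel_measurable (L \<Otimes>\<^sub>M M)" by simp
qed

text \<open>The scale factor may be taken from an independent copy of the probability space.\<close>

lemma scale_mix_distr:
  assumes M: "prob_space M" and V: "\<And>k. k \<ge> 1 \<Longrightarrow> V k \<in> borel_measurable M"
    and P: "P \<in> borel_measurable M" and ind: "indep_seq_rv M V P"
  shows "distr M (RV d) (scale_mix d \<nu> V P) = 
    distr (distr M borel (\<lambda>\<omega>. 1 / P \<omega>) \<Otimes>\<^sub>M M) (RV d) (mix_map d V \<nu>)"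
proof -
  interpret prob_space M by fact
  let ?L = "distr M borel (\<lambda>\<omega>. 1 / P \<omega>)"
  note [measurable] = P
  have P1: "(\<lambda>\<omega>. 1 / P \<omega>) \<in> borel_measurable M" by measurable
  have rm: "rvec d V \<in> measurable M (RV d)"
    unfolding rvec_def by (rule measurable_restrict) (use V in auto)
  interpret L: prob_space ?L by (rule prob_space_distr[OF P1])
  interpret D: prob_space "distr M (RV d) (rvec d V)" by (rule prob_space_distr[OF rm])
  have jm: "(\<lambda>\<omega>. (1 / P \<omega>, rvec d V \<omega>)) \<in> measurable M (borel \<Otimes>\<^sub>M RV d)"
    using P1 rm by measurable
  \<comment> \<open>Independence of the generated sigma-algebras is used on rectangles, which
    determine the joint law of the scale and the first \<open>d\<close> variables.\<close>
  have joint: "?L \<Otimes>\<^sub>M distr M (RV d) (rvec d V) = distr M (borel \<Otimes>\<^sub>M RV d) (\<lambda>\<omega>. (1 / P \<omega>, rvec d V \<omega>))"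
  proof (rule pair_measure_eqI)
    fix A B assume A: "A \<in> sets ?L" and B: "B \<in> sets (distr M (RV d) (rvec d V))"
    have A': "A \<in> sets borel" and B': "B \<in> sets (RV d)" using A B by auto
    have inv: "(\<lambda>x::real. 1 / x) -` A \<in> sets borel"
      using measurable_sets_borel[OF _ A', of "\<lambda>x. 1 / x"] by simp
    have "P -` ((\<lambda>x. 1 / x) -` A) \<inter> space M \<in> sets (vimage_algebra (space M) P borel)"
      unfolding sets_vimage_algebra using inv by (intro sigma_sets.Basic) blast
    then have a: "{\<omega>\<in>space M. 1 / P \<omega> \<in> A} \<in> sets (vimage_algebra (space M) P borel)"
      by (simp add: vimage_def Int_def conj_commute)
    have rg: "rvec d V \<in> measurable (gen_sigma M V {1..}) (RV d)"
      unfolding rvec_def by (rule measurable_restrict, rule gen_sigma_measurable) auto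
    have sp: "space (gen_sigma M V {1..}) = space M" by (simp add: gen_sigma_def space_measure_of_conv)
    have b: "{\<omega>\<in>space M. rvec d V \<omega> \<in> B} \<in> sets (gen_sigma M V {1..})"
      using measurable_sets[OF rg B'] unfolding sp by (simp add: vimage_def Int_def conj_commute)
    have "prob ({\<omega>\<in>space M. rvec d V \<omega> \<in> B} \<inter> {\<omega>\<in>space M. 1 / P \<omega> \<in> A}) =
        prob {\<omega>\<in>space M. rvec d V \<omega> \<in> B} * prob {\<omega>\<in>space M. 1 / P \<omega> \<in> A}"
      using ind a b unfolding indep_seq_rv_def by (intro indep_setD)
    then have "emeasure M ({\<omega>\<in>space M. rvec d V \<omega> \<in> B} \<inter> {\<omega>\<in>space M. 1 / P \<omega> \<in> A}) =
        emeasure M {\<omega>\<in>space M. 1 / P \<omega> \<in> A} * emeasure M {\<omega>\<in>space M. rvec d V \<omega> \<in> B}"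
      by (simp add: emeasure_eq_measure ennreal_mult mult.commute)
    moreover have "{\<omega>\<in>space M. rvec d V \<omega> \<in> B} \<inter> {\<omega>\<in>space M. 1 / P \<omega> \<in> A} = (\<lambda>\<omega>. (1 / P \<omega>, rvec d V \<omega>)) -` (A \<times> B) \<inter> space M"
      by auto
    ultimately show "emeasure ?L A * emeasure (distr M (RV d) (rvec d V)) B =
        emeasure (distr M (borel \<Otimes>\<^sub>M RV d) (\<lambda>\<omega>. (1 / P \<omega>, rvec d V \<omega>))) (A \<times> B)"
      using A' B' by (simp add: emeasure_distr[OF P1] emeasure_distr[OF rm] emeasure_distr[OF jm] vimage_def Int_def conj_commute)
  qed (auto intro: L.sigma_finite_measure_axioms D.sigma_finite_measure_axioms cong: sets_pair_measure_cong)
  define h where "h z = (\<lambda>k\<in>{1..d}. \<nu> k + snd z k * fst z)" for z :: "real \<times> (nat \<Rightarrow> real)"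
  have hm: "h \<in> measurable (borel \<Otimes>\<^sub>M RV d) (RV d)"
    unfolding h_def by (rule measurable_restrict) measurable
  have "distr M (RV d) (scale_mix d \<nu> V P) = distr M (RV d) (\<lambda>\<omega>. h (1 / P \<omega>, rvec d V \<omega>))"
    by (intro distr_cong refl) (auto simp: scale_mix_def h_def rvec_def fun_eq_iff)
  also have "\<dots> = distr (?L \<Otimes>\<^sub>M distr M (RV d) (rvec d V)) (RV d) h"
    unfolding joint by (subst distr_distr[OF hm jm]) (simp add: comp_def)
  also have "?L \<Otimes>\<^sub>M distr M (RV d) (rvec d V) = distr ?L borel (\<lambda>x. x) \<Otimes>\<^sub>M distr M (RV d) (rvec d V)"
    by (simp add: distr_id2)
  also have "\<dots> = distr (?L \<Otimes>\<^sub>M M) (borel \<Otimes>\<^sub>M RV d) (\<lambda>(x, y). (x, rvec d V y))"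
    by (rule pair_measure_distr[OF _ rm D.sigma_finite_measure_axioms]) simp
  also have "distr \<dots> (RV d) h = distr (?L \<Otimes>\<^sub>M M) (RV d) (\<lambda>z. h (fst z, rvec d V (snd z)))"
  proof (subst distr_distr[OF hm])
    show "(\<lambda>(x, y). (x, rvec d V y)) \<in> ?L \<Otimes>\<^sub>M M \<rightarrow>\<^sub>M borel \<Otimes>\<^sub>M RV d" using rm by measurable
  qed (simp add: comp_def case_prod_beta')
  also have "\<dots> = distr (?L \<Otimes>\<^sub>M M) (RV d) (mix_map d V \<nu>)"
    by (intro distr_cong refl) (auto simp: mix_map_def h_def rvec_def fun_eq_iff)
  finally show ?thesis .
qed

lemma emeasure_distr_nn_integral:
  assumes "A \<in> sets N" "f \<in> measurable M N"
  shows "emeasure (distr M N f) A = (\<integral>\<^sup>+x. indicator A (f x) \<partial>M)"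
proof -
  have "emeasure (distr M N f) A = (\<integral>\<^sup>+x. indicator (f -` A \<inter> space M) x \<partial>M)"
    using assms by (subst nn_integral_indicator) (auto simp: emeasure_distr measurable_sets)
  also have "\<dots> = (\<integral>\<^sup>+x. indicator A (f x) \<partial>M)"
    by (intro nn_integral_cong) (auto simp: indicator_def)
  finally show ?thesis .
qed

text \<open>Regroups independent pairs of a scale and a sequence into all scales followed by all
  sequences, which makes it possible to condition on the scales. Rectangles suffice, and there
  Tonelli's theorem gives the product.\<close>

lemma PiM_distr_pair:
  fixes \<phi> :: "'i \<Rightarrow> 'c \<times> 'a \<Rightarrow> 'b"
  assumes L: "prob_space L" and M: "prob_space M" and fin: "finite I"
    and ne: "I \<noteq> {}" and \<phi>: "\<And>a. a \<in> I \<Longrightarrow> \<phi> a \<in> measurable (L \<Otimes>\<^sub>M M) S"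
  shows "(\<lambda>z. \<lambda>a\<in>I. \<phi> a (fst z a, snd z a)) \<in> measurable (PiM I (\<lambda>_. L) \<Otimes>\<^sub>M PiM I (\<lambda>_. M)) (PiM I (\<lambda>_. S))"
    and "PiM I (\<lambda>a. distr (L \<Otimes>\<^sub>M M) S (\<phi> a)) =
      distr (PiM I (\<lambda>_. L) \<Otimes>\<^sub>M PiM I (\<lambda>_. M)) (PiM I (\<lambda>_. S)) (\<lambda>z. \<lambda>a\<in>I. \<phi> a (fst z a, snd z a))"
proof -
  interpret L: prob_space L by fact
  interpret M: prob_space M by fact
  interpret LM: pair_prob_space L M ..
  interpret PL: prob_space "PiM I (\<lambda>_. L)" by (intro prob_space_PiM L)
  interpret PM: prob_space "PiM I (\<lambda>_. M)" by (intro prob_space_PiM M)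
  interpret PL': product_sigma_finite "\<lambda>_::'i. L" ..
  interpret PM': product_sigma_finite "\<lambda>_::'i. M" ..
  \<comment> \<open>A product of sigma-finite measures needs a probability measure at every index,
    also outside \<open>I\<close>; a constant map supplies it.\<close>
  define \<psi> where "\<psi> a = (if a \<in> I then \<phi> a else (\<lambda>_. SOME y. y \<in> space S))" for a
  have neS: "space S \<noteq> {}"
    using ne measurable_space[OF \<phi>] LM.not_empty by blast
  let ?J = "PiM I (\<lambda>_. L) \<Otimes>\<^sub>M PiM I (\<lambda>_. M)" and ?\<psi> = "\<lambda>z. \<lambda>a\<in>I. \<phi> a (fst z a, snd z a)"
  have pm: "(\<lambda>z. (fst z a, snd z a)) \<in> measurable ?J (L \<Otimes>\<^sub>M M)" if "a \<in> I" for a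
    by (intro measurable_Pair measurable_compose[OF measurable_fst measurable_component_singleton[OF that]]
        measurable_compose[OF measurable_snd measurable_component_singleton[OF that]])
  show m: "?\<psi> \<in> measurable ?J (PiM I (\<lambda>_. S))"
    by (rule measurable_restrict) (rule measurable_compose[OF pm \<phi>])
  show "PiM I (\<lambda>a. distr (L \<Otimes>\<^sub>M M) S (\<phi> a)) = distr ?J (PiM I (\<lambda>_. S)) ?\<psi>"
  proof -
    define D where "D a = distr (L \<Otimes>\<^sub>M M) S (\<psi> a)" for a
    have \<psi>m: "\<psi> a \<in> measurable (L \<Otimes>\<^sub>M M) S" for a
    proof (cases "a \<in> I")
      case False
      have "(SOME y. y \<in> space S) \<in> space S" using neS by (simp add: some_in_eq)
      then show ?thesis unfolding \<psi>_def using False by (simp add: measurable_const)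
    qed (use \<phi> in \<open>simp add: \<psi>_def\<close>)
    have D: "prob_space (D a)" for a unfolding D_def by (rule LM.prob_space_distr[OF \<psi>m])
    interpret D: product_sigma_finite D by (rule product_sigma_finite.intro) (rule prob_space_imp_sigma_finite[OF D])
    have "distr ?J (PiM I (\<lambda>_. S)) ?\<psi> = PiM I D"
    proof (rule D.PiM_eqI[OF fin])
      show "sets (distr ?J (PiM I (\<lambda>_. S)) ?\<psi>) = sets (PiM I D)"
        unfolding D_def by (auto intro!: sets_PiM_cong)
    next
      fix A assume A: "\<And>a. a \<in> I \<Longrightarrow> A a \<in> sets (D a)"
      then have A': "A a \<in> sets S" if "a \<in> I" for a using that unfolding D_def by auto
      have PA: "Pi\<^sub>E I A \<in> sets (PiM I (\<lambda>_. S))" using A' fin by (intro sets_PiM_I_finite) auto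
      define f where "f a x y = (indicator (A a) (\<phi> a (x, y)) :: ennreal)" for a x y
      have fm: "(\<lambda>z. f a (fst z) (snd z)) \<in> borel_measurable (L \<Otimes>\<^sub>M M)" if "a \<in> I" for a
        unfolding f_def using \<phi>[OF that] A'[OF that] by simp
      have fm2: "f a x \<in> borel_measurable M" if "a \<in> I" "x \<in> space L" for a x
        using measurable_compose[OF measurable_Pair1'[OF that(2)] fm[OF that(1)]] by simp
      have fm3: "(\<lambda>x. \<integral>\<^sup>+y. f a x y \<partial>M) \<in> borel_measurable L" if "a \<in> I" for a
        using M.borel_measurable_nn_integral_fst[OF fm[OF that]] by simp
      have fm4: "(\<lambda>z. f a (fst z a) (snd z a)) \<in> borel_measurable ?J" if "a \<in> I" for a
        using measurable_compose[OF pm[OF that] fm[OF that]] by simp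
      have "emeasure (distr ?J (PiM I (\<lambda>_. S)) ?\<psi>) (Pi\<^sub>E I A) = (\<integral>\<^sup>+z. indicator (Pi\<^sub>E I A) (?\<psi> z) \<partial>?J)"
        by (rule emeasure_distr_nn_integral[OF PA m])
      also have "\<dots> = (\<integral>\<^sup>+z. (\<Prod>a\<in>I. f a (fst z a) (snd z a)) \<partial>?J)"
        unfolding f_def using fin by (intro nn_integral_cong) (auto simp: indicator_def PiE_iff prod_zero_iff)
      also have "\<dots> = (\<integral>\<^sup>+p. \<integral>\<^sup>+v. (\<Prod>a\<in>I. f a (p a) (v a)) \<partial>PiM I (\<lambda>_. M) \<partial>PiM I (\<lambda>_. L))"
        by (subst PM.nn_integral_fst[symmetric]) (auto intro!: borel_measurable_prod_ennreal fm4)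
      also have "\<dots> = (\<integral>\<^sup>+p. (\<Prod>a\<in>I. \<integral>\<^sup>+y. f a (p a) y \<partial>M) \<partial>PiM I (\<lambda>_. L))"
        using fin fm2 by (intro nn_integral_cong PM'.product_nn_integral_prod) (auto simp: space_PiM PiE_iff)
      also have "\<dots> = (\<Prod>a\<in>I. \<integral>\<^sup>+x. \<integral>\<^sup>+y. f a x y \<partial>M \<partial>L)"
        using fin fm3 by (intro PL'.product_nn_integral_prod) auto
      also have "\<dots> = (\<Prod>a\<in>I. emeasure (D a) (A a))"
      proof (rule prod.cong[OF refl])
        fix a assume a: "a \<in> I"
        have "emeasure (D a) (A a) = (\<integral>\<^sup>+z. indicator (A a) (\<phi> a z) \<partial>(L \<Otimes>\<^sub>M M))"
          unfolding D_def \<psi>_def using a by (simp add: emeasure_distr_nn_integral[OF A'[OF a] \<phi>[OF a]])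
        also have "\<dots> = (\<integral>\<^sup>+x. \<integral>\<^sup>+y. f a x y \<partial>M \<partial>L)"
          unfolding f_def using fm[OF a] unfolding f_def by (subst M.nn_integral_fst[symmetric]) auto
        finally show "(\<integral>\<^sup>+x. \<integral>\<^sup>+y. f a x y \<partial>M \<partial>L) = emeasure (D a) (A a)" by simp
      qed
      finally show "emeasure (distr ?J (PiM I (\<lambda>_. S)) ?\<psi>) (Pi\<^sub>E I A) = (\<Prod>a\<in>I. emeasure (D a) (A a))" .
    qed
    also have "PiM I D = PiM I (\<lambda>a. distr (L \<Otimes>\<^sub>M M) S (\<phi> a))"
      by (rule PiM_cong) (auto simp: D_def \<psi>_def)
    finally show ?thesis by simp
  qed
qed

lemma measure_pair_integral:
  assumes "prob_space A" "prob_space B" and E: "E \<in> sets (A \<Otimes>\<^sub>M B)"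
  shows "measure (A \<Otimes>\<^sub>M B) E = (\<integral>x. measure B (Pair x -` E) \<partial>A)"
    and "(\<lambda>x. measure B (Pair x -` E)) \<in> borel_measurable A"
proof -
  interpret A: prob_space A by fact
  interpret B: prob_space B by fact
  interpret P: pair_prob_space A B ..
  have m: "(\<lambda>x. emeasure B (Pair x -` E)) \<in> borel_measurable A" by (rule B.measurable_emeasure_Pair[OF E])
  then show bm: "(\<lambda>x. measure B (Pair x -` E)) \<in> borel_measurable A" unfolding measure_def by measurable
  have "emeasure (A \<Otimes>\<^sub>M B) E = (\<integral>\<^sup>+x. ennreal (measure B (Pair x -` E)) \<partial>A)"
    by (simp add: B.emeasure_pair_measure_alt[OF E] B.emeasure_eq_measure)
  also have "\<dots> = ennreal (\<integral>x. measure B (Pair x -` E) \<partial>A)"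
    by (rule nn_integral_eq_integral) (auto intro!: A.integrable_const_bound[where B=1] bm)
  finally show "measure (A \<Otimes>\<^sub>M B) E = (\<integral>x. measure B (Pair x -` E) \<partial>A)"
    by (simp add: P.emeasure_eq_measure)
qed

text \<open>The rejection probability depends only on the joint law of the samples, so these may be
  replaced by the canonical construction; Fubini then turns it into a mean over the scales of
  conditional probabilities.\<close>

lemma iid_samples_measure:
  fixes F :: "(nat + nat \<Rightarrow> nat \<Rightarrow> real) \<Rightarrow> real" and z :: real
  assumes M: "prob_space M" and L: "prob_space L" "sets L = sets borel"
    and V: "\<And>k. k \<ge> 1 \<Longrightarrow> V k \<in> borel_measurable M"
    and iid: "iid_samples M d m n X Y XS YS" and mn: "m \<ge> 1"
    and X: "distr M (RV d) X = distr (L \<Otimes>\<^sub>M M) (RV d) (mix_map d V \<nu>1)"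
    and Y: "distr M (RV d) Y = distr (L \<Otimes>\<^sub>M M) (RV d) (mix_map d V \<nu>2)"
    and F: "F \<in> borel_measurable (PiM ({1..m} <+> {1..n}) (\<lambda>_. RV d))"
  defines "I \<equiv> {1..m} <+> {1..n}"
  defines "G \<equiv> (\<lambda>p. measure (PiM I (\<lambda>_. M)) {v\<in>space (PiM I (\<lambda>_. M)).
      F (\<lambda>a\<in>I. mix_map d V (case_sum (\<lambda>_. \<nu>1) (\<lambda>_. \<nu>2) a) (p a, v a)) > z})"
  shows "measure M {\<omega>\<in>space M. F (\<lambda>a\<in>I. case_sum XS YS a \<omega>) > z} = (\<integral>p. G p \<partial>PiM I (\<lambda>_. L))"
    and "G \<in> borel_measurable (PiM I (\<lambda>_. L))"
proof -
  interpret prob_space M by fact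
  have fin: "finite I" and ne: "I \<noteq> {}" unfolding I_def using mn by auto
  define \<phi> where "\<phi> a = mix_map d V (case_sum (\<lambda>_. \<nu>1) (\<lambda>_. \<nu>2) a)" for a :: "nat + nat"
  have \<phi>m: "\<phi> a \<in> measurable (L \<Otimes>\<^sub>M M) (RV d)" for a
    unfolding \<phi>_def by (rule mix_map_measurable[OF V L(2)])
  have iv: "indep_vars (\<lambda>_. RV d) (case_sum XS YS) I" using iid unfolding iid_samples_def I_def by auto
  have rv: "case_sum XS YS a \<in> measurable M (RV d)" if "a \<in> I" for a
    using iv that unfolding indep_vars_def2 by auto
  let ?J = "PiM I (\<lambda>_. L) \<Otimes>\<^sub>M PiM I (\<lambda>_. M)" and ?\<psi> = "\<lambda>z. \<lambda>a\<in>I. \<phi> a (fst z a, snd z a)"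
  have "distr M (PiM I (\<lambda>_. RV d)) (\<lambda>\<omega>. \<lambda>a\<in>I. case_sum XS YS a \<omega>) = PiM I (\<lambda>a. distr M (RV d) (case_sum XS YS a))"
    using indep_vars_iff_distr_eq_PiM'[OF ne rv] iv by auto
  also have "\<dots> = PiM I (\<lambda>a. distr (L \<Otimes>\<^sub>M M) (RV d) (\<phi> a))"
    using iid X Y unfolding iid_samples_def by (intro PiM_cong) (auto simp: I_def \<phi>_def)
  also have "\<dots> = distr ?J (PiM I (\<lambda>_. RV d)) ?\<psi>"
    by (rule PiM_distr_pair(2)[OF L(1) M fin ne \<phi>m])
  finally have law: "distr M (PiM I (\<lambda>_. RV d)) (\<lambda>\<omega>. \<lambda>a\<in>I. case_sum XS YS a \<omega>) = distr ?J (PiM I (\<lambda>_. RV d)) ?\<psi>" .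
  have \<psi>m: "?\<psi> \<in> measurable ?J (PiM I (\<lambda>_. RV d))" by (rule PiM_distr_pair(1)[OF L(1) M fin ne \<phi>m])
  have sm: "(\<lambda>\<omega>. \<lambda>a\<in>I. case_sum XS YS a \<omega>) \<in> measurable M (PiM I (\<lambda>_. RV d))"
    by (rule measurable_restrict) (rule rv)
  define E where "E = {x\<in>space (PiM I (\<lambda>_. RV d)). F x > z}"
  have E: "E \<in> sets (PiM I (\<lambda>_. RV d))" unfolding E_def using F unfolding I_def[symmetric] by measurable
  define E' where "E' = ?\<psi> -` E \<inter> space ?J"
  have E': "E' \<in> sets ?J" unfolding E'_def by (rule measurable_sets[OF \<psi>m E])
  have "measure M {\<omega>\<in>space M. F (\<lambda>a\<in>I. case_sum XS YS a \<omega>) > z} = measure (distr M (PiM I (\<lambda>_. RV d)) (\<lambda>\<omega>. \<lambda>a\<in>I. case_sum XS YS a \<omega>)) E"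
  proof -
    have "(\<lambda>\<omega>. \<lambda>a\<in>I. case_sum XS YS a \<omega>) -` E \<inter> space M = {\<omega>\<in>space M. F (\<lambda>a\<in>I. case_sum XS YS a \<omega>) > z}"
      unfolding E_def using measurable_space[OF sm] by auto
    then show ?thesis unfolding measure_distr[OF sm E] by simp
  qed
  also have "\<dots> = measure ?J E'" unfolding law measure_distr[OF \<psi>m E] E'_def ..
  also have "\<dots> = (\<integral>p. measure (PiM I (\<lambda>_. M)) (Pair p -` E') \<partial>PiM I (\<lambda>_. L))"
    by (rule measure_pair_integral(1)[OF _ _ E']) (intro prob_space_PiM L M)+
  finally have 1: "measure M {\<omega>\<in>space M. F (\<lambda>a\<in>I. case_sum XS YS a \<omega>) > z} = \<dots>" .
  have sec: "Pair p -` E' = {v\<in>space (PiM I (\<lambda>_. M)). F (\<lambda>a\<in>I. \<phi> a (p a, v a)) > z}" if "p \<in> space (PiM I (\<lambda>_. L))" for p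
    unfolding E'_def E_def using that measurable_space[OF \<psi>m] by (auto simp: space_pair_measure)
  show "measure M {\<omega>\<in>space M. F (\<lambda>a\<in>I. case_sum XS YS a \<omega>) > z} = (\<integral>p. G p \<partial>PiM I (\<lambda>_. L))"
    unfolding 1 G_def by (intro Bochner_Integration.integral_cong refl) (simp add: sec \<phi>_def)
  have "(\<lambda>p. measure (PiM I (\<lambda>_. M)) (Pair p -` E')) \<in> borel_measurable (PiM I (\<lambda>_. L))"
    by (rule measure_pair_integral(2)[OF _ _ E']) (intro prob_space_PiM L M)+
  then show "G \<in> borel_measurable (PiM I (\<lambda>_. L))"
    by (rule measurable_cong[THEN iffD1, rotated]) (simp add: G_def sec \<phi>_def)
qed

section \<open>The law of the scale factors\<close>

text \<open>Integrating the pointwise inequality over two independent copies produces each product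
  of means twice. The form with four functions covers the two non-strict comparisons of the scale
  functions at once.\<close>

lemma (in prob_space) chebyshev_symmetric:
  fixes \<phi>1 \<psi>1 \<phi>2 \<psi>2 :: "'a \<Rightarrow> real"
  assumes i: "integrable M \<phi>1" "integrable M \<psi>1" "integrable M \<phi>2" "integrable M \<psi>2"
    and le: "AE x in M. AE y in M. \<phi>1 x * \<psi>1 y + \<phi>1 y * \<psi>1 x \<le> \<phi>2 x * \<psi>2 y + \<phi>2 y * \<psi>2 x"
  shows "expectation \<phi>1 * expectation \<psi>1 \<le> expectation \<phi>2 * expectation \<psi>2"
proof -
  have "AE x in M. \<phi>1 x * expectation \<psi>1 + expectation \<phi>1 * \<psi>1 x \<le> \<phi>2 x * expectation \<psi>2 + expectation \<phi>2 * \<psi>2 x"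
    using le
  proof (rule AE_mp, intro AE_I2 impI)
    fix x assume "AE y in M. \<phi>1 x * \<psi>1 y + \<phi>1 y * \<psi>1 x \<le> \<phi>2 x * \<psi>2 y + \<phi>2 y * \<psi>2 x"
    then have "expectation (\<lambda>y. \<phi>1 x * \<psi>1 y + \<phi>1 y * \<psi>1 x) \<le> expectation (\<lambda>y. \<phi>2 x * \<psi>2 y + \<phi>2 y * \<psi>2 x)"
      using i by (intro integral_mono_AE) auto
    then show "\<phi>1 x * expectation \<psi>1 + expectation \<phi>1 * \<psi>1 x \<le> \<phi>2 x * expectation \<psi>2 + expectation \<phi>2 * \<psi>2 x"
      using i by simp
  qed
  then have "expectation (\<lambda>x. \<phi>1 x * expectation \<psi>1 + expectation \<phi>1 * \<psi>1 x) \<le>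
     expectation (\<lambda>x. \<phi>2 x * expectation \<psi>2 + expectation \<phi>2 * \<psi>2 x)"
    using i by (intro integral_mono_AE) auto
  then show ?thesis using i by simp
qed

text \<open>\<open>L\<close> is the law of \<open>r = 1 / P\<close> and \<open>g0\<close> the
  variance of the sequence. The moment assumptions are those on the inverse square of
  \<open>P\<close> and on \<open>P\<close> itself.\<close>

locale scale_law = prob_space L for L :: "real measure" +
  fixes g0 :: real
  assumes sets_L[measurable_cong]: "sets L = sets borel"
    and pos: "AE r in L. r > 0"
    and sq_int: "integrable L (\<lambda>r. r\<^sup>2)"
    and inv_int: "integrable L (\<lambda>r. 1 / r)"
    and g0: "g0 > 0"
    and nondeg: "\<not> (\<exists>c. AE r in L. r = c)"
begin

text \<open>\<open>wt r s\<close> is the limit in probability of \<open>sqrt d / \<parallel>Y\<^sub>j - X\<^sub>i\<parallel>\<close>, given that the scales of \<open>X\<^sub>i\<close> and \<open>Y\<^sub>j\<close> are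
  \<open>r\<close> and \<open>s\<close>.\<close>

definition wt :: "real \<Rightarrow> real \<Rightarrow> real" where "wt r s = 1 / sqrt (g0 * (r\<^sup>2 + s\<^sup>2))"
definition h :: "real \<Rightarrow> real" where "h r = (\<integral>s. wt r s \<partial>L)"
definition f :: "real \<Rightarrow> real" where "f r = r * h r"
definition e2 :: real where "e2 = (\<integral>r. r\<^sup>2 \<partial>L)"
definition \<kappa> :: real where "\<kappa> = (\<integral>r. (f r)\<^sup>2 \<partial>L)"
definition \<theta> :: real where "\<theta> = (\<integral>r. h r \<partial>L)"
definition \<beta> :: real where "\<beta> = 1 / sqrt g0"

lemma \<beta>_pos: "\<beta> > 0" unfolding \<beta>_def using g0 by simp

lemma space_L: "space L = UNIV" using sets_eq_imp_space_eq[OF sets_L] by simp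

lemma wt_sym: "wt r s = wt s r" by (simp add: wt_def add.commute)

lemma wt_nonneg: "wt r s \<ge> 0" unfolding wt_def using g0 by simp

lemma wt_pos: "r > 0 \<Longrightarrow> wt r s > 0" unfolding wt_def using g0 by (simp add: add_pos_nonneg)

lemma wt_meas[measurable]: "case_prod wt \<in> borel_measurable (borel \<Otimes>\<^sub>M borel)"
  unfolding wt_def by measurable

text \<open>The weight is unbounded near the origin, but its product with one of the two scales is
  not. This makes the variance terms of the sign statistic bounded.\<close>

lemma abs_wt_le: "\<bar>r\<bar> * wt r s \<le> \<beta>"
proof (cases "r = 0")
  case False
  have "\<bar>r\<bar> * sqrt g0 = sqrt (g0 * r\<^sup>2)" by (simp add: real_sqrt_mult mult.commute)
  also have "\<dots> \<le> sqrt (g0 * (r\<^sup>2 + s\<^sup>2))" using g0 by (intro real_sqrt_le_mono mult_left_mono) auto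
  finally have 1: "\<bar>r\<bar> * sqrt g0 \<le> sqrt (g0 * (r\<^sup>2 + s\<^sup>2))" .
  have "r\<^sup>2 + s\<^sup>2 > 0" using False by (simp add: sum_power2_gt_zero_iff)
  then have "sqrt (g0 * (r\<^sup>2 + s\<^sup>2)) > 0" using g0 by simp
  then show ?thesis unfolding wt_def \<beta>_def using 1 g0 by (simp add: field_simps)
qed (use \<beta>_pos in simp)

lemma wt_le: "s > 0 \<Longrightarrow> wt r s \<le> \<beta> * (1 / s)"
  using abs_wt_le[of s r] by (simp add: wt_sym field_simps)

lemma wt_int: "integrable L (wt r)"
proof (rule Bochner_Integration.integrable_bound[where f="\<lambda>s. \<beta> * (1 / s)"])
  show "integrable L (\<lambda>s. \<beta> * (1 / s))" using inv_int by (rule integrable_mult_right)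
  show "AE s in L. norm (wt r s) \<le> norm (\<beta> * (1 / s))"
    using pos
  proof eventually_elim
    case (elim s)
    then show ?case using wt_le[OF elim, of r] wt_nonneg[of r s] \<beta>_pos by simp
  qed
qed simp

lemma h_nonneg: "h r \<ge> 0" unfolding h_def using wt_nonneg by simp

lemma h_le: "h r \<le> \<beta> * (\<integral>s. 1 / s \<partial>L)"
proof -
  have i: "integrable L (\<lambda>s. \<beta> * (1 / s))" using inv_int by (rule integrable_mult_right)
  have "AE s in L. wt r s \<le> \<beta> * (1 / s)" using pos by eventually_elim (rule wt_le)
  then have "h r \<le> (\<integral>s. \<beta> * (1 / s) \<partial>L)"
    unfolding h_def by (intro integral_mono_AE wt_int i)
  then show ?thesis by (simp only: integral_mult_right_zero)
qed

lemma h_meas[measurable]: "h \<in> borel_measurable borel"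
  unfolding h_def by measurable

lemma f_meas[measurable]: "f \<in> borel_measurable borel"
  unfolding f_def by measurable

lemma f_eq: "f r = (\<integral>s. r * wt r s \<partial>L)"
  unfolding f_def h_def by simp

lemma f_bound: "\<bar>f r\<bar> \<le> \<beta>"
proof -
  have "\<bar>f r\<bar> = (\<integral>s. \<bar>r\<bar> * wt r s \<partial>L)"
    unfolding f_def h_def using h_nonneg[of r] by (simp add: abs_mult h_def)
  also have "\<dots> \<le> (\<integral>s. \<beta> \<partial>L)" using wt_int by (intro integral_mono abs_wt_le) auto
  finally show ?thesis by (simp add: prob_space)
qed

lemma int_h: "integrable L h"
  using h_nonneg h_le by (intro integrable_bounded[where K="\<beta> * (\<integral>s. 1 / s \<partial>L)"]) auto

lemma int_f: "integrable L f" and int_f2: "integrable L (\<lambda>r. (f r)\<^sup>2)"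
  using f_bound by (auto intro!: integrable_bounded[where K=\<beta>] integrable_square_bounded[where K=\<beta>])

lemma int_id: "integrable L (\<lambda>r. r)"
  by (rule integrable_of_square[OF _ sq_int]) simp

lemma int_fid: "integrable L (\<lambda>r. f r * r)"
  by (rule integrable_mult_of_squares) (use int_f2 sq_int in auto)

lemma h_strict_mono:
  assumes "0 < x" "x < y"
  shows "h y < h x"
proof -
  have d: "wt y s < wt x s" for s
  proof -
    have "x\<^sup>2 < y\<^sup>2" using assms by (intro power_strict_mono) auto
    moreover have "x\<^sup>2 > 0" using assms by simp
    ultimately have "0 < g0 * (x\<^sup>2 + s\<^sup>2)" "g0 * (x\<^sup>2 + s\<^sup>2) < g0 * (y\<^sup>2 + s\<^sup>2)"
      using g0 by (auto simp: add_pos_nonneg)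
    then show ?thesis unfolding wt_def by (intro divide_strict_left_mono) auto
  qed
  have "h x - h y = (\<integral>s. wt x s - wt y s \<partial>L)" unfolding h_def using wt_int by simp
  moreover have "(\<integral>s. wt x s - wt y s \<partial>L) \<ge> 0" using d by (simp add: less_imp_le)
  moreover have "(\<integral>s. wt x s - wt y s \<partial>L) \<noteq> 0"
  proof
    assume "(\<integral>s. wt x s - wt y s \<partial>L) = 0"
    then have "AE s in L. wt x s - wt y s = 0"
      using d wt_int by (subst (asm) integral_nonneg_eq_0_iff_AE) (auto simp: less_imp_le)
    then have "AE s in L. False"
    proof eventually_elim
      case (elim s)
      then show False using d[of s] by simp
    qed
    then show False by (simp add: ae_filter_bot)
  qed
  ultimately show ?thesis by linarith
qed

lemma h_anti: "0 < x \<Longrightarrow> 0 < y \<Longrightarrow> (x - y) * (h x - h y) \<le> 0"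
  using h_strict_mono[of x y] h_strict_mono[of y x]
  by (cases x y rule: linorder_cases) (auto simp: mult_le_0_iff)

text \<open>For positive r, \<open>r * wt r s\<close> is the reciprocal of the root of
  \<open>g0 * (1 + (s / r)\<^sup>2)\<close>, which increases in r; the average over \<open>s\<close>
  inherits this.\<close>

lemma f_mono:
  assumes "0 < x" "x \<le> y"
  shows "f x \<le> f y"
  unfolding f_eq
proof (rule integral_mono)
  fix s
  have px: "x\<^sup>2 + s\<^sup>2 > 0" and py: "y\<^sup>2 + s\<^sup>2 > 0" using assms by (auto simp: sum_power2_gt_zero_iff)
  have "x\<^sup>2 \<le> y\<^sup>2" using assms by (intro power_mono) auto
  then have "x\<^sup>2 * (y\<^sup>2 + s\<^sup>2) \<le> y\<^sup>2 * (x\<^sup>2 + s\<^sup>2)"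
    using mult_right_mono[of "x\<^sup>2" "y\<^sup>2" "s\<^sup>2"] by (simp add: algebra_simps)
  then have "g0 * (x\<^sup>2 * (y\<^sup>2 + s\<^sup>2)) \<le> g0 * (y\<^sup>2 * (x\<^sup>2 + s\<^sup>2))" using g0 by simp
  then have "sqrt (x\<^sup>2 * (g0 * (y\<^sup>2 + s\<^sup>2))) \<le> sqrt (y\<^sup>2 * (g0 * (x\<^sup>2 + s\<^sup>2)))"
    by (intro real_sqrt_le_mono) (simp add: mult_ac)
  then have 1: "x * sqrt (g0 * (y\<^sup>2 + s\<^sup>2)) \<le> y * sqrt (g0 * (x\<^sup>2 + s\<^sup>2))"
    using assms by (simp add: real_sqrt_mult[of "_\<^sup>2"])
  have "sqrt (g0 * (x\<^sup>2 + s\<^sup>2)) > 0" "sqrt (g0 * (y\<^sup>2 + s\<^sup>2)) > 0" using px py g0 by auto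
  then show "x * wt x s \<le> y * wt y s" unfolding wt_def using 1 by (simp add: field_simps)
qed (use wt_int in auto)

lemma f_h_anti: "0 < x \<Longrightarrow> 0 < y \<Longrightarrow> (f x - f y) * (h x - h y) \<le> 0"
  using h_strict_mono[of x y] h_strict_mono[of y x] f_mono[of x y] f_mono[of y x]
  by (cases x y rule: linorder_cases) (auto simp: mult_le_0_iff)

lemma AE2_mono:
  assumes R: "\<And>x y. 0 < x \<Longrightarrow> 0 < y \<Longrightarrow> R x y"
  shows "AE x in L. AE y in L. R x y"
  using pos
proof eventually_elim
  case (elim x)
  show ?case using pos by eventually_elim (rule R[OF elim])
qed

lemma mean_pos: "(\<integral>r. r \<partial>L) > 0" and e2_pos: "e2 > 0"
proof -
  have z: "(\<integral>r. q r \<partial>L) > 0" if "integrable L q" "\<And>r. r > 0 \<Longrightarrow> q r > 0" for q :: "real \<Rightarrow> real"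
  proof -
    have nn: "AE r in L. 0 \<le> q r" using pos that(2) by (auto elim!: eventually_mono intro: less_imp_le)
    have "(\<integral>r. q r \<partial>L) \<noteq> 0"
    proof
      assume "(\<integral>r. q r \<partial>L) = 0"
      then have "AE r in L. q r = 0" using that(1) nn by (subst (asm) integral_nonneg_eq_0_iff_AE) auto
      with pos have "AE r in L. False" by eventually_elim (use that(2) in force)
      then show False by (simp add: ae_filter_bot)
    qed
    moreover have "(\<integral>r. q r \<partial>L) \<ge> 0" by (rule integral_nonneg_AE[OF nn])
    ultimately show ?thesis by simp
  qed
  show "(\<integral>r. r \<partial>L) > 0" by (rule z[OF int_id])
  show "e2 > 0" unfolding e2_def by (rule z[OF sq_int]) simp
qed

lemma h_pos: "r > 0 \<Longrightarrow> h r > 0"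
  using h_strict_mono[of r "r + 1"] h_nonneg[of "r + 1"] by linarith

lemma \<kappa>_pos: "\<kappa> > 0"
proof -
  have "\<kappa> \<noteq> 0"
  proof
    assume "\<kappa> = 0"
    then have "AE r in L. (f r)\<^sup>2 = 0" unfolding \<kappa>_def
      using int_f2 by (subst (asm) integral_nonneg_eq_0_iff_AE) auto
    with pos have "AE r in L. False"
    proof eventually_elim
      case (elim r)
      then show False using h_pos[of r] by (simp add: f_def)
    qed
    then show False by (simp add: ae_filter_bot)
  qed
  moreover have "\<kappa> \<ge> 0" unfolding \<kappa>_def by simp
  ultimately show ?thesis by simp
qed

text \<open>Chebyshev's association inequality, three times: \<open>h\<close> decreases while \<open>r\<close> and \<open>f r = r h r\<close>
  increase. Strictness comes from the non-degeneracy of the scales.\<close>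

lemma f_mean_less: "(\<integral>r. f r \<partial>L) < (\<integral>r. r \<partial>L) * \<theta>"
proof -
  let ?m = "\<integral>r. r \<partial>L"
  \<comment> \<open>The integrand of Chebyshev's inequality with one of the two copies integrated
    out. It is nonnegative for positive arguments and its mean is twice the gap to be shown
    positive.\<close>
  define k where "k x = (\<integral>y. (x - y) * (h y - h x) \<partial>L)" for x
  have int: "integrable L (\<lambda>y. (x - y) * (h y - h x))" for x
  proof -
    have "(\<lambda>y. (x - y) * (h y - h x)) = (\<lambda>y. x * h y - x * h x - f y + y * h x)"
      by (auto simp: f_def algebra_simps)
    then show ?thesis using int_h int_f int_id by simp
  qed
  have k: "k x = x * \<theta> - x * h x - (\<integral>r. f r \<partial>L) + ?m * h x" for x
  proof -
    have "k x = (\<integral>y. x * h y - x * h x - f y + y * h x \<partial>L)"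
      unfolding k_def by (intro Bochner_Integration.integral_cong) (auto simp: f_def algebra_simps)
    then show ?thesis using int_h int_f int_id by (simp add: \<theta>_def prob_space)
  qed
  have ik: "integrable L k" unfolding k
    using int_h int_f int_id by (auto simp flip: f_def)
  have Ek: "(\<integral>x. k x \<partial>L) = 2 * (?m * \<theta> - (\<integral>r. f r \<partial>L))"
  proof -
    have "(\<integral>x. k x \<partial>L) = (\<integral>x. x * \<theta> - f x - (\<integral>r. f r \<partial>L) + ?m * h x \<partial>L)"
      unfolding k f_def ..
    then show ?thesis using int_h int_f int_id by (simp add: \<theta>_def prob_space)
  qed
  have nn: "(x - y) * (h y - h x) \<ge> 0" if "0 < x" "0 < y" for x y
    using h_anti[OF that] by (simp add: algebra_simps)
  have knn: "k x \<ge> 0" if "x > 0" for x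
    unfolding k_def using pos nn[OF that] by (intro integral_nonneg_AE) (auto elim!: eventually_mono)
  have "(\<integral>x. k x \<partial>L) \<ge> 0" using pos knn by (intro integral_nonneg_AE) (auto elim!: eventually_mono)
  moreover have "(\<integral>x. k x \<partial>L) \<noteq> 0"
  proof
    assume "(\<integral>x. k x \<partial>L) = 0"
    then have "AE x in L. k x = 0"
      using ik pos knn by (subst (asm) integral_nonneg_eq_0_iff_AE) (auto elim!: eventually_mono)
    with pos have "AE x in L. k x = 0 \<and> x > 0" by eventually_elim auto
    \<comment> \<open>If the gap were zero, some positive \<open>x\<close> would have
      \<open>k x = 0\<close>. Since \<open>h\<close> is strictly monotone, almost every scale would
      then equal \<open>x\<close>, against non-degeneracy.\<close>
    then obtain x where x: "k x = 0" "x > 0"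
      using eventually_happens[of "\<lambda>x. k x = 0 \<and> x > 0" "ae_filter L"] by (auto simp: ae_filter_bot)
    have "AE y in L. (x - y) * (h y - h x) = 0"
      using x(1) int pos nn[OF x(2)] unfolding k_def
      by (subst (asm) integral_nonneg_eq_0_iff_AE) (auto elim!: eventually_mono)
    with pos have "AE y in L. y = x"
    proof eventually_elim
      case (elim y)
      then show ?case using h_strict_mono[of x y] h_strict_mono[of y x] x(2)
        by (cases x y rule: linorder_cases) auto
    qed
    then show False using nondeg by blast
  qed
  ultimately have "0 < (\<integral>x. k x \<partial>L)" by simp
  then show ?thesis unfolding Ek by simp
qed

text \<open>With m, F and G the means of \<open>r\<close>, \<open>f r\<close> and
  \<open>r f r\<close>, two comparisons give \<open>\<kappa> m \<le> G F\<close> and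
  \<open>G m \<le> e2 F\<close>; together they bound \<open>\<kappa> m\<^sup>2\<close> by
  \<open>e2 F\<^sup>2\<close>, and the strict inequality between F and \<open>m \<theta>\<close>
  finishes. The product \<open>r f r\<close> mediates between \<open>(f r)\<^sup>2\<close> and
  \<open>r\<^sup>2\<close>.\<close>

theorem \<kappa>_less: "\<kappa> < e2 * \<theta>\<^sup>2"
proof -
  let ?m = "\<integral>r. r \<partial>L" and ?F = "\<integral>r. f r \<partial>L" and ?G = "\<integral>r. f r * r \<partial>L"
  have 1: "\<kappa> * ?m \<le> ?G * ?F"
    unfolding \<kappa>_def
  proof (rule chebyshev_symmetric[OF int_f2 int_id int_fid int_f], rule AE2_mono)
    fix x y :: real assume p: "0 < x" "0 < y"
    have "(f x)\<^sup>2 * y + (f y)\<^sup>2 * x - (f x * x * f y + f y * y * f x) = x * y * ((f x - f y) * (h x - h y))"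
      unfolding f_def by (simp add: algebra_simps power2_eq_square)
    also have "\<dots> \<le> 0" using f_h_anti[OF p] p by (simp add: mult_nonneg_nonpos)
    finally show "(f x)\<^sup>2 * y + (f y)\<^sup>2 * x \<le> f x * x * f y + f y * y * f x" by simp
  qed
  have 2: "?G * ?m \<le> e2 * ?F"
    unfolding e2_def
  proof (rule chebyshev_symmetric[OF int_fid int_id sq_int int_f], rule AE2_mono)
    fix x y :: real assume p: "0 < x" "0 < y"
    have "f x * x * y + f y * y * x - (x\<^sup>2 * f y + y\<^sup>2 * f x) = x * y * ((x - y) * (h x - h y))"
      unfolding f_def by (simp add: algebra_simps power2_eq_square)
    also have "\<dots> \<le> 0" using h_anti[OF p] p by (simp add: mult_nonneg_nonpos)
    finally show "f x * x * y + f y * y * x \<le> x\<^sup>2 * f y + y\<^sup>2 * f x" by simp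
  qed
  have F0: "?F \<ge> 0" using pos by (intro integral_nonneg_AE) (auto elim!: eventually_mono simp: f_def h_nonneg)
  have "\<kappa> * ?m * ?m \<le> ?G * ?F * ?m" using 1 mean_pos by (intro mult_right_mono) auto
  also have "\<dots> = (?G * ?m) * ?F" by (simp add: mult_ac)
  also have "\<dots> \<le> (e2 * ?F) * ?F" using 2 F0 by (intro mult_right_mono) auto
  also have "\<dots> = e2 * ?F\<^sup>2" by (simp add: power2_eq_square)
  also have "\<dots> < e2 * (?m * \<theta>)\<^sup>2"
    using f_mean_less F0 e2_pos by (intro mult_strict_left_mono power_strict_mono) auto
  finally have "\<kappa> * ?m\<^sup>2 < (e2 * \<theta>\<^sup>2) * ?m\<^sup>2" by (simp add: power2_eq_square mult_ac)
  then show ?thesis using mean_pos by (simp add: mult_less_cancel_right)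
qed

end

section \<open>Averages over two independent samples\<close>

definition avg :: "'a set \<Rightarrow> ('a \<Rightarrow> real) \<Rightarrow> real" where
  "avg A F = (\<Sum>x\<in>A. F x) / real (card A)"

definition dp :: "'a set \<Rightarrow> ('a \<times> 'a) set" where
  "dp A = {z \<in> A \<times> A. fst z \<noteq> snd z}"

lemma dp_sub: "dp A \<subseteq> A \<times> A" by (auto simp: dp_def)

lemma finite_dp[simp]: "finite A \<Longrightarrow> finite (dp A)"
  by (rule finite_subset[OF dp_sub]) simp

lemma sum_dp: "finite A \<Longrightarrow> (\<Sum>i\<in>A. \<Sum>i'\<in>A - {i}. F i i') = (\<Sum>z\<in>dp A. F (fst z) (snd z))"
  by (subst sum.Sigma) (auto intro!: sum.cong simp: dp_def)

lemma card_dp: "finite A \<Longrightarrow> card (dp A) = card A * (card A - 1)"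
proof -
  assume A: "finite A"
  have "card (dp A) = (\<Sum>i\<in>A. \<Sum>i'\<in>A - {i}. 1)" using A by (subst sum_dp) auto
  also have "\<dots> = card A * (card A - 1)" using A by (simp add: card_Diff_singleton)
  finally show ?thesis .
qed

lemma avg_bound:
  assumes "\<And>x. x \<in> A \<Longrightarrow> \<bar>F x\<bar> \<le> K" "K \<ge> 0"
  shows "\<bar>avg A F\<bar> \<le> K"
proof (cases "card A = 0")
  case False
  have "\<bar>\<Sum>x\<in>A. F x\<bar> \<le> (\<Sum>x\<in>A. \<bar>F x\<bar>)" by (rule sum_abs)
  also have "\<dots> \<le> real (card A) * K" using assms sum_bounded_above[of A "\<lambda>x. \<bar>F x\<bar>" K] by simp
  finally show ?thesis unfolding avg_def using False by (simp add: abs_divide divide_le_eq mult.commute)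
qed (use assms in \<open>simp add: avg_def\<close>)

lemma avg_diff: "avg A F - avg A G = avg A (\<lambda>x. F x - G x)"
  by (simp add: avg_def sum_subtractf diff_divide_distrib)

lemma avg_close:
  assumes "\<And>x. x \<in> A \<Longrightarrow> \<bar>F x - G x\<bar> \<le> K" "K \<ge> 0"
  shows "\<bar>avg A F - avg A G\<bar> \<le> K"
  unfolding avg_diff using assms by (rule avg_bound)

lemma avg_const: "finite A \<Longrightarrow> A \<noteq> {} \<Longrightarrow> avg A (\<lambda>_. c) = c"
  by (simp add: avg_def)

lemma avg_prod:
  "avg (A \<times> B) (\<lambda>z. F (fst z) * G (snd z)) = avg A F * avg B G"
  unfolding avg_def by (simp add: sum_product sum.cartesian_product card_cartesian_product case_prod_beta)

lemma avg_avg: "avg (A \<times> B) F = avg A (\<lambda>x. avg B (\<lambda>y. F (x, y)))"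
  unfolding avg_def by (simp add: sum.cartesian_product' card_cartesian_product sum_divide_distrib ac_simps)

lemma avg_mult_left: "c * avg A F = avg A (\<lambda>x. c * F x)"
  by (simp add: avg_def sum_distrib_left)

lemma avg_prod2: "avg A (\<lambda>x. avg B (\<lambda>y. F x * G y)) = avg A F * avg B G"
  using avg_prod[of A B F G] by (simp add: avg_avg)

lemma avg_dp_fst:
  assumes "finite A" "card A \<ge> 2"
  shows "avg (dp A) (\<lambda>z. F (fst z)) = avg A F"
proof -
  have "(\<Sum>z\<in>dp A. F (fst z)) = (\<Sum>i\<in>A. \<Sum>i'\<in>A - {i}. F i)"
    by (rule sum_dp[OF assms(1), symmetric])
  also have "\<dots> = real (card A - 1) * (\<Sum>i\<in>A. F i)"
    unfolding sum_distrib_left using assms by (intro sum.cong refl) (simp add: card_Diff_singleton)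
  finally show ?thesis unfolding avg_def using assms by (simp add: card_dp)
qed

lemma avg_dp_snd:
  assumes "finite A" "card A \<ge> 2"
  shows "avg (dp A) (\<lambda>z. F (snd z)) = avg A F"
proof -
  have "(\<Sum>z\<in>dp A. F (snd z)) = (\<Sum>z\<in>dp A. F (fst z))"
    by (rule sum.reindex_bij_witness[of _ prod.swap prod.swap]) (auto simp: dp_def)
  then show ?thesis using avg_dp_fst[OF assms, of F] by (simp add: avg_def)
qed

lemma avg_cong: "(\<And>x. x \<in> A \<Longrightarrow> F x = G x) \<Longrightarrow> avg A F = avg A G"
  by (simp add: avg_def)

text \<open>If a fraction q of the indices is deleted, the full average is 1 - q times the remaining
  one plus a part of size at most \<open>q K\<close>. Applied to diagonals, this replaces averages
  over distinct indices by averages that factorize.\<close>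

lemma avg_sub:
  assumes A: "finite A" and D: "D \<subseteq> A" "D \<noteq> {}" and F: "\<And>x. x \<in> A \<Longrightarrow> \<bar>F x\<bar> \<le> K"
  shows "\<bar>avg A F - avg D F\<bar> \<le> 2 * K * (1 - real (card D) / real (card A))"
proof -
  have fD: "finite D" using A D finite_subset by blast
  have cD: "card D > 0" "card D \<le> card A" using fD D A by (auto simp: card_gt_0_iff card_mono)
  define q where "q = 1 - real (card D) / real (card A)"
  have q: "q \<ge> 0" "q = real (card (A - D)) / real (card A)"
    unfolding q_def using cD D fD by (auto simp: card_Diff_subset divide_simps of_nat_diff)
  have K0: "K \<ge> 0" using F D by force
  have "avg A F = (\<Sum>x\<in>D. F x) / real (card A) + (\<Sum>x\<in>A - D. F x) / real (card A)"
    unfolding avg_def using sum.subset_diff[OF D(1) A, of F] by (simp add: add_divide_distrib)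
  moreover have "(\<Sum>x\<in>D. F x) / real (card A) = (1 - q) * avg D F"
    unfolding avg_def q_def using cD by simp
  ultimately have e: "avg A F - avg D F = (\<Sum>x\<in>A - D. F x) / real (card A) - q * avg D F"
    by (simp add: algebra_simps)
  have "\<bar>\<Sum>x\<in>A - D. F x\<bar> \<le> (\<Sum>x\<in>A - D. \<bar>F x\<bar>)" by (rule sum_abs)
  also have "\<dots> \<le> real (card (A - D)) * K" using F sum_bounded_above[of "A - D" "\<lambda>x. \<bar>F x\<bar>" K] by simp
  finally have "\<bar>(\<Sum>x\<in>A - D. F x) / real (card A)\<bar> \<le> q * K"
    unfolding q(2) by (simp add: abs_divide divide_right_mono)
  moreover have "\<bar>q * avg D F\<bar> \<le> q * K"
  proof -
    have "\<bar>avg D F\<bar> \<le> K" by (rule avg_bound) (use F D K0 in auto)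
    then show ?thesis using q(1) by (simp add: abs_mult mult_left_mono)
  qed
  ultimately have "\<bar>avg A F - avg D F\<bar> \<le> q * K + q * K"
    unfolding e by (intro order_trans[OF abs_triangle_ineq4] add_mono)
  then show ?thesis unfolding q_def[symmetric] by (simp add: mult_ac)
qed

lemma ratio_dp:
  assumes "finite A" "A \<noteq> {}"
  shows "1 - real (card (dp A)) / real (card (A \<times> A)) = 1 / real (card A)"
proof -
  have c: "card A > 0" using assms by (simp add: card_gt_0_iff)
  then have e: "real (card (dp A)) = real (card A) * (real (card A) - 1)"
    using assms by (simp add: card_dp of_nat_diff)
  have "1 - x * (x - 1) / (x * x) = 1 / x" if "x > 0" for x :: real
    using that by (simp add: field_simps)
  then show ?thesis using c by (simp add: card_cartesian_product e)
qed

lemma dp_nonempty: "card A \<ge> 2 \<Longrightarrow> dp A \<noteq> {}"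
proof -
  assume A: "card A \<ge> 2"
  then have "finite A" by (metis card.infinite not_numeral_le_zero)
  then have "card (dp A) > 0" using A by (simp add: card_dp)
  then show ?thesis by auto
qed

lemma square_diff_le:
  fixes x y :: real
  assumes "\<bar>x\<bar> \<le> K" "\<bar>y\<bar> \<le> K"
  shows "\<bar>x\<^sup>2 - y\<^sup>2\<bar> \<le> 2 * K * \<bar>x - y\<bar>"
proof -
  have "\<bar>x\<^sup>2 - y\<^sup>2\<bar> = \<bar>x + y\<bar> * \<bar>x - y\<bar>" by (simp add: power2_eq_square algebra_simps flip: abs_mult)
  also have "\<dots> \<le> (2 * K) * \<bar>x - y\<bar>" using assms by (intro mult_right_mono) auto
  finally show ?thesis .
qed

lemma prod_diff_le:
  fixes x y a b :: real
  assumes "\<bar>y\<bar> \<le> K" "\<bar>a\<bar> \<le> K"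
  shows "\<bar>x * y - a * b\<bar> \<le> K * (\<bar>x - a\<bar> + \<bar>y - b\<bar>)"
proof -
  have "\<bar>x * y - a * b\<bar> = \<bar>(x - a) * y + a * (y - b)\<bar>" by (simp add: algebra_simps)
  also have "\<dots> \<le> \<bar>x - a\<bar> * \<bar>y\<bar> + \<bar>a\<bar> * \<bar>y - b\<bar>" using abs_triangle_ineq[of "(x - a) * y" "a * (y - b)"] by (simp add: abs_mult)
  also have "\<dots> \<le> \<bar>x - a\<bar> * K + K * \<bar>y - b\<bar>" using assms by (intro add_mono mult_left_mono mult_right_mono) auto
  finally show ?thesis by (simp add: algebra_simps)
qed

lemma (in prob_space) mean_abs_le_sqrt:
  fixes Z :: "'a \<Rightarrow> real"
  assumes [measurable]: "Z \<in> borel_measurable M" and i: "integrable M (\<lambda>x. (Z x)\<^sup>2)" and c: "expectation (\<lambda>x. (Z x)\<^sup>2) \<le> c\<^sup>2" "c \<ge> 0"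
  shows "expectation (\<lambda>x. \<bar>Z x\<bar>) \<le> c"
proof -
  have "\<bar>expectation (\<lambda>x. \<bar>Z x\<bar> * 1)\<bar> \<le> sqrt (expectation (\<lambda>x. \<bar>Z x\<bar>\<^sup>2)) * sqrt (expectation (\<lambda>x. 1\<^sup>2))"
    using i by (intro integral_Cauchy_Schwarz) auto
  also have "\<dots> = sqrt (expectation (\<lambda>x. (Z x)\<^sup>2))" by (simp add: prob_space)
  also have "\<dots> \<le> c" using real_sqrt_le_mono[OF c(1)] c(2) by simp
  finally show ?thesis by simp
qed

section \<open>Resampling and laws of large numbers for independent scales\<close>

locale real_law = prob_space L for L :: "real measure" +
  assumes sets_L[measurable_cong]: "sets L = sets borel"
begin

lemma space_L: "space L = UNIV" using sets_eq_imp_space_eq[OF sets_L] by simp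

abbreviation N :: "'i set \<Rightarrow> ('i \<Rightarrow> real) measure" where "N I \<equiv> PiM I (\<lambda>_. L)"

lemma N_prob: "prob_space (N I)" by (intro prob_space_PiM prob_space_axioms)

text \<open>Replacing one coordinate by a fresh independent value does not change the law. This
  gives conditional integration over any coordinate without splitting the product space
  anew.\<close>

lemma nn_resample:
  assumes j: "j \<in> I" and F: "F \<in> borel_measurable (N I)"
  shows "(\<integral>\<^sup>+p. F p \<partial>N I) = (\<integral>\<^sup>+p. \<integral>\<^sup>+y. F (p(j := y)) \<partial>L \<partial>N I)"
    and "(\<lambda>p. \<integral>\<^sup>+y. F (p(j := y)) \<partial>L) \<in> borel_measurable (N I)"
proof -
  define I' where "I' = I - {j}"
  have I: "I = insert j I'" using j by (auto simp: I'_def)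
  interpret P: prob_space "N I'" by (rule N_prob)
  interpret LP: pair_prob_space L "N I'" ..
  have u: "(\<lambda>(x, X). X(j := x)) \<in> measurable (L \<Otimes>\<^sub>M N I') (N I)"
    unfolding I by measurable
  have D: "N I = distr (L \<Otimes>\<^sub>M N I') (N I) (\<lambda>(x, X). X(j := x))"
    unfolding I by (rule distr_pair_PiM_eq_PiM[symmetric]) (rule prob_space_axioms)+
  have u2: "(\<lambda>z. (fst z)(j := snd z)) \<in> measurable (N I \<Otimes>\<^sub>M L) (N I)"
    by (rule measurable_fun_upd[where J=I]) (use j in auto)
  have F2: "(\<lambda>z. F ((fst z)(j := snd z))) \<in> borel_measurable (N I \<Otimes>\<^sub>M L)"
    by (rule measurable_compose[OF u2 F])
  show Gm: "(\<lambda>p. \<integral>\<^sup>+y. F (p(j := y)) \<partial>L) \<in> borel_measurable (N I)"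
    using borel_measurable_nn_integral_fst[OF F2] by simp
  have Fu: "(\<lambda>z. F (case z of (x, X) \<Rightarrow> X(j := x))) \<in> borel_measurable (L \<Otimes>\<^sub>M N I')"
    by (rule measurable_compose[OF u F])
  have 1: "(\<integral>\<^sup>+p. F p \<partial>N I) = (\<integral>\<^sup>+X. \<integral>\<^sup>+x. F (X(j := x)) \<partial>L \<partial>N I')"
  proof -
    have "(\<integral>\<^sup>+p. F p \<partial>N I) = (\<integral>\<^sup>+z. F (case z of (x, X) \<Rightarrow> X(j := x)) \<partial>(L \<Otimes>\<^sub>M N I'))"
      by (subst D) (simp add: nn_integral_distr[OF u] F)
    then show ?thesis by (simp add: LP.nn_integral_snd[OF Fu, symmetric])
  qed
  have "(\<integral>\<^sup>+p. \<integral>\<^sup>+y. F (p(j := y)) \<partial>L \<partial>N I) = (\<integral>\<^sup>+z. \<integral>\<^sup>+y. F ((case z of (x, X) \<Rightarrow> X(j := x))(j := y)) \<partial>L \<partial>(L \<Otimes>\<^sub>M N I'))"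
    by (subst D) (simp add: nn_integral_distr[OF u] Gm)
  also have "\<dots> = (\<integral>\<^sup>+X. \<integral>\<^sup>+x. \<integral>\<^sup>+y. F ((X(j := x))(j := y)) \<partial>L \<partial>L \<partial>N I')"
    using measurable_compose[OF u Gm] by (subst LP.nn_integral_snd[symmetric]) simp_all
  also have "\<dots> = (\<integral>\<^sup>+X. \<integral>\<^sup>+y. F (X(j := y)) \<partial>L \<partial>N I')"
    by (simp add: emeasure_space_1)
  finally show "(\<integral>\<^sup>+p. F p \<partial>N I) = (\<integral>\<^sup>+p. \<integral>\<^sup>+y. F (p(j := y)) \<partial>L \<partial>N I)" unfolding 1 by simp
qed

text \<open>Adding \<open>K\<close> makes the integrand nonnegative, so that the resampling identity
  applies; \<open>K\<close> is subtracted again at the end.\<close>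

lemma resample_zero:
  fixes F :: "('i \<Rightarrow> real) \<Rightarrow> real"
  assumes j: "j \<in> I" and F: "F \<in> borel_measurable (N I)" and K: "\<And>p. \<bar>F p\<bar> \<le> K"
    and z: "\<And>p. (\<integral>y. F (p(j := y)) \<partial>L) = 0"
  shows "(\<integral>p. F p \<partial>N I) = 0"
proof -
  interpret P: prob_space "N I" by (rule N_prob)
  have K0: "F p + K \<ge> 0" for p using K[of p] by linarith
  have u: "(\<lambda>y. p(j := y)) \<in> measurable L (N I)" if "p \<in> space (N I)" for p
    by (rule measurable_fun_upd[where J=I]) (use j that in auto)
  have i: "integrable L (\<lambda>y. F (p(j := y)))" if "p \<in> space (N I)" for p
    by (rule integrable_bounded[OF measurable_compose[OF u[OF that] F]]) (rule K)
  have "ennreal ((\<integral>p. F p \<partial>N I) + K) = ennreal (\<integral>p. F p + K \<partial>N I)"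
    using P.integrable_bounded[OF F K] by (simp add: P.prob_space)
  also have "\<dots> = (\<integral>\<^sup>+p. ennreal (F p + K) \<partial>N I)"
    using P.integrable_bounded[OF F K] K0 by (subst nn_integral_eq_integral) auto
  also have "\<dots> = (\<integral>\<^sup>+p. \<integral>\<^sup>+y. ennreal (F (p(j := y)) + K) \<partial>L \<partial>N I)"
    by (rule nn_resample(1)[OF j]) (use F in measurable)
  also have "\<dots> = (\<integral>\<^sup>+p. ennreal K \<partial>N I)"
  proof (rule nn_integral_cong)
    fix p assume p: "p \<in> space (N I)"
    have "(\<integral>\<^sup>+y. ennreal (F (p(j := y)) + K) \<partial>L) = ennreal (\<integral>y. F (p(j := y)) + K \<partial>L)"
      using i[OF p] K0 by (subst nn_integral_eq_integral) auto
    then show "(\<integral>\<^sup>+y. ennreal (F (p(j := y)) + K) \<partial>L) = ennreal K" using i[OF p] z by (simp add: prob_space)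
  qed
  finally have "ennreal ((\<integral>p. F p \<partial>N I) + K) = ennreal K" by (simp add: P.emeasure_space_1)
  moreover have "(\<integral>p. F p \<partial>N I) + K \<ge> 0" using P.abs_expectation_le[OF F K] by linarith
  moreover have "K \<ge> 0" using order_trans[OF abs_ge_zero K] .
  ultimately show ?thesis by simp
qed

lemma coord2_meas:
  assumes g: "case_prod g \<in> borel_measurable (borel \<Otimes>\<^sub>M borel)" and "i \<in> I" "j \<in> I"
  shows "(\<lambda>p. g (p i) (p j)) \<in> borel_measurable (N I)"
proof -
  have c: "(\<lambda>p. p k) \<in> borel_measurable (N I)" if "k \<in> I" for k
    using measurable_component_singleton[OF that, of "\<lambda>_. L"] by (simp add: measurable_cong_sets[OF refl sets_L])
  show ?thesis using measurable_compose[OF measurable_Pair[OF c[OF assms(2)] c[OF assms(3)]] g] by simp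
qed

text \<open>Given \<open>p i\<close>, the deviations are centred in the coordinate \<open>j\<close>,
  and resampling that coordinate shows that different deviations are orthogonal. Only the diagonal
  of the second moment remains.\<close>

lemma cond_lln:
  fixes g :: "real \<Rightarrow> real \<Rightarrow> real"
  assumes g: "case_prod g \<in> borel_measurable (borel \<Otimes>\<^sub>M borel)" and K: "\<And>x y. \<bar>g x y\<bar> \<le> K"
    and J: "finite J" "J \<noteq> {}" "J \<subseteq> I" and i: "i \<in> I" "i \<notin> J"
  shows "(\<integral>p. \<bar>avg J (\<lambda>j. g (p i) (p j)) - (\<integral>y. g (p i) y \<partial>L)\<bar> \<partial>N I) \<le> 2 * K / sqrt (real (card J))"
proof -
  interpret P: prob_space "N I" by (rule N_prob)
  define gb where "gb x = (\<integral>y. g x y \<partial>L)" for x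
  have gL: "case_prod g \<in> borel_measurable (borel \<Otimes>\<^sub>M L)"
    using g by (simp cong: measurable_cong_sets)
  have gbm: "gb \<in> borel_measurable borel" unfolding gb_def
    using borel_measurable_lebesgue_integral[OF gL] by simp
  have gi: "integrable L (g x)" for x
  proof (rule integrable_bounded[OF _ K])
    show "g x \<in> borel_measurable L" using measurable_Pair2[OF gL, of x] by simp
  qed
  have K0: "K \<ge> 0" using order_trans[OF abs_ge_zero K] .
  have gbK: "\<bar>gb x\<bar> \<le> K" for x unfolding gb_def using abs_expectation_le[OF _ K] gi by auto
  define D where "D j p = g (p i) (p j) - gb (p i)" for j and p :: "'a \<Rightarrow> real"
  have gbi: "(\<lambda>p. gb (p i)) \<in> borel_measurable (N I)"
    using coord2_meas[of "\<lambda>x y. gb x" i I i] i gbm by simp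
  have Dm: "D j \<in> borel_measurable (N I)" if "j \<in> J" for j
    unfolding D_def using coord2_meas[OF g, of i I j] that J i gbi by auto
  have DK: "\<bar>D j p\<bar> \<le> 2 * K" for j p unfolding D_def using K[of "p i" "p j"] gbK[of "p i"] by linarith
  have DDK: "\<bar>D j p * D j' p\<bar> \<le> 4 * K\<^sup>2" for j j' p
    unfolding abs_mult using mult_mono[OF DK[of j p] DK[of j' p]] K0 by (simp add: power2_eq_square)
  have DDi: "integrable (N I) (\<lambda>p. D j p * D j' p)" if "j \<in> J" "j' \<in> J" for j j'
    using Dm that by (intro P.integrable_bounded[OF _ DDK]) auto
  have z: "(\<integral>p. D j p * D j' p \<partial>N I) = 0" if jj: "j \<in> J" "j' \<in> J" "j \<noteq> j'" for j j'
  proof (rule resample_zero[OF _ _ DDK])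
    show "j' \<in> I" using jj J by auto
    show "(\<lambda>p. D j p * D j' p) \<in> borel_measurable (N I)" using Dm jj by auto
    fix p :: "'a \<Rightarrow> real"
    have ij: "i \<noteq> j'" using jj i by auto
    have "(\<integral>y. D j (p(j' := y)) * D j' (p(j' := y)) \<partial>L) = (\<integral>y. D j p * (g (p i) y - gb (p i)) \<partial>L)"
      unfolding D_def using jj ij by simp
    also have "\<dots> = 0" using gi by (simp add: gb_def prob_space)
    finally show "(\<integral>y. D j (p(j' := y)) * D j' (p(j' := y)) \<partial>L) = 0" .
  qed
  let ?n = "real (card J)"
  have n: "?n > 0" using J by (simp add: card_gt_0_iff)
  define Z where "Z p = avg J (\<lambda>j. g (p i) (p j)) - gb (p i)" for p
  have Z: "Z p = (\<Sum>j\<in>J. D j p) / ?n" for p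
    unfolding Z_def avg_def D_def using n by (simp add: sum_subtractf diff_divide_distrib)
  have Z2: "(Z p)\<^sup>2 = (\<Sum>j\<in>J. \<Sum>j'\<in>J. D j p * D j' p) / ?n\<^sup>2" for p
    unfolding Z power_divide by (simp add: power2_eq_square sum_product)
  have Zi: "integrable (N I) (\<lambda>p. (Z p)\<^sup>2)" unfolding Z2 using DDi by auto
  have "(\<integral>p. (Z p)\<^sup>2 \<partial>N I) = (\<Sum>j\<in>J. \<Sum>j'\<in>J. \<integral>p. D j p * D j' p \<partial>N I) / ?n\<^sup>2"
    unfolding Z2 using DDi by (simp add: integral_sum2)
  also have "(\<Sum>j\<in>J. \<Sum>j'\<in>J. \<integral>p. D j p * D j' p \<partial>N I) = (\<Sum>j\<in>J. \<integral>p. D j p * D j p \<partial>N I)"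
  proof (rule sum.cong[OF refl])
    fix j assume j: "j \<in> J"
    show "(\<Sum>j'\<in>J. \<integral>p. D j p * D j' p \<partial>N I) = (\<integral>p. D j p * D j p \<partial>N I)"
    proof -
      have "(\<Sum>j'\<in>J - {j}. \<integral>p. D j p * D j' p \<partial>N I) = 0"
        by (rule sum.neutral) (use z j in auto)
      then show ?thesis using sum.remove[OF J(1) j, of "\<lambda>j'. \<integral>p. D j p * D j' p \<partial>N I"] by simp
    qed
  qed
  also have "\<dots> \<le> (\<Sum>j\<in>J. 4 * K\<^sup>2)"
  proof (rule sum_mono)
    fix j assume "j \<in> J"
    then have "\<bar>\<integral>p. D j p * D j p \<partial>N I\<bar> \<le> 4 * K\<^sup>2" using Dm by (intro P.abs_expectation_le DDK) auto
    then show "(\<integral>p. D j p * D j p \<partial>N I) \<le> 4 * K\<^sup>2" by linarith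
  qed
  finally have "(\<integral>p. (Z p)\<^sup>2 \<partial>N I) \<le> (\<Sum>j\<in>J. 4 * K\<^sup>2) / ?n\<^sup>2" by (simp add: divide_right_mono)
  also have "\<dots> = (2 * K / sqrt ?n)\<^sup>2" using n by (simp add: power_divide power_mult_distrib power2_eq_square)
  finally have "(\<integral>p. (Z p)\<^sup>2 \<partial>N I) \<le> (2 * K / sqrt ?n)\<^sup>2" .
  moreover have "Z \<in> borel_measurable (N I)" unfolding Z using Dm by auto
  ultimately have "(\<integral>p. \<bar>Z p\<bar> \<partial>N I) \<le> 2 * K / sqrt ?n"
    using K0 by (intro P.mean_abs_le_sqrt Zi) auto
  then show ?thesis unfolding Z_def gb_def .
qed

lemma avg_meas:
  assumes "\<And>x. x \<in> A \<Longrightarrow> F x \<in> borel_measurable M"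
  shows "(\<lambda>p. avg A (\<lambda>x. F x p)) \<in> borel_measurable M"
  unfolding avg_def using assms by measurable

lemma avg_mean_le:
  fixes F :: "'b \<Rightarrow> 'c \<Rightarrow> real"
  assumes "prob_space M" and A: "finite A" and F: "\<And>x. x \<in> A \<Longrightarrow> integrable M (F x)"
    and c: "\<And>x. x \<in> A \<Longrightarrow> (\<integral>p. \<bar>F x p\<bar> \<partial>M) \<le> c" and c0: "c \<ge> 0"
  shows "(\<integral>p. \<bar>avg A (\<lambda>x. F x p)\<bar> \<partial>M) \<le> c"
proof -
  interpret M: prob_space M by fact
  have a: "\<bar>avg A (\<lambda>x. F x p)\<bar> \<le> avg A (\<lambda>x. \<bar>F x p\<bar>)" for p
    unfolding avg_def by (simp add: abs_divide divide_right_mono)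
  have "(\<integral>p. \<bar>avg A (\<lambda>x. F x p)\<bar> \<partial>M) \<le> (\<integral>p. avg A (\<lambda>x. \<bar>F x p\<bar>) \<partial>M)"
    by (rule integral_mono[OF _ _ a]) (use F in \<open>auto simp: avg_def\<close>)
  also have "\<dots> = avg A (\<lambda>x. \<integral>p. \<bar>F x p\<bar> \<partial>M)" unfolding avg_def using F by simp
  also have "\<dots> \<le> c"
    using avg_bound[of A "\<lambda>x. \<integral>p. \<bar>F x p\<bar> \<partial>M" c] c c0 by (auto simp: abs_le_iff)
  finally show ?thesis .
qed

definition E2 :: "(real \<Rightarrow> real \<Rightarrow> real) \<Rightarrow> real" where
  "E2 k = (\<integral>z. k (fst z) (snd z) \<partial>(L \<Otimes>\<^sub>M L))"

lemma kernel_meas: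
  assumes "case_prod k \<in> borel_measurable (borel \<Otimes>\<^sub>M borel)"
  shows "(\<lambda>z. k (fst z) (snd z)) \<in> borel_measurable (L \<Otimes>\<^sub>M L)"
  using assms by (simp add: case_prod_beta' cong: measurable_cong_sets)

lemma E2_iterated:
  assumes k: "integrable (L \<Otimes>\<^sub>M L) (\<lambda>z. k (fst z) (snd z))"
  shows "E2 k = (\<integral>x. \<integral>y. k x y \<partial>L \<partial>L)"
proof -
  interpret LL: pair_prob_space L L ..
  show ?thesis unfolding E2_def using LL.integral_fst'[OF k] by simp
qed

text \<open>The inner average is replaced by its conditional mean for each outer point; what is left
  is an ordinary law of large numbers for these conditional means.\<close>

lemma pair_lln:
  fixes k :: "real \<Rightarrow> real \<Rightarrow> real"
  assumes k: "case_prod k \<in> borel_measurable (borel \<Otimes>\<^sub>M borel)" and K: "\<And>x y. \<bar>k x y\<bar> \<le> K"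
    and A: "finite A" "A \<noteq> {}" "A \<subseteq> I" and B: "finite B" "B \<noteq> {}" "B \<subseteq> I" and AB: "A \<inter> B = {}"
  shows "(\<integral>p. \<bar>avg A (\<lambda>i. avg B (\<lambda>j. k (p i) (p j))) - E2 k\<bar> \<partial>N I) \<le>
    2 * K / sqrt (real (card A)) + 2 * K / sqrt (real (card B))"
proof -
  interpret P: prob_space "N I" by (rule N_prob)
  interpret LL: pair_prob_space L L ..
  define kb where "kb x = (\<integral>y. k x y \<partial>L)" for x
  have K0: "K \<ge> 0" using order_trans[OF abs_ge_zero K] .
  have kL: "case_prod k \<in> borel_measurable (borel \<Otimes>\<^sub>M L)"
    using k by (simp cong: measurable_cong_sets)
  have kbm: "kb \<in> borel_measurable borel" unfolding kb_def
    using borel_measurable_lebesgue_integral[OF kL] by simp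
  have kx: "k x \<in> borel_measurable L" for x using measurable_Pair2[OF kL, of x] by simp
  have kbK: "\<bar>kb x\<bar> \<le> K" for x unfolding kb_def by (rule abs_expectation_le[OF kx K])
  have E: "E2 k = (\<integral>x. kb x \<partial>L)" unfolding kb_def
    by (rule E2_iterated) (rule LL.integrable_bounded[OF kernel_meas[OF k] K])
  \<comment> \<open>A coordinate outside \<open>A\<close> serves as the idle first argument that
    turns the conditional law of large numbers into an ordinary one.\<close>
  obtain b where b: "b \<in> B" using B by auto
  have kbmm: "case_prod (\<lambda>x. kb) \<in> borel_measurable (borel \<Otimes>\<^sub>M borel)" using kbm by measurable
  have 1: "(\<integral>p. \<bar>avg A (\<lambda>i. kb (p i)) - (\<integral>y. kb y \<partial>L)\<bar> \<partial>N I) \<le> 2 * K / sqrt (real (card A))"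
    using cond_lln[OF kbmm kbK A(1,2,3), of b] b B AB by auto
  have Hm: "(\<lambda>p. avg B (\<lambda>j. k (p i) (p j))) \<in> borel_measurable (N I)" if "i \<in> A" for i
    using that A B by (intro avg_meas coord2_meas[OF k]) auto
  have kbi: "(\<lambda>p. kb (p i)) \<in> borel_measurable (N I)" if "i \<in> A" for i
    using coord2_meas[of "\<lambda>x y. kb x" i I i] that A kbm by auto
  have HK: "\<bar>avg B (\<lambda>j. k (p i) (p j))\<bar> \<le> K" for p i using K K0 by (intro avg_bound) auto
  have di: "integrable (N I) (\<lambda>p. avg B (\<lambda>j. k (p i) (p j)) - kb (p i))" if "i \<in> A" for i
    using that by (intro Bochner_Integration.integrable_diff P.integrable_bounded[OF Hm HK] P.integrable_bounded[OF kbi kbK])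
  have 2: "(\<integral>p. \<bar>avg A (\<lambda>i. avg B (\<lambda>j. k (p i) (p j)) - kb (p i))\<bar> \<partial>N I) \<le> 2 * K / sqrt (real (card B))"
    by (rule avg_mean_le[OF N_prob A(1) di]) (use cond_lln[OF k K B(1,2,3)] A AB K0 in \<open>auto simp: kb_def\<close>)
  have i1: "integrable (N I) (\<lambda>p. \<bar>avg A (\<lambda>i. kb (p i)) - (\<integral>y. kb y \<partial>L)\<bar>)"
    using P.integrable_bounded[OF kbi kbK] by (auto simp: avg_def)
  have i2: "integrable (N I) (\<lambda>p. \<bar>avg A (\<lambda>i. avg B (\<lambda>j. k (p i) (p j)) - kb (p i))\<bar>)"
    using di by (auto simp: avg_def[of A])
  have i3: "integrable (N I) (\<lambda>p. \<bar>avg A (\<lambda>i. avg B (\<lambda>j. k (p i) (p j))) - E2 k\<bar>)"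
    using P.integrable_bounded[OF Hm HK] by (auto simp: avg_def[of A])
  have "(\<integral>p. \<bar>avg A (\<lambda>i. avg B (\<lambda>j. k (p i) (p j))) - E2 k\<bar> \<partial>N I) \<le>
     (\<integral>p. \<bar>avg A (\<lambda>i. kb (p i)) - (\<integral>y. kb y \<partial>L)\<bar> + \<bar>avg A (\<lambda>i. avg B (\<lambda>j. k (p i) (p j)) - kb (p i))\<bar> \<partial>N I)"
    by (rule integral_mono[OF i3 Bochner_Integration.integrable_add[OF i1 i2]]) (simp add: E flip: avg_diff)
  then show ?thesis using 1 2 i1 i2 by simp
qed

lemma nn_kernel:
  assumes k: "case_prod k \<in> borel_measurable (borel \<Otimes>\<^sub>M borel)" and kn: "\<And>x y. k x y \<ge> 0"
    and i: "integrable (L \<Otimes>\<^sub>M L) (\<lambda>z. k (fst z) (snd z))"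
  shows "(\<integral>\<^sup>+x. \<integral>\<^sup>+y. ennreal (k x y) \<partial>L \<partial>L) = ennreal (E2 k)"
proof -
  have m: "(\<lambda>z. ennreal (k (fst z) (snd z))) \<in> borel_measurable (L \<Otimes>\<^sub>M L)" using kernel_meas[OF k] by measurable
  have "(\<integral>\<^sup>+x. \<integral>\<^sup>+y. ennreal (k x y) \<partial>L \<partial>L) = (\<integral>\<^sup>+z. ennreal (k (fst z) (snd z)) \<partial>(L \<Otimes>\<^sub>M L))"
    using nn_integral_fst[OF m] by simp
  also have "\<dots> = ennreal (E2 k)" unfolding E2_def by (rule nn_integral_eq_integral[OF i]) (use kn in auto)
  finally show ?thesis .
qed

text \<open>Four distinct coordinates are independent, so integrability of each kernel is enough for
  their product.\<close>

lemma kernel_product: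
  assumes k1: "case_prod k1 \<in> borel_measurable (borel \<Otimes>\<^sub>M borel)" "\<And>x y. k1 x y \<ge> 0"
      "integrable (L \<Otimes>\<^sub>M L) (\<lambda>z. k1 (fst z) (snd z))"
    and k2: "case_prod k2 \<in> borel_measurable (borel \<Otimes>\<^sub>M borel)" "\<And>x y. k2 x y \<ge> 0"
      "integrable (L \<Otimes>\<^sub>M L) (\<lambda>z. k2 (fst z) (snd z))"
    and d: "i1 \<in> I" "i2 \<in> I" "j1 \<in> I" "j2 \<in> I" "distinct [i1, i2, j1, j2]"
  shows "integrable (N I) (\<lambda>p. k1 (p i1) (p j1) * k2 (p i2) (p j2))"
    and "(\<integral>p. k1 (p i1) (p j1) * k2 (p i2) (p j2) \<partial>N I) = E2 k1 * E2 k2"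
proof -
  interpret P: prob_space "N I" by (rule N_prob)
  have en: "(\<lambda>p. ennreal (k (p i) (p j))) \<in> borel_measurable (N I)"
    if "case_prod k \<in> borel_measurable (borel \<Otimes>\<^sub>M borel)" "i \<in> I" "j \<in> I" for k i j
    using coord2_meas[OF that] by measurable
  \<comment> \<open>One kernel is integrated out by resampling its second and then its first
    coordinate, on neither of which the remaining factor depends.\<close>
  have one: "(\<integral>\<^sup>+p. G p * ennreal (k (p i) (p j)) \<partial>N I) = ennreal (E2 k) * (\<integral>\<^sup>+p. G p \<partial>N I)"
    if k: "case_prod k \<in> borel_measurable (borel \<Otimes>\<^sub>M borel)" "\<And>x y. k x y \<ge> 0"
      "integrable (L \<Otimes>\<^sub>M L) (\<lambda>z. k (fst z) (snd z))" and ij: "i \<in> I" "j \<in> I" "i \<noteq> j"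
      and G: "G \<in> borel_measurable (N I)" "\<And>p y. G (p(i := y)) = G p" "\<And>p y. G (p(j := y)) = G p" for k i j G
  proof -
    have kx: "(\<lambda>y. ennreal (k x y)) \<in> borel_measurable L" for x
    proof -
      have "case_prod k \<in> borel_measurable (borel \<Otimes>\<^sub>M L)" using k(1) by (simp cong: measurable_cong_sets)
      from measurable_Pair2[OF this, of x] show ?thesis by simp
    qed
    have kLn: "(\<lambda>(x, y). ennreal (k x y)) \<in> borel_measurable (borel \<Otimes>\<^sub>M L)"
    proof -
      have "case_prod k \<in> borel_measurable (borel \<Otimes>\<^sub>M L)" using k(1) by (simp cong: measurable_cong_sets)
      then show ?thesis by (simp add: case_prod_beta')
    qed
    have kbm: "(\<lambda>x. \<integral>\<^sup>+y. ennreal (k x y) \<partial>L) \<in> borel_measurable L"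
      using borel_measurable_nn_integral_fst[OF kLn] by (simp cong: measurable_cong_sets)
    have Fm: "(\<lambda>p. G p * ennreal (k (p i) (p j))) \<in> borel_measurable (N I)"
      using G(1) en[OF k(1) ij(1,2)] by measurable
    have "(\<integral>\<^sup>+p. G p * ennreal (k (p i) (p j)) \<partial>N I) = (\<integral>\<^sup>+p. \<integral>\<^sup>+y. G (p(j := y)) * ennreal (k ((p(j := y)) i) ((p(j := y)) j)) \<partial>L \<partial>N I)"
      by (rule nn_resample(1)[OF ij(2) Fm])
    also have "\<dots> = (\<integral>\<^sup>+p. G p * (\<integral>\<^sup>+y. ennreal (k (p i) y) \<partial>L) \<partial>N I)"
      using ij G(3) kx by (simp add: nn_integral_cmult)
    also have "\<dots> = (\<integral>\<^sup>+p. \<integral>\<^sup>+x. G (p(i := x)) * (\<integral>\<^sup>+y. ennreal (k ((p(i := x)) i) y) \<partial>L) \<partial>L \<partial>N I)"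
    proof (rule nn_resample(1)[OF ij(1)])
      have "(\<lambda>p. \<integral>\<^sup>+y. ennreal (k (p i) y) \<partial>L) \<in> borel_measurable (N I)"
        by (rule measurable_compose[OF measurable_component_singleton[OF ij(1)] kbm])
      then show "(\<lambda>p. G p * (\<integral>\<^sup>+y. ennreal (k (p i) y) \<partial>L)) \<in> borel_measurable (N I)" using G(1) by measurable
    qed
    also have "\<dots> = (\<integral>\<^sup>+p. G p * (\<integral>\<^sup>+x. \<integral>\<^sup>+y. ennreal (k x y) \<partial>L \<partial>L) \<partial>N I)"
      using G(2) kbm by (simp add: nn_integral_cmult)
    also have "\<dots> = ennreal (E2 k) * (\<integral>\<^sup>+p. G p \<partial>N I)"
      unfolding nn_kernel[OF k] using G(1) by (subst nn_integral_multc) (auto simp: mult.commute)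
    finally show ?thesis .
  qed
  have "(\<integral>\<^sup>+p. ennreal (k1 (p i1) (p j1)) * ennreal (k2 (p i2) (p j2)) \<partial>N I) = ennreal (E2 k2) * (\<integral>\<^sup>+p. ennreal (k1 (p i1) (p j1)) \<partial>N I)"
    by (rule one[OF k2]) (use d en[OF k1(1)] in auto)
  also have "(\<integral>\<^sup>+p. ennreal (k1 (p i1) (p j1)) \<partial>N I) = ennreal (E2 k1)"
    using one[OF k1 d(1) d(3), of "\<lambda>_. 1"] d by (simp add: P.emeasure_space_1)
  finally have n: "(\<integral>\<^sup>+p. ennreal (k1 (p i1) (p j1) * k2 (p i2) (p j2)) \<partial>N I) = ennreal (E2 k1 * E2 k2)"
    using k1(2) k2(2) by (simp add: ennreal_mult mult.commute E2_def)
  have m: "(\<lambda>p. k1 (p i1) (p j1) * k2 (p i2) (p j2)) \<in> borel_measurable (N I)"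
    using coord2_meas[OF k1(1) d(1) d(3)] coord2_meas[OF k2(1) d(2) d(4)] by measurable
  show "integrable (N I) (\<lambda>p. k1 (p i1) (p j1) * k2 (p i2) (p j2))"
    by (rule integrableI_nn_integral_finite[OF m _ n]) (use k1 k2 in \<open>auto simp: E2_def\<close>)
  have "E2 k1 * E2 k2 \<ge> 0" unfolding E2_def using k1 k2 by (intro mult_nonneg_nonneg integral_nonneg_AE) auto
  then show "(\<integral>p. k1 (p i1) (p j1) * k2 (p i2) (p j2) \<partial>N I) = E2 k1 * E2 k2"
    by (intro integral_eq_nn_integral[THEN trans] m) (use k1 k2 n in auto)
qed

end

section \<open>The limit in the sample sizes\<close>

lemma avg_pairs_close:
  fixes F :: "('a \<times> 'a) \<times> ('b \<times> 'b) \<Rightarrow> real"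
  assumes A: "finite A" "card A \<ge> 2" and B: "finite B" "card B \<ge> 2"
    and F: "\<And>x. x \<in> (A \<times> A) \<times> (B \<times> B) \<Longrightarrow> \<bar>F x\<bar> \<le> K"
  shows "\<bar>avg (dp A \<times> dp B) F - avg ((A \<times> A) \<times> (B \<times> B)) F\<bar> \<le> 2 * K * (1 / real (card A) + 1 / real (card B))"
proof -
  have ne: "A \<noteq> {}" "B \<noteq> {}" using A B by auto
  obtain a b where "a \<in> A" "b \<in> B" using ne by auto
  then have K0: "K \<ge> 0" using F[of "((a, a), (b, b))"] by auto
  have c: "real (card (dp A)) / real (card (A \<times> A)) = 1 - 1 / real (card A)"
    "real (card (dp B)) / real (card (B \<times> B)) = 1 - 1 / real (card B)"
    using ratio_dp[OF A(1) ne(1)] ratio_dp[OF B(1) ne(2)] by linarith+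
  have "\<bar>avg ((A \<times> A) \<times> (B \<times> B)) F - avg (dp A \<times> dp B) F\<bar> \<le>
     2 * K * (1 - real (card (dp A \<times> dp B)) / real (card ((A \<times> A) \<times> (B \<times> B))))"
  proof (rule avg_sub)
    show "dp A \<times> dp B \<noteq> {}" using dp_nonempty[OF A(2)] dp_nonempty[OF B(2)] by simp
    show "dp A \<times> dp B \<subseteq> (A \<times> A) \<times> (B \<times> B)" by (intro Sigma_mono dp_sub)
  qed (use A B F in auto)
  also have "real (card (dp A \<times> dp B)) / real (card ((A \<times> A) \<times> (B \<times> B))) = (1 - 1 / real (card A)) * (1 - 1 / real (card B))"
    unfolding c[symmetric] by (simp add: card_cartesian_product)
  also have "1 - (1 - 1 / real (card A)) * (1 - 1 / real (card B)) \<le> 1 / real (card A) + 1 / real (card B)"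
    by (simp add: algebra_simps)
  finally show ?thesis using K0 by (simp add: abs_minus_commute mult_left_mono)
qed

lemma avg_all_pairs:
  "avg ((A \<times> A) \<times> (B \<times> B)) (\<lambda>z. F (fst (fst z)) (fst (snd z)) * G (snd (fst z)) (snd (snd z))) =
    avg A (\<lambda>a. avg B (F a)) * avg A (\<lambda>a. avg B (G a))"
proof -
  have "avg ((A \<times> A) \<times> (B \<times> B)) (\<lambda>z. F (fst (fst z)) (fst (snd z)) * G (snd (fst z)) (snd (snd z))) =
     avg A (\<lambda>a. avg A (\<lambda>a'. avg B (\<lambda>b. avg B (\<lambda>b'. F a b * G a' b'))))"
    by (simp only: avg_avg fst_conv snd_conv)
  also have "\<dots> = avg A (\<lambda>a. avg A (\<lambda>a'. avg B (F a) * avg B (G a')))" by (simp only: avg_prod2)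
  finally show ?thesis by (simp only: avg_prod2)
qed

text \<open>For the scales \<open>p\<close> and the pair weights \<open>w\<close>, the squared coefficients of the limiting quadratic form
  sum up to a combination of \<open>UU\<close> (both indices in the same sample) and \<open>UC\<close> (one index in each
  sample), and \<open>QA\<close> multiplies the signal \<open>\<parallel>\<mu>\<parallel>\<^sup>2\<close>.\<close>

definition UU :: "(real \<Rightarrow> real \<Rightarrow> real) \<Rightarrow> 'i set \<Rightarrow> 'i set \<Rightarrow> ('i \<Rightarrow> real) \<Rightarrow> real" where
  "UU w A B p = avg (dp A) (\<lambda>z. (p (fst z) * p (snd z) *
     avg (dp B) (\<lambda>u. w (p (fst z)) (p (fst u)) * w (p (snd z)) (p (snd u))))\<^sup>2)"

definition UC :: "(real \<Rightarrow> real \<Rightarrow> real) \<Rightarrow> 'i set \<Rightarrow> 'i set \<Rightarrow> ('i \<Rightarrow> real) \<Rightarrow> real" where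
  "UC w A B p = avg (A \<times> B) (\<lambda>z. (p (fst z) * p (snd z) *
     avg ((A - {fst z}) \<times> (B - {snd z})) (\<lambda>u. w (p (fst z)) (p (snd u)) * w (p (fst u)) (p (snd z))))\<^sup>2)"

definition QA :: "(real \<Rightarrow> real \<Rightarrow> real) \<Rightarrow> (real \<Rightarrow> real \<Rightarrow> real) \<Rightarrow> 'i set \<Rightarrow> 'i set \<Rightarrow> ('i \<Rightarrow> real) \<Rightarrow> real" where
  "QA k1 k2 A B p = avg (dp A \<times> dp B)
     (\<lambda>z. k1 (p (fst (fst z))) (p (fst (snd z))) * k2 (p (snd (fst z))) (p (snd (snd z))))"

abbreviation rate :: "'i set \<Rightarrow> 'j set \<Rightarrow> real" where
  "rate A B \<equiv> 1 / sqrt (real (card A)) + 1 / sqrt (real (card B))"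

lemma inv_le_inv_sqrt: "1 / real n \<le> 1 / sqrt (real n)"
proof (cases "n = 0")
  case False
  then have "sqrt (real n) * 1 \<le> sqrt (real n) * sqrt (real n)" by (intro mult_left_mono) auto
  then have "sqrt (real n) \<le> real n" by simp
  then show ?thesis using False by (intro divide_left_mono) auto
qed simp

context real_law
begin

lemma QA_meas:
  assumes "case_prod k1 \<in> borel_measurable (borel \<Otimes>\<^sub>M borel)" "case_prod k2 \<in> borel_measurable (borel \<Otimes>\<^sub>M borel)"
    and "A \<subseteq> I" "B \<subseteq> I"
  shows "QA k1 k2 A B \<in> borel_measurable (N I)"
  unfolding QA_def using assms
  by (intro avg_meas borel_measurable_times coord2_meas) (auto simp: dp_def)

text \<open>Once the diagonals are restored, the average is a product of two averages over all
  pairs, each of which has a rate by \<open>pair_lln\<close>.\<close>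

lemma QA_bounded:
  assumes k1: "case_prod k1 \<in> borel_measurable (borel \<Otimes>\<^sub>M borel)" "\<And>x y. \<bar>k1 x y\<bar> \<le> K"
    and k2: "case_prod k2 \<in> borel_measurable (borel \<Otimes>\<^sub>M borel)" "\<And>x y. \<bar>k2 x y\<bar> \<le> K"
    and A: "finite A" "card A \<ge> 2" "A \<subseteq> I" and B: "finite B" "card B \<ge> 2" "B \<subseteq> I" and AB: "A \<inter> B = {}"
  shows "(\<integral>p. \<bar>QA k1 k2 A B p - E2 k1 * E2 k2\<bar> \<partial>N I) \<le> 6 * K\<^sup>2 * rate A B"
proof -
  interpret P: prob_space "N I" by (rule N_prob)
  interpret LL: pair_prob_space L L ..
  have K0: "K \<ge> 0" using order_trans[OF abs_ge_zero k1(2)] .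
  have ne: "A \<noteq> {}" "B \<noteq> {}" using A B by auto
  define S where "S k p = avg A (\<lambda>a. avg B (\<lambda>b. k (p a) (p b)))" for k :: "real \<Rightarrow> real \<Rightarrow> real" and p :: "'a \<Rightarrow> real"
  have Sm: "S k \<in> borel_measurable (N I)" if "case_prod k \<in> borel_measurable (borel \<Otimes>\<^sub>M borel)" for k
    unfolding S_def using A B that by (intro avg_meas coord2_meas) auto
  have SK: "\<bar>S k p\<bar> \<le> K" if "\<And>x y. \<bar>k x y\<bar> \<le> K" for k p
    unfolding S_def using that K0 by (intro avg_bound) auto
  have EK: "\<bar>E2 k\<bar> \<le> K" if "case_prod k \<in> borel_measurable (borel \<Otimes>\<^sub>M borel)" "\<And>x y. \<bar>k x y\<bar> \<le> K" for k
    unfolding E2_def by (rule LL.abs_expectation_le[OF kernel_meas[OF that(1)] that(2)])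
  have KK: "\<bar>k1 x y * k2 x' y'\<bar> \<le> K\<^sup>2" for x y x' y'
    unfolding abs_mult power2_eq_square using k1(2) k2(2) K0 by (intro mult_mono) auto
  have QK: "\<bar>QA k1 k2 A B p\<bar> \<le> K\<^sup>2" for p unfolding QA_def using KK by (intro avg_bound) auto
  let ?r = "2 * K\<^sup>2 * (1 / real (card A) + 1 / real (card B))"
  have pt: "\<bar>QA k1 k2 A B p - E2 k1 * E2 k2\<bar> \<le> ?r + K * (\<bar>S k1 p - E2 k1\<bar> + \<bar>S k2 p - E2 k2\<bar>)" for p
  proof -
    have "\<bar>QA k1 k2 A B p - S k1 p * S k2 p\<bar> \<le> ?r"
      unfolding QA_def S_def avg_all_pairs[symmetric, of A B "\<lambda>a b. k1 (p a) (p b)" "\<lambda>a b. k2 (p a) (p b)"]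
      by (rule avg_pairs_close[OF A(1,2) B(1,2)]) (rule KK)
    moreover have "\<bar>S k1 p * S k2 p - E2 k1 * E2 k2\<bar> \<le> K * (\<bar>S k1 p - E2 k1\<bar> + \<bar>S k2 p - E2 k2\<bar>)"
      by (rule prod_diff_le[OF SK[OF k2(2)] EK[OF k1]])
    ultimately show ?thesis by linarith
  qed
  have i: "integrable (N I) (\<lambda>p. \<bar>S k p - E2 k\<bar>)" if "case_prod k \<in> borel_measurable (borel \<Otimes>\<^sub>M borel)" "\<And>x y. \<bar>k x y\<bar> \<le> K" for k
    using P.integrable_bounded[OF Sm[OF that(1)] SK[OF that(2)]] by auto
  have iQ: "integrable (N I) (\<lambda>p. \<bar>QA k1 k2 A B p - E2 k1 * E2 k2\<bar>)"
    using P.integrable_bounded[OF QA_meas[OF k1(1) k2(1) A(3) B(3)] QK] by auto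
  have e: "(\<integral>p. \<bar>S k p - E2 k\<bar> \<partial>N I) \<le> 2 * K * rate A B" if "case_prod k \<in> borel_measurable (borel \<Otimes>\<^sub>M borel)" "\<And>x y. \<bar>k x y\<bar> \<le> K" for k
    using pair_lln[OF that A(1) ne(1) A(3) B(1) ne(2) B(3) AB] unfolding S_def by (simp add: distrib_left)
  have "(\<integral>p. \<bar>QA k1 k2 A B p - E2 k1 * E2 k2\<bar> \<partial>N I) \<le> (\<integral>p. ?r + K * (\<bar>S k1 p - E2 k1\<bar> + \<bar>S k2 p - E2 k2\<bar>) \<partial>N I)"
    by (rule integral_mono[OF iQ _ pt]) (use i[OF k1] i[OF k2] in auto)
  also have "\<dots> = ?r + K * ((\<integral>p. \<bar>S k1 p - E2 k1\<bar> \<partial>N I) + (\<integral>p. \<bar>S k2 p - E2 k2\<bar> \<partial>N I))"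
    using i[OF k1] i[OF k2] by (simp add: P.prob_space)
  also have "\<dots> \<le> 2 * K\<^sup>2 * rate A B + K * (2 * K * rate A B + 2 * K * rate A B)"
    using K0 e[OF k1] e[OF k2] by (intro add_mono mult_left_mono inv_le_inv_sqrt) auto
  finally show ?thesis by (simp add: power2_eq_square algebra_simps)
qed

lemma truncation:
  assumes k: "case_prod k \<in> borel_measurable (borel \<Otimes>\<^sub>M borel)" "\<And>x y. k x y \<ge> 0"
      "integrable (L \<Otimes>\<^sub>M L) (\<lambda>z. k (fst z) (snd z))"
  shows "(\<lambda>T. E2 (\<lambda>x y. min (k x y) (real T))) \<longlonglongrightarrow> E2 k"
    and "case_prod (\<lambda>x y. min (k x y) (real T)) \<in> borel_measurable (borel \<Otimes>\<^sub>M borel)"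
    and "integrable (L \<Otimes>\<^sub>M L) (\<lambda>z. min (k (fst z) (snd z)) (real T))"
    and "0 \<le> min (k x y) (real T)" "min (k x y) (real T) \<le> k x y" "\<bar>min (k x y) (real T)\<bar> \<le> real T"
proof -
  show "case_prod (\<lambda>x y. min (k x y) (real T)) \<in> borel_measurable (borel \<Otimes>\<^sub>M borel)"
    using k(1) by (simp add: case_prod_beta')
  show p: "0 \<le> min (k x y) (real T)" "min (k x y) (real T) \<le> k x y" "\<bar>min (k x y) (real T)\<bar> \<le> real T" for x y T
    using k(2)[of x y] by auto
  have m: "(\<lambda>z. min (k (fst z) (snd z)) (real T)) \<in> borel_measurable (L \<Otimes>\<^sub>M L)" for T
    using kernel_meas[OF k(1)] by measurable
  show "integrable (L \<Otimes>\<^sub>M L) (\<lambda>z. min (k (fst z) (snd z)) (real T))"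
    by (rule Bochner_Integration.integrable_bound[OF k(3) m]) (use p k(2) in auto)
  show "(\<lambda>T. E2 (\<lambda>x y. min (k x y) (real T))) \<longlonglongrightarrow> E2 k"
    unfolding E2_def
  proof (rule integral_dominated_convergence[OF kernel_meas[OF k(1)] m k(3)])
    show "AE z in L \<Otimes>\<^sub>M L. (\<lambda>T. min (k (fst z) (snd z)) (real T)) \<longlonglongrightarrow> k (fst z) (snd z)"
    proof (rule AE_I2, rule tendsto_eventually)
      fix z
      obtain T0 where "k (fst z) (snd z) \<le> real T0" using real_arch_simple by blast
      then have "\<And>T. T \<ge> T0 \<Longrightarrow> min (k (fst z) (snd z)) (real T) = k (fst z) (snd z)" by (auto simp: min_def)
      then show "\<forall>\<^sub>F T in sequentially. min (k (fst z) (snd z)) (real T) = k (fst z) (snd z)"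
        using eventually_sequentially by blast
    qed
    show "AE z in L \<Otimes>\<^sub>M L. norm (min (k (fst z) (snd z)) (real T)) \<le> k (fst z) (snd z)" for T
      using p k(2) by (auto intro!: AE_I2)
  qed
qed

text \<open>The smaller kernels give a pointwise smaller average, so the distance in mean is a
  difference of expectations. It is computed exactly and does not depend on the sample
  sizes.\<close>

lemma QA_truncation:
  assumes k1: "case_prod k1 \<in> borel_measurable (borel \<Otimes>\<^sub>M borel)" "\<And>x y. k1 x y \<ge> 0"
      "integrable (L \<Otimes>\<^sub>M L) (\<lambda>z. k1 (fst z) (snd z))"
    and k2: "case_prod k2 \<in> borel_measurable (borel \<Otimes>\<^sub>M borel)" "\<And>x y. k2 x y \<ge> 0"
      "integrable (L \<Otimes>\<^sub>M L) (\<lambda>z. k2 (fst z) (snd z))"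
    and l1: "case_prod l1 \<in> borel_measurable (borel \<Otimes>\<^sub>M borel)" "\<And>x y. l1 x y \<ge> 0"
      "integrable (L \<Otimes>\<^sub>M L) (\<lambda>z. l1 (fst z) (snd z))" "\<And>x y. l1 x y \<le> k1 x y"
    and l2: "case_prod l2 \<in> borel_measurable (borel \<Otimes>\<^sub>M borel)" "\<And>x y. l2 x y \<ge> 0"
      "integrable (L \<Otimes>\<^sub>M L) (\<lambda>z. l2 (fst z) (snd z))" "\<And>x y. l2 x y \<le> k2 x y"
    and A: "finite A" "A \<subseteq> I" and B: "finite B" "B \<subseteq> I" and AB: "A \<inter> B = {}"
  shows "(\<integral>p. \<bar>QA k1 k2 A B p - QA l1 l2 A B p\<bar> \<partial>N I) \<le> E2 k1 * E2 k2 - E2 l1 * E2 l2"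
    and "integrable (N I) (QA k1 k2 A B)"
proof -
  note P = kernel_product
  have d: "fst (fst z) \<in> I" "snd (fst z) \<in> I" "fst (snd z) \<in> I" "snd (snd z) \<in> I"
    "distinct [fst (fst z), snd (fst z), fst (snd z), snd (snd z)]" if "z \<in> dp A \<times> dp B" for z
    using that A B AB by (auto simp: dp_def)
  have ik: "integrable (N I) (\<lambda>p. k1 (p (fst (fst z))) (p (fst (snd z))) * k2 (p (snd (fst z))) (p (snd (snd z))))"
    and ek: "(\<integral>p. k1 (p (fst (fst z))) (p (fst (snd z))) * k2 (p (snd (fst z))) (p (snd (snd z))) \<partial>N I) = E2 k1 * E2 k2"
    and il: "integrable (N I) (\<lambda>p. l1 (p (fst (fst z))) (p (fst (snd z))) * l2 (p (snd (fst z))) (p (snd (snd z))))"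
    and el: "(\<integral>p. l1 (p (fst (fst z))) (p (fst (snd z))) * l2 (p (snd (fst z))) (p (snd (snd z))) \<partial>N I) = E2 l1 * E2 l2"
    if "z \<in> dp A \<times> dp B" for z
    using P[OF k1 k2 d(1)[OF that] d(2)[OF that] d(3)[OF that] d(4)[OF that] d(5)[OF that]]
      P[OF l1(1-3) l2(1-3) d(1)[OF that] d(2)[OF that] d(3)[OF that] d(4)[OF that] d(5)[OF that]] by auto
  show "integrable (N I) (QA k1 k2 A B)" unfolding QA_def avg_def using ik by auto
  have le: "l1 x y * l2 x' y' \<le> k1 x y * k2 x' y'" for x y x' y'
    using k1(2) k2(2) l1(2,4) l2(2,4) by (intro mult_mono) auto
  have E_le: "E2 l1 * E2 l2 \<le> E2 k1 * E2 k2"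
  proof (rule mult_mono)
    show "E2 l1 \<le> E2 k1" unfolding E2_def by (intro integral_mono k1(3) l1(3)) (rule l1(4))
    show "E2 l2 \<le> E2 k2" unfolding E2_def by (intro integral_mono k2(3) l2(3)) (rule l2(4))
  qed (use k1(2) l2(2) in \<open>auto simp: E2_def intro!: integral_nonneg_AE\<close>)
  have "(\<integral>p. \<bar>avg (dp A \<times> dp B) (\<lambda>z. k1 (p (fst (fst z))) (p (fst (snd z))) * k2 (p (snd (fst z))) (p (snd (snd z))) -
      l1 (p (fst (fst z))) (p (fst (snd z))) * l2 (p (snd (fst z))) (p (snd (snd z))))\<bar> \<partial>N I) \<le> E2 k1 * E2 k2 - E2 l1 * E2 l2"
    by (rule avg_mean_le[OF N_prob]) (use A B ik il ek el le E_le in auto)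
  then show "(\<integral>p. \<bar>QA k1 k2 A B p - QA l1 l2 A B p\<bar> \<partial>N I) \<le> E2 k1 * E2 k2 - E2 l1 * E2 l2"
    unfolding QA_def avg_diff .
qed

section \<open>Convergence as both sample sizes grow\<close>

abbreviation FF :: "(nat \<times> nat) filter" where "FF \<equiv> sequentially \<times>\<^sub>F sequentially"

abbreviation IA :: "nat \<times> nat \<Rightarrow> (nat + nat) set" where "IA z \<equiv> Inl ` {1..fst z}"
abbreviation IB :: "nat \<times> nat \<Rightarrow> (nat + nat) set" where "IB z \<equiv> Inr ` {1..snd z}"
abbreviation NN :: "nat \<times> nat \<Rightarrow> (nat + nat \<Rightarrow> real) measure" where "NN z \<equiv> N (IA z \<union> IB z)"

lemma card_IA[simp]: "card (IA z) = fst z" and card_IB[simp]: "card (IB z) = snd z"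
  by (auto simp: card_image)

lemma rate_tendsto: "((\<lambda>z. C * rate (IA z) (IB z)) \<longlongrightarrow> 0) FF"
proof -
  have s: "(\<lambda>n. 1 / sqrt (real n)) \<longlonglongrightarrow> 0"
    by (rule tendsto_divide_0[OF tendsto_const]) (intro filterlim_at_top_imp_at_infinity filterlim_compose[OF sqrt_at_top filterlim_real_sequentially])
  have "((\<lambda>z. C * (1 / sqrt (real (fst z)) + 1 / sqrt (real (snd z)))) \<longlongrightarrow> C * (0 + 0)) FF"
    by (intro tendsto_intros filterlim_compose[OF s filterlim_fst] filterlim_compose[OF s filterlim_snd])
  then show ?thesis by simp
qed

lemma eventually_FF: "\<forall>\<^sub>F z in FF. fst z \<ge> 2 \<and> snd z \<ge> 2"
  using eventually_prodI[OF eventually_ge_at_top[of 2] eventually_ge_at_top[of 2]] by (simp add: case_prod_beta)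

lemma tends_prob_rate:
  assumes m: "\<And>z. X z \<in> borel_measurable (NN z)" and i: "\<And>z. integrable (NN z) (X z)"
    and r: "\<And>z. fst z \<ge> 2 \<Longrightarrow> snd z \<ge> 2 \<Longrightarrow> (\<integral>p. \<bar>X z p - x\<bar> \<partial>NN z) \<le> C * rate (IA z) (IB z)"
  shows "tends_prob NN X x FF"
proof (rule tends_prob_L1[OF N_prob m])
  interpret P: prob_space "NN z" for z by (rule N_prob)
  show "integrable (NN z) (\<lambda>p. \<bar>X z p - x\<bar>)" for z using i[of z] by auto
  show "((\<lambda>z. \<integral>p. \<bar>X z p - x\<bar> \<partial>NN z) \<longlongrightarrow> 0) FF"
  proof (rule tendsto_sandwich[OF _ _ tendsto_const rate_tendsto[of C]])
    show "\<forall>\<^sub>F z in FF. (\<integral>p. \<bar>X z p - x\<bar> \<partial>NN z) \<le> C * rate (IA z) (IB z)"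
      using eventually_FF by (rule eventually_mono) (rule r, auto)
  qed auto
qed

text \<open>The truncation level is fixed first, with an error uniform in the sample sizes; the
  bounded case then applies at that level. Hence integrable kernels suffice, which is what the
  moments of the scales provide.\<close>

lemma QA_tends_prob:
  assumes k1: "case_prod k1 \<in> borel_measurable (borel \<Otimes>\<^sub>M borel)" "\<And>x y. k1 x y \<ge> 0"
      "integrable (L \<Otimes>\<^sub>M L) (\<lambda>z. k1 (fst z) (snd z))"
    and k2: "case_prod k2 \<in> borel_measurable (borel \<Otimes>\<^sub>M borel)" "\<And>x y. k2 x y \<ge> 0"
      "integrable (L \<Otimes>\<^sub>M L) (\<lambda>z. k2 (fst z) (snd z))"
  shows "tends_prob NN (\<lambda>z. QA k1 k2 (IA z) (IB z)) (E2 k1 * E2 k2) FF"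
proof (rule tends_prob_L1[OF N_prob])
  interpret P: prob_space "NN z" for z by (rule N_prob)
  show m: "QA k1 k2 (IA z) (IB z) \<in> borel_measurable (NN z)" for z
    by (rule QA_meas[OF k1(1) k2(1)]) auto
  have iQ: "integrable (NN z) (QA k1 k2 (IA z) (IB z))" for z
    by (rule QA_truncation(2)[OF k1 k2 k1 _ k2]) auto
  show "integrable (NN z) (\<lambda>p. \<bar>QA k1 k2 (IA z) (IB z) p - E2 k1 * E2 k2\<bar>)" for z using iQ[of z] by auto
  define t1 where "t1 T x y = min (k1 x y) (real T)" for T x y
  define t2 where "t2 T x y = min (k2 x y) (real T)" for T x y
  note T1 = truncation[OF k1, folded t1_def] and T2 = truncation[OF k2, folded t2_def]
  define c where "c T = E2 k1 * E2 k2 - E2 (t1 T) * E2 (t2 T)" for T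
  have c: "c \<longlonglongrightarrow> 0"
  proof -
    have "c \<longlonglongrightarrow> E2 k1 * E2 k2 - E2 k1 * E2 k2"
      unfolding c_def using T1(1) T2(1) by (intro tendsto_intros)
    then show ?thesis by simp
  qed
  show "((\<lambda>z. \<integral>p. \<bar>QA k1 k2 (IA z) (IB z) p - E2 k1 * E2 k2\<bar> \<partial>NN z) \<longlongrightarrow> 0) FF"
    unfolding tendsto_iff
  proof (intro allI impI)
    fix e :: real assume e: "e > 0"
    have "\<forall>\<^sub>F T in sequentially. dist (c T) 0 < e / 3" by (rule tendstoD[OF c]) (use e in simp)
    then obtain T where T: "\<bar>c T\<bar> < e / 3" unfolding eventually_sequentially dist_real_def by auto
    have "\<forall>\<^sub>F z in FF. dist (6 * (real T)\<^sup>2 * rate (IA z) (IB z)) 0 < e / 3"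
      by (rule tendstoD[OF rate_tendsto]) (use e in simp)
    then show "\<forall>\<^sub>F z in FF. dist (\<integral>p. \<bar>QA k1 k2 (IA z) (IB z) p - E2 k1 * E2 k2\<bar> \<partial>NN z) 0 < e"
      using eventually_FF
    proof eventually_elim
      case (elim z)
      let ?Q = "QA k1 k2 (IA z) (IB z)" and ?R = "QA (t1 T) (t2 T) (IA z) (IB z)"
      have 1: "(\<integral>p. \<bar>?Q p - ?R p\<bar> \<partial>NN z) \<le> c T"
        unfolding c_def
      proof (rule QA_truncation(1)[OF k1 k2])
        show "case_prod (t1 T) \<in> borel_measurable (borel \<Otimes>\<^sub>M borel)" "case_prod (t2 T) \<in> borel_measurable (borel \<Otimes>\<^sub>M borel)"
          by (rule T1(2) T2(2))+
        show "t1 T x y \<ge> 0" "t1 T x y \<le> k1 x y" "t2 T x y \<ge> 0" "t2 T x y \<le> k2 x y" for x y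
          by (rule T1(4) T1(5) T2(4) T2(5))+
        show "integrable (L \<Otimes>\<^sub>M L) (\<lambda>z. t1 T (fst z) (snd z))" "integrable (L \<Otimes>\<^sub>M L) (\<lambda>z. t2 T (fst z) (snd z))"
          by (rule T1(3) T2(3))+
      qed auto
      have iR: "integrable (NN z) ?R"
        by (rule QA_truncation(2)[OF T1(2) T1(4) T1(3) T2(2) T2(4) T2(3) T1(2) T1(4) T1(3) _ T2(2) T2(4) T2(3)]) auto
      have 2: "(\<integral>p. \<bar>?R p - E2 (t1 T) * E2 (t2 T)\<bar> \<partial>NN z) \<le> 6 * (real T)\<^sup>2 * rate (IA z) (IB z)"
        by (rule QA_bounded[OF T1(2) T1(6) T2(2) T2(6)]) (use elim in auto)
      have "(\<integral>p. \<bar>?Q p - E2 k1 * E2 k2\<bar> \<partial>NN z) \<le> (\<integral>p. \<bar>?Q p - ?R p\<bar> + \<bar>?R p - E2 (t1 T) * E2 (t2 T)\<bar> + \<bar>c T\<bar> \<partial>NN z)"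
        by (rule integral_mono) (use iQ[of z] iR in \<open>auto simp: c_def\<close>)
      also have "\<dots> = (\<integral>p. \<bar>?Q p - ?R p\<bar> \<partial>NN z) + (\<integral>p. \<bar>?R p - E2 (t1 T) * E2 (t2 T)\<bar> \<partial>NN z) + \<bar>c T\<bar>"
        using iQ[of z] iR by (simp add: P.prob_space)
      also have "\<dots> < e" using 1 2 T elim(1) unfolding dist_real_def by linarith
      finally show ?case by (simp add: dist_real_def)
    qed
  qed
qed

end

sublocale scale_law \<subseteq> R: real_law L
  by unfold_locales (rule sets_L)

section \<open>The coefficients produced by the sign weights\<close>

context scale_law
begin

text \<open>In \<open>UU\<close> and \<open>UC\<close> each weight is accompanied by one factor
  \<open>p\<close>; pairing them leaves only this kernel, which is bounded.\<close>

definition bk :: "real \<Rightarrow> real \<Rightarrow> real" where "bk x y = x * wt x y"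

lemma bk_meas: "case_prod bk \<in> borel_measurable (borel \<Otimes>\<^sub>M borel)"
  unfolding bk_def wt_def by measurable

lemma bk_bound: "\<bar>bk x y\<bar> \<le> \<beta>"
  unfolding bk_def abs_mult using abs_wt_le[of x y] wt_nonneg[of x y] by simp

lemma \<kappa>_le: "\<bar>\<kappa>\<bar> \<le> \<beta>\<^sup>2"
proof -
  have "\<bar>(f r)\<^sup>2\<bar> \<le> \<beta>\<^sup>2" for r using power_mono[OF f_bound[of r], of 2] by simp
  then show ?thesis unfolding \<kappa>_def by (intro abs_expectation_le) auto
qed

text \<open>The empirical counterpart of \<open>f (p a)\<close>, with the scales of the other sample
  in place of their law.\<close>

definition Hm :: "'i set \<Rightarrow> ('i \<Rightarrow> real) \<Rightarrow> 'i \<Rightarrow> real" where "Hm B p a = avg B (\<lambda>b. bk (p a) (p b))"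

lemma Hm_bound: "\<bar>Hm B p a\<bar> \<le> \<beta>"
  unfolding Hm_def using bk_bound \<beta>_pos by (intro avg_bound) auto

lemma Hm_sq: "\<bar>(Hm B p a)\<^sup>2\<bar> \<le> \<beta>\<^sup>2"
  using power_mono[OF Hm_bound[of B p a], of 2] by simp

lemma Hm_meas: "a \<in> I \<Longrightarrow> B \<subseteq> I \<Longrightarrow> (\<lambda>p. Hm B p a) \<in> borel_measurable (R.N I)"
  unfolding Hm_def by (intro R.avg_meas R.coord2_meas[OF bk_meas]) auto

lemma avg_Hm_meas: "A \<subseteq> I \<Longrightarrow> B \<subseteq> I \<Longrightarrow> (\<lambda>p. avg A (\<lambda>a. (Hm B p a)\<^sup>2)) \<in> borel_measurable (R.N I)"
  by (intro R.avg_meas borel_measurable_power Hm_meas) auto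

text \<open>Given \<open>p a\<close>, the average over \<open>B\<close> is close to
  \<open>f (p a)\<close>, and squaring is Lipschitz on the bounded range; the average of
  \<open>(f (p a))\<^sup>2\<close> over \<open>A\<close> then tends to \<kappa>.\<close>

lemma Hm_lln:
  assumes A: "finite A" "A \<noteq> {}" "A \<subseteq> I" and B: "finite B" "B \<noteq> {}" "B \<subseteq> I" and AB: "A \<inter> B = {}"
  shows "(\<integral>p. \<bar>avg A (\<lambda>a. (Hm B p a)\<^sup>2) - \<kappa>\<bar> \<partial>R.N I) \<le> 4 * \<beta>\<^sup>2 * rate A B"
proof -
  interpret P: prob_space "R.N I" by (rule R.N_prob)
  obtain b where b: "b \<in> B" using B by auto
  have f2: "\<bar>(f r)\<^sup>2\<bar> \<le> \<beta>\<^sup>2" for r using power_mono[OF f_bound[of r], of 2] by simp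
  have fm: "(\<lambda>p. (f (p a))\<^sup>2) \<in> borel_measurable (R.N I)" if "a \<in> I" for a
    using R.coord2_meas[of "\<lambda>x y. (f x)\<^sup>2" a I a] that by simp
  have f2m: "case_prod (\<lambda>x y. (f y)\<^sup>2) \<in> borel_measurable (borel \<Otimes>\<^sub>M borel)" by measurable
  have 1: "(\<integral>p. \<bar>avg A (\<lambda>a. (f (p a))\<^sup>2) - \<kappa>\<bar> \<partial>R.N I) \<le> 2 * \<beta>\<^sup>2 / sqrt (real (card A))"
    using R.cond_lln[OF f2m f2 A(1,2,3), of b] b B AB unfolding \<kappa>_def by auto
  have hi: "integrable (R.N I) (\<lambda>p. (Hm B p a)\<^sup>2)" if "a \<in> A" for a
    using that A B by (intro P.integrable_bounded[OF borel_measurable_power[OF Hm_meas] Hm_sq]) auto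
  have fi: "integrable (R.N I) (\<lambda>p. (f (p a))\<^sup>2)" if "a \<in> A" for a
    using that A by (intro P.integrable_bounded[OF fm f2]) auto
  have 2: "(\<integral>p. \<bar>(Hm B p a)\<^sup>2 - (f (p a))\<^sup>2\<bar> \<partial>R.N I) \<le> 4 * \<beta>\<^sup>2 / sqrt (real (card B))" if a: "a \<in> A" for a
  proof -
    have c: "(\<integral>p. \<bar>Hm B p a - f (p a)\<bar> \<partial>R.N I) \<le> 2 * \<beta> / sqrt (real (card B))"
      using R.cond_lln[OF bk_meas bk_bound B(1,2,3), of a] a A AB unfolding Hm_def f_eq bk_def by auto
    have m1: "(\<lambda>p. f (p a)) \<in> borel_measurable (R.N I)"
      using R.coord2_meas[of "\<lambda>x y. f x" a I a] a A by auto
    have i: "integrable (R.N I) (\<lambda>p. \<bar>Hm B p a - f (p a)\<bar>)"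
      using P.integrable_bounded[OF Hm_meas Hm_bound, of a B] P.integrable_bounded[OF m1 f_bound] a A B by auto
    have "(\<integral>p. \<bar>(Hm B p a)\<^sup>2 - (f (p a))\<^sup>2\<bar> \<partial>R.N I) \<le> (\<integral>p. 2 * \<beta> * \<bar>Hm B p a - f (p a)\<bar> \<partial>R.N I)"
      by (rule integral_mono) (use hi[OF a] fi[OF a] i square_diff_le[OF Hm_bound f_bound] in auto)
    also have "\<dots> \<le> 2 * \<beta> * (2 * \<beta> / sqrt (real (card B)))"
      using c \<beta>_pos by (simp del: times_divide_eq_right add: mult_left_mono)
    finally show ?thesis by (simp add: power2_eq_square mult_ac)
  qed
  have 3: "(\<integral>p. \<bar>avg A (\<lambda>a. (Hm B p a)\<^sup>2 - (f (p a))\<^sup>2)\<bar> \<partial>R.N I) \<le> 4 * \<beta>\<^sup>2 / sqrt (real (card B))"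
    by (rule R.avg_mean_le[OF R.N_prob A(1)]) (use hi fi 2 in auto)
  have i1: "integrable (R.N I) (\<lambda>p. \<bar>avg A (\<lambda>a. (f (p a))\<^sup>2) - \<kappa>\<bar>)"
    using fi by (auto simp: avg_def)
  have i2: "integrable (R.N I) (\<lambda>p. \<bar>avg A (\<lambda>a. (Hm B p a)\<^sup>2 - (f (p a))\<^sup>2)\<bar>)"
    using hi fi by (auto simp: avg_def[of A])
  have i3: "integrable (R.N I) (\<lambda>p. \<bar>avg A (\<lambda>a. (Hm B p a)\<^sup>2) - \<kappa>\<bar>)"
    using hi by (auto simp: avg_def[of A])
  have "(\<integral>p. \<bar>avg A (\<lambda>a. (Hm B p a)\<^sup>2) - \<kappa>\<bar> \<partial>R.N I) \<le>
     (\<integral>p. \<bar>avg A (\<lambda>a. (f (p a))\<^sup>2) - \<kappa>\<bar> + \<bar>avg A (\<lambda>a. (Hm B p a)\<^sup>2 - (f (p a))\<^sup>2)\<bar> \<partial>R.N I)"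
    by (rule integral_mono[OF i3 Bochner_Integration.integrable_add[OF i1 i2]]) (simp flip: avg_diff)
  also have "\<dots> \<le> 2 * \<beta>\<^sup>2 / sqrt (real (card A)) + 4 * \<beta>\<^sup>2 / sqrt (real (card B))"
    using 1 3 i1 i2 by simp
  also have "\<dots> \<le> 4 * \<beta>\<^sup>2 * rate A B"
    by (simp add: distrib_left divide_right_mono)
  finally show ?thesis .
qed

text \<open>With the diagonal of \<open>B\<close> restored, the inner average becomes a product of
  two values of \<open>Hm\<close>; with the diagonal of \<open>A\<close> restored, the outer average
  becomes a square. Both corrections are of the order of a reciprocal sample size.\<close>

lemma UU_close:
  assumes A: "finite A" "card A \<ge> 2" and B: "finite B" "card B \<ge> 2"
  shows "\<bar>UU wt A B p - (avg A (\<lambda>a. (Hm B p a)\<^sup>2))\<^sup>2\<bar> \<le> 4 * \<beta> ^ 4 * (1 / real (card A) + 1 / real (card B))"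
proof -
  have ne: "A \<noteq> {}" "B \<noteq> {}" using A B by auto
  define G where "G z = avg (dp B) (\<lambda>u. bk (p (fst z)) (p (fst u)) * bk (p (snd z)) (p (snd u)))" for z
  have UU: "UU wt A B p = avg (dp A) (\<lambda>z. (G z)\<^sup>2)"
    unfolding UU_def G_def avg_mult_left bk_def by (simp add: mult_ac)
  have bb: "\<bar>bk x y * bk x' y'\<bar> \<le> \<beta>\<^sup>2" for x y x' y'
    unfolding abs_mult power2_eq_square using bk_bound \<beta>_pos by (intro mult_mono) auto
  have GK: "\<bar>G z\<bar> \<le> \<beta>\<^sup>2" for z unfolding G_def using bb by (intro avg_bound) auto
  have HH: "\<bar>Hm B p a * Hm B p a'\<bar> \<le> \<beta>\<^sup>2" for a a'
    unfolding abs_mult power2_eq_square using Hm_bound \<beta>_pos by (intro mult_mono) auto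
  have G: "\<bar>G z - Hm B p (fst z) * Hm B p (snd z)\<bar> \<le> 2 * \<beta>\<^sup>2 * (1 / real (card B))" for z
  proof -
    have "\<bar>avg (B \<times> B) (\<lambda>u. bk (p (fst z)) (p (fst u)) * bk (p (snd z)) (p (snd u))) - G z\<bar> \<le>
      2 * \<beta>\<^sup>2 * (1 - real (card (dp B)) / real (card (B \<times> B)))"
      unfolding G_def by (rule avg_sub) (use B dp_sub dp_nonempty bb in auto)
    then show ?thesis
      unfolding ratio_dp[OF B(1) ne(2)] Hm_def
        avg_prod[of B B "\<lambda>b. bk (p (fst z)) (p b)" "\<lambda>b. bk (p (snd z)) (p b)"] by (simp only: abs_minus_commute)
  qed
  have "\<bar>avg (dp A) (\<lambda>z. (G z)\<^sup>2) - avg (dp A) (\<lambda>z. (Hm B p (fst z) * Hm B p (snd z))\<^sup>2)\<bar> \<le> 2 * \<beta>\<^sup>2 * (2 * \<beta>\<^sup>2 * (1 / real (card B)))"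
  proof (rule avg_close)
    fix z
    show "\<bar>(G z)\<^sup>2 - (Hm B p (fst z) * Hm B p (snd z))\<^sup>2\<bar> \<le> 2 * \<beta>\<^sup>2 * (2 * \<beta>\<^sup>2 * (1 / real (card B)))"
      by (rule order_trans[OF square_diff_le[OF GK HH]]) (intro mult_left_mono G, simp)
  qed simp
  moreover have "\<bar>avg (A \<times> A) (\<lambda>z. (Hm B p (fst z) * Hm B p (snd z))\<^sup>2) - avg (dp A) (\<lambda>z. (Hm B p (fst z) * Hm B p (snd z))\<^sup>2)\<bar> \<le>
      2 * \<beta> ^ 4 * (1 - real (card (dp A)) / real (card (A \<times> A)))"
  proof (rule avg_sub)
    fix z
    show "\<bar>(Hm B p (fst z) * Hm B p (snd z))\<^sup>2\<bar> \<le> \<beta> ^ 4"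
      using power_mono[OF HH[of "fst z" "snd z"], of 2] by (simp flip: power_mult)
  qed (use A dp_sub dp_nonempty in auto)
  moreover have "avg (A \<times> A) (\<lambda>z. (Hm B p (fst z) * Hm B p (snd z))\<^sup>2) = (avg A (\<lambda>a. (Hm B p a)\<^sup>2))\<^sup>2"
    unfolding power_mult_distrib avg_prod[of A A "\<lambda>a. (Hm B p a)\<^sup>2" "\<lambda>a. (Hm B p a)\<^sup>2"] by (simp only: power2_eq_square)
  ultimately have "\<bar>UU wt A B p - (avg A (\<lambda>a. (Hm B p a)\<^sup>2))\<^sup>2\<bar> \<le> 2 * \<beta>\<^sup>2 * (2 * \<beta>\<^sup>2 * (1 / real (card B))) + 2 * \<beta> ^ 4 * (1 / real (card A))"
    unfolding UU ratio_dp[OF A(1) ne(1)] by linarith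
  also have "\<dots> = 4 * \<beta> ^ 4 * (1 / real (card B)) + 2 * \<beta> ^ 4 * (1 / real (card A))"
    by (simp add: power2_eq_square power4_eq_xxxx)
  also have "\<dots> \<le> 4 * \<beta> ^ 4 * (1 / real (card B)) + 4 * \<beta> ^ 4 * (1 / real (card A))"
    by (intro add_left_mono mult_right_mono) auto
  finally show ?thesis by (simp add: distrib_left)
qed

text \<open>The inner average factorizes already, since one index is removed from each sample
  independently. Symmetry of the weight lets \<open>p (snd z)\<close> pair with the weight in which
  it is the second argument, and restoring one index changes an average by the order of a reciprocal
  sample size.\<close>

lemma UC_close:
  assumes A: "finite A" "card A \<ge> 2" and B: "finite B" "card B \<ge> 2"
  shows "\<bar>UC wt A B p - avg A (\<lambda>a. (Hm B p a)\<^sup>2) * avg B (\<lambda>b. (Hm A p b)\<^sup>2)\<bar> \<le> 4 * \<beta> ^ 4 * (1 / real (card A) + 1 / real (card B))"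
proof -
  have del: "\<bar>avg (J - {j}) F - avg J F\<bar> \<le> 2 * \<beta> * (1 / real (card J))"
    if J: "finite J" "card J \<ge> 2" "j \<in> J" and F: "\<And>x. \<bar>F x\<bar> \<le> \<beta>" for J :: "'a set" and j F
  proof -
    have c: "card (J - {j}) = card J - 1" using J by (simp add: card_Diff_singleton)
    have "card (J - {j}) > 0" using c J by simp
    then have "J - {j} \<noteq> {}" by (metis card.empty less_irrefl)
    then have "\<bar>avg J F - avg (J - {j}) F\<bar> \<le> 2 * \<beta> * (1 - real (card (J - {j})) / real (card J))"
      using J F by (intro avg_sub) auto
    also have "1 - real (card (J - {j})) / real (card J) = 1 / real (card J)"
    proof -
      have "real (card J - 1) = real (card J) - 1" using J by (simp add: of_nat_diff)
      moreover have "1 - (x - 1) / x = 1 / x" if "x > 0" for x :: real using that by (simp add: field_simps)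
      ultimately show ?thesis unfolding c using J by simp
    qed
    finally show ?thesis by (simp add: abs_minus_commute)
  qed
  define H1 where "H1 z = avg (B - {snd z}) (\<lambda>b. bk (p (fst z)) (p b))" for z
  define H2 where "H2 z = avg (A - {fst z}) (\<lambda>a. bk (p (snd z)) (p a))" for z
  have H1: "\<bar>H1 z\<bar> \<le> \<beta>" and H2: "\<bar>H2 z\<bar> \<le> \<beta>" for z
    unfolding H1_def H2_def using bk_bound \<beta>_pos by (auto intro!: avg_bound)
  have UC: "UC wt A B p = avg (A \<times> B) (\<lambda>z. (H2 z * H1 z)\<^sup>2)"
    unfolding UC_def
  proof (intro avg_cong arg_cong[where f="\<lambda>x. x\<^sup>2"])
    fix z
    show "p (fst z) * p (snd z) * avg ((A - {fst z}) \<times> (B - {snd z})) (\<lambda>u. wt (p (fst z)) (p (snd u)) * wt (p (fst u)) (p (snd z))) = H2 z * H1 z"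
    proof -
      have e: "H2 z * H1 z = avg ((A - {fst z}) \<times> (B - {snd z}))
          (\<lambda>u. (p (snd z) * wt (p (snd z)) (p (fst u))) * (p (fst z) * wt (p (fst z)) (p (snd u))))"
        unfolding H1_def H2_def bk_def by (rule avg_prod[symmetric])
      show ?thesis unfolding e avg_mult_left[of "p (fst z) * p (snd z)"]
        by (intro avg_cong) (simp add: wt_sym[of "p (snd z)"] mult_ac)
    qed
  qed
  have sq4: "\<bar>x * y\<bar> \<le> \<beta>\<^sup>2" if "\<bar>x\<bar> \<le> \<beta>" "\<bar>y\<bar> \<le> \<beta>" for x y
    unfolding abs_mult power2_eq_square using that \<beta>_pos by (intro mult_mono) auto
  have "\<bar>avg (A \<times> B) (\<lambda>z. (H2 z * H1 z)\<^sup>2) - avg (A \<times> B) (\<lambda>z. (Hm B p (fst z))\<^sup>2 * (Hm A p (snd z))\<^sup>2)\<bar> \<le>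
      4 * \<beta> ^ 4 * (1 / real (card A) + 1 / real (card B))"
  proof (rule avg_close)
    fix z assume z: "z \<in> A \<times> B"
    have "\<bar>(H2 z * H1 z)\<^sup>2 - (Hm A p (snd z) * Hm B p (fst z))\<^sup>2\<bar> \<le> 2 * \<beta>\<^sup>2 * \<bar>H2 z * H1 z - Hm A p (snd z) * Hm B p (fst z)\<bar>"
      by (intro square_diff_le sq4 H1 H2 Hm_bound)
    also have "\<dots> \<le> 2 * \<beta>\<^sup>2 * (\<beta> * (\<bar>H2 z - Hm A p (snd z)\<bar> + \<bar>H1 z - Hm B p (fst z)\<bar>))"
      by (intro mult_left_mono prod_diff_le H1 Hm_bound) simp
    also have "\<dots> \<le> 2 * \<beta>\<^sup>2 * (\<beta> * (2 * \<beta> * (1 / real (card A)) + 2 * \<beta> * (1 / real (card B))))"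
      unfolding H1_def H2_def Hm_def using z A B bk_bound \<beta>_pos
      by (intro mult_left_mono add_mono del) auto
    also have "\<dots> = 4 * \<beta> ^ 4 * (1 / real (card A) + 1 / real (card B))"
      by (simp add: power2_eq_square power4_eq_xxxx algebra_simps)
    finally show "\<bar>(H2 z * H1 z)\<^sup>2 - (Hm B p (fst z))\<^sup>2 * (Hm A p (snd z))\<^sup>2\<bar> \<le> 4 * \<beta> ^ 4 * (1 / real (card A) + 1 / real (card B))"
      by (simp add: power_mult_distrib mult.commute)
  qed simp
  then show ?thesis
    unfolding UC avg_prod[of A B "\<lambda>a. (Hm B p a)\<^sup>2" "\<lambda>b. (Hm A p b)\<^sup>2"] .
qed

end

lemma tends_prob_cong_eventually:
  assumes X: "tends_prob N X x F" and Y: "\<And>i. Y i \<in> borel_measurable (N i)"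
    and e: "\<forall>\<^sub>F i in F. \<forall>\<omega>\<in>space (N i). X i \<omega> = Y i \<omega>"
  shows "tends_prob N Y x F"
  unfolding tends_prob_def
proof (intro conjI allI impI Y)
  fix d :: real assume "d > 0"
  have "\<forall>\<^sub>F i in F. measure (N i) {\<omega>\<in>space (N i). d \<le> \<bar>X i \<omega> - x\<bar>} = measure (N i) {\<omega>\<in>space (N i). d \<le> \<bar>Y i \<omega> - x\<bar>}"
    using e by eventually_elim (auto intro!: arg_cong[where f="measure _"])
  then show "((\<lambda>i. measure (N i) {\<omega>\<in>space (N i). d \<le> \<bar>Y i \<omega> - x\<bar>}) \<longlongrightarrow> 0) F"
    by (rule tendsto_cong[THEN iffD1]) (rule tends_probD(2)[OF X \<open>d > 0\<close>])
qed

text \<open>\<open>An (m, n)\<close> is the common factor of \<open>\<Gamma>\<^sub>1\<close> and \<open>\<psi>\<^sub>2\<close> that carries the sample sizes.\<close>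

definition An :: "nat \<times> nat \<Rightarrow> real" where
  "An z = 2 / (real (fst z) * (real (fst z) - 1)) + 2 / (real (snd z) * (real (snd z) - 1)) + 4 / (real (fst z) * real (snd z))"

text \<open>Up to the factor \<tau>, the limiting conditional variance given the scales. Its value
  with \<open>UU\<close> and \<open>UC\<close> replaced by 1 is \<open>An\<close>.\<close>

definition Vw :: "(real \<Rightarrow> real \<Rightarrow> real) \<Rightarrow> 'i set \<Rightarrow> 'i set \<Rightarrow> ('i \<Rightarrow> real) \<Rightarrow> real" where
  "Vw w A B p = 2 * UU w A B p / (real (card A) * (real (card A) - 1)) +
     2 * UU w B A p / (real (card B) * (real (card B) - 1)) + 4 * UC w A B p / (real (card A) * real (card B))"

lemma An_pos: "fst z \<ge> 2 \<Longrightarrow> snd z \<ge> 2 \<Longrightarrow> An z > 0"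
  unfolding An_def by (intro add_pos_pos divide_pos_pos mult_pos_pos) auto

context real_law
begin

lemma UU_meas:
  assumes "case_prod w \<in> borel_measurable (borel \<Otimes>\<^sub>M borel)" "A \<subseteq> I" "B \<subseteq> I"
  shows "UU w A B \<in> borel_measurable (N I)"
proof -
  have c: "(\<lambda>p. p a * p b) \<in> borel_measurable (N I)" if "a \<in> I" "b \<in> I" for a b
    using coord2_meas[of "\<lambda>x y. x * y" a I b] that by simp
  show ?thesis unfolding UU_def using assms
    by (intro avg_meas borel_measurable_power borel_measurable_times[OF c] borel_measurable_times coord2_meas)
       (auto simp: dp_def)
qed

lemma UC_meas:
  assumes "case_prod w \<in> borel_measurable (borel \<Otimes>\<^sub>M borel)" "A \<subseteq> I" "B \<subseteq> I"
  shows "UC w A B \<in> borel_measurable (N I)"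
proof -
  have c: "(\<lambda>p. p a * p b) \<in> borel_measurable (N I)" if "a \<in> I" "b \<in> I" for a b
    using coord2_meas[of "\<lambda>x y. x * y" a I b] that by simp
  show ?thesis unfolding UC_def using assms
    by (intro avg_meas borel_measurable_power borel_measurable_times[OF c] borel_measurable_times coord2_meas) auto
qed

lemma Vw_meas:
  assumes "case_prod w \<in> borel_measurable (borel \<Otimes>\<^sub>M borel)" "A \<subseteq> I" "B \<subseteq> I"
  shows "Vw w A B \<in> borel_measurable (N I)"
  unfolding Vw_def using UU_meas[OF assms] UU_meas[OF assms(1,3,2)] UC_meas[OF assms] by measurable

text \<open>The quotient is a convex combination of \<open>UU\<close>, its mirror image and
  \<open>UC\<close>. The three weights depend on the sample sizes and may fail to converge, but they
  stay in the unit interval and all three terms have the same limit, so \<open>m\<close> and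
  \<open>n\<close> may grow at any relative speed.\<close>

lemma Vw_tends_prob:
  assumes w: "case_prod w \<in> borel_measurable (borel \<Otimes>\<^sub>M borel)"
    and u: "tends_prob NN (\<lambda>z. UU w (IA z) (IB z)) x FF" "tends_prob NN (\<lambda>z. UU w (IB z) (IA z)) x FF"
      "tends_prob NN (\<lambda>z. UC w (IA z) (IB z)) x FF"
  shows "tends_prob NN (\<lambda>z p. Vw w (IA z) (IB z) p / An z) x FF"
proof -
  \<comment> \<open>The default 0 for small samples, where \<open>An\<close> may have vanishing
    denominators, makes the bounds on the weights hold without exception.\<close>
  define q1 where "q1 z = (if fst z \<ge> 2 \<and> snd z \<ge> 2 then 2 / (real (fst z) * (real (fst z) - 1)) / An z else 0)" for z
  define q2 where "q2 z = (if fst z \<ge> 2 \<and> snd z \<ge> 2 then 2 / (real (snd z) * (real (snd z) - 1)) / An z else 0)" for z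
  define q3 where "q3 z = (if fst z \<ge> 2 \<and> snd z \<ge> 2 then 4 / (real (fst z) * real (snd z)) / An z else 0)" for z
  have q0: "0 \<le> q1 z" "0 \<le> q2 z" "0 \<le> q3 z" for z
    using An_pos[of z] unfolding q1_def q2_def q3_def by (auto intro!: divide_nonneg_nonneg simp: less_imp_le)
  have q_sum: "q1 z + q2 z + q3 z = 1" if "fst z \<ge> 2" "snd z \<ge> 2" for z
  proof -
    have "q1 z + q2 z + q3 z = An z / An z"
      using that by (simp only: q1_def q2_def q3_def if_True simp_thms add_divide_distrib[symmetric])
        (simp only: An_def)
    then show ?thesis using An_pos[OF that] by simp
  qed
  have q_le: "q1 z + q2 z + q3 z \<le> 1" for z
    using q_sum[of z] by (cases "2 \<le> fst z \<and> 2 \<le> snd z") (auto simp: q1_def q2_def q3_def)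
  have q: "0 \<le> q1 z" "0 \<le> q2 z" "0 \<le> q3 z" "q1 z \<le> 1" "q2 z \<le> 1" "q3 z \<le> 1" for z
    using q0[of z] q_le[of z] by linarith+
  have step: "tends_prob NN (\<lambda>z p. (X z p + - x) * q z) 0 FF"
    if X: "tends_prob NN X x FF" and q: "\<And>z. 0 \<le> q z" "\<And>z. q z \<le> 1" for X q
  proof (rule tends_prob_mult_bounded[where C=1])
    interpret P: prob_space "NN z" for z by (rule N_prob)
    have "tends_prob NN (\<lambda>z p. X z p + - x) (x + - x) FF"
      by (intro tends_prob_add X tends_prob_const tendsto_const N_prob)
    then show "tends_prob NN (\<lambda>z p. X z p + - x) 0 FF" by simp
    show "(\<integral>\<omega>. (q z)\<^sup>2 \<partial>NN z) \<le> 1" for z using q[of z] by (simp add: P.prob_space power_le_one)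
    show "integrable (NN z) (\<lambda>\<omega>. (q z)\<^sup>2)" for z by simp
  qed (rule N_prob, simp)
  have "tends_prob NN (\<lambda>z p. (UU w (IA z) (IB z) p + - x) * q1 z + (UU w (IB z) (IA z) p + - x) * q2 z + (UC w (IA z) (IB z) p + - x) * q3 z + x) (0 + 0 + 0 + x) FF"
    by (intro tends_prob_add step u tends_prob_const tendsto_const N_prob q)
  then have t: "tends_prob NN (\<lambda>z p. (UU w (IA z) (IB z) p + - x) * q1 z + (UU w (IB z) (IA z) p + - x) * q2 z + (UC w (IA z) (IB z) p + - x) * q3 z + x) x FF"
    by simp
  show ?thesis
  proof (rule tends_prob_cong_eventually[OF t])
    show "(\<lambda>p. Vw w (IA z) (IB z) p / An z) \<in> borel_measurable (NN z)" for z
      by (intro borel_measurable_divide Vw_meas[OF w]) auto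
    show "\<forall>\<^sub>F z in FF. \<forall>p\<in>space (NN z). (UU w (IA z) (IB z) p + - x) * q1 z + (UU w (IB z) (IA z) p + - x) * q2 z + (UC w (IA z) (IB z) p + - x) * q3 z + x =
       Vw w (IA z) (IB z) p / An z"
      using eventually_FF
    proof (rule eventually_mono, intro ballI)
      fix z :: "nat \<times> nat" and p assume z: "fst z \<ge> 2 \<and> snd z \<ge> (2::nat)"
      have "(UU w (IA z) (IB z) p + - x) * q1 z + (UU w (IB z) (IA z) p + - x) * q2 z + (UC w (IA z) (IB z) p + - x) * q3 z + x =
        UU w (IA z) (IB z) p * q1 z + UU w (IB z) (IA z) p * q2 z + UC w (IA z) (IB z) p * q3 z + x * (1 - (q1 z + q2 z + q3 z))"
        by (simp add: algebra_simps)
      also have "\<dots> = Vw w (IA z) (IB z) p / An z"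
        using z q_sum[of z] unfolding Vw_def by (simp add: q1_def q2_def q3_def add_divide_distrib mult.commute)
      finally show "(UU w (IA z) (IB z) p + - x) * q1 z + (UU w (IB z) (IA z) p + - x) * q2 z + (UC w (IA z) (IB z) p + - x) * q3 z + x =
       Vw w (IA z) (IB z) p / An z" .
    qed
  qed
qed

text \<open>The conditional power is a bounded function of the drift and the variance that is
  continuous at their limits, where the normalized standard deviation is 1.\<close>

theorem mean_power_limit:
  assumes w: "case_prod w \<in> borel_measurable (borel \<Otimes>\<^sub>M borel)"
    and B: "tends_prob NN (\<lambda>z. QA w w (IA z) (IB z)) b FF"
    and V: "tends_prob NN (\<lambda>z p. Vw w (IA z) (IB z) p / An z) (\<eta>\<^sup>2) FF" and \<eta>: "\<eta> > 0"
    and s: "(s \<longlongrightarrow> s0) FF"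
  shows "((\<lambda>z. \<integral>p. 1 - Phi ((t - s z * QA w w (IA z) (IB z) p) / (sqrt (Vw w (IA z) (IB z) p / An z) / \<eta>)) \<partial>NN z)
    \<longlongrightarrow> 1 - Phi (t - s0 * b)) FF"
proof -
  define f where "f x y = 1 - Phi ((t - x) / (sqrt y / \<eta>))" for x y
  have sB: "tends_prob NN (\<lambda>z p. s z * QA w w (IA z) (IB z) p) (s0 * b) FF"
    by (intro tends_prob_mult tends_prob_const s B N_prob)
  have fm: "case_prod f \<in> borel_measurable (borel \<Otimes>\<^sub>M borel)" unfolding f_def by measurable
  have "isCont (\<lambda>z. (t - fst z) / (sqrt (snd z) / \<eta>)) (s0 * b, \<eta>\<^sup>2)"
    using \<eta> by (auto intro!: continuous_intros)
  then have fc: "isCont (case_prod f) (s0 * b, \<eta>\<^sup>2)"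
    unfolding f_def case_prod_beta' by (intro continuous_diff continuous_const isCont_o2[OF _ isCont_Phi])
  have "tends_prob NN (\<lambda>z p. f (s z * QA w w (IA z) (IB z) p) (Vw w (IA z) (IB z) p / An z)) (f (s0 * b) (\<eta>\<^sup>2)) FF"
    by (rule tends_prob_cont2[OF N_prob sB V fm fc])
  then have "((\<lambda>z. \<integral>p. f (s z * QA w w (IA z) (IB z) p) (Vw w (IA z) (IB z) p / An z) \<partial>NN z) \<longlongrightarrow> f (s0 * b) (\<eta>\<^sup>2)) FF"
  proof (rule tends_prob_expectation[OF N_prob, where K=1])
    show "\<bar>f x y\<bar> \<le> 1" for x y unfolding f_def using Phi_bounds[of "(t - x) / (sqrt y / \<eta>)"] by auto
  qed
  moreover have "f (s0 * b) (\<eta>\<^sup>2) = 1 - Phi (t - s0 * b)" unfolding f_def using \<eta> by simp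
  ultimately show ?thesis unfolding f_def by simp
qed

end

context scale_law
begin

lemma kernel_integrable:
  assumes k: "case_prod k \<in> borel_measurable (borel \<Otimes>\<^sub>M borel)" "\<And>x y. k x y \<ge> 0"
    and i: "\<And>x. integrable L (k x)" "integrable L (\<lambda>x. \<integral>y. k x y \<partial>L)"
  shows "integrable (L \<Otimes>\<^sub>M L) (\<lambda>z. k (fst z) (snd z))" "R.E2 k = (\<integral>x. \<integral>y. k x y \<partial>L \<partial>L)"
proof -
  interpret LL: pair_prob_space L L ..
  show 1: "integrable (L \<Otimes>\<^sub>M L) (\<lambda>z. k (fst z) (snd z))"
    by (rule LL.Fubini_integrable) (use k i R.kernel_meas[OF k(1)] in auto)
  show "R.E2 k = (\<integral>x. \<integral>y. k x y \<partial>L \<partial>L)" by (rule R.E2_iterated[OF 1])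
qed

lemma wt_kernel: "integrable (L \<Otimes>\<^sub>M L) (\<lambda>z. wt (fst z) (snd z))" "R.E2 wt = \<theta>"
  using kernel_integrable[OF wt_meas wt_nonneg wt_int] int_h unfolding h_def \<theta>_def by auto

lemma sq1_kernel: "integrable (L \<Otimes>\<^sub>M L) (\<lambda>z. (fst z)\<^sup>2)" "R.E2 (\<lambda>x y. x\<^sup>2) = e2"
  using kernel_integrable[of "\<lambda>x y. x\<^sup>2"] sq_int by (auto simp: e2_def prob_space)

lemma sq2_kernel: "integrable (L \<Otimes>\<^sub>M L) (\<lambda>z. (snd z)\<^sup>2)" "R.E2 (\<lambda>x y. y\<^sup>2) = e2"
  using kernel_integrable[of "\<lambda>x y. y\<^sup>2"] sq_int by (auto simp: e2_def prob_space)

lemma QA_wt: "tends_prob R.NN (\<lambda>z. QA wt wt (R.IA z) (R.IB z)) (\<theta>\<^sup>2) R.FF"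
  using R.QA_tends_prob[OF wt_meas wt_nonneg wt_kernel(1) wt_meas wt_nonneg wt_kernel(1)]
  unfolding wt_kernel(2) power2_eq_square .

lemma UU_bound: "\<bar>UU wt A B p\<bar> \<le> \<beta> ^ 4"
proof -
  have UU: "UU wt A B p = avg (dp A) (\<lambda>z. (avg (dp B) (\<lambda>u. bk (p (fst z)) (p (fst u)) * bk (p (snd z)) (p (snd u))))\<^sup>2)"
    unfolding UU_def avg_mult_left bk_def by (simp add: mult_ac)
  have bb: "\<bar>bk x y * bk x' y'\<bar> \<le> \<beta>\<^sup>2" for x y x' y'
    unfolding abs_mult power2_eq_square using bk_bound \<beta>_pos by (intro mult_mono) auto
  show ?thesis unfolding UU
  proof (rule avg_bound)
    fix z
    have "\<bar>avg (dp B) (\<lambda>u. bk (p (fst z)) (p (fst u)) * bk (p (snd z)) (p (snd u)))\<bar> \<le> \<beta>\<^sup>2"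
      using bb by (intro avg_bound) auto
    from power_mono[OF this, of 2]
    show "\<bar>(avg (dp B) (\<lambda>u. bk (p (fst z)) (p (fst u)) * bk (p (snd z)) (p (snd u))))\<^sup>2\<bar> \<le> \<beta> ^ 4"
      by (simp flip: power_mult)
  qed (use \<beta>_pos in simp)
qed

lemma UC_bound: "\<bar>UC wt A B p\<bar> \<le> \<beta> ^ 4"
proof -
  have bb: "\<bar>bk x y * bk x' y'\<bar> \<le> \<beta>\<^sup>2" for x y x' y'
    unfolding abs_mult power2_eq_square using bk_bound \<beta>_pos by (intro mult_mono) auto
  show ?thesis unfolding UC_def
  proof (rule avg_bound)
    fix z
    have e: "p (fst z) * p (snd z) * avg ((A - {fst z}) \<times> (B - {snd z})) (\<lambda>u. wt (p (fst z)) (p (snd u)) * wt (p (fst u)) (p (snd z))) =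
       avg ((A - {fst z}) \<times> (B - {snd z})) (\<lambda>u. bk (p (fst z)) (p (snd u)) * bk (p (snd z)) (p (fst u)))"
      unfolding avg_mult_left bk_def by (intro avg_cong) (simp add: wt_sym[of "p (snd z)"] mult_ac)
    have "\<bar>avg ((A - {fst z}) \<times> (B - {snd z})) (\<lambda>u. bk (p (fst z)) (p (snd u)) * bk (p (snd z)) (p (fst u)))\<bar> \<le> \<beta>\<^sup>2"
      using bb by (intro avg_bound) auto
    from power_mono[OF this, of 2]
    show "\<bar>(p (fst z) * p (snd z) * avg ((A - {fst z}) \<times> (B - {snd z})) (\<lambda>u. wt (p (fst z)) (p (snd u)) * wt (p (fst u)) (p (snd z))))\<^sup>2\<bar> \<le> \<beta> ^ 4"
      unfolding e by (simp flip: power_mult)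
  qed (use \<beta>_pos in simp)
qed

lemma avg_Hm_bound: "\<bar>avg A (\<lambda>a. (Hm B p a)\<^sup>2)\<bar> \<le> \<beta>\<^sup>2"
  using Hm_sq by (intro avg_bound) auto

lemma UU_wt_mean:
  assumes A: "finite A" "card A \<ge> 2" "A \<subseteq> I" and B: "finite B" "card B \<ge> 2" "B \<subseteq> I" and AB: "A \<inter> B = {}"
  shows "(\<integral>p. \<bar>UU wt A B p - \<kappa>\<^sup>2\<bar> \<partial>R.N I) \<le> 12 * \<beta> ^ 4 * rate A B"
proof -
  interpret P: prob_space "R.N I" by (rule R.N_prob)
  have ne: "A \<noteq> {}" "B \<noteq> {}" using A B by auto
  let ?X = "\<lambda>p. avg A (\<lambda>a. (Hm B p a)\<^sup>2)"
  have iU: "integrable (R.N I) (\<lambda>p. \<bar>UU wt A B p - \<kappa>\<^sup>2\<bar>)"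
    using P.integrable_bounded[OF R.UU_meas[OF wt_meas A(3) B(3)] UU_bound] by auto
  have iX: "integrable (R.N I) (\<lambda>p. \<bar>?X p - \<kappa>\<bar>)"
    using P.integrable_bounded[OF avg_Hm_meas[OF A(3) B(3)] avg_Hm_bound] by auto
  let ?r = "4 * \<beta> ^ 4 * (1 / real (card A) + 1 / real (card B))"
  have "(\<integral>p. \<bar>UU wt A B p - \<kappa>\<^sup>2\<bar> \<partial>R.N I) \<le> (\<integral>p. ?r + 2 * \<beta>\<^sup>2 * \<bar>?X p - \<kappa>\<bar> \<partial>R.N I)"
  proof (rule integral_mono[OF iU])
    fix p
    show "\<bar>UU wt A B p - \<kappa>\<^sup>2\<bar> \<le> ?r + 2 * \<beta>\<^sup>2 * \<bar>?X p - \<kappa>\<bar>"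
      using UU_close[OF A(1,2) B(1,2), of p] square_diff_le[OF avg_Hm_bound[of A B p] \<kappa>_le] by linarith
  qed (use iX in auto)
  also have "\<dots> = ?r + 2 * \<beta>\<^sup>2 * (\<integral>p. \<bar>?X p - \<kappa>\<bar> \<partial>R.N I)" using iX by (simp add: P.prob_space)
  also have "\<dots> \<le> 4 * \<beta> ^ 4 * rate A B + 2 * \<beta>\<^sup>2 * (4 * \<beta>\<^sup>2 * rate A B)"
    using \<beta>_pos by (intro add_mono mult_left_mono inv_le_inv_sqrt Hm_lln A B ne AB) auto
  also have "\<dots> = 12 * \<beta> ^ 4 * rate A B" by (simp add: power2_eq_square power4_eq_xxxx algebra_simps)
  finally show ?thesis .
qed

lemma UC_wt_mean:
  assumes A: "finite A" "card A \<ge> 2" "A \<subseteq> I" and B: "finite B" "card B \<ge> 2" "B \<subseteq> I" and AB: "A \<inter> B = {}"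
  shows "(\<integral>p. \<bar>UC wt A B p - \<kappa>\<^sup>2\<bar> \<partial>R.N I) \<le> 12 * \<beta> ^ 4 * rate A B"
proof -
  interpret P: prob_space "R.N I" by (rule R.N_prob)
  have ne: "A \<noteq> {}" "B \<noteq> {}" using A B by auto
  let ?X = "\<lambda>p. avg A (\<lambda>a. (Hm B p a)\<^sup>2)" and ?Y = "\<lambda>p. avg B (\<lambda>a. (Hm A p a)\<^sup>2)"
  have iU: "integrable (R.N I) (\<lambda>p. \<bar>UC wt A B p - \<kappa>\<^sup>2\<bar>)"
    using P.integrable_bounded[OF R.UC_meas[OF wt_meas A(3) B(3)] UC_bound] by auto
  have iX: "integrable (R.N I) (\<lambda>p. \<bar>?X p - \<kappa>\<bar>)" "integrable (R.N I) (\<lambda>p. \<bar>?Y p - \<kappa>\<bar>)"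
    using P.integrable_bounded[OF avg_Hm_meas[OF A(3) B(3)] avg_Hm_bound]
      P.integrable_bounded[OF avg_Hm_meas[OF B(3) A(3)] avg_Hm_bound] by auto
  let ?r = "4 * \<beta> ^ 4 * (1 / real (card A) + 1 / real (card B))"
  have "(\<integral>p. \<bar>UC wt A B p - \<kappa>\<^sup>2\<bar> \<partial>R.N I) \<le> (\<integral>p. ?r + \<beta>\<^sup>2 * (\<bar>?X p - \<kappa>\<bar> + \<bar>?Y p - \<kappa>\<bar>) \<partial>R.N I)"
  proof (rule integral_mono[OF iU])
    fix p
    show "\<bar>UC wt A B p - \<kappa>\<^sup>2\<bar> \<le> ?r + \<beta>\<^sup>2 * (\<bar>?X p - \<kappa>\<bar> + \<bar>?Y p - \<kappa>\<bar>)"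
      using UC_close[OF A(1,2) B(1,2), of p] prod_diff_le[OF avg_Hm_bound[of B A p] \<kappa>_le, of "?X p" \<kappa>]
      unfolding power2_eq_square[of \<kappa>] by linarith
  qed (use iX in auto)
  also have "\<dots> = ?r + \<beta>\<^sup>2 * ((\<integral>p. \<bar>?X p - \<kappa>\<bar> \<partial>R.N I) + (\<integral>p. \<bar>?Y p - \<kappa>\<bar> \<partial>R.N I))"
    using iX by (simp add: P.prob_space)
  also have "\<dots> \<le> 4 * \<beta> ^ 4 * rate A B + \<beta>\<^sup>2 * (4 * \<beta>\<^sup>2 * rate A B + 4 * \<beta>\<^sup>2 * rate B A)"
    using \<beta>_pos AB by (intro add_mono mult_left_mono inv_le_inv_sqrt Hm_lln A B ne) auto
  also have "\<dots> = 12 * \<beta> ^ 4 * rate A B" by (simp add: power2_eq_square power4_eq_xxxx algebra_simps)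
  finally show ?thesis .
qed

lemma IAB: "R.IA z \<inter> R.IB z = {}" "finite (R.IA z)" "finite (R.IB z)" by auto

lemma Vw_wt: "tends_prob R.NN (\<lambda>z p. Vw wt (R.IA z) (R.IB z) p / An z) (\<kappa>\<^sup>2) R.FF"
proof (rule R.Vw_tends_prob[OF wt_meas])
  interpret P: prob_space "R.NN z" for z by (rule R.N_prob)
  have m: "UU wt (R.IA z) (R.IB z) \<in> borel_measurable (R.NN z)" "UU wt (R.IB z) (R.IA z) \<in> borel_measurable (R.NN z)"
    "UC wt (R.IA z) (R.IB z) \<in> borel_measurable (R.NN z)" for z
    by (intro R.UU_meas R.UC_meas wt_meas; simp)+
  note i = P.integrable_bounded[OF m(1) UU_bound] P.integrable_bounded[OF m(2) UU_bound] P.integrable_bounded[OF m(3) UC_bound]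
  show "tends_prob R.NN (\<lambda>z. UU wt (R.IA z) (R.IB z)) (\<kappa>\<^sup>2) R.FF"
    by (rule R.tends_prob_rate[OF m(1) i(1)], rule UU_wt_mean) (use IAB in auto)
  show "tends_prob R.NN (\<lambda>z. UC wt (R.IA z) (R.IB z)) (\<kappa>\<^sup>2) R.FF"
    by (rule R.tends_prob_rate[OF m(3) i(3)], rule UC_wt_mean) (use IAB in auto)
  show "tends_prob R.NN (\<lambda>z. UU wt (R.IB z) (R.IA z)) (\<kappa>\<^sup>2) R.FF"
  proof (rule R.tends_prob_rate[OF m(2) i(2)])
    fix z :: "nat \<times> nat" assume z: "2 \<le> fst z" "2 \<le> snd z"
    have "(\<integral>p. \<bar>UU wt (R.IB z) (R.IA z) p - \<kappa>\<^sup>2\<bar> \<partial>R.NN z) \<le> 12 * \<beta> ^ 4 * rate (R.IB z) (R.IA z)"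
      by (rule UU_wt_mean) (use IAB z in auto)
    then show "(\<integral>p. \<bar>UU wt (R.IB z) (R.IA z) p - \<kappa>\<^sup>2\<bar> \<partial>R.NN z) \<le> 12 * \<beta> ^ 4 * rate (R.IA z) (R.IB z)"
      by (simp add: add.commute)
  qed
qed

lemma QA_one: "tends_prob R.NN (\<lambda>z. QA (\<lambda>_ _. 1) (\<lambda>_ _. 1) (R.IA z) (R.IB z)) 1 R.FF"
proof -
  have m: "case_prod (\<lambda>_ _. 1::real) \<in> borel_measurable (borel \<Otimes>\<^sub>M borel)" by measurable
  have n: "0 \<le> (1::real)" by simp
  have i: "integrable L (\<lambda>_. 1::real)" "integrable L (\<lambda>_. \<integral>y. 1 \<partial>L)" by simp_all
  note k = kernel_integrable[where k="\<lambda>_ _. 1", OF m n i]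
  have E: "R.E2 (\<lambda>_ _. 1) = 1" unfolding k(2) by (simp add: prob_space)
  show ?thesis using R.QA_tends_prob[OF m n k(1) m n k(1)] unfolding E mult_1 .
qed

text \<open>For constant weights, \<open>UU\<close> and \<open>UC\<close> are averages of products
  of two squared scales with distinct indices. Writing them as \<open>QA\<close> with kernels that
  ignore one argument reduces them to the truncated law of large numbers, where a second moment of
  the scales suffices.\<close>

lemma Vw_one: "tends_prob R.NN (\<lambda>z p. Vw (\<lambda>_ _. 1) (R.IA z) (R.IB z) p / An z) (e2\<^sup>2) R.FF"
proof (rule R.Vw_tends_prob)
  have c: "2 \<le> fst z \<and> 2 \<le> snd z \<Longrightarrow> avg (dp (R.IA z)) (\<lambda>_. 1) = 1 \<and> avg (dp (R.IB z)) (\<lambda>_. 1) = 1" for z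
    using dp_nonempty[of "R.IA z"] dp_nonempty[of "R.IB z"] by (auto intro!: avg_const)
  have k1: "case_prod (\<lambda>x y::real. (x::real)\<^sup>2) \<in> borel_measurable (borel \<Otimes>\<^sub>M borel)"
    and k2: "case_prod (\<lambda>x y::real. (y::real)\<^sup>2) \<in> borel_measurable (borel \<Otimes>\<^sub>M borel)" by measurable
  have z: "0 \<le> (x::real)\<^sup>2" for x by simp
  have one: "case_prod (\<lambda>_ _. 1::real) \<in> borel_measurable (borel \<Otimes>\<^sub>M borel)" by measurable
  show "case_prod (\<lambda>_ _. 1::real) \<in> borel_measurable (borel \<Otimes>\<^sub>M borel)" by (rule one)
  show "tends_prob R.NN (\<lambda>z. UU (\<lambda>_ _. 1) (R.IA z) (R.IB z)) (e2\<^sup>2) R.FF"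
  proof (rule tends_prob_cong_eventually)
    show "tends_prob R.NN (\<lambda>z. QA (\<lambda>x y. x\<^sup>2) (\<lambda>x y. x\<^sup>2) (R.IA z) (R.IB z)) (e2\<^sup>2) R.FF"
      using R.QA_tends_prob[OF k1 z sq1_kernel(1) k1 z sq1_kernel(1)] by (simp only: sq1_kernel(2) power2_eq_square[of e2])
    show "UU (\<lambda>_ _. 1) (R.IA z) (R.IB z) \<in> borel_measurable (R.NN z)" for z by (intro R.UU_meas one) auto
    show "\<forall>\<^sub>F z in R.FF. \<forall>p\<in>space (R.NN z). QA (\<lambda>x y. x\<^sup>2) (\<lambda>x y. x\<^sup>2) (R.IA z) (R.IB z) p = UU (\<lambda>_ _. 1) (R.IA z) (R.IB z) p"
      using R.eventually_FF
    proof (rule eventually_mono, intro ballI)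
      fix z :: "nat \<times> nat" and p :: "nat + nat \<Rightarrow> real" assume zz: "2 \<le> fst z \<and> 2 \<le> (snd z :: nat)"
      show "QA (\<lambda>x y. x\<^sup>2) (\<lambda>x y. x\<^sup>2) (R.IA z) (R.IB z) p = UU (\<lambda>_ _. 1) (R.IA z) (R.IB z) p"
        unfolding QA_def UU_def
        using avg_prod[of "dp (R.IA z)" "dp (R.IB z)" "\<lambda>u. (p (fst u))\<^sup>2 * (p (snd u))\<^sup>2" "\<lambda>_. 1"] c[OF zz]
        by (simp add: power_mult_distrib)
    qed
  qed
  show "tends_prob R.NN (\<lambda>z. UU (\<lambda>_ _. 1) (R.IB z) (R.IA z)) (e2\<^sup>2) R.FF"
  proof (rule tends_prob_cong_eventually)
    show "tends_prob R.NN (\<lambda>z. QA (\<lambda>x y. y\<^sup>2) (\<lambda>x y. y\<^sup>2) (R.IA z) (R.IB z)) (e2\<^sup>2) R.FF"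
      using R.QA_tends_prob[OF k2 z sq2_kernel(1) k2 z sq2_kernel(1)] by (simp only: sq2_kernel(2) power2_eq_square[of e2])
    show "UU (\<lambda>_ _. 1) (R.IB z) (R.IA z) \<in> borel_measurable (R.NN z)" for z by (intro R.UU_meas one) auto
    show "\<forall>\<^sub>F z in R.FF. \<forall>p\<in>space (R.NN z). QA (\<lambda>x y. y\<^sup>2) (\<lambda>x y. y\<^sup>2) (R.IA z) (R.IB z) p = UU (\<lambda>_ _. 1) (R.IB z) (R.IA z) p"
      using R.eventually_FF
    proof (rule eventually_mono, intro ballI)
      fix z :: "nat \<times> nat" and p :: "nat + nat \<Rightarrow> real" assume zz: "2 \<le> fst z \<and> 2 \<le> (snd z :: nat)"
      show "QA (\<lambda>x y. y\<^sup>2) (\<lambda>x y. y\<^sup>2) (R.IA z) (R.IB z) p = UU (\<lambda>_ _. 1) (R.IB z) (R.IA z) p"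
        unfolding QA_def UU_def
        using avg_prod[of "dp (R.IA z)" "dp (R.IB z)" "\<lambda>_. 1" "\<lambda>u. (p (fst u))\<^sup>2 * (p (snd u))\<^sup>2"] c[OF zz]
        by (simp add: power_mult_distrib)
    qed
  qed
  show "tends_prob R.NN (\<lambda>z. UC (\<lambda>_ _. 1) (R.IA z) (R.IB z)) (e2\<^sup>2) R.FF"
  proof (rule tends_prob_cong_eventually)
    show "tends_prob R.NN (\<lambda>z. QA (\<lambda>x y. x\<^sup>2) (\<lambda>x y. y\<^sup>2) (R.IA z) (R.IB z)) (e2\<^sup>2) R.FF"
      using R.QA_tends_prob[OF k1 z sq1_kernel(1) k2 z sq2_kernel(1)] by (simp only: sq1_kernel(2) sq2_kernel(2) power2_eq_square[of e2])
    show "UC (\<lambda>_ _. 1) (R.IA z) (R.IB z) \<in> borel_measurable (R.NN z)" for z by (intro R.UC_meas one) auto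
    show "\<forall>\<^sub>F z in R.FF. \<forall>p\<in>space (R.NN z). QA (\<lambda>x y. x\<^sup>2) (\<lambda>x y. y\<^sup>2) (R.IA z) (R.IB z) p = UC (\<lambda>_ _. 1) (R.IA z) (R.IB z) p"
      using R.eventually_FF
    proof (rule eventually_mono, intro ballI)
      fix z :: "nat \<times> nat" and p :: "nat + nat \<Rightarrow> real" assume zz: "2 \<le> fst z \<and> 2 \<le> (snd z :: nat)"
      have o: "avg ((R.IA z - {fst u}) \<times> (R.IB z - {snd u})) (\<lambda>_. 1) = 1" if "u \<in> R.IA z \<times> R.IB z" for u
      proof (rule avg_const)
        have "card (R.IA z - {fst u}) > 0" "card (R.IB z - {snd u}) > 0"
          using that zz IAB(2,3)[of z] by (auto simp: card_Diff_singleton)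
        then have "R.IA z - {fst u} \<noteq> {}" "R.IB z - {snd u} \<noteq> {}" by (metis card.empty less_irrefl)+
        then show "(R.IA z - {fst u}) \<times> (R.IB z - {snd u}) \<noteq> {}" by simp
      qed simp
      have "UC (\<lambda>_ _. 1) (R.IA z) (R.IB z) p = avg (R.IA z \<times> R.IB z) (\<lambda>u. (p (fst u))\<^sup>2 * (p (snd u))\<^sup>2)"
        unfolding UC_def by (intro avg_cong) (simp add: o power_mult_distrib)
      also have "\<dots> = avg (R.IA z) (\<lambda>a. (p a)\<^sup>2) * avg (R.IB z) (\<lambda>b. (p b)\<^sup>2)"
        by (rule avg_prod)
      also have "\<dots> = avg (dp (R.IA z)) (\<lambda>u. (p (fst u))\<^sup>2) * avg (dp (R.IB z)) (\<lambda>u. (p (snd u))\<^sup>2)"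
        using zz avg_dp_fst[of "R.IA z" "\<lambda>a. (p a)\<^sup>2"] avg_dp_snd[of "R.IB z" "\<lambda>a. (p a)\<^sup>2"] by simp
      also have "\<dots> = QA (\<lambda>x y. x\<^sup>2) (\<lambda>x y. y\<^sup>2) (R.IA z) (R.IB z) p"
        unfolding QA_def by (rule avg_prod[symmetric])
      finally show "QA (\<lambda>x y. x\<^sup>2) (\<lambda>x y. y\<^sup>2) (R.IA z) (R.IB z) p = UC (\<lambda>_ _. 1) (R.IA z) (R.IB z) p" by simp
    qed
  qed
qed

end

section \<open>The coefficients of the limiting quadratic form\<close>

lemma sum_dp_swap: "(\<Sum>u\<in>dp B. F (fst u) (snd u)) = (\<Sum>u\<in>dp B. F (snd u) (fst u))"
  by (rule sum.reindex_bij_witness[of _ prod.swap prod.swap]) (auto simp: dp_def)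

text \<open>The coefficient of the copies a and b collects those pairs of pairs in which a belongs
  to one difference and b to the other. For a and b in the same sample this fixes the whole pair
  from that sample; for different samples it fixes one index in each, with a negative sign, and
  leaves the two others free. These cases give \<open>UU\<close> and \<open>UC\<close>.\<close>

lemma coefficient_sum:
  fixes r :: "'i \<Rightarrow> real" and w :: "real \<Rightarrow> real \<Rightarrow> real"
  assumes A: "finite A" "card A \<ge> 2" and B: "finite B" "card B \<ge> 2" and AB: "A \<inter> B = {}"
    and sym: "\<And>x y. w x y = w y x"
    and s_def: "\<And>h a. s h a = r a * ((if a = fst (snd h) then 1 else 0) - (if a = fst (fst h) then 1 else 0))"
    and t_def: "\<And>h a. t h a = r a * ((if a = snd (snd h) then 1 else 0) - (if a = snd (fst h) then 1 else 0))"
    and w0_def: "\<And>h. w0 h = w (r (fst (fst h))) (r (fst (snd h))) * w (r (snd (fst h))) (r (snd (snd h))) / real (card (dp A \<times> dp B))"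
    and T_def: "\<And>a b. T a b = (\<Sum>h\<in>dp A \<times> dp B. w0 h * ((s h a * t h b + s h b * t h a) / 2))"
  shows "2 * (\<Sum>a\<in>A \<union> B. \<Sum>b\<in>A \<union> B. (T a b)\<^sup>2) = Vw w A B r"
proof -
  define C where "C = real (card (dp A \<times> dp B))"
  define W where "W h = w (r (fst (fst h))) (r (fst (snd h))) * w (r (snd (fst h))) (r (snd (snd h)))" for h :: "('i \<times> 'i) \<times> ('i \<times> 'i)"
  define cA cB where "cA = real (card A)" and "cB = real (card B)"
  have cAB: "cA \<ge> 2" "cB \<ge> 2" using A B by (auto simp: cA_def cB_def)
  have dA: "real (card (dp A)) = cA * (cA - 1)" and dB: "real (card (dp B)) = cB * (cB - 1)"
    using A B by (auto simp: card_dp cA_def cB_def of_nat_diff)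
  have C: "C = (cA * (cA - 1)) * (cB * (cB - 1))" unfolding C_def by (simp add: card_cartesian_product dA dB)
  have C0: "C > 0" unfolding C using cAB by (intro mult_pos_pos) auto
  have T_sym: "T a b = T b a" for a b unfolding T_def by (simp add: add.commute mult.commute)
  have T: "T a b = (\<Sum>h\<in>dp A \<times> dp B. W h * (s h a * t h b + s h b * t h a)) / (2 * C)" for a b
    unfolding T_def w0_def W_def C_def sum_divide_distrib by (intro sum.cong refl) (simp add: field_simps)
  have dis: "fst (fst h) \<in> A" "snd (fst h) \<in> A" "fst (snd h) \<in> B" "snd (snd h) \<in> B" "fst (fst h) \<noteq> snd (fst h)" "fst (snd h) \<noteq> snd (snd h)"
    if "h \<in> dp A \<times> dp B" for h using that by (auto simp: dp_def)
  define G1 where "G1 a a' = (\<Sum>u\<in>dp B. w (r a) (r (fst u)) * w (r a') (r (snd u)))" for a a'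
  define G2 where "G2 b b' = (\<Sum>u\<in>dp A. w (r b) (r (fst u)) * w (r b') (r (snd u)))" for b b'
  define G3 where "G3 a b = (\<Sum>u\<in>(A - {a}) \<times> (B - {b}). w (r a) (r (snd u)) * w (r (fst u)) (r b))" for a b
  have G1_sym: "G1 a a' = G1 a' a" for a a'
    unfolding G1_def by (subst sum_dp_swap) (simp add: mult.commute)
  have G2_sym: "G2 a a' = G2 a' a" for a a'
    unfolding G2_def by (subst sum_dp_swap) (simp add: mult.commute)
  have TA: "T a a' = (if a = a' then 0 else r a * r a' * G1 a a' / C)" if a: "a \<in> A" "a' \<in> A" for a a'
  proof -
    have nB: "x \<noteq> b" if "b \<in> B" "x \<in> A" for x b using that AB by auto
    \<comment> \<open>For two indices of \<open>A\<close>, only terms whose first pair is (x, y)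
      survive; both signs are negative and cancel.\<close>
    have one: "(\<Sum>h\<in>dp A \<times> dp B. W h * (s h x * t h y)) = (if x = y then 0 else r x * r y * G1 x y)" if "x \<in> A" "y \<in> A" for x y
    proof -
      have "(\<Sum>h\<in>dp A \<times> dp B. W h * (s h x * t h y)) = (\<Sum>h\<in>dp A \<times> dp B. if fst h = (x, y) then r x * r y * W h else 0)"
        unfolding s_def t_def using that dis nB by (intro sum.cong refl) (auto simp: prod_eq_iff split: if_splits)
      also have "\<dots> = (\<Sum>z\<in>dp A. \<Sum>u\<in>dp B. if z = (x, y) then r x * r y * W (z, u) else 0)"
        by (simp add: sum.cartesian_product')
      also have "\<dots> = (\<Sum>z\<in>dp A. if z = (x, y) then (\<Sum>u\<in>dp B. r x * r y * W (z, u)) else 0)"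
        by (intro sum.cong refl) auto
      also have "\<dots> = (if (x, y) \<in> dp A then (\<Sum>u\<in>dp B. r x * r y * W ((x, y), u)) else 0)"
        using A by (simp add: sum.delta)
      also have "\<dots> = (if x = y then 0 else r x * r y * G1 x y)"
        using that by (auto simp: dp_def G1_def W_def sum_distrib_left)
      finally show ?thesis .
    qed
    have "T a a' = ((\<Sum>h\<in>dp A \<times> dp B. W h * (s h a * t h a')) + (\<Sum>h\<in>dp A \<times> dp B. W h * (s h a' * t h a))) / (2 * C)"
      unfolding T by (simp add: distrib_left sum.distrib)
    then show ?thesis unfolding one[OF a] one[OF a(2,1)] using G1_sym[of a a'] by (simp add: mult_ac)
  qed
  have TB: "T b b' = (if b = b' then 0 else r b * r b' * G2 b b' / C)" if b: "b \<in> B" "b' \<in> B" for b b'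
  proof -
    have nA: "x \<noteq> a" if "a \<in> A" "x \<in> B" for x a using that AB by auto
    have one: "(\<Sum>h\<in>dp A \<times> dp B. W h * (s h x * t h y)) = (if x = y then 0 else r x * r y * G2 x y)" if "x \<in> B" "y \<in> B" for x y
    proof -
      have "(\<Sum>h\<in>dp A \<times> dp B. W h * (s h x * t h y)) = (\<Sum>h\<in>dp A \<times> dp B. if snd h = (x, y) then r x * r y * W h else 0)"
        unfolding s_def t_def using that dis nA by (intro sum.cong refl) (auto simp: prod_eq_iff split: if_splits)
      also have "\<dots> = (\<Sum>z\<in>dp A. \<Sum>u\<in>dp B. if u = (x, y) then r x * r y * W (z, u) else 0)"
        by (simp add: sum.cartesian_product')
      also have "\<dots> = (\<Sum>z\<in>dp A. if (x, y) \<in> dp B then r x * r y * W (z, (x, y)) else 0)"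
        using B by (intro sum.cong refl) (simp add: sum.delta)
      also have "\<dots> = (if x = y then 0 else r x * r y * G2 x y)"
        using that by (auto simp: dp_def G2_def W_def sum_distrib_left sym)
      finally show ?thesis .
    qed
    have "T b b' = ((\<Sum>h\<in>dp A \<times> dp B. W h * (s h b * t h b')) + (\<Sum>h\<in>dp A \<times> dp B. W h * (s h b' * t h b))) / (2 * C)"
      unfolding T by (simp add: distrib_left sum.distrib)
    then show ?thesis unfolding one[OF b] one[OF b(2,1)] using G2_sym[of b b'] by (simp add: mult_ac)
  qed
  have TAB: "T a b = - (r a * r b * G3 a b / C)" if ab: "a \<in> A" "b \<in> B" for a b
  proof -
    \<comment> \<open>One index of each pair is now prescribed; the reindexing runs over the
      remaining two, each different from its prescribed partner.\<close>
    have 1: "(\<Sum>h\<in>dp A \<times> dp B. W h * (s h a * t h b)) = - (r a * r b * G3 a b)"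
    proof -
      have "(\<Sum>h\<in>dp A \<times> dp B. W h * (s h a * t h b)) = (\<Sum>h\<in>dp A \<times> dp B. if fst (fst h) = a \<and> snd (snd h) = b then - (r a * r b * W h) else 0)"
      proof (intro sum.cong refl)
        fix h assume h: "h \<in> dp A \<times> dp B"
        have "a \<noteq> fst (snd h)" "a \<noteq> snd (snd h)" "b \<noteq> fst (fst h)" "b \<noteq> snd (fst h)" using dis[OF h] ab AB by auto
        then show "W h * (s h a * t h b) = (if fst (fst h) = a \<and> snd (snd h) = b then - (r a * r b * W h) else 0)"
          unfolding s_def t_def by auto
      qed
      also have "\<dots> = (\<Sum>h\<in>{h\<in>dp A \<times> dp B. fst (fst h) = a \<and> snd (snd h) = b}. - (r a * r b * W h))"
        using A B by (intro sum.inter_filter[symmetric]) auto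
      also have "\<dots> = (\<Sum>u\<in>(A - {a}) \<times> (B - {b}). - (r a * r b * (w (r a) (r (snd u)) * w (r (fst u)) (r b))))"
        by (rule sum.reindex_bij_witness[of _ "\<lambda>u. ((a, fst u), (snd u, b))" "\<lambda>h. (snd (fst h), fst (snd h))"])
           (use ab in \<open>auto simp: dp_def W_def\<close>)
      also have "\<dots> = - (r a * r b * G3 a b)" unfolding G3_def by (simp add: sum_negf sum_distrib_left)
      finally show ?thesis .
    qed
    have 2: "(\<Sum>h\<in>dp A \<times> dp B. W h * (s h b * t h a)) = - (r a * r b * G3 a b)"
    proof -
      have "(\<Sum>h\<in>dp A \<times> dp B. W h * (s h b * t h a)) = (\<Sum>h\<in>dp A \<times> dp B. if snd (fst h) = a \<and> fst (snd h) = b then - (r a * r b * W h) else 0)"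
      proof (intro sum.cong refl)
        fix h assume h: "h \<in> dp A \<times> dp B"
        have "a \<noteq> fst (snd h)" "a \<noteq> snd (snd h)" "b \<noteq> fst (fst h)" "b \<noteq> snd (fst h)" using dis[OF h] ab AB by auto
        then show "W h * (s h b * t h a) = (if snd (fst h) = a \<and> fst (snd h) = b then - (r a * r b * W h) else 0)"
          unfolding s_def t_def by auto
      qed
      also have "\<dots> = (\<Sum>h\<in>{h\<in>dp A \<times> dp B. snd (fst h) = a \<and> fst (snd h) = b}. - (r a * r b * W h))"
        using A B by (intro sum.inter_filter[symmetric]) auto
      also have "\<dots> = (\<Sum>u\<in>(A - {a}) \<times> (B - {b}). - (r a * r b * (w (r a) (r (snd u)) * w (r (fst u)) (r b))))"
        by (rule sum.reindex_bij_witness[of _ "\<lambda>u. ((fst u, a), (b, snd u))" "\<lambda>h. (fst (fst h), snd (snd h))"])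
           (use ab in \<open>auto simp: dp_def W_def mult.commute\<close>)
      also have "\<dots> = - (r a * r b * G3 a b)" unfolding G3_def by (simp add: sum_negf sum_distrib_left)
      finally show ?thesis .
    qed
    have "T a b = ((\<Sum>h\<in>dp A \<times> dp B. W h * (s h a * t h b)) + (\<Sum>h\<in>dp A \<times> dp B. W h * (s h b * t h a))) / (2 * C)"
      unfolding T by (simp add: distrib_left sum.distrib)
    then show ?thesis unfolding 1 2 by simp
  qed
  have SA: "(\<Sum>a\<in>A. \<Sum>b\<in>A. (T a b)\<^sup>2) = UU w A B r / (cA * (cA - 1))"
  proof -
    have "(\<Sum>a\<in>A. \<Sum>b\<in>A. (T a b)\<^sup>2) = (\<Sum>z\<in>A \<times> A. (T (fst z) (snd z))\<^sup>2)"
      by (simp add: sum.cartesian_product case_prod_beta')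
    also have "\<dots> = (\<Sum>z\<in>dp A. (r (fst z) * r (snd z) * G1 (fst z) (snd z) / C)\<^sup>2)"
      by (rule sum.mono_neutral_cong_right) (use A TA in \<open>auto simp: dp_def\<close>)
    also have "\<dots> = (\<Sum>z\<in>dp A. (r (fst z) * r (snd z) * (G1 (fst z) (snd z) / (cB * (cB - 1))))\<^sup>2 / (cA * (cA - 1))\<^sup>2)"
      unfolding C by (intro sum.cong refl) (simp add: power_mult_distrib power_divide)
    also have "\<dots> = UU w A B r / (cA * (cA - 1))"
      unfolding UU_def avg_def dA dB G1_def by (simp add: sum_divide_distrib power2_eq_square[of "cA * (cA - 1)"])
    finally show ?thesis .
  qed
  have SB: "(\<Sum>a\<in>B. \<Sum>b\<in>B. (T a b)\<^sup>2) = UU w B A r / (cB * (cB - 1))"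
  proof -
    have "(\<Sum>a\<in>B. \<Sum>b\<in>B. (T a b)\<^sup>2) = (\<Sum>z\<in>B \<times> B. (T (fst z) (snd z))\<^sup>2)"
      by (simp add: sum.cartesian_product case_prod_beta')
    also have "\<dots> = (\<Sum>z\<in>dp B. (r (fst z) * r (snd z) * G2 (fst z) (snd z) / C)\<^sup>2)"
      by (rule sum.mono_neutral_cong_right) (use B TB in \<open>auto simp: dp_def\<close>)
    also have "\<dots> = (\<Sum>z\<in>dp B. (r (fst z) * r (snd z) * (G2 (fst z) (snd z) / (cA * (cA - 1))))\<^sup>2 / (cB * (cB - 1))\<^sup>2)"
      unfolding C by (intro sum.cong refl) (simp add: power_mult_distrib power_divide)
    also have "\<dots> = UU w B A r / (cB * (cB - 1))"
      unfolding UU_def avg_def dA dB G2_def by (simp add: sum_divide_distrib power2_eq_square[of "cB * (cB - 1)"])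
    finally show ?thesis .
  qed
  have SC: "(\<Sum>a\<in>A. \<Sum>b\<in>B. (T a b)\<^sup>2) = UC w A B r / (cA * cB)"
  proof -
    have "(\<Sum>a\<in>A. \<Sum>b\<in>B. (T a b)\<^sup>2) = (\<Sum>z\<in>A \<times> B. (T (fst z) (snd z))\<^sup>2)"
      by (simp add: sum.cartesian_product case_prod_beta')
    also have "\<dots> = (\<Sum>z\<in>A \<times> B. (r (fst z) * r (snd z) * (G3 (fst z) (snd z) / ((cA - 1) * (cB - 1))))\<^sup>2 / (cA * cB)\<^sup>2)"
      by (intro sum.cong refl) (auto simp: TAB C power_mult_distrib power_divide mult_ac)
    also have "\<dots> = UC w A B r / (cA * cB)"
    proof -
      have e: "avg ((A - {fst z}) \<times> (B - {snd z})) F = sum F ((A - {fst z}) \<times> (B - {snd z})) / ((cA - 1) * (cB - 1))" if "z \<in> A \<times> B" for z F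
        using that A B unfolding avg_def cA_def cB_def by (auto simp: card_cartesian_product card_Diff_singleton of_nat_diff)
      have "UC w A B r = (\<Sum>z\<in>A \<times> B. (r (fst z) * r (snd z) * (G3 (fst z) (snd z) / ((cA - 1) * (cB - 1))))\<^sup>2) / (cA * cB)"
        unfolding UC_def avg_def[of "A \<times> B"] G3_def
        by (simp add: e card_cartesian_product cong: sum.cong) (simp add: cA_def cB_def)
      then show ?thesis by (simp add: sum_divide_distrib power2_eq_square[of "cA * cB"])
    qed
    finally show ?thesis .
  qed
  \<comment> \<open>The two mixed blocks are equal by symmetry, which accounts for the factor 4 in
    \<open>Vw\<close> against 2 for the pure blocks.\<close>
  have "(\<Sum>a\<in>A \<union> B. \<Sum>b\<in>A \<union> B. (T a b)\<^sup>2) = (\<Sum>a\<in>A. \<Sum>b\<in>A. (T a b)\<^sup>2) + (\<Sum>a\<in>B. \<Sum>b\<in>B. (T a b)\<^sup>2) +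
      ((\<Sum>a\<in>A. \<Sum>b\<in>B. (T a b)\<^sup>2) + (\<Sum>a\<in>B. \<Sum>b\<in>A. (T a b)\<^sup>2))"
    using A B AB by (simp add: sum.union_disjoint sum.distrib)
  also have "(\<Sum>a\<in>B. \<Sum>b\<in>A. (T a b)\<^sup>2) = (\<Sum>a\<in>A. \<Sum>b\<in>B. (T a b)\<^sup>2)"
    by (subst sum.swap) (simp add: T_sym)
  finally show ?thesis unfolding SA SB SC Vw_def cA_def cB_def by (simp add: field_simps)
qed

section \<open>The statistics as averages over pairs of pairs\<close>

lemma sum_pairs_of_samples:
  "(\<Sum>i1 = 1..m. \<Sum>i2 \<in> {1..m} - {i1}. \<Sum>j1 = 1..n. \<Sum>j2 \<in> {1..n} - {j1}. G (Inl i1) (Inl i2) (Inr j1) (Inr j2)) =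
   (\<Sum>h\<in>dp (Inl ` {1..m::nat}) \<times> dp (Inr ` {1..n::nat}). G (fst (fst h)) (snd (fst h)) (fst (snd h)) (snd (snd h)))"
proof -
  have "(\<Sum>i1 = 1..m. \<Sum>i2 \<in> {1..m} - {i1}. \<Sum>j1 = 1..n. \<Sum>j2 \<in> {1..n} - {j1}. G (Inl i1) (Inl i2) (Inr j1) (Inr j2)) =
    (\<Sum>z\<in>dp {1..m}. \<Sum>u\<in>dp {1..n}. G (Inl (fst z)) (Inl (snd z)) (Inr (fst u)) (Inr (snd u)))"
    by (subst (2) sum_dp) (simp_all add: sum_dp)
  also have "\<dots> = (\<Sum>h\<in>dp {1..m} \<times> dp {1..n}. G (Inl (fst (fst h))) (Inl (snd (fst h))) (Inr (fst (snd h))) (Inr (snd (snd h))))"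
    by (simp add: sum.cartesian_product')
  also have "\<dots> = (\<Sum>h\<in>dp (Inl ` {1..m::nat}) \<times> dp (Inr ` {1..n::nat}). G (fst (fst h)) (snd (fst h)) (fst (snd h)) (snd (snd h)))"
    by (rule sum.reindex_bij_witness[of _ "\<lambda>h. ((projl (fst (fst h)), projl (snd (fst h))), (projr (fst (snd h)), projr (snd (snd h))))"
          "\<lambda>h. ((Inl (fst (fst h)), Inl (snd (fst h))), (Inr (fst (snd h)), Inr (snd (snd h))))"]) (auto simp: dp_def)
  finally show ?thesis .
qed

lemma falling_two: "falling m 2 = real m * (real m - 1)"
  by (simp add: falling_def numeral_2_eq_2 lessThan_Suc One_nat_def)

lemma card_dp_pairs:
  assumes "m \<ge> 1" "n \<ge> 1"
  shows "real (card (dp (Inl ` {1..m::nat}) \<times> dp (Inr ` {1..n::nat}))) = falling m 2 * falling n 2"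
  using assms by (simp add: card_cartesian_product card_dp card_image falling_two of_nat_diff)

lemma inner_d_shift: "inner_d d x y = (\<Sum>k<d. x (Suc k) * y (Suc k))"
  unfolding inner_d_def by (rule sum.reindex_bij_witness[of _ Suc "\<lambda>k. k - 1"]) auto

lemma norm_d_shift: "norm_d d x = sqrt (\<Sum>k<d. (x (Suc k))\<^sup>2)"
  unfolding L2_set_def by (rule arg_cong[where f=sqrt], rule sum.reindex_bij_witness[of _ Suc "\<lambda>k. k - 1"]) auto

lemma inner_sign: "inner_d d (spatial_sign d x) (spatial_sign d y) = inner_d d x y / (norm_d d x * norm_d d y)"
  by (simp add: inner_d_def spatial_sign_def sum_divide_distrib)

text \<open>The coordinates 1 to d of the vectors are shifted to 0 to d - 1, the indexing used for
  the limit theorems.\<close>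

definition pair_diff :: "('i \<Rightarrow> nat \<Rightarrow> real) \<Rightarrow> 'i \<Rightarrow> 'i \<Rightarrow> nat \<Rightarrow> real" where
  "pair_diff x a b = (\<lambda>k. x b (Suc k) - x a (Suc k))"

definition pair_norm :: "nat \<Rightarrow> ('i \<Rightarrow> nat \<Rightarrow> real) \<Rightarrow> 'i \<Rightarrow> 'i \<Rightarrow> real" where
  "pair_norm d x a b = sqrt (\<Sum>k<d. (pair_diff x a b k)\<^sup>2)"

definition pair_form :: "nat \<Rightarrow> ('i \<Rightarrow> nat \<Rightarrow> real) \<Rightarrow> ('i \<times> 'i) \<times> ('i \<times> 'i) \<Rightarrow> real" where
  "pair_form d x h = (\<Sum>k<d. pair_diff x (fst (fst h)) (fst (snd h)) k * pair_diff x (snd (fst h)) (snd (snd h)) k)"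

lemma T_CQ2_pairs:
  assumes "m \<ge> 1" "n \<ge> 1"
  shows "T_CQ2 d m n (\<lambda>i. x (Inl i)) (\<lambda>j. x (Inr j)) = avg (dp (Inl ` {1..m}) \<times> dp (Inr ` {1..n})) (pair_form d x)"
proof -
  have e: "inner_d d (vec_diff (x a) (x b)) (vec_diff (x a') (x b')) = pair_form d x ((a, a'), (b, b'))" for a b a' b'
    unfolding inner_d_shift pair_form_def pair_diff_def vec_diff_def by (intro sum.cong refl) (simp add: algebra_simps)
  show ?thesis
    unfolding T_CQ2_def avg_def card_dp_pairs[OF assms] e
    by (subst sum_pairs_of_samples[where G="\<lambda>a a' b b'. pair_form d x ((a, a'), (b, b'))"]) simp
qed

lemma T_WMW_pairs:
  assumes "m \<ge> 1" "n \<ge> 1"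
  shows "T_WMW d m n (\<lambda>i. x (Inl i)) (\<lambda>j. x (Inr j)) = avg (dp (Inl ` {1..m}) \<times> dp (Inr ` {1..n}))
    (\<lambda>h. pair_form d x h / (pair_norm d x (fst (fst h)) (fst (snd h)) * pair_norm d x (snd (fst h)) (snd (snd h))))"
proof -
  have e: "inner_d d (spatial_sign d (vec_diff (x b) (x a))) (spatial_sign d (vec_diff (x b') (x a'))) =
    pair_form d x ((a, a'), (b, b')) / (pair_norm d x a b * pair_norm d x a' b')" for a b a' b'
    unfolding inner_sign unfolding inner_d_shift norm_d_shift pair_form_def pair_norm_def pair_diff_def vec_diff_def by simp
  show ?thesis
    unfolding T_WMW_def avg_def card_dp_pairs[OF assms] e
    by (subst sum_pairs_of_samples[where G="\<lambda>a a' b b'. pair_form d x ((a, a'), (b, b')) / (pair_norm d x a b * pair_norm d x a' b')"]) simp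
qed

lemma pair_restrict:
  assumes "h \<in> dp A \<times> dp B" "A \<subseteq> I" "B \<subseteq> I"
  shows "pair_form d (restrict x I) h = pair_form d x h"
    "pair_norm d (restrict x I) (fst (fst h)) (fst (snd h)) = pair_norm d x (fst (fst h)) (fst (snd h))"
    "pair_norm d (restrict x I) (snd (fst h)) (snd (snd h)) = pair_norm d x (snd (fst h)) (snd (snd h))"
proof -
  have "fst (fst h) \<in> I" "snd (fst h) \<in> I" "fst (snd h) \<in> I" "snd (snd h) \<in> I" using assms by (auto simp: dp_def)
  then show "pair_form d (restrict x I) h = pair_form d x h"
    "pair_norm d (restrict x I) (fst (fst h)) (fst (snd h)) = pair_norm d x (fst (fst h)) (fst (snd h))"
    "pair_norm d (restrict x I) (snd (fst h)) (snd (snd h)) = pair_norm d x (snd (fst h)) (snd (snd h))"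
    unfolding pair_form_def pair_norm_def pair_diff_def by auto
qed

lemma pair_meas:
  assumes "h \<in> dp A \<times> dp B" "A \<subseteq> I" "B \<subseteq> I"
  shows "(\<lambda>x. pair_form d x h) \<in> borel_measurable (PiM I (\<lambda>_. RV d))"
    "(\<lambda>x. pair_norm d x (fst (fst h)) (fst (snd h))) \<in> borel_measurable (PiM I (\<lambda>_. RV d))"
    "(\<lambda>x. pair_norm d x (snd (fst h)) (snd (snd h))) \<in> borel_measurable (PiM I (\<lambda>_. RV d))"
proof -
  have c: "(\<lambda>x. x a (Suc k)) \<in> borel_measurable (PiM I (\<lambda>_. RV d))" if "a \<in> I" "k < d" for a k
    by (rule measurable_compose[OF measurable_component_singleton[OF that(1)]], rule measurable_component_singleton) (use that in auto)
  have d: "fst (fst h) \<in> I" "snd (fst h) \<in> I" "fst (snd h) \<in> I" "snd (snd h) \<in> I" using assms by (auto simp: dp_def)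
  have dm: "(\<lambda>x. pair_diff x a b k) \<in> borel_measurable (PiM I (\<lambda>_. RV d))" if "a \<in> I" "b \<in> I" "k < d" for a b k
    unfolding pair_diff_def using c that by (intro borel_measurable_diff) auto
  show "(\<lambda>x. pair_form d x h) \<in> borel_measurable (PiM I (\<lambda>_. RV d))"
    unfolding pair_form_def using d by (intro borel_measurable_sum borel_measurable_times dm) auto
  have nm: "(\<lambda>x. pair_norm d x a b) \<in> borel_measurable (PiM I (\<lambda>_. RV d))" if "a \<in> I" "b \<in> I" for a b
    unfolding pair_norm_def using that
    by (intro measurable_compose[OF _ borel_measurable_sqrt] borel_measurable_sum borel_measurable_power dm) auto
  show "(\<lambda>x. pair_norm d x (fst (fst h)) (fst (snd h))) \<in> borel_measurable (PiM I (\<lambda>_. RV d))"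
    "(\<lambda>x. pair_norm d x (snd (fst h)) (snd (snd h))) \<in> borel_measurable (PiM I (\<lambda>_. RV d))"
    using nm d by auto
qed

section \<open>The limit in the dimension\<close>

text \<open>The coefficients with which the copies of the sequence enter the centred difference of
  the points \<open>b\<close> and \<open>a\<close> when the scales are \<open>p\<close>.\<close>

definition lcoeff :: "('i \<Rightarrow> real) \<Rightarrow> 'i \<Rightarrow> 'i \<Rightarrow> 'i \<Rightarrow> real" where
  "lcoeff p a b c = p c * ((if c = b then 1 else 0) - (if c = a then 1 else 0))"

lemma sum_lcoeff:
  assumes "finite I" "a \<in> I" "b \<in> I"
  shows "(\<Sum>c\<in>I. lcoeff p a b c * F c) = p b * F b - p a * F a"
proof -
  have "(\<Sum>c\<in>I. lcoeff p a b c * F c) = (\<Sum>c\<in>I. (if c = b then p c * F c else 0) - (if c = a then p c * F c else 0))"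
    unfolding lcoeff_def by (intro sum.cong refl) auto
  also have "\<dots> = p b * F b - p a * F a" using assms by (simp add: sum_subtractf)
  finally show ?thesis .
qed

text \<open>The mixed part alone is positive, since each sample has a second index. Thus the
  limiting conditional law is not degenerate.\<close>

lemma Vw_pos:
  assumes A: "finite A" "card A \<ge> 2" and B: "finite B" "card B \<ge> 2"
    and p: "\<And>a. a \<in> A \<union> B \<Longrightarrow> p a > 0" and w: "\<And>x y. x > 0 \<Longrightarrow> y > 0 \<Longrightarrow> w x y > 0"
  shows "Vw w A B p > 0"
proof -
  have pos: "avg S F > 0" if "finite S" "S \<noteq> {}" "\<And>x. x \<in> S \<Longrightarrow> F x > 0" for S :: "'c set" and F
    unfolding avg_def using that by (intro divide_pos_pos sum_pos) (auto simp: card_gt_0_iff)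
  have ne: "A - {a} \<noteq> {}" "B - {b} \<noteq> {}" for a b
    using A B by (metis card_le_Suc0_iff_eq card.empty card_Diff_singleton_if One_nat_def Suc_1 diff_is_0_eq' diff_le_self not_less_eq_eq le_zero_eq diff_Suc_1 le_diff_conv add_0 plus_1_eq_Suc)+
  have "UC w A B p > 0" unfolding UC_def
  proof (rule pos)
    fix z assume z: "z \<in> A \<times> B"
    have "avg ((A - {fst z}) \<times> (B - {snd z})) (\<lambda>u. w (p (fst z)) (p (snd u)) * w (p (fst u)) (p (snd z))) > 0"
    proof (rule pos)
      show "finite ((A - {fst z}) \<times> (B - {snd z}))" using A B by simp
      show "(A - {fst z}) \<times> (B - {snd z}) \<noteq> {}" using ne by simp
      fix u assume "u \<in> (A - {fst z}) \<times> (B - {snd z})"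
      then show "0 < w (p (fst z)) (p (snd u)) * w (p (fst u)) (p (snd z))"
        using z by (intro mult_pos_pos w p) auto
    qed
    moreover have "p (fst z) > 0" "p (snd z) > 0" using z p by auto
    ultimately show "0 < (p (fst z) * p (snd z) * avg ((A - {fst z}) \<times> (B - {snd z})) (\<lambda>u. w (p (fst z)) (p (snd u)) * w (p (fst u)) (p (snd z))))\<^sup>2"
      by simp
  qed (use A B in auto)
  moreover have "UU w S T p \<ge> 0" for S T
    unfolding UU_def avg_def by (intro divide_nonneg_nonneg sum_nonneg) auto
  ultimately show ?thesis
    unfolding Vw_def using A B
    by (intro add_nonneg_pos add_nonneg_nonneg divide_nonneg_nonneg divide_pos_pos mult_pos_pos mult_nonneg_nonneg) auto
qed

context rho_sequence
begin

text \<open>The two differences in a pair of pairs share no index, so their form has no diagonal.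
  The denominator of the average is absorbed into the weights, and \<open>coefficient_sum\<close>
  evaluates the variance.\<close>

lemma pair_forms_upper_tail:
  fixes p :: "'i \<Rightarrow> real"
  assumes J: "finite J" "card J \<ge> 2" and J': "finite J'" "card J' \<ge> 2" and dis: "J \<inter> J' = {}"
    and shift: "(\<lambda>d. (\<Sum>k<d. (\<delta> d k)\<^sup>2) / sqrt (real d)) \<longlonglongrightarrow> l"
    and cross: "(\<lambda>d. (\<Sum>k<d. \<Sum>l<d. \<delta> d k * \<delta> d l * expectation (\<lambda>x. U k x * U l x)) / real d) \<longlonglongrightarrow> 0"
    and sym: "\<And>x y. w x y = w y x"
    and W: "\<And>h. h \<in> dp J \<times> dp J' \<Longrightarrow> tends_prob (\<lambda>_. Pr (J \<union> J')) (W h)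
      (w (p (fst (fst h))) (p (fst (snd h))) * w (p (snd (fst h))) (p (snd (snd h)))) sequentially"
    and scale: "\<kappa> \<longlonglongrightarrow> \<kappa>0" "\<kappa>0 > 0" and V: "Vw w J J' p > 0"
  shows "(\<lambda>d. measure (Pr (J \<union> J')) {\<omega>\<in>space (Pr (J \<union> J')).
      \<kappa> d * avg (dp J \<times> dp J') (\<lambda>h. W h d \<omega> * (shifted_form (J \<union> J') \<delta>
        (lcoeff p (fst (fst h)) (fst (snd h))) (lcoeff p (snd (fst h)) (snd (snd h))) d \<omega> / sqrt (real d))) > z})
    \<longlonglongrightarrow> 1 - Phi ((z - \<kappa>0 * (l * QA w w J J' p)) / (\<kappa>0 * sqrt (Vw w J J' p * \<tau>)))"
proof -
  let ?H = "dp J \<times> dp J'" and ?I = "J \<union> J'"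
  define s t where "s h = lcoeff p (fst (fst h)) (fst (snd h))" and "t h = lcoeff p (snd (fst h)) (snd (snd h))"
    for h :: "('i \<times> 'i) \<times> ('i \<times> 'i)"
  define C where "C = real (card ?H)"
  define w0 where "w0 h = w (p (fst (fst h))) (p (fst (snd h))) * w (p (snd (fst h))) (p (snd (snd h))) / C"
    for h :: "('i \<times> 'i) \<times> ('i \<times> 'i)"
  define T where "T a b = (\<Sum>h\<in>?H. w0 h * ((s h a * t h b + s h b * t h a) / 2))" for a b
  have v: "Vw w J J' p * \<tau> = 2 * (\<Sum>a\<in>?I. \<Sum>b\<in>?I. (T a b)\<^sup>2) * \<tau>"
    by (subst coefficient_sum[where A=J and B=J' and r=p and s=s and t=t and w=w and ?w0.0=w0 and T=T])
      (use J J' dis in \<open>simp_all add: s_def t_def lcoeff_def w0_def C_def T_def sym[symmetric]\<close>)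
  have "(\<lambda>d. measure (Pr ?I) {\<omega>\<in>space (Pr ?I).
      \<kappa> d * (\<Sum>h\<in>?H. W h d \<omega> * (1 / C) * (shifted_form ?I \<delta> (s h) (t h) d \<omega> / sqrt (real d))) > z})
    \<longlonglongrightarrow> 1 - Phi ((z - \<kappa>0 * (l * (\<Sum>h\<in>?H. w0 h))) / (\<kappa>0 * sqrt (Vw w J J' p * \<tau>)))"
  proof (rule weighted_forms_upper_tail[OF _ _ _ shift cross _ scale _ v])
    fix h a assume "h \<in> ?H"
    then have "fst (fst h) \<noteq> snd (fst h)" "fst (snd h) \<noteq> snd (snd h)" "fst (fst h) \<noteq> snd (snd h)" "fst (snd h) \<noteq> snd (fst h)"
      using dis by (auto simp: dp_def)
    then show "s h a * t h a = 0" unfolding s_def t_def lcoeff_def by auto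
  next
    fix h assume h: "h \<in> ?H"
    have "tends_prob (\<lambda>_. Pr ?I) (\<lambda>d \<omega>. W h d \<omega> * (1 / C))
        (w (p (fst (fst h))) (p (fst (snd h))) * w (p (snd (fst h))) (p (snd (snd h))) * (1 / C)) sequentially"
      by (intro tends_prob_mult prob_space_Pr W h tends_prob_const tendsto_const)
    then show "tends_prob (\<lambda>_. Pr ?I) (\<lambda>d \<omega>. W h d \<omega> * (1 / C)) (w0 h) sequentially" by (simp add: w0_def)
  qed (use J J' V \<tau>_pos in \<open>auto simp: T_def\<close>)
  moreover have "(\<Sum>h\<in>?H. w0 h) = QA w w J J' p"
    unfolding QA_def avg_def w0_def C_def by (simp add: sum_divide_distrib)
  moreover have "(\<Sum>h\<in>?H. W h d \<omega> * (1 / C) * (shifted_form ?I \<delta> (s h) (t h) d \<omega> / sqrt (real d))) =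
    avg ?H (\<lambda>h. W h d \<omega> * (shifted_form ?I \<delta> (s h) (t h) d \<omega> / sqrt (real d)))" for d \<omega>
    unfolding avg_def sum_divide_distrib C_def by (intro sum.cong refl) simp
  ultimately show ?thesis unfolding s_def t_def by simp
qed

end


section \<open>Powers of both tests for fixed sample sizes\<close>

text \<open>The parameter \<open>g0\<close> of the scale law is the variance
  \<open>\<gamma> 0\<close> of the sequence, so that \<open>wt\<close> is the limit of the
  reciprocal normalized norms.\<close>

locale mixture_model = rho_sequence M "\<lambda>k. V (Suc k)" A B \<gamma> \<rho> K + S: scale_law L "\<gamma> 0"
  for M :: "'a measure" and V :: "nat \<Rightarrow> 'a \<Rightarrow> real" and A B \<gamma> \<rho> K L
begin

lemma V_meas: "k \<ge> 1 \<Longrightarrow> V k \<in> borel_measurable M"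
  using U4[of "k - 1"] by (simp add: mom4_le_def)

definition mix_sample :: "nat set \<Rightarrow> nat set \<Rightarrow> nat \<Rightarrow> (nat \<Rightarrow> real) \<Rightarrow> (nat \<Rightarrow> real) \<Rightarrow> (nat + nat \<Rightarrow> real) \<Rightarrow> (nat + nat \<Rightarrow> 'a) \<Rightarrow> nat + nat \<Rightarrow> nat \<Rightarrow> real"
  where "mix_sample J J' d \<nu>1 \<nu>2 p v = (\<lambda>a\<in>J <+> J'. mix_map d V (case_sum (\<lambda>_. \<nu>1) (\<lambda>_. \<nu>2) a) (p a, v a))"

lemma pair_diff_mix_sample:
  assumes "i \<in> J" "j \<in> J'" "k < d"
  shows "pair_diff (mix_sample J J' d \<nu>1 \<nu>2 p v) (Inl i) (Inr j) k =
    (\<nu>2 (Suc k) - \<nu>1 (Suc k)) + p (Inr j) * V (Suc k) (v (Inr j)) - p (Inl i) * V (Suc k) (v (Inl i))"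
  using assms by (simp add: pair_diff_def mix_sample_def mix_map_def Plus_def mult.commute)

lemma pair_form_mix_sample:
  assumes fin: "finite J" "finite J'" and h: "h \<in> dp (Inl ` J) \<times> dp (Inr ` J')"
    and \<delta>: "\<And>d k. \<delta> d k = \<nu>2 d (Suc k) - \<nu>1 d (Suc k)"
  shows "pair_form d (mix_sample J J' d (\<nu>1 d) (\<nu>2 d) p v) h = shifted_form (Inl ` J \<union> Inr ` J') \<delta>
        (lcoeff p (fst (fst h)) (fst (snd h))) (lcoeff p (snd (fst h)) (snd (snd h))) d v"
proof -
  obtain i1 i2 j1 j2 where e: "h = ((Inl i1, Inl i2), (Inr j1, Inr j2))" "i1 \<in> J" "i2 \<in> J" "j1 \<in> J'" "j2 \<in> J'"
    using h by (auto simp: dp_def)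
  have s: "(\<Sum>c\<in>Inl ` J \<union> Inr ` J'. lcoeff p (Inl i) (Inr j) c * V (Suc k) (v c)) =
      p (Inr j) * V (Suc k) (v (Inr j)) - p (Inl i) * V (Suc k) (v (Inl i))" if "i \<in> J" "j \<in> J'" for i j k
    by (rule sum_lcoeff) (use fin that in auto)
  show ?thesis
    unfolding pair_form_def shifted_form_def e fst_conv snd_conv
    by (intro sum.cong refl) (simp add: pair_diff_mix_sample s e \<delta> add_diff_eq)
qed

lemma pair_norm_mix_sample:
  assumes "i \<in> J" "j \<in> J'" and \<delta>: "\<And>d k. \<delta> d k = \<nu>2 d (Suc k) - \<nu>1 d (Suc k)"
  shows "pair_norm d (mix_sample J J' d (\<nu>1 d) (\<nu>2 d) p v) (Inl i) (Inr j) =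
    sqrt (\<Sum>k<d. (\<delta> d k + p (Inr j) * V (Suc k) (v (Inr j)) - p (Inl i) * V (Suc k) (v (Inl i)))\<^sup>2)"
  unfolding pair_norm_def using assms by (intro arg_cong[where f=sqrt] sum.cong refl) (simp add: pair_diff_mix_sample)

text \<open>For fixed positive scales the conditional probability converges by assumption; since the
  scales are almost surely positive, dominated convergence integrates the limit.\<close>

lemma sample_probability_limit:
  fixes F :: "nat \<Rightarrow> (nat + nat \<Rightarrow> nat \<Rightarrow> real) \<Rightarrow> real"
  assumes mn: "m \<ge> 1"
    and iid: "\<And>d. d \<ge> 1 \<Longrightarrow> iid_samples M d m n (X d) (Y d) (XS d) (YS d)"
    and X: "\<And>d. d \<ge> 1 \<Longrightarrow> distr M (RV d) (X d) = distr (L \<Otimes>\<^sub>M M) (RV d) (mix_map d V (\<nu>1 d))"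
    and Y: "\<And>d. d \<ge> 1 \<Longrightarrow> distr M (RV d) (Y d) = distr (L \<Otimes>\<^sub>M M) (RV d) (mix_map d V (\<nu>2 d))"
    and F: "\<And>d. d \<ge> 1 \<Longrightarrow> F d \<in> borel_measurable (PiM ({1..m} <+> {1..n}) (\<lambda>_. RV d))"
    and lim: "\<And>p. (\<And>a. a \<in> {1..m} <+> {1..n} \<Longrightarrow> p a > 0) \<Longrightarrow>
      (\<lambda>d. measure (Pr ({1..m} <+> {1..n})) {v\<in>space (Pr ({1..m} <+> {1..n})).
        F d (mix_sample {1..m} {1..n} d (\<nu>1 d) (\<nu>2 d) p v) > z}) \<longlonglongrightarrow> g p"
    and g: "g \<in> borel_measurable (S.R.N ({1..m} <+> {1..n}))"
  shows "(\<lambda>d. measure M {\<omega>\<in>space M. F d (\<lambda>a\<in>{1..m} <+> {1..n}. case_sum (XS d) (YS d) a \<omega>) > z})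
    \<longlonglongrightarrow> (\<integral>p. g p \<partial>S.R.N ({1..m} <+> {1..n}))"
proof -
  let ?I = "{1..m} <+> {1..n}"
  interpret P: prob_space "S.R.N ?I" by (rule S.R.N_prob)
  interpret Q: prob_space "Pr ?I" by (rule prob_space_Pr)
  define G where "G d p = measure (Pr ?I) {v\<in>space (Pr ?I).
      F d (\<lambda>a\<in>?I. mix_map d V (case_sum (\<lambda>_. \<nu>1 d) (\<lambda>_. \<nu>2 d) a) (p a, v a)) > z}" for d p
  have eq: "measure M {\<omega>\<in>space M. F d (\<lambda>a\<in>?I. case_sum (XS d) (YS d) a \<omega>) > z} = (\<integral>p. G d p \<partial>S.R.N ?I)"
    and Gm: "G d \<in> borel_measurable (S.R.N ?I)" if d: "d \<ge> 1" for d
    using iid_samples_measure[OF prob_space_axioms S.prob_space_axioms S.sets_L V_meas iid[OF d] mn X[OF d] Y[OF d] F[OF d]]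
    unfolding G_def by auto
  \<comment> \<open>The hypotheses hold for d \<ge> 1 only, and dominated convergence wants them for
    every index.\<close>
  have "(\<lambda>d. \<integral>p. G (Suc d) p \<partial>S.R.N ?I) \<longlonglongrightarrow> (\<integral>p. g p \<partial>S.R.N ?I)"
  proof (rule integral_dominated_convergence[where w="\<lambda>_. 1"])
    show "AE p in S.R.N ?I. (\<lambda>d. G (Suc d) p) \<longlonglongrightarrow> g p"
    proof -
      have "AE p in S.R.N ?I. \<forall>a\<in>?I. p a > 0"
        by (intro AE_finite_allI AE_PiM_component S.prob_space_axioms S.pos) auto
      then show ?thesis
      proof (rule AE_mp, intro AE_I2 impI)
        fix p :: "nat + nat \<Rightarrow> real" assume "\<forall>a\<in>?I. p a > 0"
        then have "(\<lambda>d. G d p) \<longlonglongrightarrow> g p" using lim[of p] unfolding G_def mix_sample_def by blast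
        then show "(\<lambda>d. G (Suc d) p) \<longlonglongrightarrow> g p" by (rule LIMSEQ_Suc)
      qed
    qed
    show "AE p in S.R.N ?I. norm (G (Suc d) p) \<le> 1" for d unfolding G_def by simp
  qed (use g Gm in auto)
  then have "(\<lambda>d. measure M {\<omega>\<in>space M. F (Suc d) (\<lambda>a\<in>?I. case_sum (XS (Suc d)) (YS (Suc d)) a \<omega>) > z})
    \<longlonglongrightarrow> (\<integral>p. g p \<partial>S.R.N ?I)" by (simp add: eq)
  then show ?thesis by (rule LIMSEQ_imp_Suc)
qed

text \<open>The normalization \<open>\<psi>\<close> is left open except for its order, so that the
  same statement serves both tests with different constants.\<close>

theorem power_limits:
  assumes mn: "m \<ge> 2" "n \<ge> 2"
    and iid: "\<And>d. d \<ge> 1 \<Longrightarrow> iid_samples M d m n (X d) (Y d) (XS d) (YS d)"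
    and X: "\<And>d. d \<ge> 1 \<Longrightarrow> distr M (RV d) (X d) = distr (L \<Otimes>\<^sub>M M) (RV d) (mix_map d V (\<nu>1 d))"
    and Y: "\<And>d. d \<ge> 1 \<Longrightarrow> distr M (RV d) (Y d) = distr (L \<Otimes>\<^sub>M M) (RV d) (mix_map d V (\<nu>2 d))"
    and \<delta>: "\<And>d k. \<delta> d k = \<nu>2 d (Suc k) - \<nu>1 d (Suc k)"
    and shift: "(\<lambda>d. (\<Sum>k<d. (\<delta> d k)\<^sup>2) / sqrt (real d)) \<longlonglongrightarrow> l"
    and cross: "(\<lambda>d. (\<Sum>k<d. \<Sum>l<d. \<delta> d k * \<delta> d l * expectation (\<lambda>x. V (Suc k) x * V (Suc l) x)) / real d) \<longlonglongrightarrow> 0"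
    and scale: "(\<lambda>d. sqrt (real d) / sqrt (\<psi> d)) \<longlonglongrightarrow> \<kappa>0" "\<kappa>0 > 0"
  shows "(\<lambda>d. measure M {\<omega>\<in>space M. T_CQ2 d m n (\<lambda>i. XS d i \<omega>) (\<lambda>j. YS d j \<omega>) / sqrt (\<psi> d) > z}) \<longlonglongrightarrow>
      (\<integral>p. 1 - Phi ((z - \<kappa>0 * (l * QA (\<lambda>_ _. 1) (\<lambda>_ _. 1) (S.R.IA (m, n)) (S.R.IB (m, n)) p)) /
         (\<kappa>0 * sqrt (Vw (\<lambda>_ _. 1) (S.R.IA (m, n)) (S.R.IB (m, n)) p * \<tau>))) \<partial>S.R.NN (m, n))" (is ?CQ)
    and "(\<lambda>d. measure M {\<omega>\<in>space M. real d * T_WMW d m n (\<lambda>i. XS d i \<omega>) (\<lambda>j. YS d j \<omega>) / sqrt (\<psi> d) > z}) \<longlonglongrightarrow>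
      (\<integral>p. 1 - Phi ((z - \<kappa>0 * (l * QA S.wt S.wt (S.R.IA (m, n)) (S.R.IB (m, n)) p)) /
         (\<kappa>0 * sqrt (Vw S.wt (S.R.IA (m, n)) (S.R.IB (m, n)) p * \<tau>))) \<partial>S.R.NN (m, n))" (is ?WMW)
proof -
  let ?A = "Inl ` {1..m} :: (nat + nat) set" and ?B = "Inr ` {1..n} :: (nat + nat) set"
  let ?H = "dp ?A \<times> dp ?B" and ?I = "{1..m} <+> {1..n}"
  have I: "?I = ?A \<union> ?B" by (rule Plus_def)
  have mn1: "m \<ge> 1" "n \<ge> 1" using mn by auto
  have AB: "finite ?A" "card ?A \<ge> 2" "finite ?B" "card ?B \<ge> 2" "?A \<inter> ?B = {}" using mn by (auto simp: card_image)
  have sub: "?A \<subseteq> ?I" "?B \<subseteq> ?I" unfolding I by auto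
  define gg where "gg w p = 1 - Phi ((z - \<kappa>0 * (l * QA w w ?A ?B p)) / (\<kappa>0 * sqrt (Vw w ?A ?B p * \<tau>)))" for w p
  have ggm: "gg w \<in> borel_measurable (S.R.N ?I)" if w: "case_prod w \<in> borel_measurable (borel \<Otimes>\<^sub>M borel)" for w
    using S.R.Vw_meas[OF w sub] S.R.QA_meas[OF w w sub] unfolding gg_def by measurable
  define FC where "FC d x = T_CQ2 d m n (\<lambda>i. x (Inl i)) (\<lambda>j. x (Inr j)) / sqrt (\<psi> d)" for d and x :: "nat + nat \<Rightarrow> nat \<Rightarrow> real"
  define FW where "FW d x = real d * T_WMW d m n (\<lambda>i. x (Inl i)) (\<lambda>j. x (Inr j)) / sqrt (\<psi> d)" for d and x :: "nat + nat \<Rightarrow> nat \<Rightarrow> real"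
  have FC: "FC d x = avg ?H (pair_form d x) / sqrt (\<psi> d)" for d x
    unfolding FC_def T_CQ2_pairs[OF mn1] ..
  have FW: "FW d x = real d * avg ?H (\<lambda>h. pair_form d x h / (pair_norm d x (fst (fst h)) (fst (snd h)) * pair_norm d x (snd (fst h)) (snd (snd h)))) / sqrt (\<psi> d)" for d x
    unfolding FW_def T_WMW_pairs[OF mn1] ..
  have FC_restrict: "FC d (restrict x ?I) = FC d x" for d x
    unfolding FC avg_def using pair_restrict[OF _ sub] by simp
  have FW_restrict: "FW d (restrict x ?I) = FW d x" for d x
    unfolding FW avg_def using pair_restrict[OF _ sub] by simp
  have FCm: "FC d \<in> borel_measurable (PiM ?I (\<lambda>_. RV d))" for d
    unfolding FC using pair_meas[OF _ sub] by (intro borel_measurable_divide S.R.avg_meas borel_measurable_const)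
  have FWm: "FW d \<in> borel_measurable (PiM ?I (\<lambda>_. RV d))" for d
    unfolding FW using pair_meas[OF _ sub]
    by (intro borel_measurable_divide borel_measurable_times S.R.avg_meas borel_measurable_const)
  define form where "form p d v h = shifted_form (?A \<union> ?B) \<delta>
        (lcoeff p (fst (fst h)) (fst (snd h))) (lcoeff p (snd (fst h)) (snd (snd h))) d v" for p d v h
  have rd: "x / sqrt (real d) * sqrt (real d) = x" if "d = 0 \<Longrightarrow> x = 0" for x :: real and d
    using that by (cases "d = 0") auto
  have form0: "form p 0 v h = 0" for p v h by (simp add: form_def shifted_form_def)
  have limC: "(\<lambda>d. measure (Pr ?I) {v\<in>space (Pr ?I). FC d (mix_sample {1..m} {1..n} d (\<nu>1 d) (\<nu>2 d) p v) > z}) \<longlonglongrightarrow> gg (\<lambda>_ _. 1) p"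
    if p: "\<And>a. a \<in> ?I \<Longrightarrow> p a > 0" for p
  proof -
    have V: "Vw (\<lambda>_ _. 1) ?A ?B p > 0" using AB p unfolding I by (intro Vw_pos) auto
    have "(\<lambda>d. measure (Pr (?A \<union> ?B)) {v\<in>space (Pr (?A \<union> ?B)).
        (sqrt (real d) / sqrt (\<psi> d)) * avg ?H (\<lambda>h. 1 * (form p d v h / sqrt (real d))) > z}) \<longlonglongrightarrow> gg (\<lambda>_ _. 1) p"
      unfolding form_def gg_def
      by (rule pair_forms_upper_tail[OF AB shift cross _ _ scale V]) (auto intro!: tends_prob_const prob_space_Pr)
    moreover have "(sqrt (real d) / sqrt (\<psi> d)) * avg ?H (\<lambda>h. 1 * (form p d v h / sqrt (real d))) =
        FC d (mix_sample {1..m} {1..n} d (\<nu>1 d) (\<nu>2 d) p v)" for d v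
    proof -
      have "sqrt (real d) * avg ?H (\<lambda>h. 1 * (form p d v h / sqrt (real d))) =
          avg ?H (\<lambda>h. sqrt (real d) * (1 * (form p d v h / sqrt (real d))))" by (rule avg_mult_left)
      also have "\<dots> = avg ?H (\<lambda>h. form p d v h)"
        by (intro avg_cong) (cases "d = 0"; simp add: form0)
      also have "\<dots> = avg ?H (pair_form d (mix_sample {1..m} {1..n} d (\<nu>1 d) (\<nu>2 d) p v))"
        unfolding form_def by (intro avg_cong pair_form_mix_sample[symmetric] \<delta>) auto
      finally show ?thesis by (simp only: FC times_divide_eq_left)
    qed
    ultimately show ?thesis unfolding I by simp
  qed
  have limW: "(\<lambda>d. measure (Pr ?I) {v\<in>space (Pr ?I). FW d (mix_sample {1..m} {1..n} d (\<nu>1 d) (\<nu>2 d) p v) > z}) \<longlonglongrightarrow> gg S.wt p"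
    if p: "\<And>a. a \<in> ?I \<Longrightarrow> p a > 0" for p
  proof -
    have V: "Vw S.wt ?A ?B p > 0" using AB p S.wt_pos unfolding I by (intro Vw_pos) auto
    \<comment> \<open>The random weights of the sign statistic. Two of them carry the factor
      \<open>d\<close> in front of the statistic together with the two norms.\<close>
    define nr where "nr a b d v = sqrt (real d) / sqrt (\<Sum>k<d. (\<delta> d k + p b * V (Suc k) (v b) - p a * V (Suc k) (v a))\<^sup>2)"
      for a b d and v :: "nat + nat \<Rightarrow> 'a"
    have nr: "tends_prob (\<lambda>_. Pr (?A \<union> ?B)) (nr a b) (S.wt (p a) (p b)) sequentially" if "a \<in> ?A" "b \<in> ?B" for a b
    proof -
      have "a \<noteq> b" "p a > 0" using that AB(5) p unfolding I by auto
      then show ?thesis unfolding nr_def S.wt_def using that AB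
        by (intro norm_tends_prob[OF _ _ _ _ _ shift cross]) auto
    qed
    have "(\<lambda>d. measure (Pr (?A \<union> ?B)) {v\<in>space (Pr (?A \<union> ?B)).
        (sqrt (real d) / sqrt (\<psi> d)) * avg ?H (\<lambda>h. nr (fst (fst h)) (fst (snd h)) d v * nr (snd (fst h)) (snd (snd h)) d v
          * (form p d v h / sqrt (real d))) > z}) \<longlonglongrightarrow> gg S.wt p"
      unfolding form_def gg_def
    proof (rule pair_forms_upper_tail[OF AB shift cross S.wt_sym _ scale V])
      fix h assume "h \<in> ?H"
      then have "fst (fst h) \<in> ?A" "snd (fst h) \<in> ?A" "fst (snd h) \<in> ?B" "snd (snd h) \<in> ?B" by (auto simp: dp_def)
      then show "tends_prob (\<lambda>_. Pr (?A \<union> ?B)) (\<lambda>d v. nr (fst (fst h)) (fst (snd h)) d v * nr (snd (fst h)) (snd (snd h)) d v)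
          (S.wt (p (fst (fst h))) (p (fst (snd h))) * S.wt (p (snd (fst h))) (p (snd (snd h)))) sequentially"
        by (intro tends_prob_mult prob_space_Pr nr)
    qed
    moreover have "(sqrt (real d) / sqrt (\<psi> d)) * avg ?H (\<lambda>h. nr (fst (fst h)) (fst (snd h)) d v * nr (snd (fst h)) (snd (snd h)) d v
          * (form p d v h / sqrt (real d))) = FW d (mix_sample {1..m} {1..n} d (\<nu>1 d) (\<nu>2 d) p v)" for d v
    proof -
      let ?x = "mix_sample {1..m} {1..n} d (\<nu>1 d) (\<nu>2 d) p v"
      have "sqrt (real d) * avg ?H (\<lambda>h. nr (fst (fst h)) (fst (snd h)) d v * nr (snd (fst h)) (snd (snd h)) d v
          * (form p d v h / sqrt (real d))) = avg ?H (\<lambda>h. sqrt (real d) * (nr (fst (fst h)) (fst (snd h)) d v * nr (snd (fst h)) (snd (snd h)) d v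
          * (form p d v h / sqrt (real d))))" by (rule avg_mult_left)
      also have "\<dots> = avg ?H (\<lambda>h. real d * (pair_form d ?x h / (pair_norm d ?x (fst (fst h)) (fst (snd h)) * pair_norm d ?x (snd (fst h)) (snd (snd h)))))"
      proof (rule avg_cong)
        fix h assume h: "h \<in> ?H"
        then obtain i1 i2 j1 j2 where e: "h = ((Inl i1, Inl i2), (Inr j1, Inr j2))" "i1 \<in> {1..m}" "i2 \<in> {1..m}" "j1 \<in> {1..n}" "j2 \<in> {1..n}"
          by (auto simp: dp_def)
        have n: "nr (Inl i) (Inr j) d v = sqrt (real d) / pair_norm d ?x (Inl i) (Inr j)" if "i \<in> {1..m}" "j \<in> {1..n}" for i j
          unfolding nr_def using pair_norm_mix_sample[OF that, where \<delta>=\<delta> and ?\<nu>1.0=\<nu>1 and ?\<nu>2.0=\<nu>2 and p=p and v=v and d=d, OF \<delta>] by simp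
        have f: "pair_form d ?x h = form p d v h"
          unfolding form_def by (intro pair_form_mix_sample \<delta> h) auto
        \<comment> \<open>True also when a norm vanishes: division by zero makes both sides 0, in
          agreement with the spatial sign of the zero vector.\<close>
        have alg: "s * ((s / a) * (s / b) * (x / s)) = s * s * (x / (a * b))" if "s = 0 \<Longrightarrow> x = 0" for s a b x :: real
          using that by (cases "s = 0") auto
        show "sqrt (real d) * (nr (fst (fst h)) (fst (snd h)) d v * nr (snd (fst h)) (snd (snd h)) d v
          * (form p d v h / sqrt (real d))) = real d * (pair_form d ?x h / (pair_norm d ?x (fst (fst h)) (fst (snd h)) * pair_norm d ?x (snd (fst h)) (snd (snd h))))"
          unfolding f using e by (simp only: n fst_conv snd_conv) (subst alg, auto simp: form0)
      qed
      also have "\<dots> = real d * avg ?H (\<lambda>h. pair_form d ?x h / (pair_norm d ?x (fst (fst h)) (fst (snd h)) * pair_norm d ?x (snd (fst h)) (snd (snd h))))"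
        by (rule avg_mult_left[symmetric])
      finally show ?thesis by (simp only: FW times_divide_eq_left)
    qed
    ultimately show ?thesis unfolding I by simp
  qed
  have one: "case_prod (\<lambda>_ _. 1::real) \<in> borel_measurable (borel \<Otimes>\<^sub>M borel)" by measurable
  have C: "(\<lambda>d. measure M {\<omega>\<in>space M. FC d (\<lambda>a\<in>?I. case_sum (XS d) (YS d) a \<omega>) > z}) \<longlonglongrightarrow> (\<integral>p. gg (\<lambda>_ _. 1) p \<partial>S.R.N ?I)"
    by (rule sample_probability_limit[OF mn1(1) iid X Y FCm limC ggm[OF one]])
  have W: "(\<lambda>d. measure M {\<omega>\<in>space M. FW d (\<lambda>a\<in>?I. case_sum (XS d) (YS d) a \<omega>) > z}) \<longlonglongrightarrow> (\<integral>p. gg S.wt p \<partial>S.R.N ?I)"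
    by (rule sample_probability_limit[OF mn1(1) iid X Y FWm limW ggm[OF S.wt_meas]])
  show ?CQ using C unfolding FC_restrict unfolding FC_def gg_def I by simp
  show ?WMW using W unfolding FW_restrict unfolding FW_def gg_def I by simp
qed

end

section \<open>Identification of the normalizing constants\<close>

lemma norm_iexp_diff_le: "norm (iexp x - iexp y) \<le> \<bar>x - y\<bar>"
proof -
  have "iexp x - iexp y = iexp y * (iexp (x - y) - 1)"
    by (simp add: algebra_simps flip: exp_add)
  then have "norm (iexp x - iexp y) = norm (iexp (x - y) - 1)" by (simp add: norm_mult)
  also have "\<dots> \<le> \<bar>x - y\<bar>" using iexp_approx1[of "x - y" 0] by simp
  finally show ?thesis .
qed

lemma pair_integral_mult:
  fixes f :: "'a \<Rightarrow> real" and g :: "'b \<Rightarrow> real"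
  assumes "prob_space N1" "prob_space N2" and f: "integrable N1 f" and g: "integrable N2 g"
  shows "integrable (N1 \<Otimes>\<^sub>M N2) (\<lambda>z. f (fst z) * g (snd z))"
    and "(\<integral>z. f (fst z) * g (snd z) \<partial>(N1 \<Otimes>\<^sub>M N2)) = (\<integral>x. f x \<partial>N1) * (\<integral>y. g y \<partial>N2)"
proof -
  interpret N1: prob_space N1 by fact
  interpret N2: prob_space N2 by fact
  interpret P: pair_prob_space N1 N2 ..
  have [measurable]: "f \<in> borel_measurable N1" "g \<in> borel_measurable N2" using f g by auto
  show i: "integrable (N1 \<Otimes>\<^sub>M N2) (\<lambda>z. f (fst z) * g (snd z))"
    by (rule P.Fubini_integrable) (use f g in \<open>auto simp: abs_mult\<close>)
  show "(\<integral>z. f (fst z) * g (snd z) \<partial>(N1 \<Otimes>\<^sub>M N2)) = (\<integral>x. f x \<partial>N1) * (\<integral>y. g y \<partial>N2)"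
    using P.integral_fst'[OF i] by simp
qed

text \<open>Given the shared variable, the two copies are independent, so the mean of the product is
  the mean of a squared conditional mean. The expectations in \<open>psi21\<close> and
  \<open>psi22\<close> have this shape.\<close>

lemma integral_product_of_copies:
  fixes F :: "'a \<Rightarrow> 'b \<Rightarrow> real"
  assumes "prob_space N1" "prob_space N2" and [measurable]: "case_prod F \<in> borel_measurable (N1 \<Otimes>\<^sub>M N2)"
    and F: "\<And>p q. \<bar>F p q\<bar> \<le> C"
  shows "(LINT (p, q1, q2)|(N1 \<Otimes>\<^sub>M (N2 \<Otimes>\<^sub>M N2)). F p q1 * F p q2) = (\<integral>p. (\<integral>q. F p q \<partial>N2)\<^sup>2 \<partial>N1)"
proof -
  interpret N1: prob_space N1 by fact
  interpret N2: prob_space N2 by fact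
  interpret N22: pair_prob_space N2 N2 ..
  interpret P: pair_prob_space N1 "N2 \<Otimes>\<^sub>M N2" ..
  have FF: "\<bar>F p q * F p q'\<bar> \<le> C * C" for p q q'
    unfolding abs_mult using F[of p q] F[of p q'] by (intro mult_mono) auto
  have i: "integrable (N1 \<Otimes>\<^sub>M (N2 \<Otimes>\<^sub>M N2)) (\<lambda>(p, q1, q2). F p q1 * F p q2)"
    by (rule P.P.integrable_const_bound[where B="C * C"]) (use FF in auto)
  have Fi: "integrable N2 (F p)" if "p \<in> space N1" for p
    by (rule N2.integrable_const_bound[where B=C]) (use F that in auto)
  have "(LINT (p, q1, q2)|(N1 \<Otimes>\<^sub>M (N2 \<Otimes>\<^sub>M N2)). F p q1 * F p q2) = (\<integral>p. \<integral>z. F p (fst z) * F p (snd z) \<partial>(N2 \<Otimes>\<^sub>M N2) \<partial>N1)"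
    using P.integral_fst'[OF i] by (simp add: case_prod_beta')
  also have "\<dots> = (\<integral>p. (\<integral>q. F p q \<partial>N2)\<^sup>2 \<partial>N1)"
    by (intro Bochner_Integration.integral_cong refl)
       (simp add: pair_integral_mult(2)[OF N2.prob_space_axioms N2.prob_space_axioms Fi Fi] power2_eq_square)
  finally show ?thesis .
qed

lemma scale_law_inverse:
  assumes "prob_space M" and [measurable]: "P \<in> borel_measurable M" and pos: "AE \<omega> in M. P \<omega> > 0"
    and nd: "non_degenerate M P" and i: "integrable M P" "integrable M (\<lambda>\<omega>. 1 / (P \<omega>)\<^sup>2)" and g: "g > 0"
  shows "scale_law (distr M borel (\<lambda>\<omega>. 1 / P \<omega>)) g"
proof -
  interpret prob_space M by fact
  have [measurable]: "(\<lambda>\<omega>. 1 / P \<omega>) \<in> borel_measurable M" by measurable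
  interpret L: prob_space "distr M borel (\<lambda>\<omega>. 1 / P \<omega>)" by (rule prob_space_distr) measurable
  show ?thesis
  proof unfold_locales
    show "AE r in distr M borel (\<lambda>\<omega>. 1 / P \<omega>). r > 0"
      using pos by (subst AE_distr_iff) auto
    show "integrable (distr M borel (\<lambda>\<omega>. 1 / P \<omega>)) (\<lambda>r. r\<^sup>2)"
      using i(2) by (subst integrable_distr_eq) (auto simp: power_divide)
    show "integrable (distr M borel (\<lambda>\<omega>. 1 / P \<omega>)) (\<lambda>r. 1 / r)"
      using i(1) by (subst integrable_distr_eq) auto
    show "\<not> (\<exists>c. AE r in distr M borel (\<lambda>\<omega>. 1 / P \<omega>). r = c)"
    proof
      assume "\<exists>c. AE r in distr M borel (\<lambda>\<omega>. 1 / P \<omega>). r = c"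
      then obtain c where "AE r in distr M borel (\<lambda>\<omega>. 1 / P \<omega>). r = c" by blast
      then have "AE \<omega> in M. 1 / P \<omega> = c" by (subst (asm) AE_distr_iff) auto
      then have "AE \<omega> in M. P \<omega> = 1 / c" by (rule AE_mp) (auto intro!: AE_I2)
      then show False using nd by (auto simp: non_degenerate_def)
    qed
  qed (use g in simp_all)
qed

context scale_law
begin

text \<open>The law of the variance over the squared \<open>P\<close>. Unlike \<open>L\<close> and
  \<open>g0\<close> separately, it does not change when a constant factor is moved between the
  sequence and its scale.\<close>

abbreviation SqLaw :: "real measure" where "SqLaw \<equiv> distr L borel (\<lambda>r. g0 * r\<^sup>2)"

lemma SqLaw_dist: "real_distribution SqLaw"
  by (rule real_distribution_distr) measurable

lemma h_SqLaw: "h r = (\<integral>y. 1 / sqrt (g0 * r\<^sup>2 + y) \<partial>SqLaw)"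
  unfolding h_def wt_def by (subst integral_distr) (auto simp: distrib_left)

lemma \<kappa>_SqLaw: "g0 * \<kappa> = (\<integral>x. x * (\<integral>y. 1 / sqrt (x + y) \<partial>SqLaw)\<^sup>2 \<partial>SqLaw)"
proof -
  interpret D: real_distribution SqLaw by (rule SqLaw_dist)
  have m: "(\<lambda>x. x * (\<integral>y. 1 / sqrt (x + y) \<partial>SqLaw)\<^sup>2) \<in> borel_measurable borel"
    by (intro borel_measurable_times borel_measurable_power D.borel_measurable_lebesgue_integral) measurable
  have "(\<integral>x. x * (\<integral>y. 1 / sqrt (x + y) \<partial>SqLaw)\<^sup>2 \<partial>SqLaw) = (\<integral>r. g0 * r\<^sup>2 * (h r)\<^sup>2 \<partial>L)"
    unfolding h_SqLaw by (rule integral_distr[OF _ m]) measurable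
  then show ?thesis unfolding \<kappa>_def f_def by (simp add: power_mult_distrib mult.assoc)
qed

end

text \<open>Both integrals see the law of the scales only through \<open>SqLaw\<close>. If the two
  models agree there, an average over the other law can be replaced by one over the own law.\<close>

lemma cross_kernel:
  assumes "scale_law L g" "scale_law L' g'" and D: "distr L borel (\<lambda>r. g * r\<^sup>2) = distr L' borel (\<lambda>r. g' * r\<^sup>2)"
  shows "(\<integral>r. (\<integral>s. r / sqrt (g * r\<^sup>2 + g' * s\<^sup>2) \<partial>L')\<^sup>2 \<partial>L) = scale_law.\<kappa> L g"
    and "g * scale_law.\<kappa> L g = g' * scale_law.\<kappa> L' g'"
proof -
  interpret S: scale_law L g by fact
  interpret S': scale_law L' g' by fact
  have "(\<integral>s. r / sqrt (g * r\<^sup>2 + g' * s\<^sup>2) \<partial>L') = S.f r" for r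
  proof -
    have "(\<integral>s. r / sqrt (g * r\<^sup>2 + g' * s\<^sup>2) \<partial>L') = (\<integral>y. r / sqrt (g * r\<^sup>2 + y) \<partial>S'.SqLaw)"
      by (subst integral_distr) auto
    also have "\<dots> = r * (\<integral>y. 1 / sqrt (g * r\<^sup>2 + y) \<partial>S.SqLaw)"
      unfolding D by (subst Bochner_Integration.integral_mult_right_zero[symmetric]) simp
    finally show ?thesis by (simp add: S.f_def S.h_SqLaw)
  qed
  then show "(\<integral>r. (\<integral>s. r / sqrt (g * r\<^sup>2 + g' * s\<^sup>2) \<partial>L')\<^sup>2 \<partial>L) = S.\<kappa>" by (simp add: S.\<kappa>_def)
  show "g * S.\<kappa> = g' * S'.\<kappa>" unfolding S.\<kappa>_SqLaw S'.\<kappa>_SqLaw D ..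
qed

text \<open>Dividing by p q turns \<open>q / sqrt (g q\<^sup>2 + g' p\<^sup>2)\<close> into the same
  expression in the reciprocal scales, with the roles of the two arguments exchanged.\<close>

lemma psi21_eq:
  assumes "prob_space M" and [measurable]: "P \<in> borel_measurable M" "Q \<in> borel_measurable M"
    and pos: "AE \<omega> in M. P \<omega> > 0" "AE \<omega> in M. Q \<omega> > 0" and g: "g > 0" "g' > 0"
  shows "psi21 g g' (distr M borel P) (distr M borel Q) =
    (\<integral>r. (\<integral>s. r / sqrt (g * r\<^sup>2 + g' * s\<^sup>2) \<partial>distr M borel (\<lambda>\<omega>. 1 / Q \<omega>))\<^sup>2 \<partial>distr M borel (\<lambda>\<omega>. 1 / P \<omega>))\<^sup>2"
proof -
  interpret prob_space M by fact
  let ?LP = "distr M borel P" and ?LQ = "distr M borel Q"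
  let ?L = "distr M borel (\<lambda>\<omega>. 1 / P \<omega>)" and ?L' = "distr M borel (\<lambda>\<omega>. 1 / Q \<omega>)"
  interpret LP: prob_space ?LP by (rule prob_space_distr) measurable
  interpret LQ: prob_space ?LQ by (rule prob_space_distr) measurable
  interpret L': prob_space ?L' by (rule prob_space_distr) measurable
  define F where "F p q = q / sqrt (g * q\<^sup>2 + g' * p\<^sup>2)" for p q :: real
  have Fm: "case_prod F \<in> borel_measurable (borel \<Otimes>\<^sub>M borel)" unfolding F_def by measurable
  have Fm': "case_prod F \<in> borel_measurable (?LP \<Otimes>\<^sub>M ?LQ)"
    unfolding F_def by measurable
  have Fb: "\<bar>F p q\<bar> \<le> 1 / sqrt g" for p q
  proof (cases "q = 0")
    case False
    have "sqrt g * \<bar>q\<bar> = sqrt (g * q\<^sup>2)" by (simp add: real_sqrt_mult)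
    also have "\<dots> \<le> sqrt (g * q\<^sup>2 + g' * p\<^sup>2)" using g by simp
    finally have le: "sqrt g * \<bar>q\<bar> \<le> sqrt (g * q\<^sup>2 + g' * p\<^sup>2)" .
    have "sqrt (g * q\<^sup>2 + g' * p\<^sup>2) > 0" using False g by (simp add: add_pos_nonneg)
    then show ?thesis unfolding F_def using le g by (simp add: field_simps)
  qed (use g in \<open>simp add: F_def\<close>)
  have "psi21 g g' ?LP ?LQ = (LINT (p, q1, q2)|(?LP \<Otimes>\<^sub>M (?LQ \<Otimes>\<^sub>M ?LQ)). F p q1 * F p q2)\<^sup>2"
    unfolding psi21_def F_def by (simp only: real_sqrt_mult times_divide_times_eq)
  also have "(LINT (p, q1, q2)|(?LP \<Otimes>\<^sub>M (?LQ \<Otimes>\<^sub>M ?LQ)). F p q1 * F p q2) = (\<integral>p. (\<integral>q. F p q \<partial>?LQ)\<^sup>2 \<partial>?LP)"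
    by (rule integral_product_of_copies[OF LP.prob_space_axioms LQ.prob_space_axioms Fm' Fb])
  also have "\<dots> = (\<integral>\<omega>. (\<integral>\<xi>. F (P \<omega>) (Q \<xi>) \<partial>M)\<^sup>2 \<partial>M)"
  proof -
    have "(\<lambda>p. (\<integral>q. F p q \<partial>?LQ)\<^sup>2) \<in> borel_measurable borel"
      unfolding F_def by (intro borel_measurable_power LQ.borel_measurable_lebesgue_integral) measurable
    moreover have "(\<integral>q. F p q \<partial>?LQ) = (\<integral>\<xi>. F p (Q \<xi>) \<partial>M)" for p
      unfolding F_def by (rule integral_distr) measurable
    ultimately show ?thesis by (subst integral_distr) auto
  qed
  also have "\<dots> = (\<integral>\<omega>. (\<integral>\<xi>. (1 / P \<omega>) / sqrt (g * (1 / P \<omega>)\<^sup>2 + g' * (1 / Q \<xi>)\<^sup>2) \<partial>M)\<^sup>2 \<partial>M)"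
  proof (rule integral_cong_AE)
    show "AE \<omega> in M. (\<integral>\<xi>. F (P \<omega>) (Q \<xi>) \<partial>M)\<^sup>2 = (\<integral>\<xi>. (1 / P \<omega>) / sqrt (g * (1 / P \<omega>)\<^sup>2 + g' * (1 / Q \<xi>)\<^sup>2) \<partial>M)\<^sup>2"
      using pos(1)
    proof (rule AE_mp, intro AE_I2 impI)
      fix \<omega> assume P: "P \<omega> > 0"
      have "(\<integral>\<xi>. F (P \<omega>) (Q \<xi>) \<partial>M) = (\<integral>\<xi>. (1 / P \<omega>) / sqrt (g * (1 / P \<omega>)\<^sup>2 + g' * (1 / Q \<xi>)\<^sup>2) \<partial>M)"
      proof (rule integral_cong_AE)
        show "AE \<xi> in M. F (P \<omega>) (Q \<xi>) = (1 / P \<omega>) / sqrt (g * (1 / P \<omega>)\<^sup>2 + g' * (1 / Q \<xi>)\<^sup>2)"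
          using pos(2)
        proof (rule AE_mp, intro AE_I2 impI)
          fix \<xi> assume Q: "Q \<xi> > 0"
          have "g * (1 / P \<omega>)\<^sup>2 + g' * (1 / Q \<xi>)\<^sup>2 = (g * (Q \<xi>)\<^sup>2 + g' * (P \<omega>)\<^sup>2) / (P \<omega> * Q \<xi>)\<^sup>2"
            using P Q by (simp add: field_simps power2_eq_square)
          then have "sqrt (g * (1 / P \<omega>)\<^sup>2 + g' * (1 / Q \<xi>)\<^sup>2) = sqrt (g * (Q \<xi>)\<^sup>2 + g' * (P \<omega>)\<^sup>2) / (P \<omega> * Q \<xi>)"
            using P Q by (simp add: real_sqrt_divide)
          then show "F (P \<omega>) (Q \<xi>) = (1 / P \<omega>) / sqrt (g * (1 / P \<omega>)\<^sup>2 + g' * (1 / Q \<xi>)\<^sup>2)"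
            unfolding F_def using P Q by simp
        qed
      qed (use Fm in \<open>unfold F_def, measurable\<close>)
      then show "(\<integral>\<xi>. F (P \<omega>) (Q \<xi>) \<partial>M)\<^sup>2 = (\<integral>\<xi>. (1 / P \<omega>) / sqrt (g * (1 / P \<omega>)\<^sup>2 + g' * (1 / Q \<xi>)\<^sup>2) \<partial>M)\<^sup>2" by simp
    qed
  qed (unfold F_def, measurable)
  also have "\<dots> = (\<integral>r. (\<integral>s. r / sqrt (g * r\<^sup>2 + g' * s\<^sup>2) \<partial>?L')\<^sup>2 \<partial>?L)"
  proof -
    have m: "(\<lambda>r. (\<integral>s. r / sqrt (g * r\<^sup>2 + g' * s\<^sup>2) \<partial>?L')\<^sup>2) \<in> borel_measurable borel"
      by (intro borel_measurable_power L'.borel_measurable_lebesgue_integral) measurable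
    have e: "(\<integral>s. r / sqrt (g * r\<^sup>2 + g' * s\<^sup>2) \<partial>?L') = (\<integral>\<xi>. r / sqrt (g * r\<^sup>2 + g' * (1 / Q \<xi>)\<^sup>2) \<partial>M)" for r
      by (rule integral_distr) measurable
    show ?thesis unfolding e by (rule integral_distr[symmetric, OF _ m[unfolded e]]) measurable
  qed
  finally show ?thesis .
qed

lemma psi22_eq_psi21: "psi22 g g' LP LQ = psi21 g' g LQ LP"
  unfolding psi21_def psi22_def by (simp add: add.commute)

section \<open>Recovering the scales and the dispersions from the laws of the vectors\<close>

context mixture_model
begin

abbreviation "sq_dev \<nu> d z \<equiv> (\<Sum>k = 1..d. (z k - \<nu> k)\<^sup>2) / real d"

lemma mix_map_meas: "mix_map d V \<nu> \<in> measurable (L \<Otimes>\<^sub>M M) (RV d)"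
  by (intro mix_map_measurable V_meas S.sets_L)

text \<open>The mean squared deviation of a sample point from its centre is \<open>r\<^sup>2\<close>
  times a mean of squares that tends to \<open>\<gamma> 0\<close>, so its law tends to
  \<open>SqLaw\<close>. Hence the laws of the vectors in all dimensions determine
  \<open>SqLaw\<close>. Independence of the scale and the sequence bounds the error by the product
  of \<open>e2\<close> and a mean deviation.\<close>

lemma sq_dev_char_limit:
  "(\<lambda>d. char (distr (distr (L \<Otimes>\<^sub>M M) (RV d) (mix_map d V (\<nu> d))) borel (sq_dev (\<nu> d) d)) t) \<longlonglongrightarrow> char S.SqLaw t"
proof -
  interpret LM: pair_prob_space L M ..
  define m where "m d x = (\<Sum>k<d. (V (Suc k) x)\<^sup>2) / real d" for d x
  have m_meas: "m d \<in> borel_measurable M" for d unfolding m_def by measurable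
  have fst_m: "fst \<in> borel_measurable (L \<Otimes>\<^sub>M M)"
    using measurable_fst[of L M] unfolding measurable_cong_sets[OF refl S.sets_L] .
  have Zm: "(\<lambda>z. (fst z)\<^sup>2 * m d (snd z)) \<in> borel_measurable (L \<Otimes>\<^sub>M M)" for d
    by (intro borel_measurable_times borel_measurable_power fst_m measurable_compose[OF measurable_snd m_meas])
  have dev: "sq_dev (\<nu> d) d \<in> borel_measurable (RV d)" for d
    by (intro borel_measurable_divide borel_measurable_sum borel_measurable_power borel_measurable_diff measurable_component_singleton borel_measurable_const)
  have sq: "sq_dev (\<nu> d) d (mix_map d V (\<nu> d) z) = (fst z)\<^sup>2 * m d (snd z)" for d z
  proof -
    have "(\<Sum>k = 1..d. (mix_map d V (\<nu> d) z k - \<nu> d k)\<^sup>2) = (\<Sum>k<d. (fst z)\<^sup>2 * (V (Suc k) (snd z))\<^sup>2)"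
      by (rule sum.reindex_bij_witness[of _ Suc "\<lambda>k. k - 1"]) (auto simp: mix_map_def power_mult_distrib mult.commute)
    then show ?thesis by (simp add: m_def sum_distrib_left)
  qed
  have c1: "char (distr (distr (L \<Otimes>\<^sub>M M) (RV d) (mix_map d V (\<nu> d))) borel (sq_dev (\<nu> d) d)) t =
      (CLINT z|L \<Otimes>\<^sub>M M. iexp (t * ((fst z)\<^sup>2 * m d (snd z))))" for d
  proof -
    have "sq_dev (\<nu> d) d \<circ> mix_map d V (\<nu> d) = (\<lambda>z. (fst z)\<^sup>2 * m d (snd z))" by (auto simp: o_def sq)
    moreover have "(\<lambda>x. iexp (t * x)) \<in> borel_measurable borel" by measurable
    ultimately show ?thesis
      unfolding char_def by (simp only: distr_distr[OF dev mix_map_meas] integral_distr[OF Zm])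
  qed
  have ii: "integrable (L \<Otimes>\<^sub>M M) (\<lambda>z. iexp (t * G z))" if "G \<in> borel_measurable (L \<Otimes>\<^sub>M M)" for G
    by (rule LM.P.integrable_const_bound[where B=1]) (use that in auto)
  have i1: "integrable (L \<Otimes>\<^sub>M M) (\<lambda>z. iexp (t * ((fst z)\<^sup>2 * m d (snd z))))" for d by (rule ii[OF Zm])
  have i2: "integrable (L \<Otimes>\<^sub>M M) (\<lambda>z. iexp (t * (\<gamma> 0 * (fst z)\<^sup>2)))"
    by (rule ii) (intro borel_measurable_times borel_measurable_power borel_measurable_const fst_m)
  have c2: "char S.SqLaw t = (CLINT z|L \<Otimes>\<^sub>M M. iexp (t * (\<gamma> 0 * (fst z)\<^sup>2)))"
  proof -
    have "char S.SqLaw t = (CLINT r|L. iexp (t * (\<gamma> 0 * r\<^sup>2)))"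
      unfolding char_def by (subst integral_distr) auto
    also have "\<dots> = (CLINT z|L \<Otimes>\<^sub>M M. iexp (t * (\<gamma> 0 * (fst z)\<^sup>2)))"
      using LM.integral_fst'[OF i2] by (simp add: prob_space)
    finally show ?thesis .
  qed
  have m1: "integrable M (\<lambda>x. \<bar>m d x - \<gamma> 0\<bar>)"
    and m2: "expectation (\<lambda>x. \<bar>m d x - \<gamma> 0\<bar>) \<le> sqrt (expectation (\<lambda>x. (m d x - \<gamma> 0)\<^sup>2))" for d
  proof -
    have s: "integrable M (\<lambda>x. (m d x - \<gamma> 0)\<^sup>2)" unfolding m_def by (rule U_sq_lln_int)
    have mm: "(\<lambda>x. m d x - \<gamma> 0) \<in> borel_measurable M" "(\<lambda>x. \<bar>m d x - \<gamma> 0\<bar>) \<in> borel_measurable M"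
      using m_meas[of d] by measurable
    show "integrable M (\<lambda>x. \<bar>m d x - \<gamma> 0\<bar>)"
      by (rule integrable_abs, rule integrable_of_square[OF mm(1) s])
    show "expectation (\<lambda>x. \<bar>m d x - \<gamma> 0\<bar>) \<le> sqrt (expectation (\<lambda>x. (m d x - \<gamma> 0)\<^sup>2))"
      using integral_Cauchy_Schwarz[OF mm(2) borel_measurable_const, of 1] s by (simp add: prob_space)
  qed
  have bound: "norm (char (distr (distr (L \<Otimes>\<^sub>M M) (RV d) (mix_map d V (\<nu> d))) borel (sq_dev (\<nu> d) d)) t - char S.SqLaw t)
      \<le> \<bar>t\<bar> * S.e2 * sqrt (expectation (\<lambda>x. (m d x - \<gamma> 0)\<^sup>2))" for d
  proof -
    note pm = pair_integral_mult[OF S.prob_space_axioms prob_space_axioms S.sq_int m1[of d]]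
    have "norm (char (distr (distr (L \<Otimes>\<^sub>M M) (RV d) (mix_map d V (\<nu> d))) borel (sq_dev (\<nu> d) d)) t - char S.SqLaw t) =
        norm (CLINT z|L \<Otimes>\<^sub>M M. iexp (t * ((fst z)\<^sup>2 * m d (snd z))) - iexp (t * (\<gamma> 0 * (fst z)\<^sup>2)))"
      unfolding c1 c2 Bochner_Integration.integral_diff[OF i1 i2] ..
    also have "\<dots> \<le> (\<integral>z. \<bar>t\<bar> * ((fst z)\<^sup>2 * \<bar>m d (snd z) - \<gamma> 0\<bar>) \<partial>(L \<Otimes>\<^sub>M M))"
    proof (rule order_trans[OF integral_norm_bound], rule integral_mono)
      show "integrable (L \<Otimes>\<^sub>M M) (\<lambda>z. norm (iexp (t * ((fst z)\<^sup>2 * m d (snd z))) - iexp (t * (\<gamma> 0 * (fst z)\<^sup>2))))"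
        by (intro integrable_norm Bochner_Integration.integrable_diff i1 i2)
      show "integrable (L \<Otimes>\<^sub>M M) (\<lambda>z. \<bar>t\<bar> * ((fst z)\<^sup>2 * \<bar>m d (snd z) - \<gamma> 0\<bar>))" using pm(1) by simp
      fix z
      have "norm (iexp (t * ((fst z)\<^sup>2 * m d (snd z))) - iexp (t * (\<gamma> 0 * (fst z)\<^sup>2))) \<le>
          \<bar>t * ((fst z)\<^sup>2 * m d (snd z)) - t * (\<gamma> 0 * (fst z)\<^sup>2)\<bar>" by (rule norm_iexp_diff_le)
      also have "t * ((fst z)\<^sup>2 * m d (snd z)) - t * (\<gamma> 0 * (fst z)\<^sup>2) = t * ((fst z)\<^sup>2 * (m d (snd z) - \<gamma> 0))"
        by (simp add: algebra_simps)
      finally show "norm (iexp (t * ((fst z)\<^sup>2 * m d (snd z))) - iexp (t * (\<gamma> 0 * (fst z)\<^sup>2))) \<le>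
          \<bar>t\<bar> * ((fst z)\<^sup>2 * \<bar>m d (snd z) - \<gamma> 0\<bar>)" by (simp add: abs_mult)
    qed
    also have "\<dots> = \<bar>t\<bar> * (S.e2 * expectation (\<lambda>x. \<bar>m d x - \<gamma> 0\<bar>))" using pm(2) by (simp add: S.e2_def)
    also have "\<dots> \<le> \<bar>t\<bar> * (S.e2 * sqrt (expectation (\<lambda>x. (m d x - \<gamma> 0)\<^sup>2)))"
      using m2 S.e2_pos by (intro mult_left_mono) auto
    finally show ?thesis by (simp add: mult.assoc)
  qed
  have "(\<lambda>d. \<bar>t\<bar> * S.e2 * sqrt (expectation (\<lambda>x. (m d x - \<gamma> 0)\<^sup>2))) \<longlonglongrightarrow> \<bar>t\<bar> * S.e2 * sqrt 0"
    using U_sq_lln unfolding m_def by (intro tendsto_intros)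
  then have "(\<lambda>d. \<bar>t\<bar> * S.e2 * sqrt (expectation (\<lambda>x. (m d x - \<gamma> 0)\<^sup>2))) \<longlonglongrightarrow> 0" by simp
  from Lim_null_comparison[OF always_eventually[OF allI[OF bound]] this]
  show ?thesis by (rule LIM_zero_cancel)
qed

text \<open>Since the scale is independent of a centred sequence, it affects the centre not at all
  and the covariances by its second moment.\<close>

lemma Disp_mixture:
  assumes X: "X \<in> measurable M (RV d)" "distr M (RV d) X = distr (L \<Otimes>\<^sub>M M) (RV d) (mix_map d V \<nu>)"
    and k: "k \<in> {1..d}" and l: "l \<in> {1..d}"
  shows "Disp M X k l = S.e2 * expectation (\<lambda>x. V k x * V l x)"
proof -
  have tr: "expectation (\<lambda>\<omega>. F (X \<omega>)) = (\<integral>z. F (mix_map d V \<nu> z) \<partial>(L \<Otimes>\<^sub>M M))"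
    if "F \<in> borel_measurable (RV d)" for F :: "(nat \<Rightarrow> real) \<Rightarrow> real"
    using arg_cong[OF X(2), of "\<lambda>N. integral\<^sup>L N F"] by (simp add: integral_distr[OF X(1) that] integral_distr[OF mix_map_meas that])
  have c: "(\<lambda>z. z i) \<in> borel_measurable (RV d)" if "i \<in> {1..d}" for i
    using that by (rule measurable_component_singleton)
  have r: "integrable L (\<lambda>r. r)" by (rule S.integrable_of_square) (use S.sq_int in auto)
  have Vi: "integrable M (V i)" "expectation (V i) = 0" if "i \<in> {1..d}" for i
    using U_int[of "i - 1"] U_mean[of "i - 1"] that by auto
  have VV: "integrable M (\<lambda>x. V k x * V l x)" using UU_int[of "k - 1" "l - 1"] k l by auto
  have mean: "expectation (\<lambda>\<omega>. X \<omega> i) = \<nu> i" if i: "i \<in> {1..d}" for i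
  proof -
    interpret LM: pair_prob_space L M ..
    note pm = pair_integral_mult[OF S.prob_space_axioms prob_space_axioms r Vi(1)[OF i]]
    have "expectation (\<lambda>\<omega>. X \<omega> i) = (\<integral>z. \<nu> i + fst z * V i (snd z) \<partial>(L \<Otimes>\<^sub>M M))"
      unfolding tr[OF c[OF i]] using i by (simp add: mix_map_def mult.commute)
    also have "\<dots> = \<nu> i" using pm Vi(2)[OF i] by (simp add: LM.P.prob_space)
    finally show ?thesis .
  qed
  have "Disp M X k l = expectation (\<lambda>\<omega>. (X \<omega> k - \<nu> k) * (X \<omega> l - \<nu> l))"
    unfolding Disp_def covar_def mean[OF k] mean[OF l] ..
  also have "\<dots> = (\<integral>z. (fst z)\<^sup>2 * (V k (snd z) * V l (snd z)) \<partial>(L \<Otimes>\<^sub>M M))"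
    by (subst tr) (use c k l in \<open>auto simp: mix_map_def power2_eq_square mult_ac\<close>)
  also have "\<dots> = S.e2 * expectation (\<lambda>x. V k x * V l x)"
    using pair_integral_mult(2)[OF S.prob_space_axioms prob_space_axioms S.sq_int VV] by (simp add: S.e2_def)
  finally show ?thesis .
qed

lemma Disp_rvec: "k \<in> {1..d} \<Longrightarrow> l \<in> {1..d} \<Longrightarrow> Disp M (rvec d V) k l = expectation (\<lambda>x. V k x * V l x)"
  using U_mean[of "k - 1"] U_mean[of "l - 1"] by (simp add: Disp_def covar_def rvec_def)

lemma trace_mult:
  assumes S1: "\<And>k l. k \<in> {1..d} \<Longrightarrow> l \<in> {1..d} \<Longrightarrow> S1 k l = c1 * expectation (\<lambda>x. V k x * V l x)"
    and S2: "\<And>k l. k \<in> {1..d} \<Longrightarrow> l \<in> {1..d} \<Longrightarrow> S2 k l = c2 * expectation (\<lambda>x. V k x * V l x)"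
  shows "tr_d d (mat_mult d S1 S2) = c1 * c2 * tr2 d"
proof -
  have "tr_d d (mat_mult d S1 S2) = (\<Sum>k = 1..d. \<Sum>l = 1..d. c1 * c2 * (expectation (\<lambda>x. V k x * V l x))\<^sup>2)"
    unfolding tr_d_def mat_mult_def by (intro sum.cong refl) (simp add: S1 S2 power2_eq_square mult_ac)
  also have "\<dots> = (\<Sum>k<d. \<Sum>l<d. c1 * c2 * (expectation (\<lambda>x. V (Suc k) x * V (Suc l) x))\<^sup>2)"
  proof -
    have "(\<Sum>k = 1..d. F k) = (\<Sum>k<d. F (Suc k))" for F :: "nat \<Rightarrow> real"
      by (rule sum.reindex_bij_witness[of _ Suc "\<lambda>k. k - 1"]) auto
    then show ?thesis by simp
  qed
  also have "\<dots> = c1 * c2 * tr2 d" unfolding tr2_def by (simp add: sum_distrib_left)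
  finally show ?thesis .
qed

end

context rho_sequence
begin

lemma sqrt_tr2_ratio_tendsto:
  assumes "a > 0"
  shows "(\<lambda>d. sqrt (real d) / sqrt (tr2 d * c\<^sup>2 * a)) \<longlonglongrightarrow> 1 / (\<bar>c\<bar> * sqrt (\<tau> * a))"
proof (cases "c = 0")
  case False
  have "(\<lambda>d. sqrt (1 / (tr2 d / real d * c\<^sup>2 * a))) \<longlonglongrightarrow> sqrt (1 / (\<tau> * c\<^sup>2 * a))"
    using \<tau>_pos assms False by (intro tendsto_intros tr2_tendsto) auto
  moreover have "sqrt (1 / (\<tau> * c\<^sup>2 * a)) = 1 / (\<bar>c\<bar> * sqrt (\<tau> * a))"
    by (simp add: real_sqrt_divide real_sqrt_mult)
  moreover have "sqrt (1 / (tr2 d / real d * c\<^sup>2 * a)) = sqrt (real d) / sqrt (tr2 d * c\<^sup>2 * a)" for d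
    by (simp add: real_sqrt_divide[symmetric])
  ultimately show ?thesis by simp
qed simp

end

section \<open>Iterated limits and the comparison of the powers\<close>

text \<open>The signal condition is stated with the normalization of the mean-based test, so it
  identifies the drift there as \<open>c\<close>. The normalization of the sign test differs by the
  factor \<open>e2 / \<kappa>\<close>, and its weights contribute the square of \<theta>.\<close>

lemma (in mixture_model) iterated_power_limits:
  assumes iid: "\<And>m n d. m \<ge> 2 \<Longrightarrow> n \<ge> 2 \<Longrightarrow> d \<ge> 1 \<Longrightarrow>
      iid_samples M d m n (X m n d) (Y m n d) (XS m n d) (YS m n d)"
    and X: "\<And>m n d. m \<ge> 2 \<Longrightarrow> n \<ge> 2 \<Longrightarrow> d \<ge> 1 \<Longrightarrow>
      distr M (RV d) (X m n d) = distr (L \<Otimes>\<^sub>M M) (RV d) (mix_map d V (\<nu>1 m n d))"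
    and Y: "\<And>m n d. m \<ge> 2 \<Longrightarrow> n \<ge> 2 \<Longrightarrow> d \<ge> 1 \<Longrightarrow>
      distr M (RV d) (Y m n d) = distr (L \<Otimes>\<^sub>M M) (RV d) (mix_map d V (\<nu>2 m n d))"
    and \<delta>: "\<And>m n d k. \<delta> m n d k = \<nu>2 m n d (Suc k) - \<nu>1 m n d (Suc k)"
    and shift: "\<And>m n. m \<ge> 2 \<Longrightarrow> n \<ge> 2 \<Longrightarrow> (\<lambda>d. (\<Sum>k<d. (\<delta> m n d k)\<^sup>2) / sqrt (real d)) \<longlonglongrightarrow> l m n"
    and cross: "\<And>m n. m \<ge> 2 \<Longrightarrow> n \<ge> 2 \<Longrightarrow>
      (\<lambda>d. (\<Sum>k<d. \<Sum>l<d. \<delta> m n d k * \<delta> m n d l * expectation (\<lambda>x. V (Suc k) x * V (Suc l) x)) / real d) \<longlonglongrightarrow> 0"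
    and signal: "has_iterated_limit (\<lambda>m n d. (\<Sum>k<d. (\<delta> m n d k)\<^sup>2) / sqrt (tr2 d * S.e2\<^sup>2 * An (m, n))) c"
  shows "has_iterated_limit (\<lambda>m n d. measure M {\<omega>\<in>space M.
      T_CQ2 d m n (\<lambda>i. XS m n d i \<omega>) (\<lambda>j. YS m n d j \<omega>) / sqrt (tr2 d * S.e2\<^sup>2 * An (m, n)) > z}) (1 - Phi (z - c))" (is ?CQ)
    and "has_iterated_limit (\<lambda>m n d. measure M {\<omega>\<in>space M.
      real d * T_WMW d m n (\<lambda>i. XS m n d i \<omega>) (\<lambda>j. YS m n d j \<omega>) / sqrt (tr2 d * S.\<kappa>\<^sup>2 * An (m, n)) > z})
      (1 - Phi (z - c * (S.e2 / S.\<kappa>) * S.\<theta>\<^sup>2))" (is ?WMW)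
proof -
  obtain G where G: "\<And>m n. m \<ge> 2 \<Longrightarrow> n \<ge> 2 \<Longrightarrow>
      (\<lambda>d. (\<Sum>k<d. (\<delta> m n d k)\<^sup>2) / sqrt (tr2 d * S.e2\<^sup>2 * An (m, n))) \<longlonglongrightarrow> G m n"
    and Gc: "((\<lambda>(m, n). G m n) \<longlongrightarrow> c) S.R.FF"
    using signal unfolding has_iterated_limit_def by blast
  define \<kappa>0 where "\<kappa>0 \<eta> m n = 1 / (\<eta> * sqrt (\<tau> * An (m, n)))" for \<eta> :: real and m n
  have scale: "(\<lambda>d. sqrt (real d) / sqrt (tr2 d * \<eta>\<^sup>2 * An (m, n))) \<longlonglongrightarrow> \<kappa>0 \<eta> m n" "\<kappa>0 \<eta> m n > 0"
    if "\<eta> > 0" "m \<ge> 2" "n \<ge> 2" for \<eta> m n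
    using sqrt_tr2_ratio_tendsto[of "An (m, n)" \<eta>] An_pos[of "(m, n)"] that \<tau>_pos by (auto simp: \<kappa>0_def)
  have G_eq: "G m n = l m n * \<kappa>0 S.e2 m n" if "m \<ge> 2" "n \<ge> 2" for m n
  proof (rule LIMSEQ_unique[OF G[OF that]])
    have "(\<lambda>d. (\<Sum>k<d. (\<delta> m n d k)\<^sup>2) / sqrt (real d) * (sqrt (real d) / sqrt (tr2 d * S.e2\<^sup>2 * An (m, n)))) \<longlonglongrightarrow> l m n * \<kappa>0 S.e2 m n"
      by (intro tendsto_mult shift scale that S.e2_pos)
    moreover have "(\<Sum>k<d. (\<delta> m n d k)\<^sup>2) / sqrt (real d) * (sqrt (real d) / sqrt (tr2 d * S.e2\<^sup>2 * An (m, n))) =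
        (\<Sum>k<d. (\<delta> m n d k)\<^sup>2) / sqrt (tr2 d * S.e2\<^sup>2 * An (m, n))" for d
      by (cases "d = 0") auto
    ultimately show "(\<lambda>d. (\<Sum>k<d. (\<delta> m n d k)\<^sup>2) / sqrt (tr2 d * S.e2\<^sup>2 * An (m, n))) \<longlonglongrightarrow> l m n * \<kappa>0 S.e2 m n"
      by (simp only:)
  qed
  have \<kappa>0_eq: "\<kappa>0 \<eta> m n = \<kappa>0 S.e2 m n * (S.e2 / \<eta>)" for \<eta> m n
    using S.e2_pos by (simp add: \<kappa>0_def)
  \<comment> \<open>The constant \<tau> and the sample size factor cancel: relative to the
    normalization, the conditional standard deviation is the root of \<open>Vw / An\<close> over
    \<eta>.\<close>
  have sd: "\<kappa>0 \<eta> m n * sqrt (v * \<tau>) = sqrt (v / An (m, n)) / \<eta>" for \<eta> m n v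
    using \<tau>_pos by (simp add: \<kappa>0_def real_sqrt_mult real_sqrt_divide)
  \<comment> \<open>One argument for both tests: constant weights with \<eta> = \<open>e2\<close>
    and b = 1, and sign weights with \<eta> = \<kappa> and b the square of \<theta>.\<close>
  have limit: "has_iterated_limit F (1 - Phi (z - c * (S.e2 / \<eta>) * b))"
    if w: "case_prod w \<in> borel_measurable (borel \<Otimes>\<^sub>M borel)"
      and B: "tends_prob S.R.NN (\<lambda>zz. QA w w (S.R.IA zz) (S.R.IB zz)) b S.R.FF"
      and v: "tends_prob S.R.NN (\<lambda>zz p. Vw w (S.R.IA zz) (S.R.IB zz) p / An zz) (\<eta>\<^sup>2) S.R.FF" and \<eta>: "\<eta> > 0"
      and F: "\<And>m n. m \<ge> 2 \<Longrightarrow> n \<ge> 2 \<Longrightarrow> F m n \<longlonglongrightarrow>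
        (\<integral>p. 1 - Phi ((z - \<kappa>0 \<eta> m n * (l m n * QA w w (S.R.IA (m, n)) (S.R.IB (m, n)) p)) /
           (\<kappa>0 \<eta> m n * sqrt (Vw w (S.R.IA (m, n)) (S.R.IB (m, n)) p * \<tau>))) \<partial>S.R.NN (m, n))"
    for w b \<eta> F
    unfolding has_iterated_limit_def
  proof (intro exI[of _ "\<lambda>m n. \<integral>p. 1 - Phi ((z - (G m n * (S.e2 / \<eta>)) * QA w w (S.R.IA (m, n)) (S.R.IB (m, n)) p) /
           (sqrt (Vw w (S.R.IA (m, n)) (S.R.IB (m, n)) p / An (m, n)) / \<eta>)) \<partial>S.R.NN (m, n)"] conjI allI impI)
    fix m n :: nat assume mn: "m \<ge> 2" "n \<ge> 2"
    have e: "\<kappa>0 \<eta> m n * (l m n * x) = (G m n * (S.e2 / \<eta>)) * x" for x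
      unfolding G_eq[OF mn] \<kappa>0_eq[of \<eta>] by (simp add: mult_ac)
    show "F m n \<longlonglongrightarrow> (\<integral>p. 1 - Phi ((z - (G m n * (S.e2 / \<eta>)) * QA w w (S.R.IA (m, n)) (S.R.IB (m, n)) p) /
           (sqrt (Vw w (S.R.IA (m, n)) (S.R.IB (m, n)) p / An (m, n)) / \<eta>)) \<partial>S.R.NN (m, n))"
      using F[OF mn] unfolding e sd .
  next
    have "((\<lambda>zz. (case zz of (m, n) \<Rightarrow> G m n) * (S.e2 / \<eta>)) \<longlongrightarrow> c * (S.e2 / \<eta>)) S.R.FF"
      by (intro tendsto_mult Gc tendsto_const)
    from S.R.mean_power_limit[OF w B v \<eta> this, of z]
    show "((\<lambda>(m, n). \<integral>p. 1 - Phi ((z - (G m n * (S.e2 / \<eta>)) * QA w w (S.R.IA (m, n)) (S.R.IB (m, n)) p) /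
           (sqrt (Vw w (S.R.IA (m, n)) (S.R.IB (m, n)) p / An (m, n)) / \<eta>)) \<partial>S.R.NN (m, n)) \<longlongrightarrow>
           1 - Phi (z - c * (S.e2 / \<eta>) * b)) S.R.FF"
      by (simp add: case_prod_beta')
  qed
  have one: "case_prod (\<lambda>_ _. 1::real) \<in> borel_measurable (borel \<Otimes>\<^sub>M borel)" by measurable
  have "has_iterated_limit (\<lambda>m n d. measure M {\<omega>\<in>space M.
      T_CQ2 d m n (\<lambda>i. XS m n d i \<omega>) (\<lambda>j. YS m n d j \<omega>) / sqrt (tr2 d * S.e2\<^sup>2 * An (m, n)) > z}) (1 - Phi (z - c * (S.e2 / S.e2) * 1))"
    by (rule limit[OF one S.QA_one S.Vw_one S.e2_pos], rule power_limits(1)[OF _ _ iid X Y \<delta> shift cross scale(1)[OF S.e2_pos] scale(2)[OF S.e2_pos]])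
  then show ?CQ using S.e2_pos by simp
  show ?WMW
    by (rule limit[OF S.wt_meas S.QA_wt S.Vw_wt S.\<kappa>_pos], rule power_limits(2)[OF _ _ iid X Y \<delta> shift cross scale(1)[OF S.\<kappa>_pos] scale(2)[OF S.\<kappa>_pos]])
qed

theorem theorem3p2:
  fixes M :: "'a measure"
    and V W :: "nat \<Rightarrow> 'a \<Rightarrow> real"
    and P Q :: "'a \<Rightarrow> real"
    and \<mu>1 \<mu>2 \<mu> :: "nat \<Rightarrow> nat \<Rightarrow> nat \<Rightarrow> (nat \<Rightarrow> real)"
    and X Y :: "nat \<Rightarrow> nat \<Rightarrow> nat \<Rightarrow> 'a \<Rightarrow> (nat \<Rightarrow> real)"
    and XS YS :: "nat \<Rightarrow> nat \<Rightarrow> nat \<Rightarrow> nat \<Rightarrow> 'a \<Rightarrow> (nat \<Rightarrow> real)"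
    and \<Sigma>V \<Sigma>W :: "nat \<Rightarrow> (nat \<Rightarrow> nat \<Rightarrow> real)"
    and \<Gamma>1 \<psi>2 :: "nat \<Rightarrow> nat \<Rightarrow> nat \<Rightarrow> real"
    and \<sigma>V2 \<sigma>W2 \<alpha> \<epsilon> c :: real
  assumes prob: "prob_space M"
    and indep_VW: "prob_space.indep_var M RSeq (seq_map V) RSeq (seq_map W)"
    and mean_V: "\<And>k. k \<ge> 1 \<Longrightarrow> (LINT \<omega>|M. V k \<omega>) = 0"
    and mean_W: "\<And>k. k \<ge> 1 \<Longrightarrow> (LINT \<omega>|M. W k \<omega>) = 0"
    and stat_V: "strictly_stationary M V" and stat_W: "strictly_stationary M W"
    and mix_V: "rho_mixing M V" and mix_W: "rho_mixing M W"
    and mom_V: "integrable M (\<lambda>\<omega>. V 1 \<omega> ^ 4)" and mom_W: "integrable M (\<lambda>\<omega>. W 1 \<omega> ^ 4)"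
    and var_V: "\<sigma>V2 = covar M (V 1) (V 1)" "\<sigma>V2 > 0"
    and var_W: "\<sigma>W2 = covar M (W 1) (W 1)" "\<sigma>W2 > 0"
    and sum_V: "summable (\<lambda>k. rho M V (2 ^ Suc k))"
    and sum_W: "summable (\<lambda>k. rho M W (2 ^ Suc k))"
    and indep_PQ: "prob_space.indep_var M borel P borel Q"
    and indep_VP: "indep_seq_rv M V P"
    and indep_WQ: "indep_seq_rv M W Q"
    and pos_P: "AE \<omega> in M. P \<omega> > 0" and pos_Q: "AE \<omega> in M. Q \<omega> > 0"
    and nondeg_P: "non_degenerate M P" and nondeg_Q: "non_degenerate M Q"
    and mom_P: "integrable M P" "integrable M (\<lambda>\<omega>. 1 / (P \<omega>)\<^sup>2)"
    and mom_Q: "integrable M Q" "integrable M (\<lambda>\<omega>. 1 / (Q \<omega>)\<^sup>2)"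
    and X_def: "\<And>m n d. X m n d = scale_mix d (\<mu>1 m n d) V P"
    and Y_def: "\<And>m n d. Y m n d = scale_mix d (\<mu>2 m n d) W Q"
    and mu_def: "\<And>m n d. \<mu> m n d = vec_diff (\<mu>2 m n d) (\<mu>1 m n d)"
    and indep_XY: "\<And>m n d. m \<ge> 2 \<Longrightarrow> n \<ge> 2 \<Longrightarrow> d \<ge> 1 \<Longrightarrow>
      prob_space.indep_var M (RV d) (X m n d) (RV d) (Y m n d)"
    and samples: "\<And>m n d. m \<ge> 2 \<Longrightarrow> n \<ge> 2 \<Longrightarrow> d \<ge> 1 \<Longrightarrow>
      iid_samples M d m n (X m n d) (Y m n d) (XS m n d) (YS m n d)"
    and same_law: "\<And>m n d. m \<ge> 2 \<Longrightarrow> n \<ge> 2 \<Longrightarrow> d \<ge> 1 \<Longrightarrow>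
      distr M (RV d) (Y m n d) = distr M (RV d) (\<lambda>\<omega>. \<lambda>k\<in>{1..d}. X m n d \<omega> k + \<mu> m n d k)"
    and Sigma_V_def: "\<And>d. \<Sigma>V d = Disp M (rvec d V)"
    and Sigma_W_def: "\<And>d. \<Sigma>W d = Disp M (rvec d W)"
    and Gamma1_def: "\<And>m n d. \<Gamma>1 m n d = Gamma1 d m n (Disp M (X m n d)) (Disp M (Y m n d))"
    and psi2_def: "\<And>m n d. \<psi>2 m n d =
      psi2 d m n (\<Sigma>V d) (\<Sigma>W d) \<sigma>V2 \<sigma>W2 (distr M borel P) (distr M borel Q)"
    and eps: "\<epsilon> > 0"
    and mu_growth: "\<And>m n. m \<ge> 2 \<Longrightarrow> n \<ge> 2 \<Longrightarrow>
      (\<lambda>d. (norm_d d (\<mu> m n d))\<^sup>2 / real d powr (1 / 2 + \<epsilon>)) \<longlonglongrightarrow> 0"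
    and mu_Sigma: "\<And>m n. m \<ge> 2 \<Longrightarrow> n \<ge> 2 \<Longrightarrow>
      (\<lambda>d. inner_d d (\<mu> m n d) (mat_vec d (mat_add (\<Sigma>V d) (\<Sigma>W d)) (\<mu> m n d)))
        \<in> o(\<lambda>d. tr_d d (mat_add (mat_mult d (\<Sigma>V d) (\<Sigma>V d)) (mat_mult d (\<Sigma>W d) (\<Sigma>W d))))"
    and mu_limit: "\<And>m n. m \<ge> 2 \<Longrightarrow> n \<ge> 2 \<Longrightarrow>
      \<exists>l\<ge>0. (\<lambda>d. (norm_d d (\<mu> m n d))\<^sup>2 / sqrt (real d)) \<longlonglongrightarrow> l"
    and c_pos: "c > 0"
    and signal: "has_iterated_limit (\<lambda>m n d. (norm_d d (\<mu> m n d))\<^sup>2 / sqrt (\<Gamma>1 m n d)) c"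
    and alternative: "\<And>m n d. m \<ge> 2 \<Longrightarrow> n \<ge> 2 \<Longrightarrow> d \<ge> 1 \<Longrightarrow> \<exists>k\<in>{1..d}. \<mu> m n d k \<noteq> 0"
    and level: "0 < \<alpha>" "\<alpha> < 1"
  shows "\<exists>\<beta>_WMW \<beta>_CQ.
    has_iterated_limit
      (\<lambda>m n d. power_WMW M \<alpha> (\<psi>2 m n d) d m n (XS m n d) (YS m n d)) \<beta>_WMW \<and>
    has_iterated_limit
      (\<lambda>m n d. power_CQ2 M \<alpha> (\<Gamma>1 m n d) d m n (XS m n d) (YS m n d)) \<beta>_CQ \<and>
    \<beta>_WMW > \<beta>_CQ"
proof -
  interpret prob_space M by (rule prob)
  have P: "P \<in> borel_measurable M" and Q: "Q \<in> borel_measurable M"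
    using indep_var_rv1[OF indep_PQ] indep_var_rv2[OF indep_PQ] by auto
  have Vm: "V k \<in> borel_measurable M" and Wm: "W k \<in> borel_measurable M" if "k \<ge> 1" for k
    using stat_V stat_W that by (auto simp: strictly_stationary_def)
  define \<gamma>V \<gamma>W where "\<gamma>V j = (LINT \<omega>|M. V 1 \<omega> * V (Suc j) \<omega>)" and "\<gamma>W j = (LINT \<omega>|M. W 1 \<omega> * W (Suc j) \<omega>)" for j
  define L L' where "L = distr M borel (\<lambda>\<omega>. 1 / P \<omega>)" and "L' = distr M borel (\<lambda>\<omega>. 1 / Q \<omega>)"
  have \<gamma>0: "\<gamma>V 0 = \<sigma>V2" "\<gamma>W 0 = \<sigma>W2"
    using mean_V[of 1] mean_W[of 1] unfolding \<gamma>V_def \<gamma>W_def var_V(1) var_W(1) covar_def by (simp_all add: One_nat_def)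
  have SV: "scale_law L (\<gamma>V 0)"
    unfolding \<gamma>0 L_def by (rule scale_law_inverse[OF prob P pos_P nondeg_P mom_P var_V(2)])
  have SW: "scale_law L' (\<gamma>W 0)"
    unfolding \<gamma>0 L'_def by (rule scale_law_inverse[OF prob Q pos_Q nondeg_Q mom_Q var_W(2)])
  interpret V: mixture_model M V "\<lambda>n. gen_sigma M V {1..n}" "\<lambda>n. gen_sigma M V {max 1 n..}" \<gamma>V "rho M V" "LINT \<omega>|M. V 1 \<omega> ^ 4" L
    unfolding \<gamma>V_def
    by (rule mixture_model.intro[OF rho_sequence_of_stationary[OF prob stat_V mix_V mean_V mom_V var_V(2)[unfolded var_V(1)] sum_V] SV[unfolded \<gamma>V_def]])
  interpret W: mixture_model M W "\<lambda>n. gen_sigma M W {1..n}" "\<lambda>n. gen_sigma M W {max 1 n..}" \<gamma>W "rho M W" "LINT \<omega>|M. W 1 \<omega> ^ 4" L'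
    unfolding \<gamma>W_def
    by (rule mixture_model.intro[OF rho_sequence_of_stationary[OF prob stat_W mix_W mean_W mom_W var_W(2)[unfolded var_W(1)] sum_W] SW[unfolded \<gamma>W_def]])
  have Xm: "X m n d \<in> measurable M (RV d)" and Ym: "Y m n d \<in> measurable M (RV d)" for m n d
    unfolding X_def Y_def scale_mix_def using Vm Wm P Q by (auto intro!: measurable_restrict borel_measurable_add borel_measurable_divide)
  have lawX: "distr M (RV d) (X m n d) = distr (L \<Otimes>\<^sub>M M) (RV d) (mix_map d V (\<mu>1 m n d))" for m n d
    unfolding X_def L_def by (rule scale_mix_distr[OF prob Vm P indep_VP])
  have lawYW: "distr M (RV d) (Y m n d) = distr (L' \<Otimes>\<^sub>M M) (RV d) (mix_map d W (\<mu>2 m n d))" for m n d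
    unfolding Y_def L'_def by (rule scale_mix_distr[OF prob Wm Q indep_WQ])
  have lawY: "distr M (RV d) (Y m n d) = distr (L \<Otimes>\<^sub>M M) (RV d) (mix_map d V (\<mu>2 m n d))" if "m \<ge> 2" "n \<ge> 2" "d \<ge> 1" for m n d
  proof -
    have "(\<lambda>\<omega>. \<lambda>k\<in>{1..d}. X m n d \<omega> k + \<mu> m n d k) = scale_mix d (\<mu>2 m n d) V P"
      by (auto simp: X_def scale_mix_def mu_def vec_diff_def fun_eq_iff)
    then show ?thesis unfolding same_law[OF that] L_def using scale_mix_distr[OF prob Vm P indep_VP] by simp
  qed
  \<comment> \<open>For d \<ge> 1 the law of \<open>Y\<close> has two representations, one through
    \<open>V\<close> and one through \<open>W\<close>. Their mean squared deviations have the same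
    law in each such dimension, hence the same limit. The sample sizes 2 and 2 are an arbitrary
    admissible choice.\<close>
  have D: "distr L borel (\<lambda>r. \<gamma>V 0 * r\<^sup>2) = distr L' borel (\<lambda>r. \<gamma>W 0 * r\<^sup>2)"
  proof (rule Levy_uniqueness[OF V.S.SqLaw_dist W.S.SqLaw_dist], rule ext)
    fix t
    have "\<forall>\<^sub>F d in sequentially. char (distr (distr (L \<Otimes>\<^sub>M M) (RV d) (mix_map d V (\<mu>2 2 2 d))) borel (V.sq_dev (\<mu>2 2 2 d) d)) t =
        char (distr (distr (L' \<Otimes>\<^sub>M M) (RV d) (mix_map d W (\<mu>2 2 2 d))) borel (V.sq_dev (\<mu>2 2 2 d) d)) t"
      using eventually_ge_at_top[of 1] by eventually_elim (simp only: lawY[symmetric] lawYW[symmetric] order_refl)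
    from tendsto_cong[THEN iffD1, OF this V.sq_dev_char_limit]
    show "char V.S.SqLaw t = char W.S.SqLaw t" by (rule LIMSEQ_unique[OF _ W.sq_dev_char_limit])
  qed
  note ck = cross_kernel[OF SV SW D] cross_kernel(1)[OF SW SV D[symmetric]]
  \<comment> \<open>The ratio by which the covariances of \<open>W\<close> exceed those of
    \<open>V\<close>; the second moments of the scales compensate for it.\<close>
  define q where "q = V.S.e2 / W.S.e2"
  have q: "q > 0" unfolding q_def using V.S.e2_pos W.S.e2_pos by simp
  \<comment> \<open>The dispersion of \<open>Y\<close>, computed once through \<open>V\<close> and
    once through \<open>W\<close>, in a dimension large enough to contain both indices.\<close>
  have VW: "(LINT x|M. W k x * W l x) = q * (LINT x|M. V k x * V l x)" if "k \<ge> 1" "l \<ge> 1" for k l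
  proof -
    let ?d = "max k l"
    have d: "?d \<ge> 1" "k \<in> {1..?d}" "l \<in> {1..?d}" using that by auto
    have "V.S.e2 * (LINT x|M. V k x * V l x) = Disp M (Y 2 2 ?d) k l"
      by (rule V.Disp_mixture[OF Ym lawY[OF order_refl order_refl d(1)] d(2,3), symmetric])
    also have "\<dots> = W.S.e2 * (LINT x|M. W k x * W l x)" by (rule W.Disp_mixture[OF Ym lawYW d(2,3)])
    finally show ?thesis unfolding q_def using W.S.e2_pos by (simp add: field_simps)
  qed
  have q\<gamma>: "\<gamma>W 0 = q * \<gamma>V 0" using VW[of 1 1] by (simp add: \<gamma>V_def \<gamma>W_def One_nat_def)
  \<comment> \<open>The product of the variance and \<kappa> depends on \<open>SqLaw\<close> only,
    so \<kappa> changes inversely to the variance.\<close>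
  have \<kappa>W: "W.S.\<kappa> = V.S.\<kappa> / q"
    using ck(2) V.\<gamma>0 q unfolding q\<gamma> by (simp add: field_simps)
  have SigV: "\<Sigma>V d k l = 1 * (LINT x|M. V k x * V l x)" and SigW: "\<Sigma>W d k l = q * (LINT x|M. V k x * V l x)"
    if "k \<in> {1..d}" "l \<in> {1..d}" for d k l
    unfolding Sigma_V_def Sigma_W_def V.Disp_rvec[OF that] W.Disp_rvec[OF that] using that VW by auto
  have \<Gamma>: "\<Gamma>1 m n d = V.tr2 d * V.S.e2\<^sup>2 * An (m, n)" if mn: "m \<ge> 2" "n \<ge> 2" for m n d
  \<comment> \<open>The equality of laws is given for positive dimension; for d = 0 both sides are
    empty sums.\<close>
  proof (cases "d \<ge> 1")
    case True
    have DX: "Disp M (X m n d) k l = V.S.e2 * (LINT x|M. V k x * V l x)"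
      and DY: "Disp M (Y m n d) k l = V.S.e2 * (LINT x|M. V k x * V l x)" if "k \<in> {1..d}" "l \<in> {1..d}" for k l
      using V.Disp_mixture[OF Xm lawX that] V.Disp_mixture[OF Ym lawY[OF mn True] that] by auto
    have tr: "tr_d d (mat_mult d (Disp M (X m n d)) (Disp M (X m n d))) = V.S.e2 * V.S.e2 * V.tr2 d"
      "tr_d d (mat_mult d (Disp M (Y m n d)) (Disp M (Y m n d))) = V.S.e2 * V.S.e2 * V.tr2 d"
      "tr_d d (mat_mult d (Disp M (X m n d)) (Disp M (Y m n d))) = V.S.e2 * V.S.e2 * V.tr2 d"
      by (intro V.trace_mult DX DY; assumption)+
    show ?thesis unfolding Gamma1_def Defs.Gamma1_def tr An_def falling_two by (simp add: power2_eq_square algebra_simps)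
  next
    case False
    then show ?thesis unfolding Gamma1_def by (simp add: Defs.Gamma1_def tr_d_def V.tr2_def not_le)
  qed
  have psi: "psi21 \<sigma>V2 \<sigma>W2 (distr M borel P) (distr M borel Q) = V.S.\<kappa>\<^sup>2"
    "psi22 \<sigma>V2 \<sigma>W2 (distr M borel P) (distr M borel Q) = (V.S.\<kappa> / q)\<^sup>2"
    using psi21_eq[OF prob P Q pos_P pos_Q var_V(2) var_W(2)] psi21_eq[OF prob Q P pos_Q pos_P var_W(2) var_V(2)]
      ck(1,3) \<kappa>W unfolding psi22_eq_psi21 \<gamma>0 L_def[symmetric] L'_def[symmetric] by simp_all
  have psi23: "psi23 \<sigma>V2 \<sigma>W2 (distr M borel P) (distr M borel Q) = V.S.\<kappa>\<^sup>2 / q"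
  proof -
    have "sqrt (V.S.\<kappa>\<^sup>2 * (V.S.\<kappa> / q)\<^sup>2) = V.S.\<kappa> * (V.S.\<kappa> / q)"
      using q V.S.\<kappa>_pos by (simp add: real_sqrt_mult)
    then show ?thesis unfolding psi23_def psi by (simp add: power2_eq_square)
  qed
  have tr: "tr_d d (mat_mult d (\<Sigma>V d) (\<Sigma>V d)) = 1 * 1 * V.tr2 d"
    "tr_d d (mat_mult d (\<Sigma>W d) (\<Sigma>W d)) = q * q * V.tr2 d"
    "tr_d d (mat_mult d (\<Sigma>V d) (\<Sigma>W d)) = 1 * q * V.tr2 d" for d
    by (intro V.trace_mult SigV SigW; assumption)+
  \<comment> \<open>Each factor \<open>q\<close> from a trace meets its inverse from
    \<open>psi22\<close> or \<open>psi23\<close>, so all three terms carry \<open>tr2 d\<close>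
    times the square of \<kappa>, just as those of \<Gamma>1 carry the square of
    \<open>e2\<close>.\<close>
  have \<psi>: "\<psi>2 m n d = V.tr2 d * V.S.\<kappa>\<^sup>2 * An (m, n)" for m n d
    using q unfolding psi2_def Defs.psi2_def psi psi23 tr An_def falling_two by (simp add: field_simps power2_eq_square)
  define \<delta> where "\<delta> m n d k = \<mu>2 m n d (Suc k) - \<mu>1 m n d (Suc k)" for m n d k
  have \<delta>_eq: "\<delta> m n d k = \<mu> m n d (Suc k)" for m n d k by (simp add: \<delta>_def mu_def vec_diff_def)
  have norm: "(norm_d d (\<mu> m n d))\<^sup>2 = (\<Sum>k<d. (\<delta> m n d k)\<^sup>2)" for m n d
    unfolding norm_d_shift \<delta>_eq by (simp add: sum_nonneg)
  \<comment> \<open>A limit exists for each pair of sample sizes; \<open>lim\<close> names it as a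
    function of both.\<close>
  have l: "(\<lambda>d. (\<Sum>k<d. (\<delta> m n d k)\<^sup>2) / sqrt (real d)) \<longlonglongrightarrow> lim (\<lambda>d. (\<Sum>k<d. (\<delta> m n d k)\<^sup>2) / sqrt (real d))"
    if "m \<ge> 2" "n \<ge> 2" for m n
    using mu_limit[OF that] unfolding norm convergent_LIMSEQ_iff[symmetric] by (auto intro: convergentI)
  \<comment> \<open>Both dispersion matrices are multiples of the covariances of \<open>V\<close>,
    so the hypothesis bounds the form in \<open>V\<close> alone by o of \<open>tr2 d\<close>, and
    \<open>tr2 d\<close> is at most \<tau> d.\<close>
  have cross: "(\<lambda>d. (\<Sum>k<d. \<Sum>l<d. \<delta> m n d k * \<delta> m n d l * (LINT x|M. V (Suc k) x * V (Suc l) x)) / real d) \<longlonglongrightarrow> 0"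
    if mn: "m \<ge> 2" "n \<ge> 2" for m n
  proof -
    define C where "C d = (\<Sum>k<d. \<Sum>l<d. \<delta> m n d k * \<delta> m n d l * (LINT x|M. V (Suc k) x * V (Suc l) x))" for d
    have "inner_d d (\<mu> m n d) (mat_vec d (mat_add (\<Sigma>V d) (\<Sigma>W d)) (\<mu> m n d)) = (1 + q) * C d" for d
    proof -
      have "(\<Sum>k = 1..d. F k) = (\<Sum>k<d. F (Suc k))" for F :: "nat \<Rightarrow> real"
        by (rule sum.reindex_bij_witness[of _ Suc "\<lambda>k. k - 1"]) auto
      then show ?thesis
        unfolding inner_d_def mat_vec_def mat_add_def C_def \<delta>_eq
        by (simp add: SigV SigW sum_distrib_left) (intro sum.cong refl, simp add: algebra_simps)
    qed
    moreover have "tr_d d (mat_add (mat_mult d (\<Sigma>V d) (\<Sigma>V d)) (mat_mult d (\<Sigma>W d) (\<Sigma>W d))) = (1 + q * q) * V.tr2 d" for d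
    proof -
      have "tr_d d (mat_add A B) = tr_d d A + tr_d d B" for A B by (simp add: tr_d_def mat_add_def sum.distrib)
      then show ?thesis by (simp add: tr distrib_right)
    qed
    ultimately have "(\<lambda>d. (1 + q) * C d) \<in> o(\<lambda>d. (1 + q * q) * V.tr2 d)" using mu_Sigma[OF mn] by simp
    also have "(\<lambda>d. (1 + q * q) * V.tr2 d) \<in> O(\<lambda>d. real d)"
    proof (rule bigoI[where c="(1 + q * q) * V.\<tau>"], intro always_eventually allI)
      fix d
      have "V.tr2 d \<ge> 0" unfolding V.tr2_def by (intro sum_nonneg) auto
      then show "norm ((1 + q * q) * V.tr2 d) \<le> (1 + q * q) * V.\<tau> * norm (real d)"
        using V.tr2_le[of d] q by (simp add: abs_mult mult.assoc mult_left_mono)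
    qed
    finally have "(\<lambda>d. (1 + q) * C d / real d) \<longlonglongrightarrow> 0" by (rule smalloD_tendsto)
    from tendsto_mult_left[OF this, of "1 / (1 + q)"] show ?thesis using q by (simp add: C_def)
  qed
  \<comment> \<open>An iterated limit only inspects sample sizes of at least 2, the range in which
    the formula for \<Gamma>1 has been derived.\<close>
  have congr: "has_iterated_limit F x \<longleftrightarrow> has_iterated_limit F' x" if "\<And>m n d. m \<ge> 2 \<Longrightarrow> n \<ge> 2 \<Longrightarrow> F m n d = F' m n d" for F F' x
    using that unfolding has_iterated_limit_def by (metis (no_types, lifting) ext)
  have sig: "has_iterated_limit (\<lambda>m n d. (\<Sum>k<d. (\<delta> m n d k)\<^sup>2) / sqrt (V.tr2 d * V.S.e2\<^sup>2 * An (m, n))) c"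
    using signal unfolding norm by (subst (asm) congr[OF arg_cong[OF \<Gamma>, where f="\<lambda>x. _ / sqrt x"]])
  note lims = V.iterated_power_limits[where \<delta>=\<delta>, OF samples lawX lawY \<delta>_def l cross sig, of "zeta \<alpha>"]
  let ?c = "c * (V.S.e2 / V.S.\<kappa>) * V.S.\<theta>\<^sup>2"
  \<comment> \<open>The ratio of the limiting drifts of the two tests; it exceeds 1 by the strict
    association inequality.\<close>
  have "V.S.e2 / V.S.\<kappa> * V.S.\<theta>\<^sup>2 > 1" using V.S.\<kappa>_less V.S.\<kappa>_pos by (simp add: field_simps)
  then have "c * 1 < c * (V.S.e2 / V.S.\<kappa> * V.S.\<theta>\<^sup>2)" using c_pos by (intro mult_strict_left_mono)
  then have less: "Phi (zeta \<alpha> - ?c) < Phi (zeta \<alpha> - c)" by (intro Phi_strict_mono) (simp add: mult.assoc)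
  have CQ: "has_iterated_limit (\<lambda>m n d. power_CQ2 M \<alpha> (\<Gamma>1 m n d) d m n (XS m n d) (YS m n d)) (1 - Phi (zeta \<alpha> - c))"
  proof (rule congr[THEN iffD2, OF _ lims(1)])
    fix m n d :: nat assume mn: "m \<ge> 2" "n \<ge> 2"
    show "power_CQ2 M \<alpha> (\<Gamma>1 m n d) d m n (XS m n d) (YS m n d) =
        measure M {\<omega> \<in> space M. T_CQ2 d m n (\<lambda>i. XS m n d i \<omega>) (\<lambda>j. YS m n d j \<omega>) / sqrt (V.tr2 d * V.S.e2\<^sup>2 * An (m, n)) > zeta \<alpha>}"
      unfolding power_CQ2_def \<Gamma>[OF mn] ..
  qed
  have WMW: "has_iterated_limit (\<lambda>m n d. power_WMW M \<alpha> (\<psi>2 m n d) d m n (XS m n d) (YS m n d)) (1 - Phi (zeta \<alpha> - ?c))"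
    using lims(2) unfolding power_WMW_def \<psi> .
  show ?thesis using CQ WMW less by (intro exI[of _ "1 - Phi (zeta \<alpha> - ?c)"] exI[of _ "1 - Phi (zeta \<alpha> - c)"]) auto
qed

end
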